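(* Let $\Omega$ be a bounded stationary regular cluster on $\mathbb{R}^n$, which in addition is assumed to either be stable, or of bounded curvature. Then $$\int_{\Sigma^1}\mathfrak{n}\otimes\mathbf{c}\;dp=0,$$ where on each interface $\Sigma_{ij}$, $\mathfrak{n}=\mathfrak{n}_{ij}$ is the unit normal and $\mathbf{c}=\mathbf{c}_{ij}=\mathfrak{n}_{ij}-\mathbf{k}_{ij}\,p$ is the quasi-center vector at $p\in\Sigma_{ij}$, with $\mathbf{k}_{ij}=\frac{1}{n-1}H_{\Sigma_{ij}}$ (the tensor $\mathfrak{n}\otimes\mathbf{c}$ does not depend on the orientation), and $dp$ denotes integration with respect to $\mathcal{H}^{n-1}$.
   Context: **Clusters on $\mathbb{R}^n$.** $V$ is Lebesgue measure, $\mathcal{H}^k$ Hausdorff measure, $\partial^*$ the reduced boundary. A $q$-cluster $\Omega=(\Omega_1,\dots,\Omega_q)$ is a tuple of pairwise disjoint Borel sets (cells) of locally finite perimeter with $V(\mathbb{R}^n\setminus\bigcup_i\Omega_i)=0$, finite perimeter of every $\Omega_i$, and $V(\Omega_i)<\infty$ for $i\le q-1$. $P(\Omega)=\frac12\sum_i\mathcal{H}^{n-1}(\partial^*\Omega_i)$; $\Sigma_{ij}=\partial^*\Omega_i\cap\partial^*\Omega_j$; $\Sigma=\bigcup_i\partial\Omega_i$; $\Sigma^1=\bigcup_{i<j}\Sigma_{ij}$. $\Omega$ is bounded if $\Sigma$ is bounded. $E^{(m)}=\{x\in\mathbb{R}^{m+1}:\sum x_i=0\}$. **Regular.** All cells have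 positive volume and: (R1) cells are open, $\overline{\partial^*\Omega_i}=\partial\Omega_i$, $\mathcal{H}^{n-1}(\partial\Omega_i\setminus\partial^*\Omega_i)=0$; (R2) each $\Sigma_{ij}$ is a locally-finite union of embedded $(n-1)$-dimensional $C^\infty$ manifolds, relatively open in $\Sigma$, and each $x\in\Sigma_{ij}$ has a ball $B(x,\epsilon)$ disjoint from $\Omega_k$ for $k\ne i,j$ in which $\Sigma_{ij}$ is an embedded $C^\infty$ hypersurface; (R3) for compact $K$ there are $\Lambda_K,r_K>0$ with $\mathcal{H}^{n-1}(\Sigma\cap B(x,r))\le\Lambda_K r^{n-1}$ for $x\in\Sigma\cap K$, $r<r_K$; (R4) there is $\epsilon_n>0$ depending only on $n$ such that for every $p$ and every connected component $\Omega_i^\ell$ of a cell, if $\liminf_{r\to0+}\mathcal{H}^n(\Omega_i^\ell\cap B(p,r))/\mathcal{H}^n(B(p,r))<\epsilon_n$ then $p\notin\overline{\Omega_i^\ell}$; (R5) there are $\alpha>0$ and sets $\Sigma^2,\Sigma^3,\Sigma^4\subset\Sigma$ such that $\Sigma$ is the disjoint union of $\Sigma^1,\dots,\Sigma^4$; $\Sigma^2$ (resp. $\Sigma^3$) is a locally-finite union of embedded $C^\infty$ $(n-2)$-dimensional (resp. $C^{1,\alpha}$ $(n-3)$-dimensional) manifolds, near each point of which a $C^\infty$ (resp. $C^{1,\alpha}$) diffeomorphism maps the point to the origin and $\Sigma$ locally to $\mathbf{Y}\times\mathbb{R}^{n-2}\subset E^{(2)}\times\mathbb{R}^{n-2}$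 (resp. $\mathbf{T}\times\mathbb{R}^{n-3}\subset E^{(3)}\times\mathbb{R}^{n-3}$); $\Sigma^4$ is closed with $\dim_{\mathcal{H}}\Sigma^4\le n-4$. Here $\mathbf{Y}=\{x\in E^{(2)}:\exists i\ne j,\ x_i=x_j=\max_k x_k\}$ and $\mathbf{T}$ is defined identically in $E^{(3)}$. **Stationary and stable.** Let $\mathfrak{n}_{ij}$ be the unit normal on $\Sigma_{ij}$ pointing from $\Omega_i$ to $\Omega_j$, $\mathrm{II}(u,v)=\langle\nabla_u\mathfrak{n},v\rangle$, $H_{\Sigma_{ij}}=\mathrm{tr}\,\mathrm{II}$. $\Omega$ is stationary (with Lagrange multiplier $\lambda\in E^{(q-1)}$) if (R1),(R2) hold, each $H_{\Sigma_{ij}}$ is constant and equals $\lambda_i-\lambda_j$, and $\sum_{i<j}\int_{\Sigma_{ij}}\mathrm{div}_\Sigma X^{\mathbf t}\,d\mathcal{H}^{n-1}=0$ for all $C_c^\infty$ vector-fields $X$, $X^{\mathbf t}=X-\langle X,\mathfrak n\rangle\mathfrak n$. For $X\in C_c^\infty$ with flow $F_t$: $\delta^k_XV(\Omega)_i=\frac{d^k}{dt^k}|_{t=0}V(F_t(\Omega_i))$ for $i\le q-1$, $\delta^k_XV(\Omega)_q=-\sum_{i<q}\delta_X^kV(\Omega)_i$, $\delta^k_XA=\frac{d^k}{dt^k}|_{t=0}P(F_t(\Omega))$, $Q(X)=\delta^2_XA-\langle\lambda,\delta^2_XV\rangle$. A stationary cluster is stable if $\delta^1_XV=0\Rightarrow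 Q(X)\ge0$ for all $C_c^\infty$ vector-fields $X$. Bounded curvature means $\mathrm{II}$ is bounded on $\Sigma^1$. *)

theory Defs
  imports "HOL-Analysis.Analysis"
begin

section \<open>Hausdorff measure and dimension\<close>

text \<open>
  The normalisation by the volume of the unit ball makes the \<open>n\<close>-dimensional Hausdorff measure on
  \<open>n\<close>-space agree with Lebesgue measure. The case \<open>s = 0\<close> is separate because \<open>0 powr 0 = 0\<close>,
  and coverings are by bounded sets because \<open>diameter\<close> is meaningless on unbounded ones.
\<close>

definition hausdorff_gauge :: "real \<Rightarrow> 'a::metric_space set \<Rightarrow> ennreal" where
  "hausdorff_gauge s E =
     (if E = {} then 0 else if s = 0 then 1
      else ennreal (unit_ball_vol s * (diameter E / 2) powr s))"

definition hausdorff_outer :: "real \<Rightarrow> 'a::metric_space set \<Rightarrow> ennreal" where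
  "hausdorff_outer s A =
     (SUP \<delta>\<in>{0<..}.
        INF E\<in>{E :: nat \<Rightarrow> 'a set.
               A \<subseteq> (\<Union>i. E i) \<and> (\<forall>i. bounded (E i) \<and> diameter (E i) \<le> \<delta>)}.
          \<Sum>i. hausdorff_gauge s (E i))"

definition hausdorff_measure :: "real \<Rightarrow> 'a::metric_space measure" where
  "hausdorff_measure s = measure_of UNIV (sets borel) (hausdorff_outer s)"

text \<open>The empty set has dimension \<open>-\<infinity>\<close>, so a negative upper bound on the dimension forces emptiness.\<close>

definition hausdorff_dim :: "'a::metric_space set \<Rightarrow> ereal" where
  "hausdorff_dim A =
     (if A = {} then -\<infinity> else Inf {ereal s | s. 0 \<le> s \<and> hausdorff_outer s A = 0})"


section \<open>Smooth maps and embedded submanifolds\<close>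

text \<open>The classes below are meant for open sets \<open>S\<close>.\<close>

primrec Ck_on :: "nat \<Rightarrow> ('a::euclidean_space \<Rightarrow> 'b::real_normed_vector) \<Rightarrow> 'a set \<Rightarrow> bool" where
  "Ck_on 0 f S \<longleftrightarrow> continuous_on S f"
| "Ck_on (Suc k) f S \<longleftrightarrow>
     (\<forall>x\<in>S. f differentiable (at x)) \<and> (\<forall>v. Ck_on k (\<lambda>x. frechet_derivative f (at x) v) S)"

datatype smoothness = C_inf | C1_holder real

text \<open>Membership in $C^{1,\alpha}$ is local: the Hoelder constant may vary from point to point.\<close>

fun smooth_class_on ::
  "smoothness \<Rightarrow> ('a::euclidean_space \<Rightarrow> 'b::real_normed_vector) \<Rightarrow> 'a set \<Rightarrow> bool" where
  "smooth_class_on C_inf f S \<longleftrightarrow> (\<forall>k. Ck_on k f S)"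
| "smooth_class_on (C1_holder \<alpha>) f S \<longleftrightarrow>
     (\<forall>x\<in>S. f differentiable (at x)) \<and>
     (\<forall>v. \<forall>x\<in>S. \<exists>r>0. \<exists>C. \<forall>y\<in>ball x r \<inter> S. \<forall>z\<in>ball x r \<inter> S.
        norm (frechet_derivative f (at y) v - frechet_derivative f (at z) v) \<le> C * dist y z powr \<alpha>)"

text \<open>
  \<open>diffeo r \<phi> U V E\<close>: \<open>\<phi>\<close> is a diffeomorphism of class \<open>r\<close> from the open set \<open>U\<close> onto the relatively
  open subset \<open>V \<inter> E\<close> of the linear subspace \<open>E\<close>; regularity of the inverse is expressed through an
  extension to the open set \<open>V\<close> of the ambient space.
\<close>

definition diffeo ::
  "smoothness \<Rightarrow> ('a::euclidean_space \<Rightarrow> 'b::euclidean_space) \<Rightarrow> 'a set \<Rightarrow> 'b set \<Rightarrow> 'b set \<Rightarrow> bool" where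
  "diffeo r \<phi> U V E \<longleftrightarrow>
     open U \<and> open V \<and> subspace E \<and> smooth_class_on r \<phi> U \<and> \<phi> ` U = V \<inter> E \<and>
     (\<exists>\<psi>. smooth_class_on r \<psi> V \<and> (\<forall>x\<in>U. \<psi> (\<phi> x) = x))"

text \<open>
  Indexing by the codimension \<open>k\<close> avoids truncated subtraction: if \<open>k > DIM('a)\<close>, only the empty
  set qualifies.
\<close>

definition embedded_submanifold :: "smoothness \<Rightarrow> nat \<Rightarrow> 'a::euclidean_space set \<Rightarrow> bool" where
  "embedded_submanifold r k M \<longleftrightarrow>
     (\<forall>x\<in>M. \<exists>U V \<phi>. \<exists>L::'a set.
        x \<in> U \<and> diffeo r \<phi> U V (UNIV :: 'a set) \<and> subspace L \<and> dim L + k = DIM('a) \<and>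
        \<phi> ` (M \<inter> U) = V \<inter> L)"

definition locally_finite_union_of :: "('a::topological_space set \<Rightarrow> bool) \<Rightarrow> 'a set \<Rightarrow> bool" where
  "locally_finite_union_of P S \<longleftrightarrow>
     (\<exists>\<M>. locally_finite_in euclidean \<M> \<and> (\<forall>M\<in>\<M>. P M) \<and> S = \<Union>\<M>)"


section \<open>Sets of locally finite perimeter\<close>

definition divergence :: "('a::euclidean_space \<Rightarrow> 'a) \<Rightarrow> 'a \<Rightarrow> real" where
  "divergence X x = (\<Sum>b\<in>Basis. frechet_derivative X (at x) b \<bullet> b)"

definition supp :: "('a::topological_space \<Rightarrow> 'b::zero) \<Rightarrow> 'a set" where
  "supp X = closure {x. X x \<noteq> 0}"

definition locally_finite_perimeter :: "'a::euclidean_space set \<Rightarrow> bool" where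
  "locally_finite_perimeter E \<longleftrightarrow>
     E \<in> sets borel \<and>
     (\<forall>K. compact K \<longrightarrow>
        bdd_above {LINT x:E|lborel. divergence X x | X :: 'a \<Rightarrow> 'a.
                     Ck_on 1 X UNIV \<and> supp X \<subseteq> K \<and> (\<forall>x. norm (X x) \<le> 1)})"

text \<open>
  \<open>gauss_green E m \<nu>\<close>: the vector-valued Gauss-Green measure of \<open>E\<close> has polar decomposition
  \<open>\<nu> m\<close>, where \<open>m\<close> is its total variation, a Radon measure. The sign is such that \<open>\<nu>\<close> points out of \<open>E\<close>.
  For sets of locally finite perimeter \<open>m\<close> exists and is unique, and \<open>\<nu>\<close> is unique almost everywhere.
\<close>

definition gauss_green :: "'a::euclidean_space set \<Rightarrow> 'a measure \<Rightarrow> ('a \<Rightarrow> 'a) \<Rightarrow> bool" where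
  "gauss_green E m \<nu> \<longleftrightarrow>
     sets m = sets borel \<and> (\<forall>K. compact K \<longrightarrow> emeasure m K < \<infinity>) \<and>
     \<nu> \<in> borel_measurable borel \<and> (AE x in m. norm (\<nu> x) = 1) \<and>
     (\<forall>X. Ck_on 1 X UNIV \<and> compact (supp X) \<longrightarrow>
        (LINT x:E|lborel. divergence X x) = (LINT x|m. X x \<bullet> \<nu> x))"

definition has_outer_normal :: "'a::euclidean_space set \<Rightarrow> 'a \<Rightarrow> 'a \<Rightarrow> bool" where
  "has_outer_normal E x v \<longleftrightarrow>
     norm v = 1 \<and>
     (\<exists>m \<nu>. gauss_green E m \<nu> \<and> (\<forall>r>0. 0 < emeasure m (ball x r)) \<and>
        ((\<lambda>r. (LINT y:ball x r|m. \<nu> y) /\<^sub>R measure m (ball x r)) \<longlongrightarrow> v) (at_right 0))"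

definition reduced_boundary :: "'a::euclidean_space set \<Rightarrow> 'a set" where
  "reduced_boundary E = {x. \<exists>v. has_outer_normal E x v}"

definition outer_normal :: "'a::euclidean_space set \<Rightarrow> 'a \<Rightarrow> 'a" where
  "outer_normal E x = (THE v. has_outer_normal E x v)"

abbreviation surface_outer :: "'a::euclidean_space set \<Rightarrow> ennreal" where
  "surface_outer (A :: 'a set) \<equiv> hausdorff_outer (real DIM('a) - 1) A"

abbreviation surface_measure :: "'a::euclidean_space measure" where
  "surface_measure \<equiv> (hausdorff_measure (real DIM('a) - 1) :: 'a measure)"


section \<open>Clusters\<close>

text \<open>The cells of a \<open>q\<close>-cluster are \<open>\<Omega> 1, \<dots>, \<Omega> q\<close>; other values of \<open>\<Omega>\<close> are irrelevant.\<close>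

definition cluster :: "nat \<Rightarrow> (nat \<Rightarrow> 'a::euclidean_space set) \<Rightarrow> bool" where
  "cluster q \<Omega> \<longleftrightarrow>
     disjoint_family_on \<Omega> {1..q} \<and>
     (\<forall>i\<in>{1..q}. \<Omega> i \<in> sets borel \<and> locally_finite_perimeter (\<Omega> i) \<and>
        surface_outer (reduced_boundary (\<Omega> i)) < \<infinity>) \<and>
     emeasure lborel (UNIV - (\<Union>i\<in>{1..q}. \<Omega> i)) = 0 \<and>
     (\<forall>i\<in>{1..<q}. emeasure lborel (\<Omega> i) < \<infinity>)"

definition cluster_perimeter :: "nat \<Rightarrow> (nat \<Rightarrow> 'a::euclidean_space set) \<Rightarrow> real" where
  "cluster_perimeter q \<Omega> =
     (\<Sum>i\<in>{1..q}. enn2real (surface_outer (reduced_boundary (\<Omega> i)))) / 2"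

definition interface :: "(nat \<Rightarrow> 'a::euclidean_space set) \<Rightarrow> nat \<Rightarrow> nat \<Rightarrow> 'a set" where
  "interface \<Omega> i j = reduced_boundary (\<Omega> i) \<inter> reduced_boundary (\<Omega> j)"

definition index_pairs :: "nat \<Rightarrow> (nat \<times> nat) set" where
  "index_pairs q = {(i, j). 1 \<le> i \<and> i < j \<and> j \<le> q}"

definition cluster_boundary :: "nat \<Rightarrow> (nat \<Rightarrow> 'a::euclidean_space set) \<Rightarrow> 'a set" where
  "cluster_boundary q \<Omega> = (\<Union>i\<in>{1..q}. frontier (\<Omega> i))"

definition interfaces :: "nat \<Rightarrow> (nat \<Rightarrow> 'a::euclidean_space set) \<Rightarrow> 'a set" where
  "interfaces q \<Omega> = (\<Union>(i, j)\<in>index_pairs q. interface \<Omega> i j)"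

definition bounded_cluster :: "nat \<Rightarrow> (nat \<Rightarrow> 'a::euclidean_space set) \<Rightarrow> bool" where
  "bounded_cluster q \<Omega> \<longleftrightarrow> bounded (cluster_boundary q \<Omega>)"


section \<open>Regular clusters\<close>

definition zero_sum_space :: "(real ^ 'm) set" where
  "zero_sum_space = {x. (\<Sum>i\<in>UNIV. x $ i) = 0}"

text \<open>For \<open>'m = 3\<close> this is the cone \<open>Y\<close>, for \<open>'m = 4\<close> the cone \<open>T\<close>.\<close>

definition simplicial_cone :: "(real ^ 'm) set" where
  "simplicial_cone =
     {x \<in> zero_sum_space. \<exists>i j. i \<noteq> j \<and> x $ i = x $ j \<and> x $ j = Max (range (\<lambda>k. x $ k))}"

text \<open>
  \<open>locally_cone r C S p\<close>, for \<open>C\<close> in the zero-sum space \<open>E\<close> of \<open>real ^ 'm\<close> (of dimension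
  \<open>CARD('m) - 1\<close>): near \<open>p\<close>, \<open>S\<close> is diffeomorphic to \<open>C \<times> \<real>\<^sup>d\<close> in \<open>E \<times> \<real>\<^sup>d\<close>, with
  \<open>d = DIM('a) - (CARD('m) - 1)\<close>. The factor \<open>\<real>\<^sup>d\<close> is realised as a subspace \<open>W\<close> of \<open>'a\<close>; no
  \<open>W\<close> exists if \<open>d\<close> would be negative.
\<close>

definition locally_cone ::
  "smoothness \<Rightarrow> (real ^ 'm) set \<Rightarrow> 'a::euclidean_space set \<Rightarrow> 'a \<Rightarrow> bool" where
  "locally_cone r C S p \<longleftrightarrow>
     (\<exists>U V \<phi>. \<exists>W::'a set.
        subspace W \<and> dim W + CARD('m) = DIM('a) + 1 \<and>
        p \<in> U \<and> diffeo r \<phi> U V ((zero_sum_space :: (real ^ 'm) set) \<times> W) \<and> \<phi> p = 0 \<and>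
        \<phi> ` (S \<inter> U) = V \<inter> (C \<times> W))"

definition regular1 :: "nat \<Rightarrow> (nat \<Rightarrow> 'a::euclidean_space set) \<Rightarrow> bool" where
  "regular1 q \<Omega> \<longleftrightarrow>
     (\<forall>i\<in>{1..q}. open (\<Omega> i) \<and> closure (reduced_boundary (\<Omega> i)) = frontier (\<Omega> i) \<and>
        surface_outer (frontier (\<Omega> i) - reduced_boundary (\<Omega> i)) = 0)"

definition regular2 :: "nat \<Rightarrow> (nat \<Rightarrow> 'a::euclidean_space set) \<Rightarrow> bool" where
  "regular2 q \<Omega> \<longleftrightarrow>
     (\<forall>i\<in>{1..q}. \<forall>j\<in>{1..q}. i \<noteq> j \<longrightarrow>
        locally_finite_union_of
          (\<lambda>M. embedded_submanifold C_inf 1 M \<and>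
               openin (top_of_set (cluster_boundary q \<Omega>)) M) (interface \<Omega> i j) \<and>
        (\<forall>x\<in>interface \<Omega> i j. \<exists>\<epsilon>>0.
           (\<forall>k\<in>{1..q} - {i, j}. ball x \<epsilon> \<inter> \<Omega> k = {}) \<and>
           embedded_submanifold C_inf 1 (interface \<Omega> i j \<inter> ball x \<epsilon>)))"

definition regular3 :: "nat \<Rightarrow> (nat \<Rightarrow> 'a::euclidean_space set) \<Rightarrow> bool" where
  "regular3 q \<Omega> \<longleftrightarrow>
     (\<forall>K. compact K \<longrightarrow>
        (\<exists>\<Lambda>>0. \<exists>\<rho>>0. \<forall>x\<in>cluster_boundary q \<Omega> \<inter> K. \<forall>r. 0 < r \<and> r < \<rho> \<longrightarrow>
           surface_outer (cluster_boundary q \<Omega> \<inter> ball x r) \<le> ennreal (\<Lambda> * r ^ (DIM('a) - 1))))"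

definition regular4 :: "nat \<Rightarrow> (nat \<Rightarrow> 'a::euclidean_space set) \<Rightarrow> bool" where
  "regular4 q \<Omega> \<longleftrightarrow>
     (\<exists>\<epsilon>>0. \<forall>p. \<forall>i\<in>{1..q}. \<forall>C\<in>components (\<Omega> i).
        Liminf (at_right 0)
          (\<lambda>r. hausdorff_outer (real DIM('a)) (C \<inter> ball p r) /
               hausdorff_outer (real DIM('a)) (ball p r)) < ennreal \<epsilon>
        \<longrightarrow> p \<notin> closure C)"

definition regular5 :: "nat \<Rightarrow> (nat \<Rightarrow> 'a::euclidean_space set) \<Rightarrow> bool" where
  "regular5 q \<Omega> \<longleftrightarrow>
     (\<exists>\<alpha>>0. \<exists>S :: nat \<Rightarrow> 'a set.
        S 1 = interfaces q \<Omega> \<and> disjoint_family_on S {1..4} \<and>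
        (\<Union>k\<in>{1..4}. S k) = cluster_boundary q \<Omega> \<and>
        locally_finite_union_of (embedded_submanifold C_inf 2) (S 2) \<and>
        (\<forall>p\<in>S 2. locally_cone C_inf (simplicial_cone :: (real ^ 3) set) (cluster_boundary q \<Omega>) p) \<and>
        locally_finite_union_of (embedded_submanifold (C1_holder \<alpha>) 3) (S 3) \<and>
        (\<forall>p\<in>S 3. locally_cone (C1_holder \<alpha>) (simplicial_cone :: (real ^ 4) set)
                    (cluster_boundary q \<Omega>) p) \<and>
        closed (S 4) \<and> hausdorff_dim (S 4) \<le> ereal (real DIM('a) - 4))"

definition regular_cluster :: "nat \<Rightarrow> (nat \<Rightarrow> 'a::euclidean_space set) \<Rightarrow> bool" where
  "regular_cluster q \<Omega> \<longleftrightarrow>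
     cluster q \<Omega> \<and> (\<forall>i\<in>{1..q}. 0 < emeasure lborel (\<Omega> i)) \<and>
     regular1 q \<Omega> \<and> regular2 q \<Omega> \<and> regular3 q \<Omega> \<and> regular4 q \<Omega> \<and> regular5 q \<Omega>"


section \<open>Curvature, stationarity and stability\<close>

text \<open>
  On the interface of \<open>\<Omega> i\<close> and \<open>\<Omega> j\<close> the outer normal of \<open>\<Omega> i\<close> points from \<open>\<Omega> i\<close> to \<open>\<Omega> j\<close>; the
  index \<open>j\<close> is kept only to match the notation for the other quantities on an interface.
\<close>

definition interface_normal :: "(nat \<Rightarrow> 'a::euclidean_space set) \<Rightarrow> nat \<Rightarrow> nat \<Rightarrow> 'a \<Rightarrow> 'a" where
  "interface_normal \<Omega> i j x = outer_normal (\<Omega> i) x"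

text \<open>
  Derivative along the interface of a field defined on it. The derivative relative to the interface
  is determined only on tangent vectors, that is, on those orthogonal to the normal.
\<close>

definition interface_deriv ::
  "(nat \<Rightarrow> 'a::euclidean_space set) \<Rightarrow> nat \<Rightarrow> nat \<Rightarrow> ('a \<Rightarrow> 'a) \<Rightarrow> 'a \<Rightarrow> 'a \<Rightarrow> 'a" where
  "interface_deriv \<Omega> i j Y x u = frechet_derivative Y (at x within interface \<Omega> i j) u"

definition tangent_proj ::
  "(nat \<Rightarrow> 'a::euclidean_space set) \<Rightarrow> nat \<Rightarrow> nat \<Rightarrow> 'a \<Rightarrow> 'a \<Rightarrow> 'a" where
  "tangent_proj \<Omega> i j x u = u - (u \<bullet> interface_normal \<Omega> i j x) *\<^sub>R interface_normal \<Omega> i j x"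

text \<open>
  The trace over the tangent space of a bilinear form \<open>\<beta>\<close> on it, as the trace over the whole space
  of \<open>\<beta>\<close> composed with the orthogonal projection in both arguments.
\<close>

definition tangent_trace ::
  "(nat \<Rightarrow> 'a::euclidean_space set) \<Rightarrow> nat \<Rightarrow> nat \<Rightarrow> 'a \<Rightarrow> ('a \<Rightarrow> 'a \<Rightarrow> real) \<Rightarrow> real" where
  "tangent_trace \<Omega> i j x \<beta> = (\<Sum>b\<in>Basis. \<beta> (tangent_proj \<Omega> i j x b) (tangent_proj \<Omega> i j x b))"

definition second_form ::
  "(nat \<Rightarrow> 'a::euclidean_space set) \<Rightarrow> nat \<Rightarrow> nat \<Rightarrow> 'a \<Rightarrow> 'a \<Rightarrow> 'a \<Rightarrow> real" where
  "second_form \<Omega> i j x u v = interface_deriv \<Omega> i j (interface_normal \<Omega> i j) x u \<bullet> v"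

definition mean_curvature :: "(nat \<Rightarrow> 'a::euclidean_space set) \<Rightarrow> nat \<Rightarrow> nat \<Rightarrow> 'a \<Rightarrow> real" where
  "mean_curvature \<Omega> i j x = tangent_trace \<Omega> i j x (second_form \<Omega> i j x)"

definition surface_div ::
  "(nat \<Rightarrow> 'a::euclidean_space set) \<Rightarrow> nat \<Rightarrow> nat \<Rightarrow> ('a \<Rightarrow> 'a) \<Rightarrow> 'a \<Rightarrow> real" where
  "surface_div \<Omega> i j Y x = tangent_trace \<Omega> i j x (\<lambda>u v. interface_deriv \<Omega> i j Y x u \<bullet> v)"

definition test_field :: "('a::euclidean_space \<Rightarrow> 'a) \<Rightarrow> bool" where
  "test_field X \<longleftrightarrow> smooth_class_on C_inf X UNIV \<and> compact (supp X)"

definition stationary_cluster :: "nat \<Rightarrow> (nat \<Rightarrow> 'a::euclidean_space set) \<Rightarrow> (nat \<Rightarrow> real) \<Rightarrow> bool" where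
  "stationary_cluster q \<Omega> lam \<longleftrightarrow>
     cluster q \<Omega> \<and> regular1 q \<Omega> \<and> regular2 q \<Omega> \<and>
     (\<Sum>i\<in>{1..q}. lam i) = 0 \<and>
     (\<forall>i\<in>{1..q}. \<forall>j\<in>{1..q}. i \<noteq> j \<longrightarrow>
        (\<forall>x\<in>interface \<Omega> i j. mean_curvature \<Omega> i j x = lam i - lam j)) \<and>
     (\<forall>X. test_field X \<longrightarrow>
        (\<Sum>(i, j)\<in>index_pairs q.
           LINT x:interface \<Omega> i j|surface_measure.
             surface_div \<Omega> i j (\<lambda>y. tangent_proj \<Omega> i j y (X y)) x) = 0)"

definition flow :: "('a::euclidean_space \<Rightarrow> 'a) \<Rightarrow> real \<Rightarrow> 'a \<Rightarrow> 'a" where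
  "flow X = (THE F. \<forall>x. F 0 x = x \<and>
     (\<forall>t. ((\<lambda>s. F s x) has_vector_derivative X (F t x)) (at t)))"

definition volume_variation ::
  "nat \<Rightarrow> nat \<Rightarrow> (nat \<Rightarrow> 'a::euclidean_space set) \<Rightarrow> ('a \<Rightarrow> 'a) \<Rightarrow> nat \<Rightarrow> real" where
  "volume_variation k q \<Omega> X i =
     (if i < q then (deriv ^^ k) (\<lambda>t. measure lborel (flow X t ` \<Omega> i)) 0
      else - (\<Sum>j\<in>{1..<q}. (deriv ^^ k) (\<lambda>t. measure lborel (flow X t ` \<Omega> j)) 0))"

definition area_variation ::
  "nat \<Rightarrow> nat \<Rightarrow> (nat \<Rightarrow> 'a::euclidean_space set) \<Rightarrow> ('a \<Rightarrow> 'a) \<Rightarrow> real" where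
  "area_variation k q \<Omega> X = (deriv ^^ k) (\<lambda>t. cluster_perimeter q (\<lambda>i. flow X t ` \<Omega> i)) 0"

definition index_form ::
  "nat \<Rightarrow> (nat \<Rightarrow> 'a::euclidean_space set) \<Rightarrow> (nat \<Rightarrow> real) \<Rightarrow> ('a \<Rightarrow> 'a) \<Rightarrow> real" where
  "index_form q \<Omega> lam X =
     area_variation 2 q \<Omega> X - (\<Sum>i\<in>{1..q}. lam i * volume_variation 2 q \<Omega> X i)"

definition stable_cluster :: "nat \<Rightarrow> (nat \<Rightarrow> 'a::euclidean_space set) \<Rightarrow> (nat \<Rightarrow> real) \<Rightarrow> bool" where
  "stable_cluster q \<Omega> lam \<longleftrightarrow>
     (\<forall>X. test_field X \<and> (\<forall>i\<in>{1..q}. volume_variation 1 q \<Omega> X i = 0)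
        \<longrightarrow> 0 \<le> index_form q \<Omega> lam X)"

definition bounded_curvature :: "nat \<Rightarrow> (nat \<Rightarrow> 'a::euclidean_space set) \<Rightarrow> bool" where
  "bounded_curvature q \<Omega> \<longleftrightarrow>
     (\<exists>C. \<forall>(i, j)\<in>index_pairs q. \<forall>x\<in>interface \<Omega> i j. \<forall>u v.
        u \<bullet> interface_normal \<Omega> i j x = 0 \<and> v \<bullet> interface_normal \<Omega> i j x = 0 \<longrightarrow>
        \<bar>second_form \<Omega> i j x u v\<bar> \<le> C * norm u * norm v)"

definition quasi_center :: "(nat \<Rightarrow> 'a::euclidean_space set) \<Rightarrow> nat \<Rightarrow> nat \<Rightarrow> 'a \<Rightarrow> 'a" where
  "quasi_center \<Omega> i j p =
     interface_normal \<Omega> i j p - (mean_curvature \<Omega> i j p / (real DIM('a) - 1)) *\<^sub>R p"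

definition tensor :: "real ^ 'n \<Rightarrow> real ^ 'm \<Rightarrow> real ^ 'm ^ 'n" where
  "tensor u v = (\<chi> i j. u $ i * v $ j)"

end

theory Submission
  imports Defs
begin

text \<open>
  With \<open>\<nu>\<close> the unit normal, let \<open>S(a, b)\<close> be the sum of \<open>(\<lambda>\<^sub>i - \<lambda>\<^sub>j) \<integral> (\<nu> \<bullet> a) (p \<bullet> b) dp\<close> over the interfaces, \<open>T(a, b)\<close> the sum of
  \<open>\<integral> (\<nu> \<bullet> a) (\<nu> \<bullet> b) dp\<close>, and \<open>A\<close> the total area. Testing stationarity with a field equal to
  \<open>(p \<bullet> b) a\<close> near the cluster boundary gives \<open>(a \<bullet> b) A - T(a, b) = S(a, b)\<close>. The function equal to
  \<open>\<lambda>\<^sub>i\<close> on the \<open>i\<close>-th cell jumps by \<open>\<lambda>\<^sub>i - \<lambda>\<^sub>j\<close> across an interface and is constant near infinity, so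
  Gauss-Green gives \<open>S(a, b) = C (a \<bullet> b)\<close>. Hence \<open>T(a, b) = (A - C) (a \<bullet> b)\<close>, and taking traces
  \<open>A = n (A - C)\<close>, so \<open>T = S / (n - 1)\<close>. This is the claim, since the mean curvature is \<open>\<lambda>\<^sub>i - \<lambda>\<^sub>j\<close>.

  Gauss-Green is obtained from difference quotients. Moving a smooth piece of a cell by \<open>v / N\<close>
  changes it by a thin cylinder over its boundary, and the volume of such a cylinder is, up to a
  universal constant, the integral of \<open>v \<bullet> \<nu>\<close> over its base. The part of the boundary outside the
  interfaces is compact and null, hence covered by finitely many balls with small
  \<open>\<Sum>i. r i powr (n - 1)\<close>, and a cutoff near it changes the difference quotients by little.
\<close>

text \<open>The normal in the statement comes from the Gauss-Green measure of a cell, the integrals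
  from Hausdorff measure. They meet only at points of an interface, where the boundary is the zero
  set of a function \<open>w\<close> with gradient \<open>G\<close>: there the measure-theoretic
  normal is \<open>G\<close> divided by its norm, and the two cells are the sets
  \<open>w < 0\<close> and \<open>w > 0\<close>.

  Near the singular set two limits compete. A cutoff on a ball of radius \<open>r i\<close> has
  slope \<open>1 / r i\<close> but lives on a volume of order \<open>r i ^ n\<close>, so it costs
  about \<open>r i ^ (n - 1)\<close>, whatever the step \<open>v / N\<close>, once \<open>N\<close>
  is large compared with the radii. The radii are therefore fixed before \<open>N\<close> tends to
  infinity.

  A linear function has no compact support, so it is clamped far out. Only the cell that contains a
  neighbourhood of infinity meets the clamped region, and subtracting the multiplier of that cell
  makes \<open>C\<close> a finite integral. The universal factor of the cylinder formula is absorbed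
  into \<open>C\<close>, which the trace eliminates.\<close>

section \<open>Hausdorff measure\<close>

text \<open>\<open>T - F\<close> is exhausted by the sets \<open>S k\<close> at positive distance from \<open>F\<close>; the remaining layers \<open>R j\<close>
  have summable measure, since layers of the same parity are at positive distance from each other.\<close>

lemma caratheodory_closed_split:
  fixes f :: "'a::metric_space set \<Rightarrow> ennreal"
  assumes oms: "outer_measure_space UNIV f"
    and metric: "\<And>A B d. 0 < d \<Longrightarrow> (\<And>x y. x \<in> A \<Longrightarrow> y \<in> B \<Longrightarrow> d \<le> dist x y) \<Longrightarrow> f A + f B \<le> f (A \<union> B)"
    and "closed F" "F \<noteq> {}"
  shows "f (T \<inter> F) + f (T - F) \<le> f T"
proof (cases "f T = \<infinity>")
  case True
  then show ?thesis by (simp add: top_greatest)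
next
  case False
  have mono: "f A \<le> f B" if "A \<subseteq> B" for A B
    using oms that by (auto simp: outer_measure_space_def increasing_def)
  have pos: "f {} = 0"
    using oms by (auto simp: outer_measure_space_def positive_def)
  have csa: "f (\<Union>i. A i) \<le> (\<Sum>i. f (A i))" if "disjoint_family A" for A :: "nat \<Rightarrow> _"
    using oms that by (auto simp: outer_measure_space_def countably_subadditive_def)
  have sa: "f (A \<union> B) \<le> f A + f B" for A B
  proof -
    interpret sigma_algebra UNIV "UNIV :: 'a set set"
      using sigma_algebra_Pow[of "UNIV :: 'a set"] by simp
    have "subadditive UNIV f"
      using oms by (intro countably_subadditive_subadditive) (auto simp: outer_measure_space_def)
    then have "f (A \<union> (B - A)) \<le> f A + f (B - A)"
      by (intro subadditiveD) auto
    also have "\<dots> \<le> f A + f B" by (intro add_left_mono mono) auto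
    finally show ?thesis by simp
  qed
  have lip: "infdist x F \<le> infdist y F + dist x y" for x y
    by (metis infdist_triangle)
  define S where "S k = {x\<in>T. 1 / (real k + 1) \<le> infdist x F}" for k
  define R where "R k = {x\<in>T. 1 / (real k + 2) \<le> infdist x F \<and> infdist x F < 1 / (real k + 1)}" for k
  have S_le: "f (T \<inter> F) + f (S k) \<le> f T" for k
  proof -
    have "f (T \<inter> F) + f (S k) \<le> f ((T \<inter> F) \<union> S k)"
    proof (rule metric[of "1 / (real k + 1)"])
      fix x y assume "x \<in> T \<inter> F" "y \<in> S k"
      then show "1 / (real k + 1) \<le> dist x y"
        using lip[of y x] by (auto simp: S_def dist_commute)
    qed simp
    also have "\<dots> \<le> f T" by (intro mono) (auto simp: S_def)
    finally show ?thesis .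
  qed
  have sep: "(\<Sum>j<m. f (R (2 * j + d))) \<le> f (\<Union>j<m. R (2 * j + d))" for m d
  proof (induction m)
    case 0
    then show ?case by (simp add: pos)
  next
    case (Suc m)
    have "(\<Sum>j<Suc m. f (R (2 * j + d))) \<le> f (\<Union>j<m. R (2 * j + d)) + f (R (2 * m + d))"
      using Suc by (simp add: add_right_mono)
    also have "\<dots> \<le> f ((\<Union>j<m. R (2 * j + d)) \<union> R (2 * m + d))"
    proof (rule metric)
      \<comment> \<open>Earlier layers have distance at least 1/(2m+d) from \<open>F\<close>, points
        of the new layer less than 1/(2m+d+1), so \<open>e\<close> is a gap. For m = 0 the union is
        empty and any positive gap will do; the formula could then be negative, since 1/0 =
        0.\<close>
      define e where "e = 1 / (2 * real m + real d) - 1 / (2 * real m + real d + 1)"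
      show "0 < (if m = 0 then 1 else e)"
        by (auto simp: e_def intro!: divide_strict_left_mono mult_pos_pos add_pos_nonneg)
      fix x y assume "x \<in> (\<Union>j<m. R (2 * j + d))" and y: "y \<in> R (2 * m + d)"
      then obtain j where j: "j < m" "x \<in> R (2 * j + d)" by auto
      have "real (2 * j + d) + 2 \<le> 2 * real m + real d"
        using j(1) by (simp add: nat_less_real_le)
      then have "1 / (2 * real m + real d) \<le> 1 / (real (2 * j + d) + 2)"
        by (intro divide_left_mono) (auto intro!: mult_pos_pos)
      also have "\<dots> \<le> infdist x F" using j by (simp add: R_def)
      finally have "1 / (2 * real m + real d) \<le> infdist x F" .
      moreover have "infdist y F < 1 / (2 * real m + real d + 1)"
        using y by (simp add: R_def)
      ultimately show "(if m = 0 then 1 else e) \<le> dist x y"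
        using lip[of x y] j(1) by (auto simp: e_def)
    qed
    also have "(\<Union>j<m. R (2 * j + d)) \<union> R (2 * m + d) = (\<Union>j<Suc m. R (2 * j + d))"
      by (auto simp: less_Suc_eq)
    finally show ?case .
  qed
  have half: "(\<Sum>j. f (R (2 * j + d))) \<le> f T" for d
  proof (rule suminf_le_const)
    show "(\<Sum>j<m. f (R (2 * j + d))) \<le> f T" for m
      by (rule order_trans[OF sep mono]) (auto simp: R_def)
  qed auto
  define r where "r j = enn2real (f (R j))" for j
  have r: "f (R j) = ennreal (r j)" for j
  proof -
    have "f (R j) \<le> f T" by (intro mono) (auto simp: R_def)
    then show ?thesis using False by (auto simp: r_def top_unique less_top)
  qed
  have r0: "0 \<le> r j" for j by (simp add: r_def)
  have "summable (\<lambda>j. r (2 * j + d))" for d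
    using half[of d] False r0 by (intro summable_suminf_not_top) (auto simp: r top_unique)
  from this[of 0] this[of 1] have *: "summable (\<lambda>j. r (2 * j) + r (2 * j + 1))"
    using summable_add by fastforce
  have "summable r"
  proof (rule bounded_imp_summable[OF r0])
    fix n
    have "(\<Sum>j\<le>n. r j) \<le> (\<Sum>j<2 * Suc n. r j)"
      by (intro sum_mono2) (auto simp: r0)
    also have "\<dots> = (\<Sum>j<Suc n. r (2 * j) + r (2 * j + 1))"
      by (induction n) (auto simp: eval_nat_numeral)
    also have "\<dots> \<le> (\<Sum>j. r (2 * j) + r (2 * j + 1))"
      by (intro sum_le_suminf *) (auto simp: r0)
    finally show "(\<Sum>j\<le>n. r j) \<le> (\<Sum>j. r (2 * j) + r (2 * j + 1))" .
  qed
  show ?thesis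
  proof (rule ennreal_le_epsilon)
    fix e :: real assume e: "0 < e"
    from suminf_exist_split[OF e \<open>summable r\<close>] obtain k where k: "norm (\<Sum>i. r (i + k)) < e"
      by blast
    have "T - F \<subseteq> S k \<union> (\<Union>i. R (i + k))"
    proof
      fix x assume x: "x \<in> T - F"
      show "x \<in> S k \<union> (\<Union>i. R (i + k))"
      proof (cases "x \<in> S k")
        case False
        then have lt: "infdist x F < 1 / (real k + 1)" using x by (auto simp: S_def)
        have "infdist x F > 0"
          using x assms(3,4) in_closed_iff_infdist_zero[of F x] infdist_nonneg[of x F] by force
        then obtain n where n: "1 / (real n + 1) < infdist x F"
          by (metis add.commute nat_approx_posE of_nat_Suc)
        \<comment> \<open>\<open>R j\<close> collects distances in [1/(j+2), 1/(j+1)), so the first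
          threshold 1/(l+1) that is reached puts \<open>x\<close> into layer
          \<open>l - 1\<close>.\<close>
        define l where "l = (LEAST n. 1 / (real n + 1) \<le> infdist x F)"
        have l: "1 / (real l + 1) \<le> infdist x F"
          unfolding l_def by (rule LeastI[of _ n]) (use n in auto)
        have "k < l"
        proof (rule ccontr)
          assume "\<not> k < l"
          then have "1 / (real k + 1) \<le> 1 / (real l + 1)" by (intro divide_left_mono) auto
          then show False using l lt by simp
        qed
        then have "infdist x F < 1 / (real (l - 1) + 1)"
          using not_less_Least[of "l - 1" "\<lambda>n. 1 / (real n + 1) \<le> infdist x F"]
          by (auto simp: l_def[symmetric] not_le)
        then have "x \<in> R ((l - 1 - k) + k)"
          using l x \<open>k < l\<close> by (auto simp: R_def of_nat_diff add.commute)
        then show ?thesis by blast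
      qed auto
    qed
    then have "f (T - F) \<le> f (S k \<union> (\<Union>i. R (i + k)))" by (rule mono)
    also have "\<dots> \<le> f (S k) + f (\<Union>i. R (i + k))" by (rule sa)
    also have "f (\<Union>i. R (i + k)) \<le> (\<Sum>i. f (R (i + k)))"
    proof (rule csa)
      have "R i \<inter> R j = {}" if "i < j" for i j
      proof -
        have "1 / (real j + 1) \<le> 1 / (real i + 2)" using that by (intro divide_left_mono) auto
        then show ?thesis by (auto simp: R_def)
      qed
      then have "R i \<inter> R j = {}" if "i \<noteq> j" for i j
        using that by (metis Int_commute nat_neq_iff)
      then show "disjoint_family (\<lambda>i. R (i + k))" by (auto simp: disjoint_family_on_def)
    qed
    also have "(\<Sum>i. f (R (i + k))) = ennreal (\<Sum>i. r (i + k))"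
      unfolding r by (rule suminf_ennreal2) (use r0 \<open>summable r\<close> in \<open>auto simp: summable_iff_shift\<close>)
    also have "\<dots> \<le> ennreal e" using k by (intro ennreal_leI) auto
    finally have "f (T - F) \<le> f (S k) + ennreal e" by (simp add: add_left_mono)
    then have "f (T \<inter> F) + f (T - F) \<le> f (T \<inter> F) + (f (S k) + ennreal e)"
      by (rule add_left_mono)
    also have "\<dots> \<le> f T + ennreal e"
      using S_le[of k] by (simp add: add.assoc[symmetric] add_right_mono)
    finally show "f (T \<inter> F) + f (T - F) \<le> f T + ennreal e" .
  qed
qed

text \<open>Caratheodory's criterion: the splitting inequality puts every closed set into the
  sigma-algebra of measurable sets of the outer measure, and closed sets generate the Borel
  sets.\<close>

lemma caratheodory_metric:
  fixes f :: "'a::metric_space set \<Rightarrow> ennreal"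
  assumes oms: "outer_measure_space UNIV f"
    and metric: "\<And>A B d. 0 < d \<Longrightarrow> (\<And>x y. x \<in> A \<Longrightarrow> y \<in> B \<Longrightarrow> d \<le> dist x y) \<Longrightarrow> f A + f B \<le> f (A \<union> B)"
  shows "measure_space UNIV (sets borel) f"
proof -
  interpret sigma_algebra UNIV "UNIV :: 'a set set"
    using sigma_algebra_Pow[of "UNIV :: 'a set"] by simp
  have ms: "measure_space UNIV (lambda_system UNIV UNIV f) f"
    by (rule caratheodory_lemma[OF oms])
  have pos: "f {} = 0"
    using oms by (auto simp: outer_measure_space_def positive_def)
  have sa: "subadditive UNIV f"
    using oms by (intro countably_subadditive_subadditive) (auto simp: outer_measure_space_def)
  have "F \<in> lambda_system UNIV UNIV f" if F: "closed F" for F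
  proof -
    have "f (T \<inter> F) + f (T - F) = f T" for T
    proof (rule antisym)
      show "f (T \<inter> F) + f (T - F) \<le> f T"
        using caratheodory_closed_split[OF oms metric F] pos by (cases "F = {}") auto
      have "f ((T \<inter> F) \<union> (T - F)) \<le> f (T \<inter> F) + f (T - F)"
        by (rule subadditiveD[OF sa]) auto
      then show "f T \<le> f (T \<inter> F) + f (T - F)"
        by (simp add: Int_Diff_Un)
    qed
    then show ?thesis by (simp add: lambda_system_eq)
  qed
  then have "sigma_sets UNIV (Collect closed) \<subseteq> lambda_system UNIV UNIV f"
    using ms by (intro sigma_algebra.sigma_sets_subset) (auto simp: measure_space_def)
  then have "sets borel \<subseteq> lambda_system UNIV UNIV f"
    unfolding borel_eq_closed by (subst sets_measure_of) auto
  moreover have "sigma_algebra UNIV (sets (borel :: 'a measure))"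
    using sets.sigma_algebra_axioms[of "borel :: 'a measure"] by simp
  ultimately show ?thesis
    using measure_down[OF ms] by blast
qed

section \<open>Hausdorff outer measure as a metric outer measure\<close>

definition hausdorff_pre :: "real \<Rightarrow> real \<Rightarrow> 'a::metric_space set \<Rightarrow> ennreal" where
  "hausdorff_pre s \<delta> A =
     (INF E\<in>{E :: nat \<Rightarrow> 'a set. A \<subseteq> (\<Union>i. E i) \<and> (\<forall>i. bounded (E i) \<and> diameter (E i) \<le> \<delta>)}.
        \<Sum>i. hausdorff_gauge s (E i))"

lemma hausdorff_outer_eq_SUP_pre: "hausdorff_outer s A = (SUP \<delta>\<in>{0<..}. hausdorff_pre s \<delta> A)"
  by (simp add: hausdorff_outer_def hausdorff_pre_def)

lemma hausdorff_gauge_empty [simp]: "hausdorff_gauge s {} = 0"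
  by (simp add: hausdorff_gauge_def)

lemma hausdorff_gauge_pos:
  "0 < s \<Longrightarrow> hausdorff_gauge s E = ennreal (unit_ball_vol s * (diameter E / 2) powr s)"
  by (simp add: hausdorff_gauge_def)

lemma hausdorff_pre_le:
  assumes "A \<subseteq> (\<Union>i. E i)" "\<And>i. bounded (E i)" "\<And>i. diameter (E i) \<le> \<delta>"
  shows "hausdorff_pre s \<delta> A \<le> (\<Sum>i. hausdorff_gauge s (E i))"
  unfolding hausdorff_pre_def using assms by (intro INF_lower) auto

lemma hausdorff_pre_le_outer: "0 < \<delta> \<Longrightarrow> hausdorff_pre s \<delta> A \<le> hausdorff_outer s A"
  unfolding hausdorff_outer_eq_SUP_pre by (intro SUP_upper) auto

lemma hausdorff_pre_antimono: "\<delta> \<le> \<delta>' \<Longrightarrow> hausdorff_pre s \<delta>' A \<le> hausdorff_pre s \<delta> A"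
  unfolding hausdorff_pre_def by (intro INF_superset_mono) (auto intro: order_trans)

lemma hausdorff_pre_mono: "A \<subseteq> B \<Longrightarrow> hausdorff_pre s \<delta> A \<le> hausdorff_pre s \<delta> B"
  unfolding hausdorff_pre_def by (intro INF_superset_mono) auto

lemma hausdorff_outer_mono: "A \<subseteq> B \<Longrightarrow> hausdorff_outer s A \<le> hausdorff_outer s B"
  unfolding hausdorff_outer_eq_SUP_pre by (intro SUP_mono) (auto intro: hausdorff_pre_mono)

lemma hausdorff_outer_empty [simp]: "hausdorff_outer s {} = 0"
proof -
  have "hausdorff_pre s \<delta> ({} :: 'a set) \<le> 0" if "0 < \<delta>" for \<delta>
    using hausdorff_pre_le[of "{}" "\<lambda>_. {} :: 'a set" \<delta> s] that by simp
  then have "hausdorff_outer s ({} :: 'a set) \<le> 0"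
    unfolding hausdorff_outer_eq_SUP_pre by (intro SUP_least) auto
  then show ?thesis by simp
qed

lemma hausdorff_pre_approx:
  assumes "hausdorff_pre s \<delta> A < a"
  obtains E :: "nat \<Rightarrow> 'a::metric_space set" where "A \<subseteq> (\<Union>i. E i)" "\<And>i. bounded (E i)" "\<And>i. diameter (E i) \<le> \<delta>"
    "(\<Sum>i. hausdorff_gauge s (E i)) < a"
  using assms unfolding hausdorff_pre_def INF_less_iff by auto

lemma hausdorff_outer_null_cover:
  assumes "hausdorff_outer s A = 0" "0 < \<delta>" "0 < \<epsilon>"
  obtains E :: "nat \<Rightarrow> 'a::metric_space set" where "A \<subseteq> (\<Union>i. E i)" "\<And>i. bounded (E i)" "\<And>i. diameter (E i) \<le> \<delta>"
    "(\<Sum>i. hausdorff_gauge s (E i)) < \<epsilon>"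
proof -
  have "hausdorff_pre s \<delta> A < \<epsilon>"
    using hausdorff_pre_le_outer[OF assms(2), of s A] assms(1,3) by (auto simp: le_less_trans)
  from hausdorff_pre_approx[OF this] that show thesis by metis
qed

text \<open>Almost optimal covers of the \<open>A n\<close>, with errors
  \<open>e / 2 ^ Suc n\<close>, are merged into a single sequence by enumerating pairs of
  indices.\<close>

lemma hausdorff_pre_UN_le:
  "hausdorff_pre s \<delta> (\<Union>n. A n :: 'a::metric_space set) \<le> (\<Sum>n::nat. hausdorff_pre s \<delta> (A n))"
proof (cases "(\<Sum>n. hausdorff_pre s \<delta> (A n)) = \<infinity>")
  case False
  then have fin: "hausdorff_pre s \<delta> (A n) < top" for n
    by (metis ennreal_suminf_lessD infinity_ennreal_def less_top)
  show ?thesis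
  proof (rule ennreal_le_epsilon)
    fix e :: real assume e: "0 < e"
    have "\<exists>E :: nat \<Rightarrow> 'a set. A n \<subseteq> (\<Union>i. E i) \<and> (\<forall>i. bounded (E i)) \<and> (\<forall>i. diameter (E i) \<le> \<delta>) \<and>
      (\<Sum>i. hausdorff_gauge s (E i)) < hausdorff_pre s \<delta> (A n) + ennreal (e * (1/2) ^ Suc n)" for n
    proof -
      have "hausdorff_pre s \<delta> (A n) < hausdorff_pre s \<delta> (A n) + ennreal (e * (1/2) ^ Suc n)"
        using fin[of n] e
        by (cases "hausdorff_pre s \<delta> (A n)")
          (simp_all add: ennreal_plus[symmetric] ennreal_less_iff del: ennreal_plus)
      from hausdorff_pre_approx[OF this] show ?thesis by metis
    qed
    then obtain E :: "nat \<Rightarrow> nat \<Rightarrow> 'a set" where E: "\<And>n. A n \<subseteq> (\<Union>i. E n i)" "\<And>n i. bounded (E n i)"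
      "\<And>n i. diameter (E n i) \<le> \<delta>"
      "\<And>n. (\<Sum>i. hausdorff_gauge s (E n i)) < hausdorff_pre s \<delta> (A n) + ennreal (e * (1/2) ^ Suc n)"
      by metis
    define D where "D k = (case prod_decode k of (n, i) \<Rightarrow> E n i)" for k
    have "hausdorff_pre s \<delta> (\<Union>n. A n) \<le> (\<Sum>k. hausdorff_gauge s (D k))"
    proof (rule hausdorff_pre_le)
      have "E n i = D (prod_encode (n, i))" for n i by (simp add: D_def)
      then show "(\<Union>n. A n) \<subseteq> (\<Union>k. D k)"
        using E(1) by (fastforce simp: subset_iff)
    qed (auto simp: D_def E split: prod.split)
    also have "\<dots> = (\<Sum>k. (\<lambda>(n, i). hausdorff_gauge s (E n i)) (prod_decode k))"
      by (intro suminf_cong) (auto simp: D_def split: prod.split)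
    also have "\<dots> = (\<Sum>n. \<Sum>i. hausdorff_gauge s (E n i))"
      using suminf_ennreal_2dimen[of "\<lambda>n. \<Sum>i. hausdorff_gauge s (E n i)" "\<lambda>(n, i). hausdorff_gauge s (E n i)"]
      by (simp add: o_def)
    also have "\<dots> \<le> (\<Sum>n. hausdorff_pre s \<delta> (A n) + ennreal (e * (1/2) ^ Suc n))"
      using E(4) by (intro suminf_le) (auto intro: less_imp_le)
    also have "\<dots> = (\<Sum>n. hausdorff_pre s \<delta> (A n)) + (\<Sum>n. ennreal (e * (1/2) ^ Suc n))"
      by (intro suminf_add[symmetric]) auto
    also have "(\<Sum>n. ennreal (e * (1/2) ^ Suc n)) = ennreal (\<Sum>n. e * (1/2) ^ Suc n)"
      using e sums_mult[OF power_half_series, of e] by (intro suminf_ennreal2) (auto simp: sums_iff)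
    also have "(\<Sum>n. e * (1/2) ^ Suc n) = e"
      using sums_mult[OF power_half_series, of e] by (simp add: sums_iff)
    finally show "hausdorff_pre s \<delta> (\<Union>n. A n) \<le> (\<Sum>n. hausdorff_pre s \<delta> (A n)) + ennreal e" .
  qed
qed auto

lemma hausdorff_outer_UN_le:
  "hausdorff_outer s (\<Union>n. A n) \<le> (\<Sum>n::nat. hausdorff_outer s (A n))"
proof -
  have "hausdorff_pre s \<delta> (\<Union>n. A n) \<le> (\<Sum>n. hausdorff_outer s (A n))" if "0 < \<delta>" for \<delta>
    using that by (intro order_trans[OF hausdorff_pre_UN_le] suminf_le hausdorff_pre_le_outer) auto
  then show ?thesis
    unfolding hausdorff_outer_eq_SUP_pre[of _ "\<Union>n. A n"] by (intro SUP_least) auto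
qed

lemma outer_measure_space_hausdorff: "outer_measure_space UNIV (hausdorff_outer s)"
  unfolding outer_measure_space_def positive_def increasing_def countably_subadditive_def
  by (auto intro: hausdorff_outer_mono hausdorff_outer_UN_le)

text \<open>A set of diameter below \<open>d\<close> cannot meet both \<open>A\<close> and
  \<open>B\<close>, so a fine cover of the union splits into a cover of each without using any set
  twice.\<close>

lemma hausdorff_outer_separated:
  assumes d: "0 < d" and sep: "\<And>x y. x \<in> A \<Longrightarrow> y \<in> B \<Longrightarrow> d \<le> dist x y"
  shows "hausdorff_outer s A + hausdorff_outer s B \<le> hausdorff_outer s (A \<union> B)"
proof -
  have *: "hausdorff_pre s \<delta> A + hausdorff_pre s \<delta> B \<le> hausdorff_outer s (A \<union> B)" if \<delta>: "0 < \<delta>" "\<delta> < d" for \<delta>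
  proof -
    have "hausdorff_pre s \<delta> A + hausdorff_pre s \<delta> B \<le> (\<Sum>i. hausdorff_gauge s (E i))"
      if E: "A \<union> B \<subseteq> (\<Union>i. E i)" "\<forall>i. bounded (E i) \<and> diameter (E i) \<le> \<delta>" for E
    proof -
      define F where "F C i = (if E i \<inter> C \<noteq> {} then E i else {})" for C i
      have F: "hausdorff_pre s \<delta> C \<le> (\<Sum>i. hausdorff_gauge s (F C i))" if C: "C \<subseteq> A \<union> B" for C
      proof (rule hausdorff_pre_le)
        show "C \<subseteq> (\<Union>i. F C i)"
        proof
          fix x assume "x \<in> C"
          then obtain i where "x \<in> E i" using E(1) C by blast
          then show "x \<in> (\<Union>i. F C i)" using \<open>x \<in> C\<close> by (auto simp: F_def intro!: exI[of _ i])
        qed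
      qed (use E \<delta> in \<open>auto simp: F_def\<close>)
      have "hausdorff_pre s \<delta> A + hausdorff_pre s \<delta> B
          \<le> (\<Sum>i. hausdorff_gauge s (F A i)) + (\<Sum>i. hausdorff_gauge s (F B i))"
        by (intro add_mono F) auto
      also have "\<dots> = (\<Sum>i. hausdorff_gauge s (F A i) + hausdorff_gauge s (F B i))"
        by (intro suminf_add) auto
      also have "\<dots> \<le> (\<Sum>i. hausdorff_gauge s (E i))"
      proof (intro suminf_le)
        fix i
        have "False" if "x \<in> E i" "x \<in> A" "y \<in> E i" "y \<in> B" for x y
          using sep[OF that(2,4)] diameter_bounded_bound[of "E i" x y] E(2) that \<delta>
          by (metis dual_order.trans not_le)
        then show "hausdorff_gauge s (F A i) + hausdorff_gauge s (F B i) \<le> hausdorff_gauge s (E i)"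
          by (auto simp: F_def)
      qed auto
      finally show ?thesis .
    qed
    then have "hausdorff_pre s \<delta> A + hausdorff_pre s \<delta> B \<le> hausdorff_pre s \<delta> (A \<union> B)"
      unfolding hausdorff_pre_def[of _ _ "A \<union> B"] by (intro INF_greatest) auto
    also have "\<dots> \<le> hausdorff_outer s (A \<union> B)"
      using \<delta> by (intro hausdorff_pre_le_outer) auto
    finally show ?thesis .
  qed
  have "hausdorff_outer s A + hausdorff_outer s B
      = (SUP \<delta>\<in>{0<..}. SUP \<epsilon>\<in>{0<..}. hausdorff_pre s \<delta> A + hausdorff_pre s \<epsilon> B)"
    unfolding hausdorff_outer_eq_SUP_pre
    by (simp add: ennreal_SUP_add_left[symmetric] ennreal_SUP_add_right[symmetric])
  also have "\<dots> \<le> hausdorff_outer s (A \<union> B)"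
  proof (intro SUP_least)
    fix \<delta> \<epsilon> :: real assume "\<delta> \<in> {0<..}" "\<epsilon> \<in> {0<..}"
    \<comment> \<open>One scale below both given scales and below the separation; passing to a finer
      scale only increases the premeasures.\<close>
    define m where "m = Min {\<delta>, \<epsilon>, d / 2}"
    have m: "0 < m" "m < d" "m \<le> \<delta>" "m \<le> \<epsilon>"
      using \<open>\<delta> \<in> {0<..}\<close> \<open>\<epsilon> \<in> {0<..}\<close> d by (auto simp: m_def min_def)
    have "hausdorff_pre s \<delta> A + hausdorff_pre s \<epsilon> B \<le> hausdorff_pre s m A + hausdorff_pre s m B"
      using m by (intro add_mono hausdorff_pre_antimono)
    also have "\<dots> \<le> hausdorff_outer s (A \<union> B)" by (rule *[OF m(1,2)])
    finally show "hausdorff_pre s \<delta> A + hausdorff_pre s \<epsilon> B \<le> hausdorff_outer s (A \<union> B)" .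
  qed
  finally show ?thesis .
qed

lemma measure_space_hausdorff: "measure_space UNIV (sets borel) (hausdorff_outer s)"
  by (rule caratheodory_metric[OF outer_measure_space_hausdorff hausdorff_outer_separated])

lemma sets_hausdorff_measure [simp, measurable_cong]: "sets (hausdorff_measure s) = sets borel"
  using sets.sigma_sets_eq[of borel] by (simp add: hausdorff_measure_def sets_measure_of_conv)

lemma space_hausdorff_measure [simp]: "space (hausdorff_measure s) = UNIV"
  by (simp add: hausdorff_measure_def space_measure_of_conv)

lemma emeasure_hausdorff_measure:
  assumes "A \<in> sets borel"
  shows "emeasure (hausdorff_measure s) A = hausdorff_outer s A"
  unfolding hausdorff_measure_def
proof (rule emeasure_measure_of_sigma)
  show "sigma_algebra UNIV (sets (borel :: 'a measure))"
    using sets.sigma_algebra_axioms[of "borel :: 'a measure"] by simp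
qed (use measure_space_hausdorff[of s] assms in \<open>auto simp: measure_space_def\<close>)

lemma hausdorff_outer_Un_le:
  fixes A B :: "'a::metric_space set"
  shows "hausdorff_outer s (A \<union> B) \<le> hausdorff_outer s A + hausdorff_outer s B"
proof -
  interpret sigma_algebra UNIV "UNIV :: 'a set set"
    using sigma_algebra_Pow[of "UNIV :: 'a set"] by simp
  have "subadditive UNIV (hausdorff_outer s :: 'a set \<Rightarrow> ennreal)"
    using outer_measure_space_hausdorff[of s]
    by (intro countably_subadditive_subadditive) (auto simp: outer_measure_space_def)
  then have "hausdorff_outer s (A \<union> (B - A)) \<le> hausdorff_outer s A + hausdorff_outer s (B - A)"
    by (rule subadditiveD) auto
  also have "\<dots> \<le> hausdorff_outer s A + hausdorff_outer s B"
    by (intro add_left_mono hausdorff_outer_mono) auto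
  finally show ?thesis by simp
qed

lemma hausdorff_outer_null_UN:
  assumes "finite I" "\<And>i. i \<in> I \<Longrightarrow> hausdorff_outer s (A i) = 0"
  shows "hausdorff_outer s (\<Union>i\<in>I. A i) = 0"
  using assms
proof (induction I rule: finite_induct)
  case (insert i I)
  then show ?case using hausdorff_outer_Un_le[of s "A i" "\<Union>i\<in>I. A i"] by simp
qed simp

text \<open>Covering sets are intersected with \<open>A\<close> before being mapped, because the
  Lipschitz estimate holds only there. A cover at scale \<open>\<delta> / C\<close> becomes one at
  scale \<open>\<delta>\<close>, and the change of scale disappears in the supremum.\<close>

lemma hausdorff_outer_lipschitz_image:
  fixes f :: "'a::metric_space \<Rightarrow> 'b::metric_space"
  assumes s: "0 < s" and C: "0 < C" and lip: "\<And>x y. x \<in> A \<Longrightarrow> y \<in> A \<Longrightarrow> dist (f x) (f y) \<le> C * dist x y"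
  shows "hausdorff_outer s (f ` A) \<le> ennreal (C powr s) * hausdorff_outer s A"
proof -
  have "hausdorff_pre s \<delta> (f ` A) \<le> ennreal (C powr s) * hausdorff_pre s (\<delta> / C) A" if \<delta>: "0 < \<delta>" for \<delta>
  proof -
    have "hausdorff_pre s \<delta> (f ` A) \<le> ennreal (C powr s) * (\<Sum>i. hausdorff_gauge s (E i))"
      if E: "A \<subseteq> (\<Union>i. E i)" "\<forall>i. bounded (E i) \<and> diameter (E i) \<le> \<delta> / C" for E
    proof -
      have dle: "dist x y \<le> C * diameter (E i)" if xy: "x \<in> f ` (A \<inter> E i)" "y \<in> f ` (A \<inter> E i)" for x y i
      proof -
        from xy obtain a b where ab: "x = f a" "y = f b" "a \<in> A" "a \<in> E i" "b \<in> A" "b \<in> E i" by blast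
        have "dist x y \<le> C * dist a b" using lip ab by simp
        also have "\<dots> \<le> C * diameter (E i)"
          using ab E C by (intro mult_left_mono diameter_bounded_bound) auto
        finally show ?thesis .
      qed
      have diam: "diameter (f ` (A \<inter> E i)) \<le> C * diameter (E i)" for i
      proof (cases "f ` (A \<inter> E i) = {}")
        case True
        then show ?thesis using E C by (simp add: diameter_ge_0)
      next
        case False
        then show ?thesis
          using dle by (subst diameter_def) (auto intro!: cSUP_least)
      qed
      have bd: "bounded (f ` (A \<inter> E i))" for i
        unfolding bounded_two_points using dle by blast
      have "hausdorff_pre s \<delta> (f ` A) \<le> (\<Sum>i. hausdorff_gauge s (f ` (A \<inter> E i)))"
      proof (rule hausdorff_pre_le)
        show "f ` A \<subseteq> (\<Union>i. f ` (A \<inter> E i))" using E(1) by blast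
        show "diameter (f ` (A \<inter> E i)) \<le> \<delta>" for i
          using diam[of i] E(2) C by (auto simp: pos_le_divide_eq mult.commute intro: order_trans)
      qed (rule bd)
      also have "\<dots> \<le> (\<Sum>i. ennreal (C powr s) * hausdorff_gauge s (E i))"
      proof (intro suminf_le)
        fix i
        have "(diameter (f ` (A \<inter> E i)) / 2) powr s \<le> (C * (diameter (E i) / 2)) powr s"
          using diam[of i] s by (intro powr_mono2) (auto simp: diameter_ge_0 bd)
        also have "\<dots> = C powr s * (diameter (E i) / 2) powr s"
          using C E by (subst powr_mult) (auto simp: diameter_ge_0)
        finally have "unit_ball_vol s * (diameter (f ` (A \<inter> E i)) / 2) powr s
            \<le> C powr s * (unit_ball_vol s * (diameter (E i) / 2) powr s)"
          using s by (metis mult.left_commute mult_left_mono unit_ball_vol_nonneg less_imp_le)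
        then show "hausdorff_gauge s (f ` (A \<inter> E i)) \<le> ennreal (C powr s) * hausdorff_gauge s (E i)"
          using s by (simp add: hausdorff_gauge_pos ennreal_mult'[symmetric] ennreal_leI)
      qed auto
      also have "\<dots> = ennreal (C powr s) * (\<Sum>i. hausdorff_gauge s (E i))"
        by (rule ennreal_suminf_cmult)
      finally show ?thesis .
    qed
    \<comment> \<open>The factor is moved to the left side, so that the infimum over all covers can
      be taken on the right.\<close>
    moreover have inv: "ennreal (1 / C powr s) * ennreal (C powr s) = 1"
      using C by (simp add: ennreal_mult'[symmetric])
    ultimately have "ennreal (1 / C powr s) * hausdorff_pre s \<delta> (f ` A) \<le> (\<Sum>i. hausdorff_gauge s (E i))"
      if "A \<subseteq> (\<Union>i. E i)" "\<forall>i. bounded (E i) \<and> diameter (E i) \<le> \<delta> / C" for E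
      using mult_left_mono[of "hausdorff_pre s \<delta> (f ` A)" _ "ennreal (1 / C powr s)"] that
      by (metis mult.assoc mult_1 zero_le)
    then have "ennreal (1 / C powr s) * hausdorff_pre s \<delta> (f ` A) \<le> hausdorff_pre s (\<delta> / C) A"
      unfolding hausdorff_pre_def[of _ _ A] by (intro INF_greatest) auto
    then have "ennreal (C powr s) * (ennreal (1 / C powr s) * hausdorff_pre s \<delta> (f ` A))
        \<le> ennreal (C powr s) * hausdorff_pre s (\<delta> / C) A"
      by (rule mult_left_mono) auto
    then show ?thesis
      using inv by (simp add: mult.assoc[symmetric] mult.commute[of "ennreal (C powr s)"])
  qed
  also have "ennreal (C powr s) * hausdorff_pre s (\<delta> / C) A \<le> ennreal (C powr s) * hausdorff_outer s A"
    if "0 < \<delta>" for \<delta>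
    using that C by (intro mult_left_mono hausdorff_pre_le_outer) auto
  finally show ?thesis
    unfolding hausdorff_outer_eq_SUP_pre[of _ "f ` A"] by (intro SUP_least) auto
qed

lemma hausdorff_outer_isometric_image:
  fixes f :: "'a::metric_space \<Rightarrow> 'b::metric_space"
  assumes s: "0 < s" and iso: "\<And>x y. x \<in> A \<Longrightarrow> y \<in> A \<Longrightarrow> dist (f x) (f y) = dist x y"
  shows "hausdorff_outer s (f ` A) = hausdorff_outer s A"
proof (rule antisym)
  show "hausdorff_outer s (f ` A) \<le> hausdorff_outer s A"
    using hausdorff_outer_lipschitz_image[OF s, of 1 A f] iso by simp
  have inj: "inj_on f A" using iso by (metis dist_eq_0_iff inj_onI)
  have "hausdorff_outer s (the_inv_into A f ` f ` A) \<le> ennreal (1 powr s) * hausdorff_outer s (f ` A)"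
    using iso by (intro hausdorff_outer_lipschitz_image[OF s]) (auto simp: the_inv_into_f_f[OF inj])
  moreover have "the_inv_into A f ` f ` A = A"
    using the_inv_into_f_f[OF inj] by (force simp: image_image)
  ultimately show "hausdorff_outer s A \<le> hausdorff_outer s (f ` A)" by simp
qed

section \<open>Lebesgue measure of cylinders over flat sets\<close>

text \<open>The base may be curved and \<open>v\<close> oblique to it: this is the region swept over
  by the base as it moves along \<open>v\<close>.\<close>

definition cyl :: "'a::real_vector \<Rightarrow> real set \<Rightarrow> 'a set \<Rightarrow> 'a set" where
  "cyl v I A = (\<lambda>(p, t). p + t *\<^sub>R v) ` (A \<times> I)"

lemma hausdorff_pre_le_finite:
  assumes "finite F" "A \<subseteq> (\<Union>c\<in>F. E c)" "\<And>c. c \<in> F \<Longrightarrow> bounded (E c)" "\<And>c. c \<in> F \<Longrightarrow> diameter (E c) \<le> \<delta>" "0 \<le> \<delta>"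
  shows "hausdorff_pre s \<delta> A \<le> (\<Sum>c\<in>F. hausdorff_gauge s (E c))"
proof -
  obtain h where h: "bij_betw h {0..<card F} F"
    using ex_bij_betw_nat_finite[OF assms(1)] by blast
  define D where "D i = (if i < card F then E (h i) else {})" for i
  have hF: "h i \<in> F" if "i < card F" for i
    using h that by (auto simp: bij_betw_def)
  have "hausdorff_pre s \<delta> A \<le> (\<Sum>i. hausdorff_gauge s (D i))"
  proof (rule hausdorff_pre_le)
    have "F = h ` {0..<card F}" using h by (simp add: bij_betw_def)
    then have "(\<Union>c\<in>F. E c) = (\<Union>i<card F. E (h i))" by (metis UN_extend_simps(10) lessThan_atLeast0)
    then show "A \<subseteq> (\<Union>i. D i)"
      using assms(2) by (fastforce simp: D_def)
  qed (use assms hF in \<open>auto simp: D_def\<close>)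
  also have "\<dots> = (\<Sum>i\<in>{0..<card F}. hausdorff_gauge s (D i))"
    by (rule suminf_finite) (auto simp: D_def)
  also have "\<dots> = (\<Sum>i\<in>{0..<card F}. hausdorff_gauge s (E (h i)))"
    by (intro sum.cong) (auto simp: D_def)
  also have "\<dots> = (\<Sum>c\<in>F. hausdorff_gauge s (E c))"
    by (rule sum.reindex_bij_betw[OF h])
  finally show ?thesis .
qed

text \<open>A grid of mesh 1/m covers \<open>A\<close> by (2Rm)^(n-1) cubes whose gauge is at most a
  constant times (n/m)^(n-1). In the product \<open>m\<close> cancels, which leaves the bound
  \<open>C\<close> at every scale.\<close>

lemma hausdorff_outer_coord_plane_finite:
  fixes A :: "(real ^ 'n) set"
  assumes n: "2 \<le> CARD('n)" and A: "bounded A" "\<And>x. x \<in> A \<Longrightarrow> x $ k = 0"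
  shows "surface_outer A < \<infinity>"
proof -
  define s where "s = real CARD('n) - 1"
  have s: "0 < s" using n by (simp add: s_def)
  obtain R' where R': "\<And>x. x \<in> A \<Longrightarrow> norm x \<le> R'" using A(1) by (auto simp: bounded_iff)
  obtain R :: nat where "R' < real R" using reals_Archimedean2 by blast
  with R' have R: "\<bar>x $ j\<bar> < real R" if "x \<in> A" for x j
    using that component_le_norm_cart[of x j] by fastforce
  define C where "C = unit_ball_vol s * (2 * real R * real CARD('n)) powr s"
  have "hausdorff_pre s \<delta> A \<le> ennreal C" if \<delta>: "0 < \<delta>" for \<delta>
  proof -
    obtain m :: nat where m: "real CARD('n) / \<delta> < real m" using reals_Archimedean2 by blast
    then have m0: "0 < m" using \<delta> by (metis divide_nonneg_pos gr0I not_le of_nat_0 of_nat_0_le_iff)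
    have m\<delta>: "real CARD('n) / real m \<le> \<delta>" using m m0 \<delta> by (simp add: field_simps)
    define F where "F = (UNIV - {k}) \<rightarrow>\<^sub>E {- int (R * m)..<int (R * m)}"
    define E where "E c = {x. x $ k = 0 \<and> (\<forall>j. j \<noteq> k \<longrightarrow> real_of_int (c j) / m \<le> x $ j \<and> x $ j \<le> (real_of_int (c j) + 1) / m)}" for c :: "'n \<Rightarrow> int"
    have dist: "dist x y \<le> real CARD('n) / m" if "x \<in> E c" "y \<in> E c" for x y c
    proof -
      have "\<bar>(x - y) $ j\<bar> \<le> 1 / m" for j
      proof (cases "j = k")
        case False
        then have "real_of_int (c j) / m \<le> x $ j" "x $ j \<le> (real_of_int (c j) + 1) / m"
          "real_of_int (c j) / m \<le> y $ j" "y $ j \<le> (real_of_int (c j) + 1) / m"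
          using that by (auto simp: E_def)
        then show ?thesis by (simp add: add_divide_distrib)
      qed (use that in \<open>auto simp: E_def\<close>)
      then have "norm (x - y) \<le> (\<Sum>j\<in>(UNIV :: 'n set). 1 / m)"
        by (intro order_trans[OF norm_le_l1_cart] sum_mono)
      then show ?thesis by (simp add: dist_norm)
    qed
    have diam: "diameter (E c) \<le> real CARD('n) / m" for c
      using dist[of _ c] by (intro diameter_le) (auto simp: dist_norm)
    have "hausdorff_pre s \<delta> A \<le> (\<Sum>c\<in>F. hausdorff_gauge s (E c))"
    proof (rule hausdorff_pre_le_finite)
      show "finite F" unfolding F_def by (intro finite_PiE) auto
      show "A \<subseteq> (\<Union>c\<in>F. E c)"
      proof
        fix x assume x: "x \<in> A"
        define c where "c = restrict (\<lambda>j. \<lfloor>real m * x $ j\<rfloor>) (UNIV - {k})"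
        have "c \<in> F"
        proof -
          have "- int (R * m) \<le> \<lfloor>real m * x $ j\<rfloor> \<and> \<lfloor>real m * x $ j\<rfloor> < int (R * m)" for j
          proof
            have "\<bar>real m * x $ j\<bar> < real m * real R"
              using R[OF x, of j] m0 by (simp add: abs_mult)
            then have *: "real m * x $ j < real m * real R" "- (real m * real R) < real m * x $ j" by linarith+
            then show "- int (R * m) \<le> \<lfloor>real m * x $ j\<rfloor>" by (simp add: le_floor_iff mult.commute)
            show "\<lfloor>real m * x $ j\<rfloor> < int (R * m)" using * by (simp add: floor_less_iff mult.commute)
          qed
          then show ?thesis by (auto simp: F_def c_def)
        qed
        moreover have "x \<in> E c"
        proof -
          have "real_of_int \<lfloor>real m * x $ j\<rfloor> / m \<le> x $ j \<and> x $ j \<le> (real_of_int \<lfloor>real m * x $ j\<rfloor> + 1) / m" for j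
            using m0 by (simp add: field_simps) linarith
          then show ?thesis using A(2)[OF x] by (auto simp: E_def c_def)
        qed
        ultimately show "x \<in> (\<Union>c\<in>F. E c)" by blast
      qed
      show "bounded (E c)" for c
        unfolding bounded_two_points using dist by blast
      show "diameter (E c) \<le> \<delta>" for c using diam[of c] m\<delta> by linarith
    qed (use \<delta> in simp)
    also have "\<dots> \<le> (\<Sum>c\<in>F. ennreal (unit_ball_vol s * (real CARD('n) / m) powr s))"
    proof (intro sum_mono)
      fix c
      have "bounded (E c)" unfolding bounded_two_points using dist by blast
      then have "0 \<le> diameter (E c)" by (rule diameter_ge_0)
      then have "diameter (E c) / 2 \<le> real CARD('n) / m" "0 \<le> diameter (E c)"
        using diam[of c] by linarith+
      then show "hausdorff_gauge s (E c) \<le> ennreal (unit_ball_vol s * (real CARD('n) / m) powr s)"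
        using s by (auto simp: hausdorff_gauge_pos intro!: ennreal_leI mult_left_mono powr_mono2)
    qed
    also have "\<dots> = ennreal (real (card F) * (unit_ball_vol s * (real CARD('n) / m) powr s))"
      unfolding sum_constant ennreal_of_nat_eq_real_of_nat by (rule ennreal_mult'[symmetric]) simp
    also have "card F = (2 * R * m) ^ (CARD('n) - 1)"
      unfolding F_def by (subst card_PiE) (auto simp: card_Diff_singleton nat_mult_distrib power_mult_distrib)
    also have "real \<dots> = real (2 * R * m) powr s"
    proof (cases "R = 0")
      case False
      then show ?thesis using n m0 by (simp add: s_def powr_realpow[symmetric] of_nat_diff)
    qed (use n in \<open>auto simp: s_def power_0_left\<close>)
    also have "real (2 * R * m) powr s * (unit_ball_vol s * (real CARD('n) / m) powr s) = C"
    proof -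
      have "real (2 * R * m) powr s * (real CARD('n) / m) powr s = (real (2 * R * m) * (real CARD('n) / m)) powr s"
        by (subst powr_mult) auto
      also have "real (2 * R * m) * (real CARD('n) / m) = 2 * real R * real CARD('n)"
        using m0 by simp
      finally show ?thesis by (simp add: C_def mult.left_commute)
    qed
    finally show ?thesis .
  qed
  then have "hausdorff_outer s A \<le> ennreal C"
    unfolding hausdorff_outer_eq_SUP_pre by (intro SUP_least) auto
  then show ?thesis by (simp add: s_def le_less_trans)
qed

section \<open>Lebesgue measure under translations and linear maps\<close>

lemma emeasure_lborel_vimage_plus:
  fixes z :: "'a::euclidean_space"
  assumes "S \<in> sets borel"
  shows "emeasure lborel ((+) z -` S) = emeasure lborel S"
  using assms emeasure_distr[of "(+) z" lborel borel S] by (simp add: lborel_distr_plus)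

lemma emeasure_lborel_translate:
  fixes z :: "'a::euclidean_space"
  assumes "S \<in> sets borel"
  shows "emeasure lborel ((+) z ` S) = emeasure lborel S"
proof -
  have "(+) z ` S = (+) (- z) -` S"
    by (force simp: image_iff algebra_simps)
  then show ?thesis using emeasure_lborel_vimage_plus[OF assms, of "- z"] by simp
qed

lemma UN_cball_nat: "(\<Union>i::nat. cball (0 :: 'a::real_normed_vector) (real i)) = UNIV"
  by (auto simp: real_arch_simple)

text \<open>Uniqueness of Haar measure: both iterated integrals of \<open>1\<^sub>A x * 1\<^sub>C (y - x)\<close> are computed.\<close>

lemma translation_invariant_measure_unique:
  fixes M :: "'a::euclidean_space measure"
  assumes sets[measurable_cong]: "sets M = sets borel"
    and inv: "\<And>z A. A \<in> sets borel \<Longrightarrow> emeasure M ((+) z -` A) = emeasure M A"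
    and fin: "\<And>r. emeasure M (cball 0 r) < \<infinity>"
    and [measurable]: "A \<in> sets borel"
  shows "emeasure M A * emeasure lborel (cball (0 :: 'a) 1) = emeasure M (cball 0 1) * emeasure lborel A"
proof -
  define C where "C = cball (0 :: 'a) 1"
  have [measurable]: "C \<in> sets borel" and C: "uminus -` C = C" by (auto simp: C_def)
  have spM: "space M = UNIV" using sets_eq_imp_space_eq[OF sets] by simp
  interpret M: sigma_finite_measure M
    by unfold_locales (rule exI[of _ "range (\<lambda>i::nat. cball 0 (real i))"], use fin UN_cball_nat[where 'a='a] spM in \<open>auto simp: less_top[symmetric]\<close>)
  interpret Mlb: pair_sigma_finite M lborel ..
  have "emeasure M A * emeasure lborel C = (\<integral>\<^sup>+x. indicator A x * emeasure lborel ((+) (- x) -` C) \<partial>M)"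
    by (subst emeasure_lborel_vimage_plus) (auto simp: nn_integral_multc)
  also have "\<dots> = (\<integral>\<^sup>+x. \<integral>\<^sup>+y. indicator A x * indicator C (y - x) \<partial>lborel \<partial>M)"
  proof (intro nn_integral_cong)
    fix x
    have [measurable]: "(+) (- x) -` C \<in> sets borel"
      using measurable_sets[of "(+) (- x)" borel borel C] by simp
    have "(\<integral>\<^sup>+y. indicator A x * indicator C (y - x) \<partial>lborel) = (\<integral>\<^sup>+y. indicator A x * indicator ((+) (- x) -` C) y \<partial>lborel)"
      by (intro nn_integral_cong) (auto simp: indicator_def)
    then show "indicator A x * emeasure lborel ((+) (- x) -` C) = (\<integral>\<^sup>+y. indicator A x * indicator C (y - x) \<partial>lborel)"
      by (simp add: nn_integral_cmult)
  qed
  also have "\<dots> = (\<integral>\<^sup>+y. \<integral>\<^sup>+x. indicator A x * indicator C (y - x) \<partial>M \<partial>lborel)"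
    by (rule Mlb.Fubini'[symmetric]) measurable
  also have "\<dots> = (\<integral>\<^sup>+y. \<integral>\<^sup>+x. indicator A (x + y) * indicator C (- x) \<partial>M \<partial>lborel)"
  proof (rule nn_integral_cong)
    fix y
    \<comment> \<open>By invariance \<open>x\<close> may be replaced by \<open>x + y\<close>, which
      removes \<open>y\<close> from the factor with \<open>C\<close>; then the
      \<open>y\<close>-integral gives the Lebesgue measure of \<open>A\<close>.\<close>
    have "M = distr M borel ((+) y)"
      by (rule measure_eqI) (auto simp: sets emeasure_distr spM inv)
    then have "(\<integral>\<^sup>+x. indicator A x * indicator C (y - x) \<partial>M) = (\<integral>\<^sup>+x. indicator A x * indicator C (y - x) \<partial>distr M borel ((+) y))"
      by simp
    also have "\<dots> = (\<integral>\<^sup>+x. indicator A (x + y) * indicator C (- x) \<partial>M)"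
      by (subst nn_integral_distr) (auto simp: add.commute)
    finally show "(\<integral>\<^sup>+x. indicator A x * indicator C (y - x) \<partial>M) = (\<integral>\<^sup>+x. indicator A (x + y) * indicator C (- x) \<partial>M)" .
  qed
  also have "\<dots> = (\<integral>\<^sup>+x. \<integral>\<^sup>+y. indicator A (x + y) * indicator C (- x) \<partial>lborel \<partial>M)"
    by (rule Mlb.Fubini') measurable
  also have "\<dots> = (\<integral>\<^sup>+x. emeasure lborel A * indicator (uminus -` C) x \<partial>M)"
  proof (intro nn_integral_cong)
    fix x
    have [measurable]: "(+) x -` A \<in> sets borel"
      using measurable_sets[of "(+) x" borel borel A] by simp
    have "(\<integral>\<^sup>+y. indicator A (x + y) * indicator C (- x) \<partial>lborel) = (\<integral>\<^sup>+y. indicator ((+) x -` A) y * indicator C (- x) \<partial>lborel)"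
      by (intro nn_integral_cong) (auto simp: indicator_def)
    also have "\<dots> = emeasure lborel A * indicator (uminus -` C) x"
      by (subst nn_integral_multc) (auto simp: emeasure_lborel_vimage_plus indicator_def)
    finally show "(\<integral>\<^sup>+y. indicator A (x + y) * indicator C (- x) \<partial>lborel) = emeasure lborel A * indicator (uminus -` C) x" .
  qed
  also have "\<dots> = emeasure lborel A * emeasure M (uminus -` C)"
    using measurable_sets[of uminus borel borel C] by (subst nn_integral_cmult) auto
  finally show ?thesis by (simp add: C C_def[symmetric] mult.commute)
qed

lemma emeasure_unit_cball:
  "0 < emeasure lborel (cball (0 :: 'a::euclidean_space) 1)" "emeasure lborel (cball (0 :: 'a::euclidean_space) 1) < \<infinity>"
proof -
  have "0 < emeasure lborel (ball (0 :: 'a) 1)"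
    using content_ball_pos[of 1 "0 :: 'a"] by (simp add: measure_def enn2real_positive_iff)
  also have "\<dots> \<le> emeasure lborel (cball (0 :: 'a) 1)" by (intro emeasure_mono) auto
  finally show "0 < emeasure lborel (cball (0 :: 'a) 1)" .
qed (rule emeasure_lborel_cball_finite)

text \<open>For \<open>real ^ 'n\<close> this is \<open>\<bar>det (matrix f)\<bar>\<close>, but \<open>measure_linear_image\<close> of the library needs
  \<open>'n\<close> to be well-ordered.\<close>

definition vol_factor :: "('a::euclidean_space \<Rightarrow> 'a) \<Rightarrow> real" where
  "vol_factor f = measure lborel (f ` cball 0 1) / measure lborel (cball (0 :: 'a) 1)"

lemma vol_factor_nonneg: "0 \<le> vol_factor f"
  by (simp add: vol_factor_def)

lemma linear_image_borel:
  fixes f :: "'a::euclidean_space \<Rightarrow> 'a"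
  assumes "linear f" "bij f" "A \<in> sets borel"
  shows "f ` A \<in> sets borel"
proof -
  obtain g where g: "linear g" "g \<circ> f = id" "f \<circ> g = id"
    using linear_injective_isomorphism[of f] assms(1,2) by (auto simp: bij_def fun_eq_iff)
  have "g \<in> borel_measurable borel"
    using g(1) by (intro borel_measurable_continuous_onI linear_continuous_on) (simp add: linear_conv_bounded_linear)
  moreover have "f ` A = g -` A"
    using g(2,3) by (intro set_eqI) (metis comp_apply id_apply image_iff vimage_eq)
  ultimately show ?thesis
    using assms(3) measurable_sets[of g borel borel A] by simp
qed

text \<open>Pulling Lebesgue measure back by \<open>f\<close> gives a translation invariant measure,
  hence a multiple of Lebesgue measure; the factor is read off from the unit ball.\<close>

lemma emeasure_lborel_linear_image:
  fixes f :: "'a::euclidean_space \<Rightarrow> 'a"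
  assumes f: "linear f" "bij f" and A: "A \<in> sets borel"
  shows "emeasure lborel (f ` A) = ennreal (vol_factor f) * emeasure lborel A"
proof -
  obtain g where g: "linear g" "g \<circ> f = id" "f \<circ> g = id"
    using linear_injective_isomorphism[of f] f by (auto simp: bij_def fun_eq_iff)
  have g_meas[measurable]: "g \<in> borel_measurable borel"
    using g(1) by (intro borel_measurable_continuous_onI linear_continuous_on) (simp add: linear_conv_bounded_linear)
  have im: "f ` A = g -` A" for A
    using g(2,3) by (intro set_eqI) (metis comp_apply id_apply image_iff vimage_eq)
  define M where "M = distr lborel borel g"
  have M: "emeasure M A = emeasure lborel (f ` A)" if "A \<in> sets borel" for A
    using that by (simp add: M_def emeasure_distr im)
  have fin: "emeasure M (cball 0 r) < \<infinity>" for r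
  proof -
    have "bounded (f ` cball 0 r)"
      using f(1) by (intro bounded_linear_image) (auto simp: linear_conv_bounded_linear)
    from emeasure_bounded_finite[OF this] show ?thesis by (simp add: M)
  qed
  have "emeasure M ((+) z -` A) = emeasure M A" if "A \<in> sets borel" for z A
  proof -
    have "f ` ((+) z -` A) = (+) (f z) -` (f ` A)"
      using g(2,3) unfolding im by (auto simp: fun_eq_iff linear_add[OF g(1)])
    then show ?thesis
      using that measurable_sets[of "(+) z" borel borel A] linear_image_borel[OF f that]
      by (simp add: M emeasure_lborel_vimage_plus)
  qed
  from translation_invariant_measure_unique[OF _ this fin A]
  have eq: "emeasure lborel (f ` A) * emeasure lborel (cball (0 :: 'a) 1)
      = emeasure lborel (f ` cball 0 1) * emeasure lborel A"
    using A by (simp add: M[symmetric]) (simp add: M_def)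
  define a where "a = measure lborel (cball (0 :: 'a) 1)"
  have a: "0 < a" "emeasure lborel (cball (0 :: 'a) 1) = ennreal a"
    using emeasure_unit_cball[where 'a='a] by (auto simp: a_def measure_def enn2real_positive_iff)
  have b: "emeasure lborel (f ` cball 0 1) = ennreal (measure lborel (f ` cball 0 1))"
    using fin[of 1] by (subst emeasure_eq_ennreal_measure) (auto simp: M)
  have "emeasure lborel (f ` A) = (emeasure lborel (f ` A) * ennreal a) * ennreal (1 / a)"
    using a(1) by (simp add: mult.assoc ennreal_mult'[symmetric])
  also have "\<dots> = ennreal (measure lborel (f ` cball 0 1)) * emeasure lborel A * ennreal (1 / a)"
    using eq by (simp only: a(2) b)
  also have "\<dots> = ennreal (measure lborel (f ` cball 0 1) * (1 / a)) * emeasure lborel A"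
    using a(1) by (subst ennreal_mult) (auto simp: mult_ac)
  finally show ?thesis by (simp add: vol_factor_def a_def)
qed

lemma vol_factor_eqI:
  fixes f :: "'a::euclidean_space \<Rightarrow> 'a"
  assumes "emeasure lborel (f ` cball 0 1) = ennreal c * emeasure lborel (cball (0 :: 'a) 1)" "0 \<le> c"
  shows "vol_factor f = c"
proof -
  have "0 < measure lborel (cball (0 :: 'a) 1)"
    using emeasure_unit_cball[where 'a='a] by (simp add: measure_def enn2real_positive_iff)
  moreover have "measure lborel (f ` cball 0 1) = c * measure lborel (cball (0 :: 'a) 1)"
    using assms by (simp add: measure_def enn2real_mult)
  ultimately show ?thesis by (simp add: vol_factor_def)
qed

lemma vol_factor_compose:
  fixes f g :: "'a::euclidean_space \<Rightarrow> 'a"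
  assumes "linear f" "bij f" "linear g" "bij g"
  shows "vol_factor (f \<circ> g) = vol_factor f * vol_factor g"
proof (rule vol_factor_eqI)
  have "emeasure lborel ((f \<circ> g) ` cball 0 1) = ennreal (vol_factor f) * emeasure lborel (g ` cball 0 1)"
    unfolding image_comp[symmetric]
    by (intro emeasure_lborel_linear_image[OF assms(1,2)] linear_image_borel[OF assms(3,4)]) auto
  then show "emeasure lborel ((f \<circ> g) ` cball 0 1) = ennreal (vol_factor f * vol_factor g) * emeasure lborel (cball (0 :: 'a) 1)"
    by (simp add: emeasure_lborel_linear_image[OF assms(3,4)] ennreal_mult vol_factor_nonneg mult.assoc)
qed (simp add: vol_factor_nonneg)

lemma vol_factor_orthogonal:
  fixes f :: "'a::euclidean_space \<Rightarrow> 'a"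
  assumes "orthogonal_transformation f"
  shows "vol_factor f = 1"
proof (rule vol_factor_eqI)
  have "f ` cball 0 1 = cball 0 1"
  proof -
    have "surj f" using assms orthogonal_transformation_surj by blast
    then have "x \<in> f ` cball 0 1" if "x \<in> cball 0 1" for x
      using that assms orthogonal_transformation_norm[OF assms]
      by (metis (no_types, lifting) image_iff mem_cball_0 surjD)
    then show ?thesis using orthogonal_transformation_norm[OF assms] by auto
  qed
  then show "emeasure lborel (f ` cball 0 1) = ennreal 1 * emeasure lborel (cball (0 :: 'a) 1)" by simp
qed simp

text \<open>A shear is conjugate to its inverse by the reflection in the coordinate plane.\<close>

lemma vol_factor_shear:
  fixes w :: "'a::euclidean_space"
  assumes e: "e \<in> Basis" and w: "w \<bullet> e = 0"
  defines "f \<equiv> (\<lambda>u y. y + (y \<bullet> e) *\<^sub>R u)"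
  shows "linear (f w)" "bij (f w)" "vol_factor (f w) = 1"
proof -
  have lin: "linear (f u)" for u by (auto simp: f_def linear_iff algebra_simps inner_add_left)
  have inv: "f w \<circ> f (- w) = id" "f (- w) \<circ> f w = id"
    using w by (auto simp: f_def fun_eq_iff inner_add_left inner_diff_left)
  then have bij: "bij (f w)" "bij (f (- w))" by (auto intro: o_bij)
  define D where "D y = y - (2 * (y \<bullet> e)) *\<^sub>R e" for y
  have D: "orthogonal_transformation D"
    unfolding orthogonal_transformation_def
  proof (intro conjI allI)
    show "linear D" by (auto simp: D_def linear_iff algebra_simps inner_add_left)
    show "D x \<bullet> D y = x \<bullet> y" for x y
      using e by (simp add: D_def inner_diff_left inner_diff_right inner_commute)
  qed
  have linD: "linear D" "bij D"
    using D by (auto simp: orthogonal_transformation_def intro: orthogonal_transformation_bij)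
  have conj: "f (- w) = D \<circ> (f w \<circ> D)"
  proof
    fix y
    have "D y \<bullet> e = - (y \<bullet> e)" "D w = w"
      using e w by (simp_all add: D_def inner_diff_left)
    then have "f w (D y) = D y - (y \<bullet> e) *\<^sub>R w" by (simp add: f_def)
    moreover have "D (D y - (y \<bullet> e) *\<^sub>R w) = D (D y) - (y \<bullet> e) *\<^sub>R D w"
      using linD(1) by (simp add: linear_diff linear_cmul)
    moreover have "D (D y) = y"
      using e by (simp add: D_def inner_diff_left)
    ultimately show "f (- w) y = (D \<circ> (f w \<circ> D)) y"
      using \<open>D w = w\<close> by (simp add: f_def)
  qed
  have "vol_factor (f (- w)) = vol_factor (f w)"
    unfolding conj using D linD lin bij
    by (simp add: vol_factor_compose linear_compose bij_comp vol_factor_orthogonal)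
  moreover have "vol_factor (f w) * vol_factor (f (- w)) = 1"
    unfolding vol_factor_compose[OF lin bij(1) lin bij(2), symmetric] inv
    by (rule vol_factor_orthogonal) (auto simp: orthogonal_transformation_def linear_id)
  ultimately have "vol_factor (f w) ^ 2 = 1" by (simp add: power2_eq_square)
  then show "vol_factor (f w) = 1"
    using vol_factor_nonneg[of "f w"] by (simp add: power2_eq_1_iff)
  show "linear (f w)" "bij (f w)" using lin bij by auto
qed

lemma vol_factor_dilation:
  fixes e :: "'a::euclidean_space"
  assumes e: "e \<in> Basis" and c: "0 < c"
  defines "f \<equiv> (\<lambda>y. y + ((c - 1) * (y \<bullet> e)) *\<^sub>R e)"
  shows "linear f" "bij f" "vol_factor f = c"
proof -
  show lin: "linear f" by (auto simp: f_def linear_iff algebra_simps inner_add_left)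
  define g where "g y = y + ((1 / c - 1) * (y \<bullet> e)) *\<^sub>R e" for y
  have "f \<circ> g = id" "g \<circ> f = id"
    using e c by (auto simp: f_def g_def fun_eq_iff inner_add_left algebra_simps)
  then show bij: "bij f" by (auto intro: o_bij)
  define d where "d j = (if j = e then c else 1)" for j
  have f_eq: "f = (\<lambda>x. 0 + (\<Sum>j\<in>Basis. (d j * (x \<bullet> j)) *\<^sub>R j))"
  proof
    fix x
    have "(\<Sum>j\<in>Basis. (d j * (x \<bullet> j)) *\<^sub>R j) = (\<Sum>j\<in>Basis. (x \<bullet> j) *\<^sub>R j + (if j = e then ((c - 1) * (x \<bullet> e)) *\<^sub>R e else 0))"
      by (intro sum.cong) (auto simp: d_def algebra_simps)
    also have "\<dots> = f x" using e by (simp add: sum.distrib f_def euclidean_representation)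
    finally show "f x = 0 + (\<Sum>j\<in>Basis. (d j * (x \<bullet> j)) *\<^sub>R j)" by simp
  qed
  have prod: "(\<Prod>j\<in>Basis. \<bar>d j\<bar>) = c"
    using e c by (simp add: d_def prod.If_cases if_distrib cong: if_cong)
  have "lborel = density (distr lborel borel f) (\<lambda>_. ennreal c)"
    using lborel_affine_euclidean[of d 0] c unfolding f_eq[symmetric] prod by (auto simp: d_def f_eq)
  then have "emeasure lborel (f ` cball 0 1) = emeasure (density (distr lborel borel f) (\<lambda>_. ennreal c)) (f ` cball 0 1)"
    by simp
  also have "\<dots> = ennreal c * emeasure lborel (cball (0 :: 'a) 1)"
  proof -
    have [measurable]: "f \<in> borel_measurable borel"
      using lin by (intro borel_measurable_continuous_onI linear_continuous_on) (simp add: linear_conv_bounded_linear)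
    have [measurable]: "f ` cball 0 1 \<in> sets borel" by (rule linear_image_borel[OF lin bij]) auto
    have "f -` f ` cball 0 1 = cball 0 1" using bij by (simp add: inj_vimage_image_eq bij_is_inj)
    then show ?thesis by (simp add: emeasure_density_const emeasure_distr)
  qed
  finally show "vol_factor f = c" using c by (intro vol_factor_eqI) auto
qed

section \<open>Hausdorff measure on hyperplanes\<close>

definition flatten :: "'n \<Rightarrow> real ^ 'n \<Rightarrow> real ^ 'n" where
  "flatten k y = y - (y $ k) *\<^sub>R axis k 1"

text \<open>A layer of height one over the coordinate plane: the volume of the part of it above a
  set of the plane serves as the (n-1)-dimensional Lebesgue measure of that set.\<close>

definition slab :: "'n \<Rightarrow> (real ^ 'n) set" where
  "slab k = {y. 0 \<le> y $ k \<and> y $ k < 1}"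

lemma flatten_nth: "flatten k y $ j = (if j = k then 0 else y $ j)"
  by (simp add: flatten_def axis_def)

lemma flatten_measurable [measurable]: "flatten k \<in> borel_measurable borel"
  unfolding flatten_def by (intro borel_measurable_continuous_onI continuous_intros)

lemma slab_sets [measurable]: "slab k \<in> sets borel"
  unfolding slab_def by measurable

lemma coord_plane_closed: "closed {x :: real ^ 'n. x $ k = 0}"
  by (intro closed_Collect_eq continuous_intros)

text \<open>Again both iterated integrals of \<open>1\<^sub>A x * 1\<^sub>C (y - x)\<close>; here the reflection \<open>x \<mapsto> y - x\<close> of the
  plane exchanges \<open>A\<close> and \<open>C\<close>.\<close>

lemma hausdorff_coord_plane:
  fixes k :: "'n::finite"
  assumes n: "2 \<le> CARD('n)"
  obtains \<kappa> :: real where "0 \<le> \<kappa>"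
    "\<And>A :: (real ^ 'n) set. A \<in> sets borel \<Longrightarrow> (\<And>x. x \<in> A \<Longrightarrow> x $ k = 0) \<Longrightarrow>
       surface_outer A = ennreal \<kappa> * emeasure lborel {y \<in> slab k. flatten k y \<in> A}"
proof -
  define L where "L = {x :: real ^ 'n. x $ k = 0}"
  have L[measurable]: "L \<in> sets borel" unfolding L_def by (intro borel_closed coord_plane_closed)
  define M where "M = density (surface_measure :: (real ^ 'n) measure) (indicator L)"
  define N where "N = distr (density lborel (indicator (slab k))) borel (flatten k)"
  have [measurable_cong]: "sets M = sets borel" "sets N = sets borel" by (auto simp: M_def N_def)
  have spM: "space M = UNIV" "space N = UNIV" by (auto simp: M_def N_def)
  have M: "emeasure M A = surface_outer (A \<inter> L)" if [measurable]: "A \<in> sets borel" for A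
  proof -
    have "emeasure M A = (\<integral>\<^sup>+x. indicator (A \<inter> L) x \<partial>surface_measure)"
      unfolding M_def
      by (subst emeasure_density) (auto intro!: nn_integral_cong simp: indicator_inter_arith mult.commute simp del: nn_integral_indicator)
    then show ?thesis by (simp add: emeasure_hausdorff_measure)
  qed
  have N: "emeasure N A = emeasure lborel {y \<in> slab k. flatten k y \<in> A}" if [measurable]: "A \<in> sets borel" for A
  proof -
    have [measurable]: "flatten k -` A \<in> sets borel"
      using measurable_sets[OF flatten_measurable that] by simp
    have "emeasure N A = (\<integral>\<^sup>+x. indicator (slab k \<inter> flatten k -` A) x \<partial>lborel)"
      unfolding N_def
      by (simp add: emeasure_distr emeasure_density indicator_inter_arith del: nn_integral_indicator)
    also have "slab k \<inter> flatten k -` A = {y \<in> slab k. flatten k y \<in> A}" by auto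
    finally have "emeasure N A = (\<integral>\<^sup>+x. indicator {y \<in> slab k. flatten k y \<in> A} x \<partial>lborel)" .
    then show ?thesis by simp
  qed
  have AE_M: "AE x in M. x \<in> L"
    unfolding M_def by (subst AE_density) (auto simp: indicator_def)
  have AE_N: "AE x in N. x \<in> L"
    unfolding N_def by (subst AE_distr_iff) (auto simp: L_def flatten_nth)
  have finM: "emeasure M (cball 0 r) < \<infinity>" for r
  proof -
    have "bounded (cball 0 r \<inter> L)" by (rule bounded_subset[OF bounded_cball[of 0 r]]) auto
    from hausdorff_outer_coord_plane_finite[OF n this, of k] show ?thesis
      by (simp add: M) (simp add: L_def)
  qed
  have finN: "emeasure N (cball 0 r) < \<infinity>" for r
  proof -
    have "norm y \<le> r + 1" if "y \<in> slab k" "norm (flatten k y) \<le> r" for y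
    proof -
      have "norm y \<le> norm (flatten k y) + norm ((y $ k) *\<^sub>R axis k (1::real))"
        using norm_triangle_ineq[of "flatten k y" "(y $ k) *\<^sub>R axis k 1"] by (simp add: flatten_def)
      then show ?thesis using that by (auto simp: slab_def)
    qed
    then have "{y \<in> slab k. flatten k y \<in> cball 0 r} \<subseteq> cball 0 (r + 1)"
      by auto
    then have "emeasure N (cball 0 r) \<le> emeasure lborel (cball (0 :: real ^ 'n) (r + 1))"
      by (subst N) (auto intro!: emeasure_mono)
    also have "\<dots> < \<infinity>" by (rule emeasure_lborel_cball_finite)
    finally show ?thesis .
  qed
  interpret M: sigma_finite_measure M
    by unfold_locales (rule exI[of _ "range (\<lambda>i::nat. cball 0 (real i))"], use finM UN_cball_nat[where 'a="real ^ 'n"] spM in \<open>auto simp: less_top[symmetric]\<close>)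
  interpret N: sigma_finite_measure N
    by unfold_locales (rule exI[of _ "range (\<lambda>i::nat. cball 0 (real i))"], use finN UN_cball_nat[where 'a="real ^ 'n"] spM in \<open>auto simp: less_top[symmetric]\<close>)
  interpret MN: pair_sigma_finite M N ..
  define I where "I A C = (\<integral>\<^sup>+x. \<integral>\<^sup>+y. indicator A x * indicator C (y - x) \<partial>N \<partial>M)" for A C :: "(real ^ 'n) set"
  have I1: "I A C = emeasure M A * emeasure N C" if [measurable]: "A \<in> sets borel" "C \<in> sets borel" for A C
  proof -
    have *: "(\<integral>\<^sup>+y. indicator A x * indicator C (y - x) \<partial>N) = indicator A x * emeasure N C" if "x \<in> L" for x
    proof -
      have "(\<integral>\<^sup>+y. indicator A x * indicator C (y - x) \<partial>N) = indicator A x * (\<integral>\<^sup>+y. indicator ((\<lambda>y. y - x) -` C) y \<partial>N)"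
        by (subst nn_integral_cmult[symmetric]) (auto intro!: nn_integral_cong simp: indicator_def)
      also have "(\<integral>\<^sup>+y. indicator ((\<lambda>y. y - x) -` C) y \<partial>N) = emeasure N ((\<lambda>y. y - x) -` C)"
        using measurable_sets[of "\<lambda>y. y - x" borel borel C] by (intro nn_integral_indicator) simp
      also have "\<dots> = emeasure lborel {y \<in> slab k. flatten k y \<in> (\<lambda>y. y - x) -` C}"
        using measurable_sets[of "\<lambda>y. y - x" borel borel C] by (intro N) simp
      \<comment> \<open>Translation by a vector of the coordinate plane preserves the slab and
        commutes with \<open>flatten k\<close>.\<close>
      also have "{y \<in> slab k. flatten k y \<in> (\<lambda>y. y - x) -` C} = (+) (- x) -` {y \<in> slab k. flatten k y \<in> C}"
        using that by (auto simp: slab_def flatten_def L_def algebra_simps)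
      also have "emeasure lborel \<dots> = emeasure N C"
        by (subst emeasure_lborel_vimage_plus) (auto simp: N)
      finally show ?thesis .
    qed
    have "I A C = (\<integral>\<^sup>+x. indicator A x * emeasure N C \<partial>M)"
      unfolding I_def by (intro nn_integral_cong_AE) (use AE_M * in auto)
    also have "\<dots> = emeasure M A * emeasure N C"
      by (subst nn_integral_multc) auto
    finally show ?thesis .
  qed
  have I2: "I A C = I C A" if [measurable]: "A \<in> sets borel" "C \<in> sets borel" for A C
  proof -
    have swap: "I A C = (\<integral>\<^sup>+y. \<integral>\<^sup>+x. indicator A x * indicator C (y - x) \<partial>M \<partial>N)"
      if [measurable]: "A \<in> sets borel" "C \<in> sets borel" for A C
      unfolding I_def by (rule MN.Fubini'[symmetric]) measurable
    have inner: "(\<integral>\<^sup>+x. indicator A x * indicator C (y - x) \<partial>M) = surface_outer (A \<inter> (\<lambda>x. y - x) -` C \<inter> L)"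
      if [measurable]: "A \<in> sets borel" "C \<in> sets borel" for A C y
    proof -
      have [measurable]: "(\<lambda>x. y - x) -` C \<in> sets borel"
        using measurable_sets[of "\<lambda>x. y - x" borel borel C] by simp
      have "(\<integral>\<^sup>+x. indicator A x * indicator C (y - x) \<partial>M) = (\<integral>\<^sup>+x. indicator (A \<inter> (\<lambda>x. y - x) -` C) x \<partial>M)"
        by (intro nn_integral_cong) (auto simp: indicator_def)
      also have "\<dots> = emeasure M (A \<inter> (\<lambda>x. y - x) -` C)" by (intro nn_integral_indicator) measurable
      finally show ?thesis by (simp add: M)
    qed
    have "surface_outer (A \<inter> (\<lambda>x. y - x) -` C \<inter> L) = surface_outer (C \<inter> (\<lambda>x. y - x) -` A \<inter> L)" if "y \<in> L" for y
    proof -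
      have "(\<lambda>x. y - x) ` (A \<inter> (\<lambda>x. y - x) -` C \<inter> L) = C \<inter> (\<lambda>x. y - x) -` A \<inter> L"
        using that by (force simp: L_def image_iff algebra_simps)
      moreover have "surface_outer ((\<lambda>x. y - x) ` (A \<inter> (\<lambda>x. y - x) -` C \<inter> L)) = surface_outer (A \<inter> (\<lambda>x. y - x) -` C \<inter> L)"
        using n by (intro hausdorff_outer_isometric_image) (auto simp: dist_norm norm_minus_commute)
      ultimately show ?thesis by simp
    qed
    note reflect = this
    have "I A C = (\<integral>\<^sup>+y. surface_outer (A \<inter> (\<lambda>x. y - x) -` C \<inter> L) \<partial>N)"
      unfolding swap[OF that] inner[OF that] ..
    also have "\<dots> = (\<integral>\<^sup>+y. surface_outer (C \<inter> (\<lambda>x. y - x) -` A \<inter> L) \<partial>N)"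
      by (rule nn_integral_cong_AE, rule AE_mp[OF AE_N], rule AE_I2, rule impI, rule reflect)
    also have "\<dots> = I C A"
      unfolding swap[OF that(2,1)] inner[OF that(2,1)] ..
    finally show ?thesis .
  qed
  \<comment> \<open>The reference set: its part of the slab lies between the open and the closed
    unit cube, so \<open>N\<close> gives it measure one and the factor sought is its Hausdorff
    measure in the plane.\<close>
  define C :: "(real ^ 'n) set" where "C = cbox 0 (\<chi> i. 1)"
  have [measurable]: "C \<in> sets borel" by (simp add: C_def)
  have NC: "emeasure N C = 1"
  proof -
    have mem: "0 \<le> y $ i \<and> y $ i \<le> 1" if y: "y \<in> slab k" "flatten k y \<in> C" for y i
    proof (cases "i = k")
      case False
      then have "flatten k y $ i = y $ i" by (simp add: flatten_nth)
      moreover have "0 $ i \<le> flatten k y $ i \<and> flatten k y $ i \<le> ((\<chi> i. 1) :: real ^ 'n) $ i"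
        using y(2) unfolding C_def mem_box_cart by blast
      ultimately show ?thesis by simp
    qed (use y in \<open>auto simp: slab_def\<close>)
    have le: "emeasure N C \<le> emeasure lborel C"
      by (subst N, simp, intro emeasure_mono) (use mem in \<open>auto simp: C_def mem_box_cart\<close>)
    have ge: "emeasure lborel (box 0 (\<chi> i. 1) :: (real ^ 'n) set) \<le> emeasure N C"
      by (subst N, simp, intro emeasure_mono) (auto simp: C_def slab_def flatten_nth mem_box_cart less_imp_le)
    have one: "(\<chi> i. (1 :: real)) \<bullet> b = 1" if "b \<in> Basis" for b :: "real ^ 'n"
      using that by (auto simp: Basis_vec_def inner_axis)
    have "emeasure lborel C = 1" "emeasure lborel (box 0 (\<chi> i. 1) :: (real ^ 'n) set) = 1"
      by (simp_all add: C_def emeasure_lborel_cbox_eq emeasure_lborel_box_eq one)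
    with le ge show ?thesis by (intro antisym) simp_all
  qed
  have "emeasure M C \<noteq> \<infinity>"
  proof -
    have "bounded C" by (simp add: C_def)
    then obtain r where "C \<subseteq> cball 0 r" by (auto simp: bounded_iff subset_iff)
    then have "emeasure M C \<le> emeasure M (cball 0 r)" by (intro emeasure_mono) auto
    then show ?thesis using finM[of r] by auto
  qed
  then have MC: "emeasure M C = ennreal (enn2real (emeasure M C))" by (simp add: less_top)
  show thesis
  proof (rule that[of "enn2real (emeasure M C)"])
    fix A :: "(real ^ 'n) set" assume A[measurable]: "A \<in> sets borel" and AL: "\<And>x. x \<in> A \<Longrightarrow> x $ k = 0"
    have "emeasure M A * emeasure N C = emeasure M C * emeasure N A"
      using I1[of A C] I1[of C A] I2[of A C] by simp
    moreover have "A \<inter> L = A" using AL by (auto simp: L_def)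
    ultimately show "surface_outer A = ennreal (enn2real (emeasure M C)) * emeasure lborel {y \<in> slab k. flatten k y \<in> A}"
      using NC MC by (simp add: M[OF A] N[OF A])
  qed simp
qed

text \<open>On hyperplanes \<open>H\<close> is \<open>\<kappa>\<close> times the Lebesgue measure. That \<open>\<kappa> = 1\<close> for the normalised Hausdorff
  measure is the isodiametric inequality; the value of \<open>\<kappa>\<close> plays no role in what follows.\<close>

definition flat_density :: "real \<Rightarrow> ('a::euclidean_space set \<Rightarrow> ennreal) \<Rightarrow> bool" where
  "flat_density \<kappa> H \<longleftrightarrow> 0 \<le> \<kappa> \<and>
     (\<forall>n v x0 B. norm n = 1 \<and> 0 < v \<bullet> n \<and> B \<in> sets borel \<and> bounded B \<and> (\<forall>p\<in>B. (p - x0) \<bullet> n = 0) \<longrightarrow>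
        ennreal \<kappa> * emeasure lborel (cyl v {0..<1} B) = ennreal (v \<bullet> n) * H B)"

lemma cyl_plus: "cyl v I ((+) z ` A) = (+) z ` cyl v I A"
  by (force simp: cyl_def image_iff algebra_simps)

text \<open>A rotation \<open>R\<close> takes the coordinate plane to the hyperplane orthogonal to
  \<open>u\<close>. The oblique cylinder is then the image of a piece of the slab under
  \<open>R\<close> and a linear map \<open>g\<close> that fixes the plane and tilts its normal;
  \<open>g\<close> stretches volume by \<open>v \<bullet> u\<close>.\<close>

lemma flat_density_exists:
  assumes n: "2 \<le> CARD('n::finite)"
  shows "\<exists>\<kappa>. flat_density \<kappa> (surface_outer :: (real ^ 'n) set \<Rightarrow> ennreal)"
proof -
  define k :: 'n where "k = undefined"
  define e where "e = (axis k 1 :: real ^ 'n)"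
  obtain \<kappa> where \<kappa>: "0 \<le> \<kappa>"
    "\<And>A :: (real ^ 'n) set. A \<in> sets borel \<Longrightarrow> (\<And>x. x \<in> A \<Longrightarrow> x $ k = 0) \<Longrightarrow>
       surface_outer A = ennreal \<kappa> * emeasure lborel {y \<in> slab k. flatten k y \<in> A}"
    using hausdorff_coord_plane[OF n, of k] by blast
  have lin: "ennreal \<kappa> * emeasure lborel (cyl v {0..<1} B) = ennreal (v \<bullet> u) * surface_outer B \<and> cyl v {0..<1} B \<in> sets borel"
    if u: "norm u = 1" and vu: "0 < v \<bullet> u" and B: "B \<in> sets borel" "bounded B" "\<And>p. p \<in> B \<Longrightarrow> p \<bullet> u = 0"
    for u v :: "real ^ 'n" and B
  proof -
    obtain R where R: "orthogonal_transformation R" "R e = u"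
      using orthogonal_transformation_exists_1[of e u] u by (auto simp: e_def)
    have linR: "linear R" and Rip: "\<And>x y. R x \<bullet> R y = x \<bullet> y"
      using R(1) by (auto simp: orthogonal_transformation_def)
    have bijR: "bij R" using R(1) by (rule orthogonal_transformation_bij)
    have isoR: "dist (R x) (R y) = dist x y" for x y
      using R(1) by (simp add: dist_norm linear_diff[OF linR, symmetric] orthogonal_transformation_norm)
    define b where "b = inv R v"
    have Rb: "R b = v" using bijR by (simp add: b_def bij_is_surj surj_f_inv_f)
    have bk: "b $ k = v \<bullet> u"
    proof -
      have "v \<bullet> u = R b \<bullet> R e" by (simp add: Rb R(2))
      then show ?thesis unfolding Rip by (simp add: e_def inner_axis)
    qed
    define g where "g y = y + (y $ k) *\<^sub>R (b - e)" for y
    have ling: "linear g"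
      by (auto simp: g_def linear_iff algebra_simps)
    \<comment> \<open>Chosen so that stretching by \<open>v \<bullet> u\<close> along
      \<open>e\<close>, followed by the shear with \<open>w\<close>, takes \<open>e\<close> to
      \<open>b\<close> and fixes the coordinate plane.\<close>
    define w where "w = (1 / (v \<bullet> u)) *\<^sub>R (b - (b $ k) *\<^sub>R e)"
    have eB: "e \<in> Basis" and eip: "\<And>y. y \<bullet> e = y $ k" by (auto simp: e_def inner_axis axis_in_Basis_iff)
    have w: "w \<bullet> e = 0" by (simp add: w_def eip) (simp add: e_def)
    have g_eq: "g = (\<lambda>y. y + (y \<bullet> e) *\<^sub>R w) \<circ> (\<lambda>y. y + ((v \<bullet> u - 1) * (y \<bullet> e)) *\<^sub>R e)"
      using vu by (auto simp: g_def fun_eq_iff w_def eip bk algebra_simps) (simp add: e_def algebra_simps)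
    note shear = vol_factor_shear[OF eB w] and dil = vol_factor_dilation[OF eB vu]
    have detg: "vol_factor g = v \<bullet> u"
      unfolding g_eq vol_factor_compose[OF shear(1,2) dil(1,2)] shear(3) dil(3) by simp
    have bijg: "bij g"
      unfolding g_eq by (rule bij_comp[OF dil(2) shear(2)])
    define A where "A = R -` B"
    have R_meas: "R \<in> borel_measurable borel"
      using linR by (intro borel_measurable_continuous_onI linear_continuous_on) (simp add: linear_conv_bounded_linear)
    have A[measurable]: "A \<in> sets borel"
      using measurable_sets[OF R_meas B(1)] by (simp add: A_def)
    have RA: "R ` A = B" using bijR by (simp add: A_def bij_is_surj)
    have Ak: "x $ k = 0" if "x \<in> A" for x
    proof -
      have "R x \<bullet> R e = 0" using that B(3) by (simp add: A_def R(2))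
      then show ?thesis unfolding Rip by (simp add: e_def inner_axis)
    qed
    define S where "S = {y \<in> slab k. flatten k y \<in> A}"
    have S[measurable]: "S \<in> sets borel" by (simp add: S_def)
    have cyl: "cyl v {0..<1} B = (R \<circ> g) ` S"
    proof -
      have *: "R (g y) = R (flatten k y) + (y $ k) *\<^sub>R v" for y
        using linR by (simp add: g_def flatten_def e_def[symmetric] linear_add linear_diff linear_cmul Rb algebra_simps)
      have S_alt: "y \<in> S \<longleftrightarrow> flatten k y \<in> A \<and> 0 \<le> y $ k \<and> y $ k < 1" for y
        by (auto simp: S_def slab_def)
      show ?thesis
      proof (intro set_eqI iffI)
        fix x assume "x \<in> cyl v {0..<1} B"
        then obtain p t where pt: "x = p + t *\<^sub>R v" "p \<in> B" "0 \<le> t" "t < 1" by (auto simp: cyl_def)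
        obtain a where a: "a \<in> A" "p = R a" using pt(2) RA by blast
        have "flatten k (a + t *\<^sub>R e) = a" "(a + t *\<^sub>R e) $ k = t"
          using Ak[OF a(1)] by (auto simp: vec_eq_iff flatten_nth e_def axis_def)
        then show "x \<in> (R \<circ> g) ` S"
          using pt a by (intro image_eqI[of _ _ "a + t *\<^sub>R e"]) (auto simp: S_alt *)
      next
        fix x assume "x \<in> (R \<circ> g) ` S"
        then obtain y where y: "y \<in> S" "x = R (flatten k y) + (y $ k) *\<^sub>R v" by (auto simp: *)
        then show "x \<in> cyl v {0..<1} B"
          unfolding cyl_def by (intro image_eqI[of _ _ "(R (flatten k y), y $ k)"]) (auto simp: S_alt A_def)
      qed
    qed
    have RS: "cyl v {0..<1} B \<in> sets borel"
      unfolding cyl using linR ling bijR bijg by (intro linear_image_borel linear_compose bij_comp) auto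
    have "emeasure lborel (cyl v {0..<1} B) = ennreal (vol_factor (R \<circ> g)) * emeasure lborel S"
      unfolding cyl using linR ling bijR bijg
      by (intro emeasure_lborel_linear_image) (auto intro: linear_compose bij_comp)
    also have "vol_factor (R \<circ> g) = v \<bullet> u"
      using linR ling bijR bijg R(1) by (simp add: vol_factor_compose vol_factor_orthogonal detg)
    finally have "ennreal \<kappa> * emeasure lborel (cyl v {0..<1} B) = ennreal (v \<bullet> u) * (ennreal \<kappa> * emeasure lborel S)"
      by (simp add: mult.left_commute)
    also have "ennreal \<kappa> * emeasure lborel S = surface_outer A"
      unfolding S_def by (rule \<kappa>(2)[symmetric]) (use A Ak in auto)
    also have "surface_outer A = surface_outer B"
      unfolding RA[symmetric] using n isoR by (intro hausdorff_outer_isometric_image[symmetric]) auto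
    finally show ?thesis using RS by blast
  qed
  have "ennreal \<kappa> * emeasure lborel (cyl v {0..<1} B) = ennreal (v \<bullet> u) * surface_outer B"
    if u: "norm u = 1" and vu: "0 < v \<bullet> u" and B: "B \<in> sets borel" "bounded B" "\<forall>p\<in>B. (p - x0) \<bullet> u = 0"
    for u v x0 :: "real ^ 'n" and B
  proof -
    define B' where "B' = (+) x0 -` B"
    have BB': "B = (+) x0 ` B'"
      by (simp add: B'_def image_vimage_eq)
    have B'[measurable]: "B' \<in> sets borel"
      using measurable_sets[of "(+) x0" borel borel B] B(1) by (simp add: B'_def)
    have bdB': "bounded B'"
    proof -
      have "B' = (+) (- x0) ` B" unfolding BB' by (force simp: image_iff)
      then show ?thesis using B(2) by (simp add: bounded_translation_minus)
    qed
    have flat: "p \<bullet> u = 0" if "p \<in> B'" for p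
      using B(3) that by (auto simp: B'_def)
    have "ennreal \<kappa> * emeasure lborel (cyl v {0..<1} B') = ennreal (v \<bullet> u) * surface_outer B'"
      and cyl_sets: "cyl v {0..<1} B' \<in> sets borel"
      using lin[OF u vu B' bdB' flat] by auto
    moreover have "emeasure lborel (cyl v {0..<1} B) = emeasure lborel (cyl v {0..<1} B')"
      unfolding BB' cyl_plus by (rule emeasure_lborel_translate[OF cyl_sets])
    moreover have "surface_outer B = surface_outer B'"
      unfolding BB' using n by (intro hausdorff_outer_isometric_image) (auto simp: dist_norm)
    ultimately show ?thesis by simp
  qed
  then show ?thesis using \<kappa>(1) by (auto simp: flat_density_def)
qed

section \<open>Cylinders over hypersurface pieces\<close>

lemma borel_Times_real:
  fixes A :: "'a::euclidean_space set" and I :: "real set"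
  assumes "A \<in> sets borel" "I \<in> sets borel"
  shows "A \<times> I \<in> sets borel"
  using assms unfolding borel_prod[symmetric] by (rule pair_measureI)

lemma image_plus_borel:
  fixes z :: "'a::euclidean_space"
  assumes "S \<in> sets borel"
  shows "(+) z ` S \<in> sets borel"
proof -
  have "(+) z ` S = (+) (- z) -` S"
    by (force simp: image_iff algebra_simps)
  then show ?thesis using measurable_sets[of "(+) (- z)" borel borel S] assms by simp
qed

text \<open>On a compact set the inverse of \<open>f\<close> is continuous, and the image of
  \<open>A\<close> is a preimage under it. This is the source of measurability for curved cylinders
  and for projections of surface pieces.\<close>

lemma compact_injective_image_borel:
  fixes f :: "'a::euclidean_space \<Rightarrow> 'b::euclidean_space"
  assumes "compact K" "continuous_on K f" "inj_on f K" "A \<in> sets borel" "A \<subseteq> K"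
  shows "f ` A \<in> sets borel"
proof -
  obtain g where g: "homeomorphism K (f ` K) f g"
    using homeomorphism_compact[OF assms(1,2) _ assms(3)] by blast
  have "g \<in> borel_measurable (restrict_space borel (f ` K))"
    using g by (intro borel_measurable_continuous_on_restrict) (auto simp: homeomorphism_def)
  from measurable_sets[OF this assms(4)]
  have "g -` A \<inter> f ` K \<in> sets (restrict_space borel (f ` K))"
    by (simp add: space_restrict_space)
  moreover have "f ` K \<in> sets borel"
    using assms(1,2) by (intro borel_compact compact_continuous_image)
  ultimately have "g -` A \<inter> f ` K \<in> sets borel"
    by (simp add: sets_restrict_space_iff)
  moreover have "f ` A = g -` A \<inter> f ` K"
    using g assms(5) by (force simp: homeomorphism_def image_iff)
  ultimately show ?thesis by simp
qed

text \<open>Every line in direction \<open>v\<close> meets the set at most once, so a point of a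
  cylinder determines its base point and its height.\<close>

definition transversal :: "'a::real_vector \<Rightarrow> 'a set \<Rightarrow> bool" where
  "transversal v K \<longleftrightarrow> (\<forall>p\<in>K. \<forall>q\<in>K. \<forall>t. q = p + t *\<^sub>R v \<longrightarrow> t = 0)"

lemma transversal_subset: "transversal v K \<Longrightarrow> A \<subseteq> K \<Longrightarrow> transversal v A"
  by (auto simp: transversal_def)

lemma transversal_eq:
  assumes "transversal v K" "p \<in> K" "q \<in> K" "p + t *\<^sub>R v = q + s *\<^sub>R v"
  shows "p = q" "t = s"
proof -
  have "q = p + (t - s) *\<^sub>R v" using assms(4) by (simp add: algebra_simps)
  then have "t - s = 0" using assms(1-3) unfolding transversal_def by blast
  then show "p = q" "t = s" using assms(4) by auto
qed

lemma transversal_inj_on: "transversal v K \<Longrightarrow> inj_on (\<lambda>(p, t). p + t *\<^sub>R v) (K \<times> I)"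
  by (auto simp: inj_on_def dest: transversal_eq)

lemma cyl_borel:
  fixes v :: "'a::euclidean_space"
  assumes "compact K" "transversal v K" "A \<in> sets borel" "A \<subseteq> K" "I \<in> sets borel" "I \<subseteq> {a..b}"
  shows "cyl v I A \<in> sets borel"
  unfolding cyl_def
proof (rule compact_injective_image_borel)
  show "compact (K \<times> {a..b})" using assms(1) by (intro compact_Times) auto
  show "continuous_on (K \<times> {a..b}) (\<lambda>(p, t). p + t *\<^sub>R v)"
    unfolding split_beta by (intro continuous_intros)
  show "inj_on (\<lambda>(p, t). p + t *\<^sub>R v) (K \<times> {a..b})" by (rule transversal_inj_on[OF assms(2)])
qed (use assms borel_Times_real in auto)

lemma cyl_bounded:
  fixes v :: "'a::euclidean_space"
  assumes "bounded A" "bounded I"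
  shows "bounded (cyl v I A)"
proof -
  obtain a b where a: "\<And>x. x \<in> A \<Longrightarrow> norm x \<le> a" and b: "\<And>t. t \<in> I \<Longrightarrow> \<bar>t\<bar> \<le> b"
    using assms by (auto simp: bounded_iff)
  have "norm (p + t *\<^sub>R v) \<le> a + b * norm v" if "p \<in> A" "t \<in> I" for p t
    using a[OF that(1)] b[OF that(2)]
    by (intro norm_triangle_le add_mono) (auto intro: mult_right_mono)
  then show ?thesis by (auto simp: cyl_def bounded_iff)
qed

lemma cyl_shift:
  "cyl v ((+) s ` I) A = (+) (s *\<^sub>R v) ` cyl v I A"
  by (force simp: cyl_def image_iff algebra_simps)

lemma cyl_Un_left: "cyl v (I \<union> J) A = cyl v I A \<union> cyl v J A"
  by (auto simp: cyl_def)

lemma cyl_Un_right: "cyl v I (A \<union> B) = cyl v I A \<union> cyl v I B"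
  by (auto simp: cyl_def)

lemma cyl_disjoint:
  assumes "transversal v K" "A \<subseteq> K" "B \<subseteq> K" "A \<inter> B = {} \<or> I \<inter> J = {}"
  shows "cyl v I A \<inter> cyl v J B = {}"
proof -
  have False if "p \<in> A" "t \<in> I" "q \<in> B" "s \<in> J" "p + t *\<^sub>R v = q + s *\<^sub>R v" for p q t s
    using transversal_eq[OF assms(1) _ _ that(5)] that assms(2,3,4) by blast
  then show ?thesis by (auto simp: cyl_def)
qed

text \<open>The tall cylinder is a disjoint stack of translates of the short one.\<close>

lemma emeasure_cyl_multiple:
  fixes v :: "'a::euclidean_space"
  assumes K: "compact K" "transversal v K" and A: "A \<in> sets borel" "A \<subseteq> K" and h: "0 \<le> h"
  shows "emeasure lborel (cyl v {0..<real N * h} A) = of_nat N * emeasure lborel (cyl v {0..<h} A)"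
proof (induction N)
  case 0
  then show ?case by (simp add: cyl_def)
next
  case (Suc N)
  have meas: "cyl v {a..<b} A \<in> sets borel" for a b
    by (rule cyl_borel[OF K A, of _ a b]) auto
  have I: "{0..<real (Suc N) * h} = {0..<real N * h} \<union> {real N * h..<real N * h + h}"
    using h by (subst ivl_disj_un_two(3)) (auto simp: distrib_right)
  have "{real N * h..<real N * h + h} = (+) (real N * h) ` {0..<h}" by (simp add: add.commute)
  then have eq: "cyl v {real N * h..<real N * h + h} A = (+) ((real N * h) *\<^sub>R v) ` cyl v {0..<h} A"
    by (simp only: cyl_shift)
  have "emeasure lborel (cyl v {0..<real (Suc N) * h} A)
      = emeasure lborel (cyl v {0..<real N * h} A) + emeasure lborel (cyl v {real N * h..<real N * h + h} A)"
    unfolding I cyl_Un_left using meas A by (intro plus_emeasure[symmetric] cyl_disjoint[OF K(2)]) auto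
  also have "emeasure lborel (cyl v {real N * h..<real N * h + h} A) = emeasure lborel (cyl v {0..<h} A)"
    unfolding eq by (rule emeasure_lborel_translate[OF meas])
  finally show ?case by (simp add: Suc.IH distrib_right add.commute)
qed

text \<open>Shearing along \<open>v\<close> does not change the volume: compare long cylinders.\<close>

lemma emeasure_cyl_shear_le:
  fixes v :: "'a::euclidean_space"
  assumes K: "compact K" "transversal v K" and A: "A \<in> sets borel" "A \<subseteq> K"
    and K': "compact K'" "transversal v K'" and A': "A' \<in> sets borel" "A' \<subseteq> K'"
    and shift: "\<And>p. p \<in> A \<Longrightarrow> \<exists>s. \<bar>s\<bar> \<le> 1 \<and> p + s *\<^sub>R v \<in> A'"
  shows "emeasure lborel (cyl v {0..<1} A) \<le> emeasure lborel (cyl v {0..<1} A')"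
proof -
  have fin: "emeasure lborel (cyl v {0..<1} B) < \<infinity>" if "B \<subseteq> C" "compact C" for B C
    by (intro emeasure_bounded_finite cyl_bounded bounded_subset[OF compact_imp_bounded[OF that(2)] that(1)])
      (rule bounded_subset[of "{0..1}"], auto)
  obtain a where a: "emeasure lborel (cyl v {0..<1} A) = ennreal a" "0 \<le> a"
    using fin[OF A(2) K(1)] by (cases "emeasure lborel (cyl v {0..<1} A)") auto
  obtain a' where a': "emeasure lborel (cyl v {0..<1} A') = ennreal a'" "0 \<le> a'"
    using fin[OF A'(2) K'(1)] by (cases "emeasure lborel (cyl v {0..<1} A')") auto
  \<comment> \<open>Base points move by at most \<open>v\<close> in either direction, so the
    cylinder of height \<open>N\<close> over \<open>A\<close> fits into that of height
    \<open>N + 2\<close> over \<open>A'\<close>, lowered by \<open>v\<close>. Dividing by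
    \<open>N\<close> makes the two extra layers negligible.\<close>
  have N: "real N * a \<le> real (N + 2) * a'" for N :: nat
  proof -
    have meas: "cyl v {a..<b} A' \<in> sets borel" for a b
      by (rule cyl_borel[OF K' A', of _ a b]) auto
    have sub: "cyl v {0..<real N * 1} A \<subseteq> (+) ((-1) *\<^sub>R v) ` cyl v {0..<real (N + 2) * 1} A'"
    proof
      fix x assume "x \<in> cyl v {0..<real N * 1} A"
      then obtain p t where pt: "x = p + t *\<^sub>R v" "p \<in> A" "0 \<le> t" "t < real N" by (auto simp: cyl_def)
      from shift[OF pt(2)] obtain s where s: "\<bar>s\<bar> \<le> 1" "p + s *\<^sub>R v \<in> A'" by blast
      have "x = (-1) *\<^sub>R v + ((p + s *\<^sub>R v) + (t - s + 1) *\<^sub>R v)"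
        using pt by (simp add: algebra_simps)
      moreover have "(p + s *\<^sub>R v) + (t - s + 1) *\<^sub>R v \<in> cyl v {0..<real (N + 2) * 1} A'"
        unfolding cyl_def using s pt by (intro image_eqI[of _ _ "(p + s *\<^sub>R v, t - s + 1)"]) auto
      ultimately show "x \<in> (+) ((-1) *\<^sub>R v) ` cyl v {0..<real (N + 2) * 1} A'" by blast
    qed
    have "(+) ((-1) *\<^sub>R v) ` cyl v {0..<real (N + 2) * 1} A' \<in> sets borel"
      by (intro image_plus_borel meas)
    then have "emeasure lborel (cyl v {0..<real N * 1} A) \<le> emeasure lborel ((+) ((-1) *\<^sub>R v) ` cyl v {0..<real (N + 2) * 1} A')"
      using sub by (intro emeasure_mono) auto
    also have "\<dots> = emeasure lborel (cyl v {0..<real (N + 2) * 1} A')"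
      by (rule emeasure_lborel_translate[OF meas])
    finally have "of_nat N * ennreal a \<le> of_nat (N + 2) * ennreal a'"
      unfolding emeasure_cyl_multiple[OF K A zero_le_one] emeasure_cyl_multiple[OF K' A' zero_le_one] a a' .
    then have "ennreal (real N * a) \<le> ennreal (real (N + 2) * a')"
      unfolding ennreal_of_nat_eq_real_of_nat
      by (subst (1 2) ennreal_mult') auto
    then show ?thesis
      using a'(2) by (subst (asm) ennreal_le_iff) auto
  qed
  have "a \<le> a'"
  proof (rule ccontr)
    assume "\<not> a \<le> a'"
    then have pos: "0 < a - a'" by simp
    obtain N :: nat where "2 * a' / (a - a') < real N" using reals_Archimedean2 by blast
    then have "2 * a' < real N * (a - a')" using pos by (simp add: field_simps)
    then show False using N[of N] by (simp add: algebra_simps)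
  qed
  then show ?thesis by (simp add: a a' ennreal_leI)
qed

text \<open>Compactness leaves finitely many good balls; \<open>A\<close> is cut along them, one at
  a time. Finite additivity carries the local inequalities over to \<open>A\<close>, for area-like
  set functions with values in the extended or the real numbers.\<close>

lemma local_to_global_le:
  fixes f g :: "'a::metric_space set \<Rightarrow> 'b::ordered_comm_monoid_add"
  assumes K: "compact K"
    and addf: "\<And>A B. A \<in> sets borel \<Longrightarrow> B \<in> sets borel \<Longrightarrow> A \<subseteq> K \<Longrightarrow> B \<subseteq> K \<Longrightarrow> A \<inter> B = {} \<Longrightarrow> f (A \<union> B) = f A + f B"
    and addg: "\<And>A B. A \<in> sets borel \<Longrightarrow> B \<in> sets borel \<Longrightarrow> A \<subseteq> K \<Longrightarrow> B \<subseteq> K \<Longrightarrow> A \<inter> B = {} \<Longrightarrow> g (A \<union> B) = g A + g B"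
    and emp: "f {} \<le> g {}"
    and loc: "\<And>p. p \<in> K \<Longrightarrow> \<exists>r>0. \<forall>A\<in>sets borel. A \<subseteq> K \<inter> ball p r \<longrightarrow> f A \<le> g A"
    and A: "A \<in> sets borel" "A \<subseteq> K"
  shows "f A \<le> g A"
proof -
  obtain r where r: "\<And>p. p \<in> K \<Longrightarrow> 0 < r p"
    "\<And>p A. p \<in> K \<Longrightarrow> A \<in> sets borel \<Longrightarrow> A \<subseteq> K \<inter> ball p (r p) \<Longrightarrow> f A \<le> g A"
    using loc by metis
  have "K \<subseteq> (\<Union>p\<in>K. ball p (r p))" using r(1) by force
  then obtain F where F: "F \<subseteq> K" "finite F" "K \<subseteq> (\<Union>p\<in>F. ball p (r p))"
    using compactE_image[OF K, of K "\<lambda>p. ball p (r p)"] by auto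
  have "finite F \<Longrightarrow> F \<subseteq> K \<Longrightarrow> A \<in> sets borel \<Longrightarrow> A \<subseteq> K \<Longrightarrow> A \<subseteq> (\<Union>p\<in>F. ball p (r p)) \<Longrightarrow> f A \<le> g A" for A
  proof (induction F arbitrary: A rule: finite_induct)
    case (insert p F)
    have eq: "A = (A \<inter> ball p (r p)) \<union> (A - ball p (r p))" by blast
    have "f A = f (A \<inter> ball p (r p)) + f (A - ball p (r p))"
      by (subst eq, rule addf) (use insert.prems in auto)
    also have "\<dots> \<le> g (A \<inter> ball p (r p)) + g (A - ball p (r p))"
      using insert.prems by (intro add_mono r(2)[of p] insert.IH) auto
    also have "\<dots> = g A"
      by (subst (3) eq, rule addg[symmetric]) (use insert.prems in auto)
    finally show ?case .
  qed (use emp in auto)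
  then show ?thesis using F A by blast
qed

text \<open>The last clause compares two arbitrary nearby points, not just a point with
  \<open>p\<close>. So near \<open>p\<close> the set lies on a graph of small Lipschitz constant
  over the tangent plane, and projecting it there hardly changes distances.\<close>

definition flat_surface :: "('a::euclidean_space \<Rightarrow> 'a) \<Rightarrow> 'a set \<Rightarrow> bool" where
  "flat_surface \<nu> K \<longleftrightarrow> compact K \<and> continuous_on K \<nu> \<and> (\<forall>p\<in>K. norm (\<nu> p) = 1) \<and>
     (\<forall>p\<in>K. \<forall>\<epsilon>>0. \<exists>r>0. \<forall>q\<in>K \<inter> ball p r. \<forall>q'\<in>K \<inter> ball p r. \<bar>(q - q') \<bullet> \<nu> p\<bar> \<le> \<epsilon> * dist q q')"

text \<open>The projection \<open>\<pi>\<close> along \<open>v\<close> onto the tangent hyperplane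
  at \<open>p\<close> slides points along \<open>v\<close>, so it preserves the volume of the
  cylinder; it distorts distances by factors between \<open>1 - \<eta>\<close> and
  \<open>1 + \<eta>\<close>, hence Hausdorff measure by their \<open>s\<close>-th powers. On the
  hyperplane \<open>flat_density\<close> applies.\<close>

lemma flat_surface_local:
  fixes K :: "(real ^ 'n) set"
  assumes n: "2 \<le> CARD('n)" and \<kappa>: "flat_density \<kappa> (surface_outer :: (real ^ 'n) set \<Rightarrow> ennreal)"
    and flat: "flat_surface \<nu> K" and tr: "transversal v K" and p: "p \<in> K" "0 < v \<bullet> \<nu> p"
    and \<eta>: "0 < \<eta>" "\<eta> < 1"
  defines "a \<equiv> v \<bullet> \<nu> p" and "s \<equiv> real CARD('n) - 1"
  shows "\<exists>r>0. \<forall>A\<in>sets borel. A \<subseteq> K \<inter> ball p r \<longrightarrow>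
           ennreal \<kappa> * emeasure lborel (cyl v {0..<1} A) \<le> ennreal (a * (1 + \<eta>) powr s) * surface_outer A \<and>
           ennreal (a * (1 - \<eta>) powr s) * surface_outer A \<le> ennreal \<kappa> * emeasure lborel (cyl v {0..<1} A)"
proof -
  have K: "compact K" and \<nu>p: "norm (\<nu> p) = 1" using flat p by (auto simp: flat_surface_def)
  have a: "0 < a" using p by (simp add: a_def)
  then have v: "v \<noteq> 0" by (auto simp: a_def)
  have s: "0 < s" using n by (simp add: s_def)
  \<comment> \<open>Two projected points are displaced relative to each other by their normal
    difference times \<open>norm v / a\<close>; this slope makes that at most \<open>\<eta>\<close>
    times their distance.\<close>
  define \<theta> where "\<theta> = \<eta> * a / norm v"
  have "0 < \<theta>" using \<eta> a v by (simp add: \<theta>_def)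
  then obtain r1 where r1: "0 < r1"
    "\<And>q q'. q \<in> K \<inter> ball p r1 \<Longrightarrow> q' \<in> K \<inter> ball p r1 \<Longrightarrow> \<bar>(q - q') \<bullet> \<nu> p\<bar> \<le> \<theta> * dist q q'"
    using flat p(1) unfolding flat_surface_def by meson
  \<comment> \<open>Radius at most \<open>a\<close> keeps the sliding parameter in [-1, 1], as the
    shearing lemma requires; half of \<open>r1\<close> lets closed balls fit into the open ball of
    radius \<open>r1\<close>.\<close>
  define r where "r = min a (r1 / 2)"
  have r: "0 < r" "r \<le> a" "r < r1" using r1 a by (auto simp: r_def)
  define \<pi> where "\<pi> q = q - (((q - p) \<bullet> \<nu> p) / a) *\<^sub>R v" for q
  have \<pi>_flat: "(\<pi> q - p) \<bullet> \<nu> p = 0" for q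
    using a by (simp add: \<pi>_def inner_diff_left a_def)
  have \<pi>_dist: "(1 - \<eta>) * dist q q' \<le> dist (\<pi> q) (\<pi> q')" "dist (\<pi> q) (\<pi> q') \<le> (1 + \<eta>) * dist q q'"
    if "q \<in> K \<inter> cball p r" "q' \<in> K \<inter> cball p r" for q q'
  proof -
    define c where "c = (((q - q') \<bullet> \<nu> p) / a) *\<^sub>R v"
    have "\<pi> q - \<pi> q' = (q - q') - c"
      by (simp add: \<pi>_def c_def inner_diff_left diff_divide_distrib algebra_simps)
    moreover have "norm c \<le> \<eta> * dist q q'"
    proof -
      have "norm c = \<bar>(q - q') \<bullet> \<nu> p\<bar> * (norm v / a)" using a by (simp add: c_def)
      also have "\<dots> \<le> (\<theta> * dist q q') * (norm v / a)"
        using r1(2)[of q q'] that r a by (intro mult_right_mono) auto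
      also have "\<dots> = \<eta> * dist q q'" using a v by (simp add: \<theta>_def)
      finally show ?thesis .
    qed
    ultimately show "(1 - \<eta>) * dist q q' \<le> dist (\<pi> q) (\<pi> q')" "dist (\<pi> q) (\<pi> q') \<le> (1 + \<eta>) * dist q q'"
      using norm_triangle_ineq4[of "q - q'" c] norm_triangle_ineq2[of "q - q'" c]
      by (simp_all add: dist_norm left_diff_distrib distrib_right)
  qed
  define K1 where "K1 = K \<inter> cball p r"
  have K1: "compact K1" using K by (simp add: K1_def compact_Int_closed)
  have cont: "continuous_on K1 \<pi>" unfolding \<pi>_def by (intro continuous_intros) (use a in auto)
  have inj: "inj_on \<pi> K1"
  proof (rule inj_onI)
    fix q q' assume "q \<in> K1" "q' \<in> K1" "\<pi> q = \<pi> q'"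
    then have "(1 - \<eta>) * dist q q' \<le> 0" using \<pi>_dist(1)[of q q'] by (simp add: K1_def)
    then show "q = q'" using \<eta> by (simp add: mult_le_0_iff)
  qed
  have trK1: "transversal v K1" using tr by (rule transversal_subset) (auto simp: K1_def)
  have cK1: "compact (\<pi> ` K1)" using cont K1 by (rule compact_continuous_image)
  have tr\<pi>: "transversal v (\<pi> ` K1)"
  proof -
    have "t = 0" if "\<pi> q' = \<pi> q + t *\<^sub>R v" for q q' t
    proof -
      have "(\<pi> q' - p) \<bullet> \<nu> p = (\<pi> q - p) \<bullet> \<nu> p + t * a"
        using that by (simp add: a_def algebra_simps inner_add_left inner_diff_left)
      then show ?thesis using \<pi>_flat a by simp
    qed
    then show ?thesis by (auto simp: transversal_def)
  qed
  have main: "ennreal \<kappa> * emeasure lborel (cyl v {0..<1} A) \<le> ennreal (a * (1 + \<eta>) powr s) * surface_outer A \<and>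
           ennreal (a * (1 - \<eta>) powr s) * surface_outer A \<le> ennreal \<kappa> * emeasure lborel (cyl v {0..<1} A)"
    if A: "A \<in> sets borel" "A \<subseteq> K1" for A
  proof -
    have \<pi>A: "\<pi> ` A \<in> sets borel" by (rule compact_injective_image_borel[OF K1 cont inj A])
    have shift: "\<bar>((q - p) \<bullet> \<nu> p) / a\<bar> \<le> 1" if "q \<in> K1" for q
    proof -
      have "\<bar>(q - p) \<bullet> \<nu> p\<bar> \<le> norm (q - p)" using Cauchy_Schwarz_ineq2[of "q - p" "\<nu> p"] \<nu>p by simp
      also have "\<dots> \<le> a" using that r by (simp add: K1_def dist_norm norm_minus_commute)
      finally show ?thesis using a by simp
    qed
    have "emeasure lborel (cyl v {0..<1} A) = emeasure lborel (cyl v {0..<1} (\<pi> ` A))"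
    proof (rule antisym)
      show "emeasure lborel (cyl v {0..<1} A) \<le> emeasure lborel (cyl v {0..<1} (\<pi> ` A))"
      proof (rule emeasure_cyl_shear_le[OF K1 trK1 A cK1 tr\<pi> \<pi>A])
        fix q assume q: "q \<in> A"
        then show "\<exists>s. \<bar>s\<bar> \<le> 1 \<and> q + s *\<^sub>R v \<in> \<pi> ` A"
          using shift[of q] A by (intro exI[of _ "- (((q - p) \<bullet> \<nu> p) / a)"]) (auto simp: \<pi>_def)
      qed (use A in auto)
      show "emeasure lborel (cyl v {0..<1} (\<pi> ` A)) \<le> emeasure lborel (cyl v {0..<1} A)"
      proof (rule emeasure_cyl_shear_le[OF cK1 tr\<pi> \<pi>A _ K1 trK1 A])
        fix q assume "q \<in> \<pi> ` A"
        then obtain q' where q: "q' \<in> A" "q = \<pi> q'" by blast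
        then show "\<exists>s. \<bar>s\<bar> \<le> 1 \<and> q + s *\<^sub>R v \<in> A"
          using shift[of q'] A by (intro exI[of _ "((q' - p) \<bullet> \<nu> p) / a"]) (auto simp: \<pi>_def)
      qed (use A in auto)
    qed
    also have "ennreal \<kappa> * \<dots> = ennreal a * surface_outer (\<pi> ` A)"
    proof -
      have "bounded (\<pi> ` A)" using bounded_subset[OF compact_imp_bounded[OF cK1]] A(2) by blast
      then show ?thesis
        using \<kappa> \<nu>p a \<pi>A \<pi>_flat unfolding flat_density_def a_def by blast
    qed
    finally have eq: "ennreal \<kappa> * emeasure lborel (cyl v {0..<1} A) = ennreal a * surface_outer (\<pi> ` A)" .
    have AK: "q \<in> K \<inter> cball p r" if "q \<in> A" for q
      using that A(2) by (auto simp: K1_def)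
    have up: "surface_outer (\<pi> ` A) \<le> ennreal ((1 + \<eta>) powr s) * surface_outer A"
      unfolding s_def using \<pi>_dist(2)[OF AK AK] \<eta> s
      by (simp add: s_def) (intro hausdorff_outer_lipschitz_image, auto)
    have lo: "surface_outer (the_inv_into K1 \<pi> ` \<pi> ` A) \<le> ennreal ((1 / (1 - \<eta>)) powr s) * surface_outer (\<pi> ` A)"
    proof -
      have "dist q q' \<le> 1 / (1 - \<eta>) * dist (\<pi> q) (\<pi> q')" if "q \<in> A" "q' \<in> A" for q q'
        using \<pi>_dist(1)[OF AK AK] that \<eta> by (auto simp: field_simps)
      then show ?thesis
        using A \<eta> s by (simp add: s_def)
         (intro hausdorff_outer_lipschitz_image, auto simp: the_inv_into_f_f[OF inj] subset_iff)
    qed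
    have "the_inv_into K1 \<pi> ` \<pi> ` A = A"
      using A by (force simp: image_image the_inv_into_f_f[OF inj] subset_iff)
    with lo have "ennreal ((1 - \<eta>) powr s) * surface_outer A
        \<le> ennreal ((1 - \<eta>) powr s) * (ennreal ((1 / (1 - \<eta>)) powr s) * surface_outer (\<pi> ` A))"
      by (intro mult_left_mono) auto
    also have "\<dots> = surface_outer (\<pi> ` A)"
      using \<eta> by (simp add: mult.assoc[symmetric] ennreal_mult'[symmetric] powr_divide)
    finally have lo': "ennreal ((1 - \<eta>) powr s) * surface_outer A \<le> surface_outer (\<pi> ` A)" .
    show ?thesis
      unfolding eq using mult_left_mono[OF up, of "ennreal a"] mult_left_mono[OF lo', of "ennreal a"] a
      by (simp add: ennreal_mult mult.assoc)
  qed
  show ?thesis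
  proof (intro exI[of _ r] conjI[OF r(1)] ballI impI)
    fix A :: "(real ^ 'n) set" assume A: "A \<in> sets borel" "A \<subseteq> K \<inter> ball p r"
    then have "A \<subseteq> K1" by (auto simp: K1_def)
    with A(1) show "ennreal \<kappa> * emeasure lborel (cyl v {0..<1} A) \<le> ennreal (a * (1 + \<eta>) powr s) * surface_outer A \<and>
        ennreal (a * (1 - \<eta>) powr s) * surface_outer A \<le> ennreal \<kappa> * emeasure lborel (cyl v {0..<1} A)"
      by (rule main)
  qed
qed

lemma emeasure_cyl_Un:
  fixes v :: "'a::euclidean_space"
  assumes "compact K" "transversal v K" "A \<in> sets borel" "B \<in> sets borel" "A \<subseteq> K" "B \<subseteq> K" "A \<inter> B = {}"
  shows "emeasure lborel (cyl v {0..<1} (A \<union> B)) = emeasure lborel (cyl v {0..<1} A) + emeasure lborel (cyl v {0..<1} B)"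
proof -
  have "cyl v {0..<1} C \<in> sets borel" if "C \<in> sets borel" "C \<subseteq> K" for C
    by (rule cyl_borel[OF assms(1,2) that, of _ 0 1]) auto
  then show ?thesis
    unfolding cyl_Un_right using assms by (intro plus_emeasure[symmetric] cyl_disjoint[OF assms(2)]) auto
qed

lemma ennreal_le_mult_limit:
  fixes x y :: ennreal
  assumes "\<And>c. 1 < c \<Longrightarrow> x \<le> ennreal c * y"
  shows "x \<le> y"
proof (cases y)
  case (real r)
  show ?thesis
  proof (rule ennreal_le_epsilon)
    fix e :: real assume e: "0 < e"
    have "x \<le> ennreal (1 + e / (r + 1)) * y" using real e by (intro assms) auto
    also have "\<dots> = ennreal (r + e * (r / (r + 1)))"
      using real e by (simp add: ennreal_mult'[symmetric] algebra_simps)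
    also have "\<dots> \<le> ennreal (r + e)"
      using real e by (intro ennreal_leI add_left_mono mult_left_le) (auto simp: field_simps)
    also have "\<dots> = y + ennreal e" using real e by (simp add: ennreal_plus)
    finally show "x \<le> y + ennreal e" .
  qed
qed simp

text \<open>Both sides are additive in \<open>A\<close>. Near each point they are both almost
  \<open>v \<bullet> \<nu> p\<close> times the Hausdorff measure, so they agree up to a factor
  \<open>c\<close> close to 1 on small pieces, hence on all of \<open>A\<close>; then
  \<open>c\<close> tends to 1.\<close>

lemma flat_surface_area:
  fixes K :: "(real ^ 'n) set"
  assumes n: "2 \<le> CARD('n)" and \<kappa>: "flat_density \<kappa> (surface_outer :: (real ^ 'n) set \<Rightarrow> ennreal)"
    and flat: "flat_surface \<nu> K" and tr: "transversal v K" and pos: "\<And>p. p \<in> K \<Longrightarrow> 0 < v \<bullet> \<nu> p"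
    and A: "A \<in> sets borel" "A \<subseteq> K"
  shows "ennreal \<kappa> * emeasure lborel (cyl v {0..<1} A)
       = (\<integral>\<^sup>+p. ennreal (v \<bullet> \<nu> p) * indicator A p \<partial>surface_measure)"
proof -
  have K: "compact K" and \<nu>_cont: "continuous_on K \<nu>" using flat by (auto simp: flat_surface_def)
  define f where "f A = ennreal \<kappa> * emeasure lborel (cyl v {0..<1} A)" for A
  define g where "g A = (\<integral>\<^sup>+p. ennreal (v \<bullet> \<nu> p) * indicator A p \<partial>surface_measure)" for A
  define s where "s = real CARD('n) - 1"
  have "(\<lambda>p. v \<bullet> \<nu> p) \<in> borel_measurable (restrict_space borel K)"
    by (intro borel_measurable_continuous_on_restrict continuous_intros \<nu>_cont)
  then have "(\<lambda>p. indicator K p *\<^sub>R (v \<bullet> \<nu> p)) \<in> borel_measurable borel"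
    using K by (subst (asm) borel_measurable_restrict_space_iff) (auto simp: borel_compact)
  then have meas[measurable]: "(\<lambda>p. ennreal (v \<bullet> \<nu> p) * indicator A p) \<in> borel_measurable borel"
    if A: "A \<in> sets borel" "A \<subseteq> K" for A
  proof -
    have [measurable]: "A \<in> sets borel" by fact
    have "(\<lambda>p. ennreal (indicator K p *\<^sub>R (v \<bullet> \<nu> p)) * indicator A p) \<in> borel_measurable borel"
      using \<open>(\<lambda>p. indicator K p *\<^sub>R (v \<bullet> \<nu> p)) \<in> borel_measurable borel\<close> by measurable
    moreover have "(\<lambda>p. ennreal (indicator K p *\<^sub>R (v \<bullet> \<nu> p)) * indicator A p) = (\<lambda>p. ennreal (v \<bullet> \<nu> p) * indicator A p)"
      using that by (auto simp: indicator_def fun_eq_iff)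
    ultimately show ?thesis by simp
  qed
  have addf: "f (A \<union> B) = f A + f B" if "A \<in> sets borel" "B \<in> sets borel" "A \<subseteq> K" "B \<subseteq> K" "A \<inter> B = {}" for A B
    using emeasure_cyl_Un[OF K tr that] by (simp add: f_def distrib_left)
  have addg: "g (A \<union> B) = g A + g B" if "A \<in> sets borel" "B \<in> sets borel" "A \<subseteq> K" "B \<subseteq> K" "A \<inter> B = {}" for A B
  proof -
    have "g A + g B = (\<integral>\<^sup>+p. ennreal (v \<bullet> \<nu> p) * indicator A p + ennreal (v \<bullet> \<nu> p) * indicator B p \<partial>surface_measure)"
      unfolding g_def using meas that by (intro nn_integral_add[symmetric]) auto
    also have "\<dots> = g (A \<union> B)"
      unfolding g_def using that(5) by (intro nn_integral_cong) (auto simp: indicator_def)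
    finally show ?thesis by simp
  qed
  have g_bounds: "ennreal a * surface_outer A \<le> g A" "g A \<le> ennreal b * surface_outer A"
    if A: "A \<in> sets borel" "A \<subseteq> K" and ab: "\<And>p. p \<in> A \<Longrightarrow> a \<le> v \<bullet> \<nu> p" "\<And>p. p \<in> A \<Longrightarrow> v \<bullet> \<nu> p \<le> b" for A a b
  proof -
    have c: "ennreal c * surface_outer A = (\<integral>\<^sup>+p. ennreal c * indicator A p \<partial>surface_measure)" for c
      using A by (simp add: nn_integral_cmult emeasure_hausdorff_measure)
    show "ennreal a * surface_outer A \<le> g A" unfolding c g_def
      using ab by (intro nn_integral_mono) (auto simp: indicator_def intro: ennreal_leI)
    show "g A \<le> ennreal b * surface_outer A" unfolding c g_def
      using ab by (intro nn_integral_mono) (auto simp: indicator_def intro: ennreal_leI)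
  qed
  have both: "f A \<le> ennreal c * g A \<and> g A \<le> ennreal c * f A" if c: "1 < c" for c
  proof -
    \<comment> \<open>Two distortions combine: powers of \<open>1 \<plusminus> \<eta>\<close> from
      the projection and factors \<open>1 \<plusminus> \<eta>\<close> from the variation of
      \<open>v \<bullet> \<nu>\<close>. For small \<open>\<eta>\<close> both worst quotients are
      below \<open>c\<close>.\<close>
    have "((\<lambda>\<eta>. (1 + \<eta>) powr s - c * (1 - \<eta>)) \<longlongrightarrow> (1 + 0) powr s - c * (1 - 0)) (at_right 0)"
      by (intro tendsto_intros) auto
    then have e1: "eventually (\<lambda>\<eta>. (1 + \<eta>) powr s - c * (1 - \<eta>) < 0) (at_right 0)"
      using c by (intro order_tendstoD) auto
    have "((\<lambda>\<eta>. (1 + \<eta>) - c * (1 - \<eta>) powr s) \<longlongrightarrow> (1 + 0) - c * (1 - 0) powr s) (at_right 0)"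
      by (intro tendsto_intros) auto
    then have e2: "eventually (\<lambda>\<eta>. (1 + \<eta>) - c * (1 - \<eta>) powr s < 0) (at_right 0)"
      using c by (intro order_tendstoD) auto
    have e3: "eventually (\<lambda>\<eta>. \<eta> \<in> {0<..<1 :: real}) (at_right 0)"
      by (rule eventually_at_right_real) auto
    from eventually_happens'[OF _ eventually_conj[OF e1 eventually_conj[OF e2 e3]]]
    obtain \<eta> where \<eta>: "0 < \<eta>" "\<eta> < 1" "(1 + \<eta>) powr s \<le> c * (1 - \<eta>)" "1 + \<eta> \<le> c * (1 - \<eta>) powr s"
      by (auto simp: trivial_limit_at_right_real)
    have loc: "\<exists>r>0. \<forall>A\<in>sets borel. A \<subseteq> K \<inter> ball p r \<longrightarrow> f A \<le> ennreal c * g A \<and> g A \<le> ennreal c * f A"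
      if p: "p \<in> K" for p
    proof -
      define a where "a = v \<bullet> \<nu> p"
      have a: "0 < a" using pos[OF p] by (simp add: a_def)
      from flat_surface_local[OF n \<kappa> flat tr p pos[OF p] \<eta>(1,2)]
      obtain r1 where r1: "0 < r1" "\<And>A. A \<in> sets borel \<Longrightarrow> A \<subseteq> K \<inter> ball p r1 \<Longrightarrow>
           f A \<le> ennreal (a * (1 + \<eta>) powr s) * surface_outer A \<and>
           ennreal (a * (1 - \<eta>) powr s) * surface_outer A \<le> f A"
        unfolding f_def a_def s_def by meson
      have "continuous_on K (\<lambda>q. v \<bullet> \<nu> q)" by (intro continuous_intros \<nu>_cont)
      moreover have "0 < a * \<eta>" using a \<eta> by simp
      ultimately have "\<exists>r2>0. \<forall>q\<in>K. dist q p < r2 \<longrightarrow> dist (v \<bullet> \<nu> q) (v \<bullet> \<nu> p) < a * \<eta>"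
        using p unfolding continuous_on_iff by blast
      then obtain r2 where r2: "0 < r2" "\<And>q. q \<in> K \<Longrightarrow> dist q p < r2 \<Longrightarrow> dist (v \<bullet> \<nu> q) a < a * \<eta>"
        unfolding a_def by blast
      show ?thesis
      proof (intro exI[of _ "min r1 r2"] conjI ballI impI)
        fix A :: "(real ^ 'n) set" assume A: "A \<in> sets borel" "A \<subseteq> K \<inter> ball p (min r1 r2)"
        have AK: "A \<subseteq> K \<inter> ball p r1" "A \<subseteq> ball p r2" "A \<subseteq> K" using A(2) by auto
        have bd: "a * (1 - \<eta>) \<le> v \<bullet> \<nu> q" "v \<bullet> \<nu> q \<le> a * (1 + \<eta>)" if "q \<in> A" for q
        proof -
          have "\<bar>v \<bullet> \<nu> q - a\<bar> < a * \<eta>"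
            using r2(2)[of q] AK(2,3) that by (auto simp: dist_real_def dist_commute subset_iff)
          then show "a * (1 - \<eta>) \<le> v \<bullet> \<nu> q" "v \<bullet> \<nu> q \<le> a * (1 + \<eta>)"
            by (simp_all add: distrib_left right_diff_distrib)
        qed
        have g: "ennreal (a * (1 - \<eta>)) * surface_outer A \<le> g A" "g A \<le> ennreal (a * (1 + \<eta>)) * surface_outer A"
          using g_bounds[OF A(1) AK(3) bd] by blast+
        have f: "f A \<le> ennreal (a * (1 + \<eta>) powr s) * surface_outer A"
           "ennreal (a * (1 - \<eta>) powr s) * surface_outer A \<le> f A"
          using r1(2)[OF A(1) AK(1)] by blast+
        have "f A \<le> ennreal (c * (a * (1 - \<eta>))) * surface_outer A"
          using \<eta>(3) a by (intro order_trans[OF f(1)] mult_right_mono ennreal_leI) (auto simp: mult.left_commute)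
        also have "\<dots> = ennreal c * (ennreal (a * (1 - \<eta>)) * surface_outer A)"
          using c by (simp add: ennreal_mult' mult.assoc)
        also have "\<dots> \<le> ennreal c * g A" by (intro mult_left_mono g) auto
        finally show "f A \<le> ennreal c * g A" .
        have "g A \<le> ennreal (c * (a * (1 - \<eta>) powr s)) * surface_outer A"
          using \<eta>(4) a by (intro order_trans[OF g(2)] mult_right_mono ennreal_leI) (auto simp: mult.left_commute)
        also have "\<dots> = ennreal c * (ennreal (a * (1 - \<eta>) powr s) * surface_outer A)"
          using c by (simp add: ennreal_mult' mult.assoc)
        also have "\<dots> \<le> ennreal c * f A" by (intro mult_left_mono f) auto
        finally show "g A \<le> ennreal c * f A" .
      qed (use r1 r2 in auto)
    qed
    have "f A \<le> ennreal c * g A"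
    proof (rule local_to_global_le[OF K addf _ _ _ A])
      show "ennreal c * g (A \<union> B) = ennreal c * g A + ennreal c * g B"
        if "A \<in> sets borel" "B \<in> sets borel" "A \<subseteq> K" "B \<subseteq> K" "A \<inter> B = {}" for A B
        by (simp only: addg[OF that] distrib_left)
      show "\<exists>r>0. \<forall>A\<in>sets borel. A \<subseteq> K \<inter> ball p r \<longrightarrow> f A \<le> ennreal c * g A" if "p \<in> K" for p
        using loc[OF that] by blast
    qed (simp_all add: f_def cyl_def)
    moreover have "g A \<le> ennreal c * f A"
    proof (rule local_to_global_le[OF K addg _ _ _ A])
      show "ennreal c * f (A \<union> B) = ennreal c * f A + ennreal c * f B"
        if "A \<in> sets borel" "B \<in> sets borel" "A \<subseteq> K" "B \<subseteq> K" "A \<inter> B = {}" for A B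
        by (simp only: addf[OF that] distrib_left)
      show "\<exists>r>0. \<forall>A\<in>sets borel. A \<subseteq> K \<inter> ball p r \<longrightarrow> g A \<le> ennreal c * f A" if "p \<in> K" for p
        using loc[OF that] by blast
    qed (simp_all add: g_def)
    ultimately show ?thesis by blast
  qed
  have "f A = g A"
  proof (rule antisym)
    show "f A \<le> g A" by (rule ennreal_le_mult_limit) (rule both[THEN conjunct1])
    show "g A \<le> f A" by (rule ennreal_le_mult_limit) (rule both[THEN conjunct2])
  qed
  then show ?thesis by (simp add: f_def g_def)
qed

section \<open>Gauss-Green for difference quotients\<close>

text \<open>\<open>w\<close> is continuously differentiable with nowhere vanishing gradient
  \<open>G\<close>; so its zero set is a hypersurface whose normal along \<open>G\<close> points out
  of the region \<open>w < 0\<close>.\<close>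

definition level_chart :: "('a::euclidean_space \<Rightarrow> real) \<Rightarrow> ('a \<Rightarrow> 'a) \<Rightarrow> 'a set \<Rightarrow> bool" where
  "level_chart w G U \<longleftrightarrow> open U \<and> (\<forall>y\<in>U. (w has_derivative (\<lambda>h. G y \<bullet> h)) (at y)) \<and>
     continuous_on U G \<and> (\<forall>y\<in>U. G y \<noteq> 0)"

lemma level_chart_mvt:
  assumes w: "level_chart w G U" and C: "convex C" "C \<subseteq> U" and q: "q \<in> C" "q' \<in> C"
  shows "\<exists>\<xi>\<in>C. w q - w q' = G \<xi> \<bullet> (q - q')"
proof -
  define f where "f t = w (q' + t *\<^sub>R (q - q'))" for t :: real
  have inC: "q' + t *\<^sub>R (q - q') \<in> C" if "t \<in> {0..1}" for t
  proof -
    have "q' + t *\<^sub>R (q - q') = (1 - t) *\<^sub>R q' + t *\<^sub>R q" by (simp add: algebra_simps)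
    then show ?thesis using C(1) q that by (auto simp: convex_alt)
  qed
  have "(f has_derivative (\<lambda>h. G (q' + t *\<^sub>R (q - q')) \<bullet> (h *\<^sub>R (q - q')))) (at t within {0..1})" if "t \<in> {0..1}" for t
  proof -
    have "(w has_derivative (\<lambda>h. G (q' + t *\<^sub>R (q - q')) \<bullet> h)) (at (q' + t *\<^sub>R (q - q')))"
      using w inC[OF that] C(2) by (auto simp: level_chart_def)
    then show ?thesis unfolding f_def
      by (rule has_derivative_compose[where f = "\<lambda>t. q' + t *\<^sub>R (q - q')" and g = w, rotated])
        (auto intro!: derivative_eq_intros)
  qed
  from mvt_simple[OF zero_less_one this]
  obtain t where "t \<in> {0<..<1}" "f 1 - f 0 = G (q' + t *\<^sub>R (q - q')) \<bullet> ((1 - 0) *\<^sub>R (q - q'))"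
    by auto
  then show ?thesis using inC[of t] by (intro bexI[of _ "q' + t *\<^sub>R (q - q')"]) (auto simp: f_def)
qed

text \<open>For two zeros of \<open>w\<close> the mean value theorem makes their difference
  orthogonal to \<open>G\<close> at a point between them; by continuity it is then almost orthogonal
  to \<open>G p\<close>.\<close>

lemma level_chart_flat:
  fixes w :: "'a::euclidean_space \<Rightarrow> real"
  assumes w: "level_chart w G U" and K: "compact K" "K \<subseteq> U" "\<And>y. y \<in> K \<Longrightarrow> w y = 0"
  shows "flat_surface (\<lambda>p. G p /\<^sub>R norm (G p)) K"
proof -
  have U: "open U" and contG: "continuous_on U G" and G0: "\<And>y. y \<in> U \<Longrightarrow> G y \<noteq> 0"
    using w by (auto simp: level_chart_def)
  have "\<exists>r>0. \<forall>q\<in>K \<inter> ball p r. \<forall>q'\<in>K \<inter> ball p r. \<bar>(q - q') \<bullet> (G p /\<^sub>R norm (G p))\<bar> \<le> \<epsilon> * dist q q'"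
    if p: "p \<in> K" and \<epsilon>: "0 < \<epsilon>" for p \<epsilon>
  proof -
    have pU: "p \<in> U" using p K by auto
    define c where "c = norm (G p)"
    have c: "0 < c" using G0[OF pU] by (simp add: c_def)
    obtain r1 where r1: "0 < r1" "ball p r1 \<subseteq> U" using U pU by (auto simp: open_contains_ball)
    have "\<exists>r2>0. \<forall>q\<in>U. dist q p < r2 \<longrightarrow> dist (G q) (G p) < \<epsilon> * c"
      using contG pU c \<epsilon> unfolding continuous_on_iff by simp
    then obtain r2 where r2: "0 < r2" "\<And>q. q \<in> U \<Longrightarrow> dist q p < r2 \<Longrightarrow> dist (G q) (G p) < \<epsilon> * c" by blast
    show ?thesis
    proof (intro exI[of _ "min r1 r2"] conjI ballI)
      fix q q' assume q: "q \<in> K \<inter> ball p (min r1 r2)" "q' \<in> K \<inter> ball p (min r1 r2)"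
      have "ball p (min r1 r2) \<subseteq> U" using r1 by auto
      from level_chart_mvt[OF w convex_ball this, of q q'] q
      obtain \<xi> where \<xi>: "\<xi> \<in> ball p (min r1 r2)" "w q - w q' = G \<xi> \<bullet> (q - q')" by auto
      then have 0: "G \<xi> \<bullet> (q - q') = 0" using q K(3) by simp
      have "\<xi> \<in> U" using \<xi>(1) r1 by auto
      then have "dist (G \<xi>) (G p) < \<epsilon> * c" using r2(2)[of \<xi>] \<xi>(1) by (simp add: dist_commute)
      then have le: "norm (G p - G \<xi>) \<le> \<epsilon> * c" by (simp add: dist_norm norm_minus_commute)
      have "(G p - G \<xi>) \<bullet> (q - q') = G p \<bullet> (q - q')" using 0 by (simp add: inner_diff_left)
      then have "\<bar>(q - q') \<bullet> G p\<bar> = \<bar>(G p - G \<xi>) \<bullet> (q - q')\<bar>" by (simp only: inner_commute)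
      also have "\<dots> \<le> norm (G p - G \<xi>) * norm (q - q')" by (rule Cauchy_Schwarz_ineq2)
      also have "\<dots> \<le> (\<epsilon> * c) * norm (q - q')" using le by (rule mult_right_mono) simp
      finally show "\<bar>(q - q') \<bullet> (G p /\<^sub>R norm (G p))\<bar> \<le> \<epsilon> * dist q q'"
        using c by (simp add: c_def[symmetric] dist_norm abs_mult field_simps)
    qed (use r1 r2 in auto)
  qed
  moreover have "continuous_on K (\<lambda>p. G p /\<^sub>R norm (G p))"
    using G0 K(2) continuous_on_subset[OF contG K(2)] by (intro continuous_intros) auto
  ultimately show ?thesis
    unfolding flat_surface_def using K G0 by (auto simp: subset_iff)
qed

text \<open>Over a small piece of \<open>K\<close> the integrand is nearly constant, and the
  cylinder of height \<open>1 / N\<close> has exactly \<open>1 / N\<close> of the volume of the unit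
  cylinder, which \<open>flat_surface_area\<close> expresses as a surface integral. The pieces are
  added up by \<open>local_to_global_le\<close>.\<close>

lemma cyl_integral_limit:
  fixes K :: "(real ^ 'n) set" and g :: "real ^ 'n \<Rightarrow> real"
  assumes n: "2 \<le> CARD('n)" and \<kappa>: "flat_density \<kappa> (surface_outer :: (real ^ 'n) set \<Rightarrow> ennreal)"
    and flat: "flat_surface \<nu> K" and tr: "transversal v K" and pos: "\<And>p. p \<in> K \<Longrightarrow> 0 < v \<bullet> \<nu> p"
    and g: "uniformly_continuous_on UNIV g" and gN: "uniform_limit UNIV gN g sequentially"
    and gN_meas: "\<And>N. gN N \<in> borel_measurable borel" and bd: "\<And>N y. \<bar>gN N y\<bar> \<le> B" "\<And>y. \<bar>g y\<bar> \<le> B"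
  shows "integrable surface_measure (\<lambda>p. indicator K p * (g p * (v \<bullet> \<nu> p)))"
    "(\<lambda>N. \<kappa> * (real N * (LINT y|lborel. indicator (cyl v {0..<1 / real N} K) y * gN N y)))
       \<longlonglongrightarrow> (LINT p|surface_measure. indicator K p * (g p * (v \<bullet> \<nu> p)))"
proof -
  have K: "compact K" and \<nu>_cont: "continuous_on K \<nu>" using flat by (auto simp: flat_surface_def)
  have K_borel[measurable]: "K \<in> sets borel" using K by (rule borel_compact)
  have \<kappa>0: "0 \<le> \<kappa>" using \<kappa> by (simp add: flat_density_def)
  have g_meas[measurable]: "g \<in> borel_measurable borel"
    using g by (intro borel_measurable_continuous_onI uniformly_continuous_imp_continuous)
  define m where "m p = indicator K p * (v \<bullet> \<nu> p)" for p
  have "(\<lambda>p. v \<bullet> \<nu> p) \<in> borel_measurable (restrict_space borel K)"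
    by (intro borel_measurable_continuous_on_restrict continuous_intros \<nu>_cont)
  then have m_meas[measurable]: "m \<in> borel_measurable borel"
    unfolding m_def by (subst (asm) borel_measurable_restrict_space_iff) auto
  have m0: "0 \<le> m p" for p using pos[of p] by (auto simp: m_def indicator_def less_imp_le)
  have C_meas: "cyl v {0..<h} A \<in> sets borel" if "A \<in> sets borel" "A \<subseteq> K" for A h
    by (rule cyl_borel[OF K tr that, of _ 0 h]) auto
  have C_fin: "emeasure lborel (cyl v {0..<h} A) < \<infinity>" if "A \<subseteq> K" for A h
    by (intro emeasure_bounded_finite cyl_bounded bounded_subset[OF compact_imp_bounded[OF K] that])
      (rule bounded_subset[of "{0..h}"], auto)
  have nn: "ennreal \<kappa> * emeasure lborel (cyl v {0..<1} A) = (\<integral>\<^sup>+p. ennreal (indicator A p * m p) \<partial>surface_measure)"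
    if "A \<in> sets borel" "A \<subseteq> K" for A
  proof -
    have "ennreal \<kappa> * emeasure lborel (cyl v {0..<1} A) = (\<integral>\<^sup>+p. ennreal (v \<bullet> \<nu> p) * indicator A p \<partial>surface_measure)"
      by (rule flat_surface_area[OF n \<kappa> flat tr pos that])
    also have "\<dots> = (\<integral>\<^sup>+p. ennreal (indicator A p * m p) \<partial>surface_measure)"
      using that by (intro nn_integral_cong) (auto simp: m_def indicator_def)
    finally show ?thesis .
  qed
  have int: "integrable surface_measure (\<lambda>p. indicator A p * m p)" if [measurable]: "A \<in> sets borel" and "A \<subseteq> K" for A
  proof (rule integrableI_nonneg)
    show "(\<integral>\<^sup>+p. ennreal (indicator A p * m p) \<partial>surface_measure) < \<infinity>"
      unfolding nn[OF that, symmetric] using C_fin[OF that(2), of 1] by (simp add: ennreal_mult_eq_top_iff less_top[symmetric])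
  qed (use m0 in auto)
  have area: "\<kappa> * measure lborel (cyl v {0..<1} A) = (LINT p|surface_measure. indicator A p * m p)"
    if [measurable]: "A \<in> sets borel" and "A \<subseteq> K" for A
  proof -
    have "ennreal (LINT p|surface_measure. indicator A p * m p) = ennreal \<kappa> * emeasure lborel (cyl v {0..<1} A)"
      unfolding nn[OF that] using int[OF that] m0 by (intro nn_integral_eq_integral[symmetric]) auto
    also have "emeasure lborel (cyl v {0..<1} A) = ennreal (measure lborel (cyl v {0..<1} A))"
      using C_fin[OF that(2), of 1] by (intro emeasure_eq_ennreal_measure) auto
    finally have "ennreal (LINT p|surface_measure. indicator A p * m p) = ennreal (\<kappa> * measure lborel (cyl v {0..<1} A))"
      using \<kappa>0 by (simp add: ennreal_mult)
    then show ?thesis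
      using \<kappa>0 m0 by (subst (asm) ennreal_inj) auto
  qed
  have int_g: "integrable surface_measure (\<lambda>p. indicator A p * m p * u p)"
    if "A \<in> sets borel" "A \<subseteq> K" "u \<in> borel_measurable borel" "\<And>p. \<bar>u p\<bar> \<le> b" for A b and u :: "real ^ 'n \<Rightarrow> real"
  proof (rule Bochner_Integration.integrable_bound)
    show "integrable surface_measure (\<lambda>p. b * (indicator A p * m p))" using int[OF that(1,2)] by simp
    show "(\<lambda>p. indicator A p * m p * u p) \<in> borel_measurable surface_measure" using that(1,3) by measurable
    show "AE p in surface_measure. norm (indicator A p * m p * u p) \<le> norm (b * (indicator A p * m p))"
      using that(4) m0 by (auto simp: abs_mult mult.commute intro!: AE_I2 mult_right_mono order_trans[OF that(4)])
  qed
  show int_K: "integrable surface_measure (\<lambda>p. indicator K p * (g p * (v \<bullet> \<nu> p)))"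
  proof -
    have "integrable surface_measure (\<lambda>p. indicator K p * m p * g p)" using bd(2) by (intro int_g) auto
    moreover have "(\<lambda>p. indicator K p * m p * g p) = (\<lambda>p. indicator K p * (g p * (v \<bullet> \<nu> p)))"
      by (auto simp: m_def indicator_def fun_eq_iff)
    ultimately show ?thesis by simp
  qed
  define I where "I u N A = \<kappa> * (real N * (LINT y|lborel. indicator (cyl v {0..<1 / real N} A) y * u N y))"
    for u :: "nat \<Rightarrow> real ^ 'n \<Rightarrow> real" and N A
  define J where "J u A = (LINT p|surface_measure. indicator A p * m p * u p)" for u :: "real ^ 'n \<Rightarrow> real" and A
  have int_C: "integrable lborel (\<lambda>y. indicator (cyl v {0..<h} A) y * u y)"
    if "A \<in> sets borel" "A \<subseteq> K" "u \<in> borel_measurable borel" "\<And>y. \<bar>u y\<bar> \<le> b" for u :: "real ^ 'n \<Rightarrow> real" and A h b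
  proof (rule Bochner_Integration.integrable_bound)
    show "integrable lborel (\<lambda>y. b * indicator (cyl v {0..<h} A) y)"
      using C_meas[OF that(1,2)] C_fin[OF that(2)] by simp
    show "(\<lambda>y. indicator (cyl v {0..<h} A) y * u y) \<in> borel_measurable lborel"
      using C_meas[OF that(1,2), of h] that(3) by measurable
    show "AE y in lborel. norm (indicator (cyl v {0..<h} A) y * u y) \<le> norm (b * indicator (cyl v {0..<h} A) y)"
      using that(4) by (auto simp: indicator_def intro!: AE_I2 order_trans[OF that(4)])
  qed
  \<comment> \<open>Stated for arbitrary \<open>u\<close> and \<open>uN\<close>, so that applying it
    to the negatives as well yields the lower estimate.\<close>
  have upper: "\<exists>N0. \<forall>N\<ge>N0. I uN N K \<le> J (\<lambda>p. u p + 2 * \<epsilon>) K"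
    if u: "uniformly_continuous_on UNIV u" and uN: "uniform_limit UNIV uN u sequentially"
      and uN_meas: "\<And>N. uN N \<in> borel_measurable borel" and bd: "\<And>N y. \<bar>uN N y\<bar> \<le> B" "\<And>y. \<bar>u y\<bar> \<le> B"
      and \<epsilon>: "0 < \<epsilon>" for u uN \<epsilon>
  proof -
    have u_meas[measurable]: "u \<in> borel_measurable borel"
      using u by (intro borel_measurable_continuous_onI uniformly_continuous_imp_continuous)
    obtain \<delta> where \<delta>: "0 < \<delta>" "\<And>y y'. dist y y' < \<delta> \<Longrightarrow> \<bar>u y - u y'\<bar> < \<epsilon> / 3"
      using u \<epsilon> unfolding uniformly_continuous_on_def dist_real_def by (metis UNIV_I divide_pos_pos zero_less_numeral)
    obtain N1 where N1: "\<And>N y. N1 \<le> N \<Longrightarrow> \<bar>uN N y - u y\<bar> < \<epsilon> / 3"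
      using uN \<epsilon> unfolding uniform_limit_iff eventually_sequentially dist_real_def by (metis UNIV_I divide_pos_pos zero_less_numeral)
    obtain N2 :: nat where N2: "norm v / \<delta> < real N2" using reals_Archimedean2 by blast
    have "I uN N K \<le> J (\<lambda>p. u p + 2 * \<epsilon>) K" if N: "max 1 (max N1 N2) \<le> N" for N
    proof (rule local_to_global_le[OF K _ _ _ _ K_borel order_refl])
      have Npos: "0 < real N" and h0: "0 \<le> 1 / real N" using N by auto
      have step: "norm (t *\<^sub>R v) < \<delta>" if "t \<in> {0..<1 / real N}" for t
      proof -
        have "norm (t *\<^sub>R v) = t * norm v" using that by simp
        also have "\<dots> \<le> (1 / real N) * norm v" using that by (intro mult_right_mono) auto
        also have "\<dots> < \<delta>"
        proof -
          have "norm v / \<delta> < real N" using N2 N by linarith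
          then show ?thesis using \<delta>(1) Npos by (simp add: field_simps)
        qed
        finally show ?thesis .
      qed
      show "I uN N (A1 \<union> A2) = I uN N A1 + I uN N A2"
        if "A1 \<in> sets borel" "A2 \<in> sets borel" "A1 \<subseteq> K" "A2 \<subseteq> K" "A1 \<inter> A2 = {}" for A1 A2
      proof -
        have "cyl v {0..<1 / real N} A1 \<inter> cyl v {0..<1 / real N} A2 = {}"
          using that by (intro cyl_disjoint[OF tr]) auto
        then have "(\<lambda>y. indicator (cyl v {0..<1 / real N} (A1 \<union> A2)) y * uN N y)
          = (\<lambda>y. indicator (cyl v {0..<1 / real N} A1) y * uN N y + indicator (cyl v {0..<1 / real N} A2) y * uN N y)"
          unfolding cyl_Un_right by (auto simp: indicator_def fun_eq_iff)
        then show ?thesis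
          unfolding I_def using int_C[OF that(1,3) uN_meas bd(1)] int_C[OF that(2,4) uN_meas bd(1)]
          by (simp add: distrib_left)
      qed
      have bd2: "\<bar>u p + 2 * \<epsilon>\<bar> \<le> B + 2 * \<epsilon>" for p using bd(2)[of p] \<epsilon> by linarith
      show "J (\<lambda>p. u p + 2 * \<epsilon>) (A1 \<union> A2) = J (\<lambda>p. u p + 2 * \<epsilon>) A1 + J (\<lambda>p. u p + 2 * \<epsilon>) A2"
        if "A1 \<in> sets borel" "A2 \<in> sets borel" "A1 \<subseteq> K" "A2 \<subseteq> K" "A1 \<inter> A2 = {}" for A1 A2
      proof -
        have "(\<lambda>p. indicator (A1 \<union> A2) p * m p * (u p + 2 * \<epsilon>))
          = (\<lambda>p. indicator A1 p * m p * (u p + 2 * \<epsilon>) + indicator A2 p * m p * (u p + 2 * \<epsilon>))"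
          using that(5) by (auto simp: indicator_def fun_eq_iff)
        moreover have "integrable surface_measure (\<lambda>p. indicator A1 p * m p * (u p + 2 * \<epsilon>))"
          "integrable surface_measure (\<lambda>p. indicator A2 p * m p * (u p + 2 * \<epsilon>))"
          by (rule int_g[OF that(1,3) _ bd2] int_g[OF that(2,4) _ bd2], measurable)+
        ultimately show ?thesis unfolding J_def by simp
      qed
      show "\<exists>r>0. \<forall>A\<in>sets borel. A \<subseteq> K \<inter> ball p r \<longrightarrow> I uN N A \<le> J (\<lambda>p. u p + 2 * \<epsilon>) A" if p: "p \<in> K" for p
      proof (intro exI[of _ \<delta>] conjI ballI impI \<delta>)
        fix A :: "(real ^ 'n) set" assume A: "A \<in> sets borel" "A \<subseteq> K \<inter> ball p \<delta>"
        then have AK: "A \<subseteq> K" by auto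
        have uA: "\<bar>u q - u p\<bar> < \<epsilon> / 3" if "q \<in> A" for q
          using A(2) that by (intro \<delta>(2)) (auto simp: dist_commute)
        \<comment> \<open>The constant that separates the two sides on this piece: moving up the
          cylinder, replacing \<open>uN\<close> by \<open>u\<close> and moving along the base cost
          less than \<open>\<epsilon> / 3\<close> each, so \<open>uN \<le> c\<close> on the cylinder
          and \<open>c \<le> u + 2 * \<epsilon>\<close> on the base.\<close>
        define c where "c = u p + \<epsilon>"
        have "(LINT y|lborel. indicator (cyl v {0..<1 / real N} A) y * uN N y)
            \<le> (LINT y|lborel. c * indicator (cyl v {0..<1 / real N} A) y)"
        proof (rule integral_mono)
          show "integrable lborel (\<lambda>y. indicator (cyl v {0..<1 / real N} A) y * uN N y)"
            by (rule int_C[OF A(1) AK uN_meas bd(1)])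
          show "integrable lborel (\<lambda>y. c * indicator (cyl v {0..<1 / real N} A) y)"
            using C_meas[OF A(1) AK] C_fin[OF AK] by simp
          fix y
          show "indicator (cyl v {0..<1 / real N} A) y * uN N y \<le> c * indicator (cyl v {0..<1 / real N} A) y"
          proof (cases "y \<in> cyl v {0..<1 / real N} A")
            case True
            then obtain q t where y: "y = q + t *\<^sub>R v" "q \<in> A" "t \<in> {0..<1 / real N}" by (auto simp: cyl_def)
            have "\<bar>u y - u q\<bar> < \<epsilon> / 3" using step[OF y(3)] y(1) by (intro \<delta>(2)) (simp add: dist_norm)
            moreover have "\<bar>uN N y - u y\<bar> < \<epsilon> / 3" using N by (intro N1) auto
            ultimately have "uN N y \<le> c" using uA[OF y(2)] \<epsilon> unfolding c_def by linarith
            then show ?thesis using True by simp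
          qed simp
        qed
        also have "\<dots> = c * measure lborel (cyl v {0..<1 / real N} A)" by simp
        finally have 1: "I uN N A \<le> \<kappa> * (real N * (c * measure lborel (cyl v {0..<1 / real N} A)))"
          unfolding I_def using \<kappa>0 by (intro mult_left_mono) auto
        have "measure lborel (cyl v {0..<real N * (1 / real N)} A) = real N * measure lborel (cyl v {0..<1 / real N} A)"
          unfolding measure_def emeasure_cyl_multiple[OF K tr A(1) AK h0] by (simp add: enn2real_mult)
        then have "\<kappa> * (real N * (c * measure lborel (cyl v {0..<1 / real N} A))) = c * (\<kappa> * measure lborel (cyl v {0..<1} A))"
          using Npos by simp
        also have "\<dots> = (LINT p|surface_measure. c * (indicator A p * m p))"
          using area[OF A(1) AK] by simp
        also have "\<dots> \<le> J (\<lambda>p. u p + 2 * \<epsilon>) A"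
          unfolding J_def
        proof (rule integral_mono)
          show "integrable surface_measure (\<lambda>p. c * (indicator A p * m p))" using int[OF A(1) AK] by simp
          show "integrable surface_measure (\<lambda>p. indicator A p * m p * (u p + 2 * \<epsilon>))"
            by (rule int_g[OF A(1) AK _ bd2]) measurable
          fix q
          show "c * (indicator A q * m q) \<le> indicator A q * m q * (u q + 2 * \<epsilon>)"
          proof (cases "q \<in> A")
            case True
            have "c \<le> u q + 2 * \<epsilon>" using uA[OF True] \<epsilon> unfolding c_def by linarith
            then have "m q * c \<le> m q * (u q + 2 * \<epsilon>)" by (intro mult_left_mono m0)
            then show ?thesis using True by (simp add: mult.commute)
          qed simp
        qed
        finally show "I uN N A \<le> J (\<lambda>p. u p + 2 * \<epsilon>) A" using 1 by simp
      qed
    qed (auto simp: I_def J_def cyl_def)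
    then show ?thesis by blast
  qed
  define L where "L = J g K"
  define c where "c = (LINT p|surface_measure. indicator K p * m p)"
  have c0: "0 \<le> c" unfolding c_def using m0 by (intro integral_nonneg_AE) auto
  have J_shift: "J (\<lambda>p. u p + e) K = J u K + e * c" if "u \<in> borel_measurable borel" "\<And>p. \<bar>u p\<bar> \<le> B" for u e
  proof -
    have "J (\<lambda>p. u p + e) K = (LINT p|surface_measure. indicator K p * m p * u p + e * (indicator K p * m p))"
      unfolding J_def by (intro Bochner_Integration.integral_cong) (auto simp: algebra_simps)
    also have "\<dots> = J u K + e * c"
      unfolding J_def c_def using int_g[OF K_borel order_refl that] int[OF K_borel order_refl] by simp
    finally show ?thesis .
  qed
  have "(\<lambda>N. I gN N K) \<longlonglongrightarrow> L"
    unfolding LIMSEQ_iff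
  proof (intro allI impI)
    fix e :: real assume e: "0 < e"
    \<comment> \<open>Raising the integrand by \<open>2 * \<epsilon>\<close> changes
      \<open>J\<close> by \<open>2 * \<epsilon> * c\<close>, with \<open>c\<close> the integral of
      \<open>v \<bullet> \<nu>\<close> over \<open>K\<close>; this has to stay below
      \<open>e\<close>, also when \<open>c\<close> is zero.\<close>
    define \<epsilon> where "\<epsilon> = e / (4 * (c + 1))"
    have \<epsilon>: "0 < \<epsilon>" using e c0 by (simp add: \<epsilon>_def)
    have small: "2 * \<epsilon> * c < e" using e c0 by (simp add: \<epsilon>_def field_simps) (smt (verit) mult_nonneg_nonneg)
    from upper[OF g gN gN_meas bd \<epsilon>] obtain N1 where N1: "\<And>N. N1 \<le> N \<Longrightarrow> I gN N K \<le> J (\<lambda>p. g p + 2 * \<epsilon>) K" by blast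
    have g': "uniformly_continuous_on UNIV (\<lambda>y. - g y)" by (rule uniformly_continuous_on_minus[OF g])
    have gN': "uniform_limit UNIV (\<lambda>N y. - gN N y) (\<lambda>y. - g y) sequentially"
      by (rule uniform_limit_uminus[OF gN])
    have "\<exists>N0. \<forall>N\<ge>N0. I (\<lambda>N y. - gN N y) N K \<le> J (\<lambda>p. - g p + 2 * \<epsilon>) K"
      by (rule upper[OF g' gN' _ _ _ \<epsilon>]) (use gN_meas bd in auto)
    then obtain N2 where N2: "\<And>N. N2 \<le> N \<Longrightarrow> I (\<lambda>N y. - gN N y) N K \<le> J (\<lambda>p. - g p + 2 * \<epsilon>) K" by blast
    have Ineg: "I (\<lambda>N y. - gN N y) N K = - I gN N K" for N by (simp add: I_def)
    have Jneg: "J (\<lambda>p. - g p) K = - L" by (simp add: J_def L_def)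
    have up: "J (\<lambda>p. g p + 2 * \<epsilon>) K = L + 2 * \<epsilon> * c"
      using J_shift[OF g_meas bd(2)] by (simp add: L_def)
    have lo: "J (\<lambda>p. - g p + 2 * \<epsilon>) K = - L + 2 * \<epsilon> * c"
      using J_shift[of "\<lambda>p. - g p" "2 * \<epsilon>"] bd(2) by (simp add: Jneg)
    show "\<exists>no. \<forall>N\<ge>no. norm (I gN N K - L) < e"
      using N1 N2 small unfolding Ineg up lo
      by (intro exI[of _ "max N1 N2"]) (fastforce simp: abs_less_iff)
  qed
  moreover have "L = (LINT p|surface_measure. indicator K p * (g p * (v \<bullet> \<nu> p)))"
    unfolding L_def J_def m_def by (intro Bochner_Integration.integral_cong) (auto simp: indicator_def)
  ultimately show "(\<lambda>N. \<kappa> * (real N * (LINT y|lborel. indicator (cyl v {0..<1 / real N} K) y * gN N y)))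
       \<longlonglongrightarrow> (LINT p|surface_measure. indicator K p * (g p * (v \<bullet> \<nu> p)))"
    unfolding I_def by simp
qed

section \<open>Moving a cell across a smooth boundary\<close>

lemma uniformly_continuous_compact_support:
  fixes g :: "'a::euclidean_space \<Rightarrow> 'b::real_normed_vector"
  assumes g: "continuous_on UNIV g" and supp: "\<And>y. y \<notin> ball x r \<Longrightarrow> g y = 0"
  shows "uniformly_continuous_on UNIV g"
  unfolding uniformly_continuous_on_def
proof (intro allI impI)
  fix e :: real assume e: "0 < e"
  have "uniformly_continuous_on (cball x (r + 1)) g"
    by (intro compact_uniformly_continuous continuous_on_subset[OF g]) auto
  then obtain d where d: "0 < d" "\<And>y y'. y \<in> cball x (r + 1) \<Longrightarrow> y' \<in> cball x (r + 1) \<Longrightarrow> dist y' y < d \<Longrightarrow> dist (g y') (g y) < e"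
    using e unfolding uniformly_continuous_on_def by metis
  show "\<exists>d>0. \<forall>y\<in>UNIV. \<forall>y'\<in>UNIV. dist y' y < d \<longrightarrow> dist (g y') (g y) < e"
  proof (intro exI[of _ "min d 1"] conjI ballI impI)
    fix y y' :: 'a assume dist: "dist y' y < min d 1"
    show "dist (g y') (g y) < e"
    proof (cases "y \<in> cball x (r + 1) \<and> y' \<in> cball x (r + 1)")
      case True
      then show ?thesis using d(2) dist by auto
    next
      case False
      then have "y \<notin> ball x r" "y' \<notin> ball x r"
        using dist dist_triangle[of x y y'] dist_triangle[of x y' y] by (auto simp: dist_commute)
      then show ?thesis using supp e by simp
    qed
  qed (use d in auto)
qed

lemma compact_support_bounded:
  fixes g :: "'a::euclidean_space \<Rightarrow> real"
  assumes g: "continuous_on UNIV g" and supp: "\<And>y. y \<notin> ball x r \<Longrightarrow> g y = 0"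
  obtains B where "0 \<le> B" "\<And>y. \<bar>g y\<bar> \<le> B"
proof -
  have "compact (g ` cball x r)"
    by (intro compact_continuous_image continuous_on_subset[OF g]) auto
  then obtain B where "\<forall>y\<in>cball x r. \<bar>g y\<bar> \<le> B"
    by (auto dest!: compact_imp_bounded simp: bounded_iff)
  then have B: "\<bar>g y\<bar> \<le> B" if "y \<in> cball x r" for y using that by blast
  have "\<bar>g y\<bar> \<le> max B 0" for y
    using B[of y] supp[of y] by (cases "y \<in> ball x r") auto
  then show thesis using that[of "max B 0"] by auto
qed

lemma compact_support_integrable:
  fixes g :: "'a::euclidean_space \<Rightarrow> real"
  assumes g: "continuous_on UNIV g" and supp: "\<And>y. y \<notin> ball x r \<Longrightarrow> g y = 0"
    and f: "f \<in> borel_measurable borel" "\<And>y. \<bar>f y\<bar> \<le> C"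
  shows "integrable lborel (\<lambda>y. f y * g y)"
proof -
  obtain B where B: "0 \<le> B" "\<And>y. \<bar>g y\<bar> \<le> B" using compact_support_bounded[OF g supp] by blast
  have [measurable]: "g \<in> borel_measurable borel" using g by (rule borel_measurable_continuous_onI)
  show ?thesis
  proof (rule Bochner_Integration.integrable_bound)
    show "integrable lborel (\<lambda>y. (C * B) * indicator (ball x r) y)"
      using emeasure_lborel_ball_finite[of x r] by (intro integrable_mult_right integrable_real_indicator) simp_all
    show "(\<lambda>y. f y * g y) \<in> borel_measurable lborel" using f(1) by measurable
    have "\<bar>f y * g y\<bar> \<le> \<bar>C * B * indicator (ball x r) y\<bar>" for y
    proof (cases "y \<in> ball x r")
      case True
      have "\<bar>f y\<bar> * \<bar>g y\<bar> \<le> C * B"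
        using f(2)[of y] B by (intro mult_mono) auto
      then have "\<bar>f y * g y\<bar> \<le> \<bar>C * B\<bar>"
        unfolding abs_mult[of "f y"] by (rule order_trans[OF _ abs_ge_self])
      then show ?thesis using True by simp
    qed (use supp in auto)
    then show "AE y in lborel. norm (f y * g y) \<le> norm (C * B * indicator (ball x r) y)" by auto
  qed
qed

lemma lborel_integral_translate:
  fixes f :: "'a::euclidean_space \<Rightarrow> real" and z :: 'a
  assumes [measurable]: "f \<in> borel_measurable borel"
  shows "(LINT y|lborel. f (z + y)) = (LINT y|lborel. f y)" "integrable lborel (\<lambda>y. f (z + y)) \<longleftrightarrow> integrable lborel f"
proof -
  have "(LINT y|lborel. f y) = (LINT y|distr lborel borel ((+) z). f y)" by (simp add: lborel_distr_plus)
  also have "\<dots> = (LINT y|lborel. f (z + y))" by (rule integral_distr) auto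
  finally show "(LINT y|lborel. f (z + y)) = (LINT y|lborel. f y)" by simp
  have "integrable (distr lborel borel ((+) z)) f \<longleftrightarrow> integrable lborel (\<lambda>y. f (z + y))"
    by (rule integrable_distr_eq) auto
  then show "integrable lborel (\<lambda>y. f (z + y)) \<longleftrightarrow> integrable lborel f" by (simp add: lborel_distr_plus)
qed

text \<open>Near a boundary point, moving \<open>E\<close> by \<open>v / N\<close> changes it by the cylinder of height \<open>1 / N\<close> over
  the boundary. The test function may vary with \<open>N\<close> because a general \<open>v\<close> is treated as a difference
  of two directions transversal to the boundary.\<close>

definition slides ::
  "real \<Rightarrow> 'a::euclidean_space set \<Rightarrow> 'a set \<Rightarrow> ('a \<Rightarrow> 'a) \<Rightarrow> 'a \<Rightarrow> 'a \<Rightarrow> real \<Rightarrow> bool" where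
  "slides \<kappa> E M \<nu> v x r \<longleftrightarrow>
     (\<forall>gN g. (\<forall>N. continuous_on UNIV (gN N)) \<longrightarrow> continuous_on UNIV g \<longrightarrow>
     (\<forall>N y. y \<notin> ball x r \<longrightarrow> gN N y = 0) \<longrightarrow> uniform_limit UNIV gN g sequentially \<longrightarrow>
     integrable surface_measure (\<lambda>p. indicator M p * (g p * (v \<bullet> \<nu> p))) \<and>
     (\<lambda>N. \<kappa> * (real N * (LINT y|lborel. indicator E y * (gN N (y + v /\<^sub>R real N) - gN N y))))
       \<longlonglongrightarrow> (LINT p|surface_measure. indicator M p * (g p * (v \<bullet> \<nu> p))))"

text \<open>Near \<open>x\<close> the function \<open>w\<close> increases along \<open>v\<close>.
  Shifting the integral moves the increment from the test function to \<open>E\<close>, and the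
  difference of the indicators of the moved and the original set is exactly the indicator of a
  cylinder over the zero set.\<close>

lemma sliding_positive:
  fixes w :: "real ^ 'n \<Rightarrow> real"
  assumes n: "2 \<le> CARD('n)" and \<kappa>: "flat_density \<kappa> (surface_outer :: (real ^ 'n) set \<Rightarrow> ennreal)"
    and w: "level_chart w G U" and x: "x \<in> U" and v: "0 < v \<bullet> G x"
    and E: "E \<in> sets borel" "E \<inter> U = {y \<in> U. w y < 0}" and M: "M \<in> sets borel" "M \<inter> U = {y \<in> U. w y = 0}"
  defines "\<nu> \<equiv> (\<lambda>p. G p /\<^sub>R norm (G p))"
  shows "\<exists>r>0. slides \<kappa> E M \<nu> v x r"
proof -
  have U: "open U" and contG: "continuous_on U G" and G0: "\<And>y. y \<in> U \<Longrightarrow> G y \<noteq> 0"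
    and w_deriv: "\<And>y. y \<in> U \<Longrightarrow> (w has_derivative (\<lambda>h. G y \<bullet> h)) (at y)"
    using w by (auto simp: level_chart_def)
  have w_cont: "continuous_on U w"
    using w_deriv has_derivative_continuous continuous_at_imp_continuous_on by blast
  obtain r1 where r1: "0 < r1" "ball x r1 \<subseteq> U" using U x by (auto simp: open_contains_ball)
  have "continuous_on U (\<lambda>y. v \<bullet> G y)" by (intro continuous_intros contG)
  then have "\<exists>r2>0. \<forall>y\<in>U. dist y x < r2 \<longrightarrow> dist (v \<bullet> G y) (v \<bullet> G x) < v \<bullet> G x"
    using x v unfolding continuous_on_iff by blast
  then obtain r2 where r2: "0 < r2" "\<And>y. y \<in> U \<Longrightarrow> dist y x < r2 \<Longrightarrow> dist (v \<bullet> G y) (v \<bullet> G x) < v \<bullet> G x" by blast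
  \<comment> \<open>Test functions live in the ball of radius \<open>r\<close>, shifts are shorter
    than \<open>r\<close>, and the closed ball of radius \<open>2 * r\<close> still lies where
    \<open>w\<close> increases along \<open>v\<close>.\<close>
  define r where "r = min r1 r2 / 3"
  have r: "0 < r" "3 * r \<le> r1" "3 * r \<le> r2" using r1 r2 by (auto simp: r_def)
  define C where "C = cball x (2 * r)"
  have C: "convex C" "C \<subseteq> U" using r r1 by (auto simp: C_def)
  have vG: "0 < v \<bullet> G y" if "y \<in> C" for y
  proof -
    have "\<bar>v \<bullet> G y - v \<bullet> G x\<bar> < v \<bullet> G x" using r2(2)[of y] that C r by (auto simp: C_def dist_real_def dist_commute)
    then show ?thesis by linarith
  qed
  have mono: "w p < w (p + t *\<^sub>R v)" if pt: "p \<in> C" "p + t *\<^sub>R v \<in> C" "0 < t" for p t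
  proof -
    obtain \<xi> where "\<xi> \<in> C" "w (p + t *\<^sub>R v) - w p = G \<xi> \<bullet> ((p + t *\<^sub>R v) - p)"
      using level_chart_mvt[OF w C pt(2,1)] by blast
    then have "w (p + t *\<^sub>R v) - w p = t * (v \<bullet> G \<xi>)" by (simp add: inner_commute)
    moreover have "0 < t * (v \<bullet> G \<xi>)" using vG[OF \<open>\<xi> \<in> C\<close>] that(3) by simp
    ultimately show ?thesis by linarith
  qed
  define K where "K = {y \<in> C. w y = 0}"
  have K: "compact K" "K \<subseteq> U"
  proof -
    have "closed K" unfolding K_def
      by (rule continuous_closed_preimage_constant) (use w_cont C continuous_on_subset in \<open>auto simp: C_def\<close>)
    moreover have "bounded K" by (rule bounded_subset[of C]) (auto simp: K_def C_def)
    ultimately show "compact K" by (simp add: compact_eq_bounded_closed)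
    show "K \<subseteq> U" using C by (auto simp: K_def)
  qed
  have flat: "flat_surface \<nu> K"
    unfolding \<nu>_def by (rule level_chart_flat[OF w K]) (simp add: K_def)
  have tr: "transversal v K"
    unfolding transversal_def
  proof (intro ballI allI impI)
    fix p q t assume pq: "p \<in> K" "q \<in> K" "q = p + t *\<^sub>R v"
    then have "\<not> 0 < t" using mono[of p t] by (auto simp: K_def)
    moreover have "\<not> t < 0" using mono[of q "- t"] pq by (auto simp: K_def)
    ultimately show "t = 0" by simp
  qed
  have pos: "0 < v \<bullet> \<nu> p" if "p \<in> K" for p
    using vG[of p] G0[of p] that K(2) by (auto simp: \<nu>_def K_def)
  have main: "integrable surface_measure (\<lambda>p. indicator M p * (g p * (v \<bullet> \<nu> p))) \<and>
     (\<lambda>N. \<kappa> * (real N * (LINT y|lborel. indicator E y * (gN N (y + v /\<^sub>R real N) - gN N y))))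
       \<longlonglongrightarrow> (LINT p|surface_measure. indicator M p * (g p * (v \<bullet> \<nu> p)))"
    if gN: "\<And>N. continuous_on UNIV (gN N)" and g: "continuous_on UNIV g"
      and supp: "\<And>N y. y \<notin> ball x r \<Longrightarrow> gN N y = 0" and lim: "uniform_limit UNIV gN g sequentially" for gN g
  proof -
    have supp_g: "g y = 0" if "y \<notin> ball x r" for y
    proof -
      have "(\<lambda>N. gN N y) \<longlonglongrightarrow> g y" using tendsto_uniform_limitI[OF lim] by simp
      then show ?thesis using supp[OF that] LIMSEQ_unique by (simp add: LIMSEQ_const_iff)
    qed
    obtain B where B: "0 \<le> B" "\<And>y. \<bar>g y\<bar> \<le> B" using compact_support_bounded[OF g supp_g] by blast
    obtain N1 where N1: "\<And>N y. N1 \<le> N \<Longrightarrow> \<bar>gN N y - g y\<bar> < 1"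
      using lim unfolding uniform_limit_iff eventually_sequentially dist_real_def by (metis UNIV_I zero_less_one)
    obtain N2 :: nat where N2: "norm v / r < real N2" using reals_Archimedean2 by blast
    \<comment> \<open>Uniform convergence bounds \<open>gN\<close> only from some index on; the
      earlier functions are replaced by zero to have one bound for all \<open>N\<close>.\<close>
    define gM where "gM N y = (if N1 \<le> N then gN N y else 0)" for N y
    have gM_lim: "uniform_limit UNIV gM g sequentially"
      unfolding uniform_limit_iff
    proof (intro allI impI)
      fix e :: real assume "0 < e"
      with lim have "\<forall>\<^sub>F N in sequentially. \<forall>y\<in>UNIV. dist (gN N y) (g y) < e"
        unfolding uniform_limit_iff by blast
      then show "\<forall>\<^sub>F N in sequentially. \<forall>y\<in>UNIV. dist (gM N y) (g y) < e"
        using eventually_ge_at_top[of N1] by eventually_elim (simp add: gM_def)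
    qed
    have gM_bd: "\<bar>gM N y\<bar> \<le> B + 1" for N y
      using N1[of N y] B(1) B(2)[of y] by (auto simp: gM_def)
    have gM_meas: "gM N \<in> borel_measurable borel" for N
      using borel_measurable_continuous_onI[OF gN[of N]] by (cases "N1 \<le> N") (simp_all add: gM_def[abs_def])
    have g_bd: "\<bar>g y\<bar> \<le> B + 1" for y using B(2)[of y] by simp
    note lim_cyl = cyl_integral_limit[OF n \<kappa> flat tr pos uniformly_continuous_compact_support[OF g supp_g] gM_lim gM_meas gM_bd g_bd]
    have eqK: "(\<lambda>p. indicator K p * (g p * (v \<bullet> \<nu> p))) = (\<lambda>p. indicator M p * (g p * (v \<bullet> \<nu> p)) :: real)"
    proof
      fix p
      show "indicator K p * (g p * (v \<bullet> \<nu> p)) = (indicator M p * (g p * (v \<bullet> \<nu> p)) :: real)"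
      proof (cases "p \<in> ball x r")
        case True
        then have "p \<in> C" "p \<in> U" using r C by (auto simp: C_def)
        then have "p \<in> K \<longleftrightarrow> p \<in> M" using M(2) by (auto simp: K_def)
        then show ?thesis by (simp add: indicator_def)
      qed (simp add: supp_g)
    qed
    have E_meas[measurable]: "E \<in> sets borel" by (rule E(1))
    have key: "(LINT y|lborel. indicator E y * (gN N (y + v /\<^sub>R real N) - gN N y))
        = (LINT y|lborel. indicator (cyl v {0..<1 / real N} K) y * gM N y)"
      if N: "N1 \<le> N" "N2 \<le> N" "1 \<le> N" for N
    proof -
      define h where "h = 1 / real N"
      have h: "0 < h" using N by (simp add: h_def)
      have hv: "h * norm v < r"
      proof -
        have "norm v / r < real N" using N2 N(2) by linarith
        then show ?thesis using r(1) N(3) by (simp add: h_def field_simps)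
      qed
      have [measurable]: "gN N \<in> borel_measurable borel" by (rule borel_measurable_continuous_onI[OF gN])
      have int1: "integrable lborel (\<lambda>y. indicator E y * gN N y)"
        by (rule compact_support_integrable[OF gN supp, where C = 1]) (auto simp: indicator_def)
      have int2: "integrable lborel (\<lambda>y. indicator E (- (h *\<^sub>R v) + y) * gN N y)"
        by (rule compact_support_integrable[OF gN supp, where C = 1]) (auto simp: indicator_def)
      have tr2: "integrable lborel (\<lambda>y. indicator E y * gN N (y + h *\<^sub>R v))"
        "(LINT y|lborel. indicator E y * gN N (y + h *\<^sub>R v)) = (LINT y|lborel. indicator E (- (h *\<^sub>R v) + y) * gN N y)"
        using lborel_integral_translate[of "\<lambda>y. indicator E (- (h *\<^sub>R v) + y) * gN N y" "h *\<^sub>R v"] int2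
        by (simp_all add: add.commute)
      have "(LINT y|lborel. indicator E y * (gN N (y + h *\<^sub>R v) - gN N y))
          = (LINT y|lborel. indicator E y * gN N (y + h *\<^sub>R v)) - (LINT y|lborel. indicator E y * gN N y)"
        using int1 tr2(1) by (simp add: right_diff_distrib)
      also have "\<dots> = (LINT y|lborel. indicator E (- (h *\<^sub>R v) + y) * gN N y - indicator E y * gN N y)"
        unfolding tr2(2) using int1 int2 by simp
      also have "\<dots> = (LINT y|lborel. indicator (cyl v {0..<h} K) y * gM N y)"
      proof (rule Bochner_Integration.integral_cong[OF refl])
        fix y
        show "indicator E (- (h *\<^sub>R v) + y) * gN N y - indicator E y * gN N y = indicator (cyl v {0..<h} K) y * gM N y"
        proof (cases "y \<in> ball x r")
          case False
          then show ?thesis using supp by (simp add: gM_def)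
        next
          case True
          have inC: "y - t *\<^sub>R v \<in> C" if "0 \<le> t" "t \<le> h" for t
          proof -
            have "norm (t *\<^sub>R v) \<le> h * norm v" using that by (auto intro: mult_right_mono)
            then have "norm (t *\<^sub>R v) < r" using hv by linarith
            moreover have "dist x (y - t *\<^sub>R v) \<le> dist x y + norm (t *\<^sub>R v)"
              using dist_triangle[of x "y - t *\<^sub>R v" y] by (simp add: dist_norm)
            ultimately show ?thesis using True by (simp add: C_def)
          qed
          have yC: "y \<in> C" using inC[of 0] h by simp
          have yhC: "y - h *\<^sub>R v \<in> C" using inC[of h] h by simp
          have Ew: "z \<in> E \<longleftrightarrow> w z < 0" if "z \<in> C" for z using that C(2) E(2) by blast
          have less: "w (y - h *\<^sub>R v) < w y" using mono[of "y - h *\<^sub>R v" h] yC yhC h by simp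
          \<comment> \<open>The base is where the line through \<open>y\<close> crosses zero, which
            exists by the intermediate value theorem. Since \<open>E\<close> is the strict sublevel
            set, points with \<open>w y = 0\<close> are newly covered; this is why the heights form
            the half-open interval containing 0.\<close>
          have cyl_iff: "y \<in> cyl v {0..<h} K \<longleftrightarrow> 0 \<le> w y \<and> w (y - h *\<^sub>R v) < 0"
          proof
            assume "y \<in> cyl v {0..<h} K"
            then obtain p t where pt: "y = p + t *\<^sub>R v" "p \<in> K" "0 \<le> t" "t < h" by (auto simp: cyl_def)
            have p: "p \<in> C" "w p = 0" using pt(2) by (auto simp: K_def)
            have "0 \<le> w y"
              using mono[of p t] p yC pt by (cases "t = 0") auto
            moreover have "w (y - h *\<^sub>R v) < w (y - h *\<^sub>R v + (h - t) *\<^sub>R v)"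
              using pt yhC p by (intro mono) (auto simp: algebra_simps)
            then have "w (y - h *\<^sub>R v) < 0" using pt p by (simp add: algebra_simps)
            ultimately show "0 \<le> w y \<and> w (y - h *\<^sub>R v) < 0" by simp
          next
            assume *: "0 \<le> w y \<and> w (y - h *\<^sub>R v) < 0"
            have "continuous_on {0..h} (\<lambda>t. w (y - t *\<^sub>R v))"
              by (rule continuous_on_compose2[OF w_cont]) (use inC C in \<open>auto intro!: continuous_intros\<close>)
            then obtain t where t: "0 \<le> t" "t \<le> h" "w (y - t *\<^sub>R v) = 0"
              using IVT2'[of "\<lambda>t. w (y - t *\<^sub>R v)" h 0 0] * h by auto
            then have "t \<noteq> h" using * by auto
            then show "y \<in> cyl v {0..<h} K"
              unfolding cyl_def using t inC[of t]
              by (intro image_eqI[of _ _ "(y - t *\<^sub>R v, t)"]) (auto simp: K_def)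
          qed
          have eq: "- (h *\<^sub>R v) + y = y - h *\<^sub>R v" by simp
          show ?thesis
            unfolding eq using cyl_iff Ew[OF yC] Ew[OF yhC] less N(1) by (auto simp: indicator_def gM_def)
        qed
      qed
      finally show ?thesis by (simp add: h_def divide_inverse)
    qed
    have "\<forall>\<^sub>F N in sequentially. \<kappa> * (real N * (LINT y|lborel. indicator (cyl v {0..<1 / real N} K) y * gM N y))
        = \<kappa> * (real N * (LINT y|lborel. indicator E y * (gN N (y + v /\<^sub>R real N) - gN N y)))"
      using eventually_ge_at_top[of "max 1 (max N1 N2)"] by eventually_elim (simp add: key)
    from Lim_transform_eventually[OF lim_cyl(2) this] lim_cyl(1)
    show ?thesis unfolding eqK by blast
  qed
  show ?thesis unfolding slides_def using r(1) main by (intro exI[of _ r] conjI allI impI; blast)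
qed

text \<open>An arbitrary \<open>v\<close> is the difference of two vectors that cross the boundary
  outwards at \<open>x\<close>, and the limit is linear in the direction.\<close>

lemma sliding:
  fixes w :: "real ^ 'n \<Rightarrow> real"
  assumes n: "2 \<le> CARD('n)" and \<kappa>: "flat_density \<kappa> (surface_outer :: (real ^ 'n) set \<Rightarrow> ennreal)"
    and w: "level_chart w G U" and x: "x \<in> U"
    and E: "E \<in> sets borel" "E \<inter> U = {y \<in> U. w y < 0}" and M: "M \<in> sets borel" "M \<inter> U = {y \<in> U. w y = 0}"
  defines "\<nu> \<equiv> (\<lambda>p. G p /\<^sub>R norm (G p))"
  shows "\<exists>r>0. \<forall>g. continuous_on UNIV g \<longrightarrow> (\<forall>y. y \<notin> ball x r \<longrightarrow> g y = 0) \<longrightarrow>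
     (\<lambda>N. \<kappa> * (real N * (LINT y|lborel. indicator E y * (g (y + v /\<^sub>R real N) - g y))))
       \<longlonglongrightarrow> (LINT p|surface_measure. indicator M p * (g p * (v \<bullet> \<nu> p)))"
proof -
  have Gx: "0 < G x \<bullet> G x" using w x by (auto simp: level_chart_def)
  \<comment> \<open>Makes \<open>c * (G x \<bullet> G x)\<close> equal to
    \<open>\<bar>v \<bullet> G x\<bar> + 1\<close>, so both \<open>v1\<close> and \<open>v2\<close>
    have positive product with \<open>G x\<close>.\<close>
  define c where "c = (\<bar>v \<bullet> G x\<bar> + 1) / (G x \<bullet> G x)"
  define v1 where "v1 = v + c *\<^sub>R G x"
  define v2 where "v2 = c *\<^sub>R G x"
  have v12: "v = v1 - v2" by (simp add: v1_def v2_def)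
  have cG: "c * (G x \<bullet> G x) = \<bar>v \<bullet> G x\<bar> + 1" using Gx by (simp add: c_def)
  have "0 < v1 \<bullet> G x" "0 < v2 \<bullet> G x"
    using cG by (auto simp: v1_def v2_def inner_add_left)
  note s1 = sliding_positive[OF n \<kappa> w x this(1) E M, folded \<nu>_def]
   and s2 = sliding_positive[OF n \<kappa> w x this(2) E M, folded \<nu>_def]
  define D where "D u gN N = \<kappa> * (real N * (LINT y|lborel. indicator E y * (gN N (y + u /\<^sub>R real N) - gN N y)))"
    for u and gN :: "nat \<Rightarrow> real ^ 'n \<Rightarrow> real" and N
  from s1 s2 obtain r1 r2 where r1: "0 < r1" "slides \<kappa> E M \<nu> v1 x r1" and r2: "0 < r2" "slides \<kappa> E M \<nu> v2 x r2"
    by blast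
  define r where "r = min r1 r2 / 2"
  have r: "0 < r" "2 * r \<le> r1" "2 * r \<le> r2" using r1 r2 by (auto simp: r_def)
  have "(\<lambda>N. \<kappa> * (real N * (LINT y|lborel. indicator E y * (g (y + v /\<^sub>R real N) - g y))))
       \<longlonglongrightarrow> (LINT p|surface_measure. indicator M p * (g p * (v \<bullet> \<nu> p)))"
    if g: "continuous_on UNIV g" and supp: "\<And>y. y \<notin> ball x r \<Longrightarrow> g y = 0" for g
  proof -
    have uc: "uniformly_continuous_on UNIV g" by (rule uniformly_continuous_compact_support[OF g supp])
    obtain N2 :: nat where N2: "norm v2 / r < real N2" using reals_Archimedean2 by blast
    define N0 where "N0 = max 1 N2"
    \<comment> \<open>Pre-shifted by \<open>- v2 / N\<close>: then the \<open>v1\<close>-step lands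
      at \<open>y + v / N\<close>, the \<open>v2\<close>-step at \<open>y\<close>, and subtracting
      the two difference quotients leaves that of \<open>g\<close> along \<open>v\<close>.\<close>
    define gN where "gN N y = (if N0 \<le> N then g (y - v2 /\<^sub>R real N) else 0)" for N y
    have small: "norm (v2 /\<^sub>R real N) < r" if "N0 \<le> N" for N
    proof -
      have "norm v2 / r < real N" "0 < real N" using N2 that by (auto simp: N0_def)
      then show ?thesis using r(1) by (simp add: field_simps)
    qed
    have supp': "gN N y = 0" if "y \<notin> ball x (2 * r)" for N y
    proof (cases "N0 \<le> N")
      case True
      have "dist x y \<le> dist x (y - v2 /\<^sub>R real N) + norm (v2 /\<^sub>R real N)"
        using dist_triangle[of x y "y - v2 /\<^sub>R real N"] by (simp add: dist_norm)
      then have "y - v2 /\<^sub>R real N \<notin> ball x r" using small[OF True] that by auto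
      then show ?thesis using supp by (simp add: gN_def)
    qed (simp add: gN_def)
    have cont: "continuous_on UNIV (gN N)" for N
      unfolding gN_def by (cases "N0 \<le> N") (auto intro!: continuous_intros continuous_on_compose2[OF g])
    have lim: "uniform_limit UNIV gN g sequentially"
      unfolding uniform_limit_iff
    proof (intro allI impI)
      fix e :: real assume "0 < e"
      then obtain d where d: "0 < d" "\<And>y y'. dist y' y < d \<Longrightarrow> dist (g y') (g y) < e"
        using uc unfolding uniformly_continuous_on_def by (metis UNIV_I)
      obtain N3 :: nat where N3: "norm v2 / d < real N3" using reals_Archimedean2 by blast
      show "\<forall>\<^sub>F N in sequentially. \<forall>y\<in>UNIV. dist (gN N y) (g y) < e"
        using eventually_ge_at_top[of "max N0 N3"]
      proof eventually_elim
        case (elim N)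
        have "norm v2 / d < real N" "0 < real N" using N3 elim by (auto simp: N0_def)
        then have "norm (v2 /\<^sub>R real N) < d" using d(1) by (simp add: field_simps)
        then show ?case using elim d(2) by (auto simp: gN_def dist_norm)
      qed
    qed
    have L1: "integrable surface_measure (\<lambda>p. indicator M p * (g p * (v1 \<bullet> \<nu> p)))"
        "D v1 gN \<longlonglongrightarrow> (LINT p|surface_measure. indicator M p * (g p * (v1 \<bullet> \<nu> p)))"
      using r1(2)[unfolded slides_def, rule_format, of gN g] cont g lim supp' r unfolding D_def[abs_def] by auto
    have L2: "integrable surface_measure (\<lambda>p. indicator M p * (g p * (v2 \<bullet> \<nu> p)))"
        "D v2 gN \<longlonglongrightarrow> (LINT p|surface_measure. indicator M p * (g p * (v2 \<bullet> \<nu> p)))"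
      using r2(2)[unfolded slides_def, rule_format, of gN g] cont g lim supp' r unfolding D_def[abs_def] by auto
    have [measurable]: "E \<in> sets borel" by (rule E(1))
    have eq: "D v1 gN N - D v2 gN N = D v (\<lambda>_. g) N" if N: "N0 \<le> N" for N
    proof -
      have meas: "g \<in> borel_measurable borel" by (rule borel_measurable_continuous_onI[OF g])
      have int: "integrable lborel (\<lambda>y. indicator E y * g (y + z))" for z
      proof -
        have "integrable lborel (\<lambda>y. indicator E (- z + y) * g y)"
          by (rule compact_support_integrable[OF g supp, where C = 1]) (auto simp: indicator_def)
        then show ?thesis
          using lborel_integral_translate(2)[of "\<lambda>y. indicator E (- z + y) * g y" z] meas by (simp add: add.commute)
      qed
      have "(LINT y|lborel. indicator E y * (gN N (y + v1 /\<^sub>R real N) - gN N y))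
          - (LINT y|lborel. indicator E y * (gN N (y + v2 /\<^sub>R real N) - gN N y))
        = (LINT y|lborel. indicator E y * (g (y + v /\<^sub>R real N) - g y))"
        using N int[of "v /\<^sub>R real N"] int[of "- (v2 /\<^sub>R real N)"] int[of 0]
        by (simp add: gN_def v12 right_diff_distrib scaleR_diff_right algebra_simps)
      moreover have "\<kappa> * (real N * a) - \<kappa> * (real N * b) = \<kappa> * (real N * (a - b))" for a b
        by (simp add: right_diff_distrib)
      ultimately show ?thesis by (simp only: D_def)
    qed
    have "(\<lambda>N. D v1 gN N - D v2 gN N) \<longlonglongrightarrow>
      (LINT p|surface_measure. indicator M p * (g p * (v1 \<bullet> \<nu> p))) - (LINT p|surface_measure. indicator M p * (g p * (v2 \<bullet> \<nu> p)))"
      by (rule tendsto_diff[OF L1(2) L2(2)])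
    also have "(LINT p|surface_measure. indicator M p * (g p * (v1 \<bullet> \<nu> p))) - (LINT p|surface_measure. indicator M p * (g p * (v2 \<bullet> \<nu> p)))
        = (LINT p|surface_measure. indicator M p * (g p * (v \<bullet> \<nu> p)))"
      unfolding Bochner_Integration.integral_diff[OF L1(1) L2(1), symmetric]
      by (intro Bochner_Integration.integral_cong) (auto simp: v12 inner_diff_left algebra_simps)
    finally have "D v (\<lambda>_. g) \<longlonglongrightarrow> (LINT p|surface_measure. indicator M p * (g p * (v \<bullet> \<nu> p)))"
      by (rule Lim_transform_eventually) (rule eventually_mono[OF eventually_ge_at_top[of N0] eq])
    then show ?thesis unfolding D_def[abs_def] .
  qed
  then show ?thesis using r(1) by (intro exI[of _ r]) blast
qed

section \<open>The measure-theoretic normal\<close>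

lemma DERIV_max0_square: "((\<lambda>s::real. (max 0 s)\<^sup>2) has_real_derivative 2 * max 0 s) (at s)"
proof (cases "s = 0")
  case True
  have "((\<lambda>h. (max 0 (0 + h))\<^sup>2 / h) \<longlongrightarrow> 0) (at (0 :: real))"
  proof (rule Lim_null_comparison)
    show "\<forall>\<^sub>F h in at (0 :: real). norm ((max 0 (0 + h))\<^sup>2 / h) \<le> \<bar>h\<bar>"
      by (rule always_eventually) (auto simp: max_def power2_eq_square)
    show "((\<lambda>h::real. \<bar>h\<bar>) \<longlongrightarrow> 0) (at 0)" by (rule tendsto_rabs_zero) (rule tendsto_ident_at)
  qed
  then show ?thesis using True by (simp add: DERIV_def)
next
  case False
  show ?thesis
  proof (cases "0 < s")
    case True
    have "((\<lambda>s. s\<^sup>2) has_real_derivative 2 * max 0 s) (at s)" using True by (auto intro!: derivative_eq_intros)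
    then show ?thesis
      by (rule has_field_derivative_transform_within_open[where S = "{0<..}"]) (use True in auto)
  next
    case neg: False
    have "((\<lambda>s. 0) has_real_derivative 2 * max 0 s) (at s)" using neg by simp
    then show ?thesis
      by (rule has_field_derivative_transform_within_open[where S = "{..<0}"]) (use neg False in auto)
  qed
qed

text \<open>With s the squared positive part of r^2 - |y - x|^2 this is ks / (1 + ks): a
  continuously differentiable function between 0 and 1, supported in the closed ball, which tends to
  the indicator of the open ball as \<open>k\<close> grows.\<close>

definition plateau :: "'a::euclidean_space \<Rightarrow> real \<Rightarrow> real \<Rightarrow> 'a \<Rightarrow> real" where
  "plateau x r k y = k * (max 0 (r\<^sup>2 - (y - x) \<bullet> (y - x)))\<^sup>2 / (1 + k * (max 0 (r\<^sup>2 - (y - x) \<bullet> (y - x)))\<^sup>2)"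

text \<open>Only the radial factor: the differential in direction \<open>d\<close> is this number
  times \<open>(y - x) \<bullet> d\<close>.\<close>

definition plateau_deriv :: "'a::euclidean_space \<Rightarrow> real \<Rightarrow> real \<Rightarrow> 'a \<Rightarrow> real" where
  "plateau_deriv x r k y = - 4 * k * max 0 (r\<^sup>2 - (y - x) \<bullet> (y - x)) / (1 + k * (max 0 (r\<^sup>2 - (y - x) \<bullet> (y - x)))\<^sup>2)\<^sup>2"

lemma plateau_bounds: "0 \<le> k \<Longrightarrow> 0 \<le> plateau x r k y" "0 \<le> k \<Longrightarrow> plateau x r k y \<le> 1"
proof -
  assume k: "0 \<le> k"
  define s where "s = k * (max 0 (r\<^sup>2 - (y - x) \<bullet> (y - x)))\<^sup>2"
  have "0 \<le> s" using k by (simp add: s_def)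
  then show "0 \<le> plateau x r k y" "plateau x r k y \<le> 1"
    unfolding plateau_def s_def[symmetric] by simp_all
qed

lemma inner_self_ball: "0 \<le> r \<Longrightarrow> r\<^sup>2 - (y - x) \<bullet> (y - x) \<le> 0 \<longleftrightarrow> y \<notin> ball x r"
  by (simp add: dot_square_norm dist_norm norm_minus_commute[of y x] abs_le_square_iff[symmetric] not_less)

lemma plateau_outside: "0 \<le> r \<Longrightarrow> y \<notin> ball x r \<Longrightarrow> plateau x r k y = 0"
  using inner_self_ball[of r y x] by (simp add: plateau_def max_def)

lemma plateau_deriv_outside: "0 \<le> r \<Longrightarrow> y \<notin> ball x r \<Longrightarrow> plateau_deriv x r k y = 0"
  using inner_self_ball[of r y x] by (simp add: plateau_deriv_def max_def)

lemma plateau_has_derivative: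
  assumes k: "0 \<le> k"
  shows "(plateau x r k has_derivative (\<lambda>d. plateau_deriv x r k y * ((y - x) \<bullet> d))) (at y)"
proof -
  define q where "q y = r\<^sup>2 - (y - x) \<bullet> (y - x)" for y
  have q: "(q has_derivative (\<lambda>d. - 2 * ((y - x) \<bullet> d))) (at y)"
    unfolding q_def by (auto intro!: derivative_eq_intros simp: inner_commute)
  have pos: "1 + k * (max 0 t)\<^sup>2 \<noteq> 0" for t
    using mult_nonneg_nonneg[OF k zero_le_power2[of "max 0 t"]] by linarith
  have "((\<lambda>t. k * (max 0 t)\<^sup>2 / (1 + k * (max 0 t)\<^sup>2)) has_real_derivative
      (k * (2 * max 0 t) * (1 + k * (max 0 t)\<^sup>2) - k * (max 0 t)\<^sup>2 * (0 + k * (2 * max 0 t))) / ((1 + k * (max 0 t)\<^sup>2) * (1 + k * (max 0 t)\<^sup>2))) (at t)" for t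
    by (intro DERIV_divide DERIV_add DERIV_const DERIV_cmult DERIV_max0_square pos)
  then have "((\<lambda>t. k * (max 0 t)\<^sup>2 / (1 + k * (max 0 t)\<^sup>2)) has_real_derivative
      2 * k * max 0 t / (1 + k * (max 0 t)\<^sup>2)\<^sup>2) (at t)" for t
    by (rule DERIV_cong) (simp add: power2_eq_square algebra_simps)
  from has_derivative_compose[OF q this[of "q y", unfolded has_field_derivative_def]]
  show ?thesis
    unfolding plateau_def q_def plateau_deriv_def by (simp add: mult_ac)
qed

lemma plateau_deriv_continuous: "0 \<le> k \<Longrightarrow> continuous_on UNIV (plateau_deriv x r k)"
proof -
  assume k: "0 \<le> k"
  have pos: "1 + k * (max 0 t)\<^sup>2 \<noteq> 0" for t
    using mult_nonneg_nonneg[OF k zero_le_power2[of "max 0 t"]] by linarith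
  show ?thesis unfolding plateau_deriv_def by (intro continuous_intros) (use pos in auto)
qed

lemma plateau_continuous: "0 \<le> k \<Longrightarrow> continuous_on UNIV (plateau x r k)"
  by (intro continuous_at_imp_continuous_on ballI has_derivative_continuous[OF plateau_has_derivative])

lemma plateau_limit:
  assumes r: "0 \<le> r"
  shows "(\<lambda>k. plateau x r (real k) y) \<longlonglongrightarrow> indicator (ball x r) y"
proof (cases "y \<in> ball x r")
  case True
  define s where "s = (max 0 (r\<^sup>2 - (y - x) \<bullet> (y - x)))\<^sup>2"
  have "0 < r\<^sup>2 - (y - x) \<bullet> (y - x)" using inner_self_ball[OF r, of y x] True by linarith
  then have s: "0 < s" by (simp add: s_def)
  have "(\<lambda>k. 1 - inverse (1 + real k * s)) \<longlonglongrightarrow> 1 - 0"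
  proof (intro tendsto_diff tendsto_const tendsto_inverse_0_at_top)
    have "filterlim (\<lambda>k. real k * s) at_top sequentially"
      by (rule filterlim_at_top_mult_tendsto_pos[OF tendsto_const s filterlim_real_sequentially])
    then show "filterlim (\<lambda>k. 1 + real k * s) at_top sequentially"
      by (rule filterlim_tendsto_add_at_top[OF tendsto_const])
  qed
  moreover have "1 - inverse (1 + real k * s) = plateau x r (real k) y" for k
  proof -
    have "0 < 1 + real k * s" using s by (simp add: add_pos_nonneg)
    then show ?thesis unfolding plateau_def s_def[symmetric] by (simp add: field_simps)
  qed
  ultimately show ?thesis using True by simp
qed (simp add: plateau_outside[OF r])

lemma Ck_on_1I:
  assumes "\<And>y. (X has_derivative D y) (at y)" "\<And>v. continuous_on UNIV (\<lambda>y. D y v)"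
  shows "Ck_on 1 X UNIV"
proof -
  have "frechet_derivative X (at y) = D y" for y
    using frechet_derivative_at[OF assms(1)[of y]] by simp
  then show ?thesis using assms unfolding One_nat_def by (auto simp: differentiable_def)
qed

lemma plateau_field:
  fixes u x :: "'a::euclidean_space"
  assumes k: "0 \<le> k" and r: "0 \<le> r"
  defines "X \<equiv> (\<lambda>y. plateau x r k y *\<^sub>R u)"
  shows "Ck_on 1 X UNIV" "compact (supp X)" "divergence X y = plateau_deriv x r k y * ((y - x) \<bullet> u)"
proof -
  have D: "(X has_derivative (\<lambda>d. (plateau_deriv x r k y * ((y - x) \<bullet> d)) *\<^sub>R u)) (at y)" for y
    unfolding X_def by (intro has_derivative_scaleR_left plateau_has_derivative k)
  show "Ck_on 1 X UNIV"
    by (rule Ck_on_1I[OF D]) (intro continuous_intros plateau_deriv_continuous k)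
  have "supp X \<subseteq> cball x r"
    unfolding supp_def X_def using plateau_outside[OF r, of _ x k] by (intro closure_minimal) force+
  then show "compact (supp X)"
    unfolding supp_def by (metis bounded_cball bounded_subset closed_closure compact_eq_bounded_closed)
  have fd: "frechet_derivative X (at y) = (\<lambda>d. (plateau_deriv x r k y * ((y - x) \<bullet> d)) *\<^sub>R u)"
    using frechet_derivative_at[OF D] by simp
  have "(\<Sum>b\<in>Basis. ((y - x) \<bullet> b) * (u \<bullet> b)) = (y - x) \<bullet> u"
    by (rule euclidean_inner[symmetric])
  then show "divergence X y = plateau_deriv x r k y * ((y - x) \<bullet> u)"
    unfolding divergence_def fd by (simp add: mult.assoc sum_distrib_left[symmetric])
qed

text \<open>If \<open>E\<close> is (locally, almost everywhere) stable under small translations by \<open>- u\<close>, then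
  \<open>\<integral>\<^sub>E \<partial>\<^sub>u \<phi> \<ge> 0\<close> for bumps \<open>\<phi> \<ge> 0\<close>; averaging bounds the angle between \<open>u\<close> and the normal.\<close>

lemma outer_normal_monotone_direction:
  fixes E :: "'a::euclidean_space set"
  assumes v: "has_outer_normal E x v" and E: "E \<in> sets borel" and r0: "0 < r0" and h0: "0 < h0"
    and slide: "\<And>h. 0 < h \<Longrightarrow> h < h0 \<Longrightarrow> AE y in lborel. y \<in> ball x r0 \<longrightarrow> y \<in> E \<longrightarrow> y - h *\<^sub>R u \<in> E"
  shows "0 \<le> u \<bullet> v"
proof -
  obtain m \<nu> where gg: "gauss_green E m \<nu>"
    and lim: "((\<lambda>r. (LINT y:ball x r|m. \<nu> y) /\<^sub>R measure m (ball x r)) \<longlongrightarrow> v) (at_right 0)"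
    using v unfolding has_outer_normal_def by blast
  have sets_m[measurable_cong]: "sets m = sets borel" and fin_m: "\<And>K. compact K \<Longrightarrow> emeasure m K < \<infinity>"
    and \<nu>_meas[measurable]: "\<nu> \<in> borel_measurable borel" and \<nu>1: "AE y in m. norm (\<nu> y) = 1"
    and gg': "\<And>X. Ck_on 1 X UNIV \<Longrightarrow> compact (supp X) \<Longrightarrow> (LINT y:E|lborel. divergence X y) = (LINT y|m. X y \<bullet> \<nu> y)"
    using gg unfolding gauss_green_def by blast+
  have [measurable]: "E \<in> sets borel" by (rule E)
  have \<nu>_meas_m[measurable]: "\<nu> \<in> borel_measurable m"
    using \<nu>_meas by (subst measurable_cong_sets[OF sets_m refl])
  have ball_m[measurable]: "ball x r \<in> sets m" for r by (simp add: sets_m)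
  have div_nonneg: "0 \<le> (LINT y:E|lborel. plateau_deriv x r k y * ((y - x) \<bullet> u))"
    if r: "0 < r" "r < r0" and k: "0 \<le> k" for r k
  proof -
    define \<phi> where "\<phi> = plateau x r k"
    define d where "d y = plateau_deriv x r k y * ((y - x) \<bullet> u)" for y
    have \<phi>_cont: "continuous_on UNIV \<phi>" unfolding \<phi>_def by (rule plateau_continuous[OF k])
    have d_cont: "continuous_on UNIV d"
      unfolding d_def by (intro continuous_intros plateau_deriv_continuous k)
    have [measurable]: "\<phi> \<in> borel_measurable borel" "d \<in> borel_measurable borel"
      using \<phi>_cont d_cont by (auto intro: borel_measurable_continuous_onI)
    have \<phi>_supp: "\<phi> y = 0" if "y \<notin> ball x r" for y
      unfolding \<phi>_def using r that by (intro plateau_outside) auto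
    have d_supp: "d y = 0" if "y \<notin> ball x r" for y
      unfolding d_def using r that by (subst plateau_deriv_outside) auto
    obtain B where B: "0 \<le> B" "\<And>y. \<bar>d y\<bar> \<le> B" using compact_support_bounded[OF d_cont d_supp] by blast
    have deriv: "((\<lambda>t. \<phi> (y + t *\<^sub>R u)) has_real_derivative d (y + t *\<^sub>R u)) (at t)" for y t
    proof -
      have "((\<lambda>t. \<phi> (y + t *\<^sub>R u)) has_derivative (\<lambda>s. plateau_deriv x r k (y + t *\<^sub>R u) * ((y + t *\<^sub>R u - x) \<bullet> (s *\<^sub>R u)))) (at t)"
        unfolding \<phi>_def
        by (rule has_derivative_compose[OF _ plateau_has_derivative[OF k], where f = "\<lambda>t. y + t *\<^sub>R u"]) (auto intro!: derivative_eq_intros)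
      then show ?thesis unfolding has_field_derivative_def d_def
        by (rule has_derivative_eq_rhs) (simp add: fun_eq_iff mult_ac)
    qed
    have lip: "\<bar>\<phi> (y + t *\<^sub>R u) - \<phi> y\<bar> \<le> B * t" if t: "0 < t" for y t
    proof -
      obtain z where "\<phi> (y + t *\<^sub>R u) - \<phi> (y + 0 *\<^sub>R u) = (t - 0) * d (y + z *\<^sub>R u)"
        using MVT2[OF t, of "\<lambda>t. \<phi> (y + t *\<^sub>R u)" "\<lambda>t. d (y + t *\<^sub>R u)"] deriv by blast
      then show ?thesis using B(2)[of "y + z *\<^sub>R u"] t by (simp add: abs_mult mult.commute mult_left_mono)
    qed
    obtain N0 :: nat where N0: "max (1 / h0) (max 1 (norm u)) < real N0" using reals_Archimedean2 by blast
    \<comment> \<open>The difference quotients are bounded by the Lipschitz constant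
      \<open>B\<close> along \<open>u\<close> and vanish outside a ball enlarged by
      \<open>norm u\<close>, so dominated convergence applies.\<close>
    have "(\<lambda>N. LINT y|lborel. indicator E y * (real N * (\<phi> (y + (1 / real N) *\<^sub>R u) - \<phi> y))) \<longlonglongrightarrow> (LINT y|lborel. indicator E y * d y)"
    proof (rule integral_dominated_convergence[where w = "\<lambda>y. B * indicator (cball x (r + norm u)) y"])
      show "integrable lborel (\<lambda>y. B * indicator (cball x (r + norm u)) y)"
        using emeasure_lborel_cball_finite[of x "r + norm u"] by (intro integrable_mult_right integrable_real_indicator) simp_all
      show "AE y in lborel. (\<lambda>N. indicator E y * (real N * (\<phi> (y + (1 / real N) *\<^sub>R u) - \<phi> y))) \<longlonglongrightarrow> indicator E y * d y"
      proof (intro AE_I2 tendsto_mult tendsto_const)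
        fix y
        have "((\<lambda>h. (\<phi> (y + h *\<^sub>R u) - \<phi> y) / h) \<longlongrightarrow> d y) (at 0)"
          using deriv[of y 0] by (simp add: DERIV_def)
        moreover have "filterlim (\<lambda>N. 1 / real N) (at 0) sequentially"
          by (rule filterlim_atI[OF lim_1_over_n]) (use eventually_gt_at_top[of 0] in \<open>auto elim: eventually_mono\<close>)
        ultimately have "((\<lambda>N. (\<phi> (y + (1 / real N) *\<^sub>R u) - \<phi> y) / (1 / real N)) \<longlongrightarrow> d y) sequentially"
          by (rule filterlim_compose)
        then show "(\<lambda>N. real N * (\<phi> (y + (1 / real N) *\<^sub>R u) - \<phi> y)) \<longlonglongrightarrow> d y"
          by (simp add: mult.commute)
      qed
      fix N
      show "AE y in lborel. norm (indicator E y * (real N * (\<phi> (y + (1 / real N) *\<^sub>R u) - \<phi> y))) \<le> B * indicator (cball x (r + norm u)) y"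
      proof (intro AE_I2)
        fix y
        show "norm (indicator E y * (real N * (\<phi> (y + (1 / real N) *\<^sub>R u) - \<phi> y))) \<le> B * indicator (cball x (r + norm u)) y"
        proof (cases "N = 0")
          case False
          then have N: "0 < 1 / real N" "1 / real N \<le> 1" by auto
          show ?thesis
          proof (cases "y \<in> cball x (r + norm u)")
            case True
            have "real N * \<bar>\<phi> (y + (1 / real N) *\<^sub>R u) - \<phi> y\<bar> \<le> real N * (B * (1 / real N))"
              by (intro mult_left_mono lip N) simp
            also have "\<dots> = B" using False by simp
            finally show ?thesis using True B(1) by (simp add: abs_mult indicator_def)
          next
            case out: False
            have "norm ((1 / real N) *\<^sub>R u) \<le> 1 * norm u" using N unfolding norm_scaleR by (intro mult_right_mono) auto
            moreover have "dist x y \<le> dist x (y + (1 / real N) *\<^sub>R u) + norm ((1 / real N) *\<^sub>R u)"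
              using dist_triangle[of x y "y + (1 / real N) *\<^sub>R u"] by (simp add: dist_norm)
            ultimately have "y + (1 / real N) *\<^sub>R u \<notin> ball x r" "y \<notin> ball x r"
              using out r norm_ge_zero[of u] by (auto simp del: norm_ge_zero)
            then show ?thesis using \<phi>_supp out by simp
          qed
        qed (use B(1) in simp)
      qed
    qed measurable
    moreover have "\<forall>\<^sub>F N in sequentially. 0 \<le> (LINT y|lborel. indicator E y * (real N * (\<phi> (y + (1 / real N) *\<^sub>R u) - \<phi> y)))"
      using eventually_ge_at_top[of N0]
    proof eventually_elim
      case (elim N)
      define h where "h = 1 / real N"
      have N: "0 < real N" "1 / h0 < real N" using N0 elim by auto
      have h: "0 < h" "h < h0" using N h0 by (auto simp: h_def field_simps)
      have int1: "integrable lborel (\<lambda>y. indicator E y * \<phi> y)"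
        by (rule compact_support_integrable[OF \<phi>_cont \<phi>_supp, where C = 1]) (auto simp: indicator_def)
      have int2: "integrable lborel (\<lambda>y. indicator E (- (h *\<^sub>R u) + y) * \<phi> y)"
        by (rule compact_support_integrable[OF \<phi>_cont \<phi>_supp, where C = 1]) (auto simp: indicator_def)
      have tr: "integrable lborel (\<lambda>y. indicator E y * \<phi> (y + h *\<^sub>R u))"
        "(LINT y|lborel. indicator E y * \<phi> (y + h *\<^sub>R u)) = (LINT y|lborel. indicator E (- (h *\<^sub>R u) + y) * \<phi> y)"
        using lborel_integral_translate[of "\<lambda>y. indicator E (- (h *\<^sub>R u) + y) * \<phi> y" "h *\<^sub>R u"] int2
        by (simp_all add: add.commute)
      \<comment> \<open>After the shift the increment compares \<open>\<phi>\<close> on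
        \<open>E\<close> translated by \<open>h *\<^sub>R u\<close> with \<open>\<phi>\<close> on
        \<open>E\<close>; by hypothesis the translate contains almost all of \<open>E\<close> in the
        ball, and \<open>\<phi>\<close> is nonnegative.\<close>
      have "(LINT y|lborel. indicator E y * \<phi> y) \<le> (LINT y|lborel. indicator E (- (h *\<^sub>R u) + y) * \<phi> y)"
      proof (rule integral_mono_AE[OF int1 int2])
        show "AE y in lborel. indicator E y * \<phi> y \<le> indicator E (- (h *\<^sub>R u) + y) * \<phi> y"
          using slide[OF h]
        proof eventually_elim
          case (elim y)
          have "0 \<le> \<phi> y" unfolding \<phi>_def by (rule plateau_bounds(1)[OF k])
          moreover have "y \<in> ball x r \<Longrightarrow> y \<in> ball x r0" using r by auto
          ultimately show ?case using elim \<phi>_supp[of y] by (auto simp: indicator_def)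
        qed
      qed
      then have "0 \<le> real N * ((LINT y|lborel. indicator E y * \<phi> (y + h *\<^sub>R u)) - (LINT y|lborel. indicator E y * \<phi> y))"
        using tr by simp
      also have "\<dots> = (LINT y|lborel. real N * (indicator E y * \<phi> (y + h *\<^sub>R u) - indicator E y * \<phi> y))"
        using tr(1) int1 by simp
      also have "\<dots> = (LINT y|lborel. indicator E y * (real N * (\<phi> (y + h *\<^sub>R u) - \<phi> y)))"
        by (intro Bochner_Integration.integral_cong) (auto simp: algebra_simps)
      finally show ?case by (simp only: h_def)
    qed
    ultimately have "0 \<le> (LINT y|lborel. indicator E y * d y)"
      by (rule tendsto_lowerbound) simp
    then show ?thesis by (simp add: set_lebesgue_integral_def d_def)
  qed
  have avg: "0 \<le> (LINT y:ball x r|m. \<nu> y) \<bullet> u \<and> set_integrable m (ball x r) \<nu>" if r: "0 < r" "r < r0" for r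
  proof
    have "emeasure m (cball x r) < \<infinity>" by (rule fin_m) simp
    then have ind: "integrable m (\<lambda>y. norm u * indicator (cball x r) y)"
      by (intro integrable_mult_right integrable_real_indicator) (simp_all add: sets_m)
    have "emeasure m (ball x r) \<le> emeasure m (cball x r)" by (intro emeasure_mono) (auto simp: sets_m)
    then have "emeasure m (ball x r) < \<infinity>" using \<open>emeasure m (cball x r) < \<infinity>\<close> by (rule le_less_trans)
    then have ind1: "integrable m (indicator (ball x r) :: 'a \<Rightarrow> real)"
      by (intro integrable_real_indicator) (simp_all add: sets_m)
    show si: "set_integrable m (ball x r) \<nu>"
      unfolding set_integrable_def
    proof (rule Bochner_Integration.integrable_bound[OF ind1])
      show "AE y in m. norm (indicator (ball x r) y *\<^sub>R \<nu> y) \<le> norm (indicator (ball x r) y :: real)"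
        using \<nu>1 by eventually_elim (simp add: indicator_def)
    qed measurable
    \<comment> \<open>As \<open>k\<close> grows, the right side of Gauss-Green for the plateau
      fields tends to the integral of \<open>u \<bullet> \<nu>\<close> over the ball, so the sign of
      the divergence integrals passes to the averages that define the normal.\<close>
    have "(\<lambda>k. LINT y|m. (plateau x r (real k) y *\<^sub>R u) \<bullet> \<nu> y) \<longlonglongrightarrow> (LINT y|m. indicator (ball x r) y * (u \<bullet> \<nu> y))"
    proof (rule integral_dominated_convergence[OF _ _ ind])
      show "AE y in m. (\<lambda>k. (plateau x r (real k) y *\<^sub>R u) \<bullet> \<nu> y) \<longlonglongrightarrow> indicator (ball x r) y * (u \<bullet> \<nu> y)"
        using plateau_limit[of r x] r by (auto intro!: AE_I2 tendsto_intros)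
      fix k
      have "continuous_on UNIV (plateau x r (real k))" by (rule plateau_continuous) simp
      then have [measurable]: "plateau x r (real k) \<in> borel_measurable borel" by (rule borel_measurable_continuous_onI)
      show "(\<lambda>y. (plateau x r (real k) y *\<^sub>R u) \<bullet> \<nu> y) \<in> borel_measurable m" by measurable
      show "AE y in m. norm ((plateau x r (real k) y *\<^sub>R u) \<bullet> \<nu> y) \<le> norm u * indicator (cball x r) y"
        using \<nu>1
      proof eventually_elim
        case (elim y)
        show ?case
        proof (cases "y \<in> ball x r")
          case True
          have "\<bar>plateau x r (real k) y\<bar> * \<bar>u \<bullet> \<nu> y\<bar> \<le> 1 * (norm u * norm (\<nu> y))"
            using plateau_bounds[of "real k" x r y] by (intro mult_mono Cauchy_Schwarz_ineq2) auto
          then show ?thesis using True elim by (simp add: abs_mult)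
        next
          case False
          then have "plateau x r (real k) y = 0" using r by (intro plateau_outside) auto
          then show ?thesis by simp
        qed
      qed
    qed measurable
    moreover have "0 \<le> (LINT y|m. (plateau x r (real k) y *\<^sub>R u) \<bullet> \<nu> y)" for k
    proof -
      have "(LINT y|m. (plateau x r (real k) y *\<^sub>R u) \<bullet> \<nu> y) = (LINT y:E|lborel. divergence (\<lambda>y. plateau x r (real k) y *\<^sub>R u) y)"
        using r by (intro gg'[symmetric] plateau_field) auto
      also have "\<dots> = (LINT y:E|lborel. plateau_deriv x r (real k) y * ((y - x) \<bullet> u))"
        using r by (subst plateau_field(3)) auto
      finally show ?thesis using div_nonneg[OF r, of "real k"] by simp
    qed
    ultimately have "0 \<le> (LINT y|m. indicator (ball x r) y * (u \<bullet> \<nu> y))"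
      by (intro tendsto_lowerbound[of _ _ sequentially]) auto
    also have "\<dots> = (LINT y|m. (indicator (ball x r) y *\<^sub>R \<nu> y) \<bullet> u)"
      by (simp add: inner_commute)
    also have "\<dots> = (LINT y:ball x r|m. \<nu> y) \<bullet> u"
      unfolding set_lebesgue_integral_def using si unfolding set_integrable_def by (rule integral_inner_left)
    finally show "0 \<le> (LINT y:ball x r|m. \<nu> y) \<bullet> u" .
  qed
  have "((\<lambda>r. ((LINT y:ball x r|m. \<nu> y) /\<^sub>R measure m (ball x r)) \<bullet> u) \<longlongrightarrow> v \<bullet> u) (at_right 0)"
    by (intro tendsto_inner lim tendsto_const)
  moreover have "\<forall>\<^sub>F r in at_right 0. 0 \<le> ((LINT y:ball x r|m. \<nu> y) /\<^sub>R measure m (ball x r)) \<bullet> u"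
    using eventually_at_right_real[OF r0] by eventually_elim (use avg in auto)
  ultimately have "0 \<le> v \<bullet> u"
    by (intro tendsto_lowerbound[of _ _ "at_right 0"]) auto
  then show ?thesis by (simp add: inner_commute)
qed

text \<open>Testing with \<open>\<epsilon> *\<^sub>R n - \<tau>\<close>, for \<open>\<tau>\<close>
  the part of \<open>v\<close> orthogonal to \<open>n\<close>, and letting \<open>\<epsilon>\<close>
  tend to 0 forces \<open>\<tau> = 0\<close>. So \<open>v\<close> is plus or minus \<open>n\<close>,
  and testing with \<open>n\<close> decides the sign.\<close>

lemma unit_vector_eq_of_halfspace:
  fixes n v :: "'a::real_inner"
  assumes n: "norm n = 1" and v: "norm v = 1" and pos: "\<And>u. 0 < u \<bullet> n \<Longrightarrow> 0 \<le> u \<bullet> v"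
  shows "v = n"
proof -
  define \<tau> where "\<tau> = v - (v \<bullet> n) *\<^sub>R n"
  have nn: "n \<bullet> n = 1" using n by (simp add: dot_square_norm)
  have \<tau>n: "\<tau> \<bullet> n = 0" by (simp add: \<tau>_def inner_diff_left nn)
  have \<tau>v: "\<tau> \<bullet> v = \<tau> \<bullet> \<tau>" using \<tau>n by (simp add: \<tau>_def inner_diff_right)
  have "\<tau> \<bullet> \<tau> \<le> \<epsilon> * (n \<bullet> v)" if "0 < \<epsilon>" for \<epsilon>
  proof -
    have "0 < (\<epsilon> *\<^sub>R n - \<tau>) \<bullet> n" using that by (simp add: inner_diff_left nn \<tau>n)
    from pos[OF this] show ?thesis by (simp add: inner_diff_left \<tau>v)
  qed
  moreover have "n \<bullet> v \<le> 1" using norm_cauchy_schwarz[of n v] n v by simp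
  ultimately have "\<tau> \<bullet> \<tau> \<le> 0 + \<epsilon>" if "0 < \<epsilon>" for \<epsilon>
    using that by (metis add_0 mult_left_le less_imp_le order_trans)
  then have "\<tau> \<bullet> \<tau> \<le> 0" by (rule field_le_epsilon)
  then have "\<tau> = 0" using inner_ge_zero[of \<tau>] by (simp add: antisym)
  then have vn: "v = (v \<bullet> n) *\<^sub>R n" by (simp add: \<tau>_def)
  then have "\<bar>v \<bullet> n\<bar> = 1" using v n by (metis mult.right_neutral norm_scaleR)
  moreover have "0 \<le> v \<bullet> n" using pos[of n] nn by (simp add: inner_commute)
  ultimately show ?thesis using vn by simp
qed

text \<open>Every \<open>u\<close> with \<open>0 < u \<bullet> G x\<close> decreases
  \<open>w\<close> backwards, so small translations by \<open>- u\<close> keep points of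
  \<open>E\<close> near \<open>x\<close> in \<open>E\<close>, and each outer normal lies on the side
  of \<open>u\<close>. All such \<open>u\<close> together determine the normal, which also gives the
  uniqueness that \<open>outer_normal\<close>, a definite description, presupposes.\<close>

lemma outer_normal_level_set:
  fixes E :: "'a::euclidean_space set"
  assumes w: "level_chart w G U" and x: "x \<in> U" "x \<in> reduced_boundary E" and E: "E \<in> sets borel" "E \<inter> U = {y \<in> U. w y < 0}"
  shows "outer_normal E x = G x /\<^sub>R norm (G x)"
proof -
  have U: "open U" and contG: "continuous_on U G" and G0: "G x \<noteq> 0"
    using w x by (auto simp: level_chart_def)
  have unique: "v = G x /\<^sub>R norm (G x)" if v: "has_outer_normal E x v" for v
  proof (rule unit_vector_eq_of_halfspace)
    show "norm (G x /\<^sub>R norm (G x)) = 1" using G0 by simp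
    show "norm v = 1" using v by (simp add: has_outer_normal_def)
    fix u assume "0 < u \<bullet> (G x /\<^sub>R norm (G x))"
    then have u: "0 < u \<bullet> G x" using G0 by (simp add: zero_less_mult_iff)
    obtain r1 where r1: "0 < r1" "ball x r1 \<subseteq> U" using U x by (auto simp: open_contains_ball)
    have "continuous_on U (\<lambda>y. u \<bullet> G y)" by (intro continuous_intros contG)
    then have "\<exists>r2>0. \<forall>y\<in>U. dist y x < r2 \<longrightarrow> dist (u \<bullet> G y) (u \<bullet> G x) < u \<bullet> G x"
      using x u unfolding continuous_on_iff by blast
    then obtain r2 where r2: "0 < r2" "\<And>y. y \<in> U \<Longrightarrow> dist y x < r2 \<Longrightarrow> dist (u \<bullet> G y) (u \<bullet> G x) < u \<bullet> G x" by blast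
    define r where "r = min r1 r2"
    have C: "ball x r \<subseteq> U" using r1 by (auto simp: r_def)
    have vG: "0 < u \<bullet> G y" if "y \<in> ball x r" for y
    proof -
      have "\<bar>u \<bullet> G y - u \<bullet> G x\<bar> < u \<bullet> G x" using r2(2)[of y] that C by (auto simp: r_def dist_real_def dist_commute)
      then show ?thesis by linarith
    qed
    have u0: "0 < norm u" using u by auto
    show "0 \<le> u \<bullet> v"
    proof (rule outer_normal_monotone_direction[OF v E(1)])
      show "0 < r / 2" using r1 r2 by (simp add: r_def)
      then show "0 < r / 2 / norm u" using u0 by simp
      fix h assume h: "0 < h" "h < r / 2 / norm u"
      have "y - h *\<^sub>R u \<in> E" if y: "y \<in> ball x (r / 2)" "y \<in> E" for y
      proof -
        have "norm (h *\<^sub>R u) < r / 2" using h u0 by (simp add: pos_less_divide_eq)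
        moreover have "dist x (y - h *\<^sub>R u) \<le> dist x y + norm (h *\<^sub>R u)"
          using dist_triangle[of x "y - h *\<^sub>R u" y] by (simp add: dist_norm)
        ultimately have in1: "y - h *\<^sub>R u \<in> ball x r" using y by auto
        have in2: "y \<in> ball x r" using y(1) \<open>0 < r / 2\<close> by auto
        obtain \<xi> where \<xi>: "\<xi> \<in> ball x r" "w y - w (y - h *\<^sub>R u) = G \<xi> \<bullet> (y - (y - h *\<^sub>R u))"
          using level_chart_mvt[OF w convex_ball C in2 in1] by blast
        then have "w y - w (y - h *\<^sub>R u) = h * (u \<bullet> G \<xi>)" by (simp add: inner_commute)
        moreover have "0 < h * (u \<bullet> G \<xi>)" using vG[OF \<xi>(1)] h by simp
        moreover have "w y < 0" using E(2) y(2) in2 C by blast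
        ultimately have "w (y - h *\<^sub>R u) < 0" by linarith
        then show ?thesis using E(2) in1 C by blast
      qed
      then show "AE y in lborel. y \<in> ball x (r / 2) \<longrightarrow> y \<in> E \<longrightarrow> y - h *\<^sub>R u \<in> E" by simp
    qed
  qed
  obtain v where v: "has_outer_normal E x v" using x(2) by (auto simp: reduced_boundary_def)
  show ?thesis
    unfolding outer_normal_def by (rule the_equality) (use v unique in auto)
qed

section \<open>Local structure of the interfaces\<close>

text \<open>\<open>G\<close> points from cell \<open>i\<close> to cell \<open>j\<close>. Its
  differentiability serves the second fundamental form; the curves of the last clause realise every
  tangent vector as a velocity within the interface, which makes tangential derivatives well
  defined.\<close>

definition interface_chart ::
  "nat \<Rightarrow> (nat \<Rightarrow> 'a::euclidean_space set) \<Rightarrow> nat \<Rightarrow> nat \<Rightarrow> ('a \<Rightarrow> real) \<Rightarrow> ('a \<Rightarrow> 'a) \<Rightarrow> 'a set \<Rightarrow> bool" where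
  "interface_chart q \<Omega> i j w G U \<longleftrightarrow>
     level_chart w G U \<and> (\<forall>y\<in>U. G differentiable (at y)) \<and>
     \<Omega> i \<inter> U = {y \<in> U. w y < 0} \<and> \<Omega> j \<inter> U = {y \<in> U. 0 < w y} \<and>
     (\<forall>k\<in>{1..q} - {i, j}. \<Omega> k \<inter> U = {}) \<and>
     cluster_boundary q \<Omega> \<inter> U = {y \<in> U. w y = 0} \<and> interface \<Omega> i j \<inter> U = {y \<in> U. w y = 0} \<and>
     (\<forall>y\<in>U. w y = 0 \<longrightarrow> (\<forall>u. u \<bullet> G y = 0 \<longrightarrow>
        (\<exists>\<gamma>. \<gamma> 0 = y \<and> (\<gamma> has_vector_derivative u) (at 0) \<and> (\<forall>\<^sub>F t in at 0. \<gamma> t \<in> U \<and> w (\<gamma> t) = 0))))"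

text \<open>The vector is the adjoint of \<open>f\<close> applied to \<open>a\<close>, that is, the
  gradient of \<open>a \<bullet> f h\<close> in \<open>h\<close>.\<close>

lemma inner_linear_gradient:
  fixes f :: "'a::euclidean_space \<Rightarrow> 'b::real_inner"
  assumes "linear f"
  shows "(\<Sum>b\<in>Basis. (a \<bullet> f b) *\<^sub>R b) \<bullet> h = a \<bullet> f h"
proof -
  have "f h = f (\<Sum>b\<in>Basis. (h \<bullet> b) *\<^sub>R b)" by (simp add: euclidean_representation)
  also have "\<dots> = (\<Sum>b\<in>Basis. (h \<bullet> b) *\<^sub>R f b)"
    using assms by (simp add: linear_sum linear_cmul)
  finally have "a \<bullet> f h = (\<Sum>b\<in>Basis. (h \<bullet> b) * (a \<bullet> f b))"
    by (simp add: inner_sum_right)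
  then show ?thesis unfolding inner_sum_left by (simp add: inner_commute mult.commute)
qed

lemma hyperplane_normal:
  fixes L :: "'a::euclidean_space set"
  assumes "subspace L" "dim L + 1 = DIM('a)"
  obtains a where "a \<noteq> 0" "L = {x. a \<bullet> x = 0}"
proof -
  obtain a where a: "a \<noteq> 0" "span L \<subseteq> {x. a \<bullet> x = 0}"
    using lowdim_subset_hyperplane[of L] assms(2) by auto
  have "L = {x. a \<bullet> x = 0}"
  proof (rule subspace_dim_equal[OF assms(1) subspace_hyperplane])
    show "L \<subseteq> {x. a \<bullet> x = 0}" using a(2) span_superset by blast
    show "dim {x. a \<bullet> x = 0} \<le> dim L" using dim_hyperplane[OF a(1)] assms(2) by simp
  qed
  with a(1) show thesis by (rule that)
qed

lemma open_not_null:
  fixes S :: "'a::euclidean_space set"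
  assumes "open S" "S \<noteq> {}" "emeasure lborel N = 0" "N \<in> sets borel"
  shows "\<not> S \<subseteq> N"
proof
  assume "S \<subseteq> N"
  then have "emeasure lborel S \<le> emeasure lborel N" using assms(4) by (intro emeasure_mono) auto
  then have "S \<in> null_sets lebesgue" using assms by (intro null_setsI) auto
  then show False using open_not_negligible[OF assms(1,2)] by (simp add: negligible_iff_null_sets)
qed

lemma connected_avoiding_frontier:
  "connected S \<Longrightarrow> S \<inter> frontier T = {} \<Longrightarrow> S \<inter> T \<noteq> {} \<Longrightarrow> S \<subseteq> T"
  using connected_Int_frontier by blast

text \<open>The cells cover almost everything, so an open set meets one of them; a connected set
  that avoids the frontier of this cell stays inside it.\<close>

lemma connected_in_cell:
  fixes \<Omega> :: "nat \<Rightarrow> 'a::euclidean_space set"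
  assumes cl: "cluster q \<Omega>" and S: "open S" "connected S" "S \<noteq> {}" "S \<inter> cluster_boundary q \<Omega> = {}"
  shows "\<exists>k\<in>{1..q}. S \<subseteq> \<Omega> k"
proof -
  have borel: "\<Omega> k \<in> sets borel" if "k \<in> {1..q}" for k using cl that by (auto simp: cluster_def)
  then have "UNIV - (\<Union>i\<in>{1..q}. \<Omega> i) \<in> sets borel" by (intro sets.Diff sets.finite_UN) auto
  moreover have "emeasure lborel (UNIV - (\<Union>i\<in>{1..q}. \<Omega> i)) = 0" using cl by (simp add: cluster_def)
  ultimately have "\<not> S \<subseteq> UNIV - (\<Union>i\<in>{1..q}. \<Omega> i)" using S open_not_null by blast
  then obtain k where k: "k \<in> {1..q}" "S \<inter> \<Omega> k \<noteq> {}" by blast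
  moreover have "S \<inter> frontier (\<Omega> k) = {}" using S(4) k(1) unfolding cluster_boundary_def by blast
  ultimately show ?thesis using connected_avoiding_frontier[OF S(2)] by blast
qed

lemma reduced_boundary_subset_frontier:
  "regular1 q \<Omega> \<Longrightarrow> i \<in> {1..q} \<Longrightarrow> reduced_boundary (\<Omega> i) \<subseteq> frontier (\<Omega> i)"
  unfolding regular1_def using closure_subset by blast

lemma interface_subset_boundary:
  "regular1 q \<Omega> \<Longrightarrow> i \<in> {1..q} \<Longrightarrow> interface \<Omega> i j \<subseteq> cluster_boundary q \<Omega>"
  using reduced_boundary_subset_frontier unfolding interface_def cluster_boundary_def by blast

text \<open>A submanifold chart \<open>\<phi>\<close> straightens the boundary near \<open>x\<close>
  to a hyperplane with normal \<open>a\<close>, and \<open>w\<close> is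
  \<open>a \<bullet> \<phi>\<close>. The two sides are connected and avoid the boundary, so each
  lies in one cell; as \<open>\<Omega> i\<close> and \<open>\<Omega> j\<close> both accumulate at
  \<open>x\<close>, these are the two cells.\<close>

lemma interface_chart_exists:
  fixes \<Omega> :: "nat \<Rightarrow> 'a::euclidean_space set"
  assumes cl: "cluster q \<Omega>" and r1: "regular1 q \<Omega>" and r2: "regular2 q \<Omega>"
    and ij: "i \<in> {1..q}" "j \<in> {1..q}" "i \<noteq> j" and x: "x \<in> interface \<Omega> i j"
  shows "\<exists>w G U. x \<in> U \<and> interface_chart q \<Omega> i j w G U"
proof -
  define \<Sigma> where "\<Sigma> = cluster_boundary q \<Omega>"
  have disj: "\<Omega> k \<inter> \<Omega> l = {}" if "k \<in> {1..q}" "l \<in> {1..q}" "k \<noteq> l" for k l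
    using cl that by (auto simp: cluster_def disjoint_family_on_def)
  have op: "open (\<Omega> k)" if "k \<in> {1..q}" for k using r1 that by (auto simp: regular1_def)
  obtain \<M> where \<M>: "\<forall>M\<in>\<M>. embedded_submanifold C_inf 1 M \<and> openin (top_of_set \<Sigma>) M" "interface \<Omega> i j = \<Union>\<M>"
  proof -
    have "locally_finite_union_of (\<lambda>M. embedded_submanifold C_inf 1 M \<and> openin (top_of_set \<Sigma>) M) (interface \<Omega> i j)"
      using r2 ij unfolding regular2_def \<Sigma>_def by simp
    then show thesis using that unfolding locally_finite_union_of_def by (elim exE conjE)
  qed
  then obtain M where M: "x \<in> M" "M \<in> \<M>" using x by auto
  then have emb: "embedded_submanifold C_inf 1 M" and "openin (top_of_set \<Sigma>) M" using \<M> by auto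
  then obtain T where T: "open T" "M = \<Sigma> \<inter> T" by (auto simp: openin_open)
  have MI: "M \<subseteq> interface \<Omega> i j" using \<M>(2) M(2) by blast
  obtain U0 V \<phi> and L :: "'a set" where U0: "x \<in> U0" "diffeo C_inf \<phi> U0 V (UNIV :: 'a set)" and L: "subspace L" "dim L + 1 = DIM('a)"
    and \<phi>M: "\<phi> ` (M \<inter> U0) = V \<inter> L"
    using emb M(1) unfolding embedded_submanifold_def by blast
  obtain \<psi> where op_U0: "open U0" and op_V: "open V" and \<phi>V: "\<phi> ` U0 = V" and \<phi>C: "\<And>k. Ck_on k \<phi> U0"
    and \<psi>C: "\<And>k. Ck_on k \<psi> V" and inv: "\<And>y. y \<in> U0 \<Longrightarrow> \<psi> (\<phi> y) = y"
    using U0(2) unfolding diffeo_def by auto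
  obtain a0 where a0: "a0 \<noteq> 0" "L = {y. a0 \<bullet> y = 0}" using hyperplane_normal[OF L] by blast
  define D where "D y = frechet_derivative \<phi> (at y)" for y
  have D: "(\<phi> has_derivative D y) (at y)" if "y \<in> U0" for y
    using \<phi>C[of 1] that by (simp add: D_def frechet_derivative_works)
  have D_diff: "(\<lambda>y. D y b) differentiable (at y)" if "y \<in> U0" for y b
    using \<phi>C[of "Suc (Suc 0)"] that by (simp add: D_def)
  have \<phi>_cont: "continuous_on U0 \<phi>"
    using D has_derivative_continuous continuous_at_imp_continuous_on by blast
  have \<psi>_diff: "\<psi> differentiable (at z)" if "z \<in> V" for z
    using \<psi>C[of 1] that by simp
  have \<psi>_cont: "continuous_on V \<psi>" using \<psi>C[of 0] by simp
  \<comment> \<open>The chain rule for \<open>\<psi>\<close> after \<open>\<phi>\<close> shows that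
    the derivative of \<open>\<phi>\<close> is injective, hence surjective by dimension; so the
    gradient of \<open>w\<close> cannot vanish.\<close>
  have \<psi>D: "\<exists>D'. (\<psi> has_derivative D') (at (\<phi> y)) \<and> (\<forall>u. D' (D y u) = u)" if y: "y \<in> U0" for y
  proof -
    obtain D' where D': "(\<psi> has_derivative D') (at (\<phi> y))"
      using \<psi>_diff[of "\<phi> y"] y \<phi>V by (auto simp: differentiable_def)
    have "((\<lambda>y. \<psi> (\<phi> y)) has_derivative (\<lambda>u. D' (D y u))) (at y)"
      by (rule has_derivative_compose[OF D[OF y] D'])
    then have "((\<lambda>y. y) has_derivative (\<lambda>u. D' (D y u))) (at y)"
      by (rule has_derivative_transform_within_open[OF _ op_U0 y]) (simp add: inv)
    then have "(\<lambda>u. D' (D y u)) = (\<lambda>u. u)"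
      using has_derivative_unique has_derivative_ident by blast
    then show ?thesis using D' by (auto simp: fun_eq_iff)
  qed
  have linD: "linear (D y)" if "y \<in> U0" for y using D[OF that] has_derivative_linear by blast
  have surj_D: "surj (D y)" if y: "y \<in> U0" for y
  proof -
    have "inj (D y)" using \<psi>D[OF y] by (metis injI)
    then show ?thesis by (rule linear_inj_imp_surj[OF linD[OF y]])
  qed
  have xV: "\<phi> x \<in> V" using U0(1) \<phi>V by auto
  have x0: "a0 \<bullet> \<phi> x = 0" using \<phi>M M(1) U0(1) a0(2) by blast
  \<comment> \<open>A ball in the chart whose preimage stays in \<open>T\<close>, where
    \<open>M\<close> is all of the cluster boundary. Its two open halves are convex, so their
    preimages are connected.\<close>
  have "\<exists>\<rho>>0. ball (\<phi> x) \<rho> \<subseteq> V \<inter> \<psi> -` T"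
  proof -
    have "open (V \<inter> \<psi> -` T)" by (rule continuous_open_preimage[OF \<psi>_cont op_V T(1)])
    moreover have "\<phi> x \<in> V \<inter> \<psi> -` T" using xV inv[OF U0(1)] M(1) T(2) by auto
    ultimately show ?thesis by (auto simp: open_contains_ball)
  qed
  then obtain \<rho> where \<rho>: "0 < \<rho>" "ball (\<phi> x) \<rho> \<subseteq> V" "ball (\<phi> x) \<rho> \<subseteq> \<psi> -` T" by blast
  define W where "W = ball (\<phi> x) \<rho>"
  have W: "W \<subseteq> V" "open W" "convex W" "\<phi> x \<in> W" using \<rho> by (auto simp: W_def)
  define U where "U = U0 \<inter> \<phi> -` W"
  have op_U: "open U" unfolding U_def by (rule continuous_open_preimage[OF \<phi>_cont op_U0 W(2)])
  have UU0: "U \<subseteq> U0" and xU: "x \<in> U" using U0(1) W(4) by (auto simp: U_def)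
  have \<psi>W: "\<psi> z \<in> U \<and> \<phi> (\<psi> z) = z" if z: "z \<in> W" for z
  proof -
    obtain y where "y \<in> U0" "\<phi> y = z" using z W(1) \<phi>V by blast
    then show ?thesis using inv z by (auto simp: U_def)
  qed
  have UT: "U \<subseteq> T"
    using \<rho>(3) inv by (force simp: U_def W_def)
  have MU: "y \<in> M \<longleftrightarrow> a0 \<bullet> \<phi> y = 0" if y: "y \<in> U" for y
  proof
    assume "y \<in> M"
    then have "\<phi> y \<in> L" using \<phi>M y UU0 by blast
    then show "a0 \<bullet> \<phi> y = 0" using a0(2) by simp
  next
    assume "a0 \<bullet> \<phi> y = 0"
    then have "\<phi> y \<in> V \<inter> L" using a0(2) y UU0 \<phi>V by auto
    then obtain p where "p \<in> M" "p \<in> U0" "\<phi> y = \<phi> p" using \<phi>M by blast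
    then show "y \<in> M" using inv y UU0 by (metis subsetD)
  qed
  have \<Sigma>U: "y \<in> \<Sigma> \<longleftrightarrow> a0 \<bullet> \<phi> y = 0" if "y \<in> U" for y
    using MU[OF that] T(2) UT that by auto
  define P where "P s = {y \<in> U. 0 < s * (a0 \<bullet> \<phi> y)}" for s :: real
  have P_cell: "\<exists>k\<in>{1..q}. P s \<subseteq> \<Omega> k" if s: "s = 1 \<or> s = - 1" for s
  proof (rule connected_in_cell[OF cl])
    define H where "H = W \<inter> {z. (s *\<^sub>R a0) \<bullet> z > 0}"
    have P_im: "P s = \<psi> ` H"
    proof (intro set_eqI iffI)
      fix y assume "y \<in> P s"
      then have "y \<in> U0" "\<phi> y \<in> H" by (auto simp: P_def U_def H_def)
      then show "y \<in> \<psi> ` H" using inv by (intro image_eqI[of _ _ "\<phi> y"]) auto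
    next
      fix y assume "y \<in> \<psi> ` H"
      then obtain z where "z \<in> H" "y = \<psi> z" by blast
      then show "y \<in> P s" using \<psi>W[of z] by (auto simp: P_def H_def)
    qed
    have "convex H" unfolding H_def by (intro convex_Int W convex_halfspace_gt)
    then show "connected (P s)" unfolding P_im
      by (intro connected_continuous_image convex_connected continuous_on_subset[OF \<psi>_cont]) (use W(1) in \<open>auto simp: H_def\<close>)
    have "P s = U \<inter> \<phi> -` {z. (s *\<^sub>R a0) \<bullet> z > 0}" by (auto simp: P_def)
    then show "open (P s)"
      using continuous_open_preimage[OF continuous_on_subset[OF \<phi>_cont UU0] op_U open_halfspace_gt] by metis
    show "P s \<inter> cluster_boundary q \<Omega> = {}"
      using \<Sigma>U by (auto simp: P_def \<Sigma>_def[symmetric])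
    show "P s \<noteq> {}"
    proof -
      define e where "e = \<rho> / 2 / norm a0"
      have e: "0 < e" "e * norm a0 < \<rho>" using a0 \<rho> by (auto simp: e_def)
      define z where "z = \<phi> x + (s * e) *\<^sub>R a0"
      have "dist (\<phi> x) z = e * norm a0" using s e by (auto simp: z_def dist_norm)
      then have "z \<in> W" using e by (simp add: W_def)
      moreover have "(s *\<^sub>R a0) \<bullet> z = e * (a0 \<bullet> a0)" using s x0 by (auto simp: z_def inner_add_right)
      then have "(s *\<^sub>R a0) \<bullet> z > 0" using e a0 by simp
      ultimately have "z \<in> H" by (simp add: H_def)
      then show ?thesis unfolding P_im by blast
    qed
  qed
  obtain k1 where k1: "k1 \<in> {1..q}" "P 1 \<subseteq> \<Omega> k1" using P_cell[of 1] by blast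
  obtain k2 where k2: "k2 \<in> {1..q}" "P (- 1) \<subseteq> \<Omega> k2" using P_cell[of "- 1"] by blast
  have U_split: "y \<in> P 1 \<or> y \<in> P (- 1) \<or> y \<in> M" if "y \<in> U" for y
    using that MU[OF that] by (auto simp: P_def)
  have M_front: "M \<subseteq> frontier (\<Omega> i)" "M \<subseteq> frontier (\<Omega> j)"
    using MI reduced_boundary_subset_frontier[OF r1] ij unfolding interface_def by blast+
  have meet: "\<exists>y\<in>U. y \<in> \<Omega> l" if "l \<in> {i, j}" for l
  proof -
    have "x \<in> closure (\<Omega> l)" using M_front M(1) that by (auto simp: frontier_def)
    then show ?thesis using op_U xU by (auto simp: closure_iff_nhds_not_empty)
  qed
  have M_out: "y \<notin> \<Omega> l" if "y \<in> M" "l \<in> {i, j}" for y l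
    using that M_front op[of l] ij by (auto simp: frontier_def interior_open)
  have kk: "l = k1 \<or> l = k2" if l: "l \<in> {i, j}" for l
  proof -
    obtain y where y: "y \<in> U" "y \<in> \<Omega> l" using meet[OF l] by blast
    then have "y \<in> P 1 \<or> y \<in> P (- 1)" using U_split[OF y(1)] M_out[OF _ l] by blast
    then have "y \<in> \<Omega> k1 \<or> y \<in> \<Omega> k2" using k1 k2 by blast
    then show ?thesis using y(2) disj[of l k1] disj[of l k2] k1(1) k2(1) l ij by blast
  qed
  \<comment> \<open>The sign that puts \<open>\<Omega> i\<close> on the negative side, so that
    \<open>G\<close> points out of \<open>\<Omega> i\<close>.\<close>
  have "\<exists>s. (s = 1 \<or> s = - 1) \<and> P (- s) \<subseteq> \<Omega> i \<and> P s \<subseteq> \<Omega> j"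
  proof (cases "i = k1")
    case True
    then have "j = k2" using kk[of j] ij(3) by auto
    then show ?thesis using True k1 k2 by (intro exI[of _ "- 1"]) auto
  next
    case False
    then have "i = k2" "j = k1" using kk[of i] kk[of j] ij(3) by auto
    then show ?thesis using k1 k2 by (intro exI[of _ "1"]) auto
  qed
  then obtain s where s: "s = 1 \<or> s = - 1" "P (- s) \<subseteq> \<Omega> i" "P s \<subseteq> \<Omega> j" by blast
  define a where "a = s *\<^sub>R a0"
  have a: "a \<noteq> 0" using a0 s by (auto simp: a_def)
  define w where "w y = a \<bullet> \<phi> y" for y
  define G where "G y = (\<Sum>b\<in>Basis. (a \<bullet> D y b) *\<^sub>R b)" for y
  have w0: "w y = 0 \<longleftrightarrow> y \<in> M" if "y \<in> U" for y using MU[OF that] s(1) by (auto simp: w_def a_def)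
  have wneg: "w y < 0 \<longleftrightarrow> y \<in> P (- s)" and wpos: "0 < w y \<longleftrightarrow> y \<in> P s" if "y \<in> U" for y
    using that by (auto simp: w_def a_def P_def)
  have G: "G y \<bullet> h = a \<bullet> D y h" if "y \<in> U0" for y h
    unfolding G_def by (rule inner_linear_gradient[OF linD[OF that]])
  have Gdiff: "G differentiable (at y)" if y: "y \<in> U0" for y
  proof -
    have "(\<lambda>y. (a \<bullet> D y b) *\<^sub>R b) differentiable (at y)" for b
    proof -
      obtain F' where "((\<lambda>y. D y b) has_derivative F') (at y)" using D_diff[OF y, of b] by (auto simp: differentiable_def)
      then have "((\<lambda>y. (a \<bullet> D y b) *\<^sub>R b) has_derivative (\<lambda>h. (a \<bullet> F' h) *\<^sub>R b)) (at y)"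
        by (intro has_derivative_scaleR_left has_derivative_inner_right)
      then show ?thesis by (auto simp: differentiable_def)
    qed
    then show ?thesis unfolding G_def[abs_def] by (intro differentiable_sum) auto
  qed
  have "level_chart w G U"
    unfolding level_chart_def
  proof (intro conjI ballI op_U)
    fix y assume "y \<in> U"
    then have y: "y \<in> U0" using UU0 by auto
    have "(w has_derivative (\<lambda>h. a \<bullet> D y h)) (at y)"
      unfolding w_def[abs_def] by (intro has_derivative_inner_right D y)
    then show "(w has_derivative (\<lambda>h. G y \<bullet> h)) (at y)" using G[OF y] by simp
    show "G y \<noteq> 0"
    proof
      assume "G y = 0"
      obtain u where "D y u = a" using surjE[OF surj_D[OF y]] by metis
      then have "a \<bullet> a = 0" using G[OF y, of u] \<open>G y = 0\<close> by simp
      then show False using a by simp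
    qed
  next
    show "continuous_on U G"
      using Gdiff UU0 differentiable_imp_continuous_within by (intro continuous_at_imp_continuous_on) blast
  qed
  moreover have "\<forall>y\<in>U. G differentiable (at y)" using Gdiff UU0 by blast
  moreover have "\<Omega> i \<inter> U = {y \<in> U. w y < 0}"
    using U_split wneg s M_out[of _ i] disj[OF ij] by (auto simp: w_def) blast+
  moreover have "\<Omega> j \<inter> U = {y \<in> U. 0 < w y}"
    using U_split wpos s M_out[of _ j] disj[OF ij] by (auto simp: w_def) blast+
  moreover have "\<forall>k\<in>{1..q} - {i, j}. \<Omega> k \<inter> U = {}"
  proof (intro ballI)
    fix k assume k: "k \<in> {1..q} - {i, j}"
    have ki: "\<Omega> k \<inter> \<Omega> i = {}" using disj[of k i] k ij by simp
    have kj: "\<Omega> k \<inter> \<Omega> j = {}" using disj[of k j] k ij by simp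
    have 1: "\<Omega> k \<inter> U \<subseteq> M"
    proof
      fix y assume y: "y \<in> \<Omega> k \<inter> U"
      then have "y \<notin> P s" "y \<notin> P (- s)" using ki kj s(2,3) by auto
      then show "y \<in> M" using U_split[of y] y s(1) by auto
    qed
    \<comment> \<open>The third cell is confined to \<open>M\<close> within \<open>U\<close>; but
      \<open>M\<close> lies in the closure of \<open>\<Omega> i\<close>, which an open set disjoint
      from \<open>\<Omega> i\<close> does not meet.\<close>
    from ki have "\<Omega> k \<inter> closure (\<Omega> i) = {}"
      using op[of k] k by (simp add: open_Int_closure_eq_empty)
    moreover have "M \<subseteq> closure (\<Omega> i)" using M_front(1) by (auto simp: frontier_def)
    ultimately show "\<Omega> k \<inter> U = {}" using 1 by blast
  qed
  moreover have "cluster_boundary q \<Omega> \<inter> U = {y \<in> U. w y = 0}"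
    using w0 \<Sigma>U MU by (auto simp: \<Sigma>_def)
  moreover have "interface \<Omega> i j \<inter> U = {y \<in> U. w y = 0}"
    using w0 \<Sigma>U MU MI interface_subset_boundary[OF r1 ij(1), of j] by (auto simp: \<Sigma>_def)
  moreover have "\<exists>\<gamma>. \<gamma> 0 = y \<and> (\<gamma> has_vector_derivative u) (at 0) \<and> (\<forall>\<^sub>F t in at 0. \<gamma> t \<in> U \<and> w (\<gamma> t) = 0)"
    if y: "y \<in> U" "w y = 0" and u: "u \<bullet> G y = 0" for y u
  proof -
    have yU0: "y \<in> U0" using y UU0 by auto
    obtain D' where D': "(\<psi> has_derivative D') (at (\<phi> y))" "\<And>u. D' (D y u) = u" using \<psi>D[OF yU0] by blast
    \<comment> \<open>A straight line within the hyperplane of the chart, pulled back; its velocity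
      in the chart is the image of \<open>u\<close>.\<close>
    define \<gamma> where "\<gamma> t = \<psi> (\<phi> y + t *\<^sub>R D y u)" for t
    have "(\<psi> has_derivative D') (at (\<phi> y + 0 *\<^sub>R D y u))" using D' by simp
    then have "(\<gamma> has_derivative (\<lambda>t. D' (t *\<^sub>R D y u))) (at 0)"
      unfolding \<gamma>_def
      by (rule has_derivative_compose[where f = "\<lambda>t. \<phi> y + t *\<^sub>R D y u" and g = \<psi>, rotated])
        (auto intro!: derivative_eq_intros)
    moreover have "D' (t *\<^sub>R D y u) = t *\<^sub>R u" for t
      using has_derivative_linear[OF D'(1)] D'(2) by (simp add: linear_cmul)
    ultimately have "(\<gamma> has_vector_derivative u) (at 0)" by (simp add: has_vector_derivative_def)
    moreover have "\<forall>\<^sub>F t in at 0. \<gamma> t \<in> U \<and> w (\<gamma> t) = 0"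
    proof -
      have "((\<lambda>t. \<phi> y + t *\<^sub>R D y u) \<longlongrightarrow> \<phi> y + 0 *\<^sub>R D y u) (at 0)" by (intro tendsto_intros)
      moreover have "\<phi> y + 0 *\<^sub>R D y u \<in> W" using y(1) by (simp add: U_def)
      ultimately have "\<forall>\<^sub>F t in at 0. \<phi> y + t *\<^sub>R D y u \<in> W" using W(2) topological_tendstoD by blast
      then show ?thesis
      proof eventually_elim
        case (elim t)
        have "a \<bullet> D y u = 0" using G[OF yU0, of u] u by (simp add: inner_commute)
        then have "a \<bullet> (\<phi> y + t *\<^sub>R D y u) = 0" using y(2) by (simp add: w_def inner_add_right)
        then show ?case using \<psi>W[OF elim] by (simp add: \<gamma>_def w_def)
      qed
    qed
    moreover have "\<gamma> 0 = y" using inv[OF yU0] by (simp add: \<gamma>_def)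
    ultimately show ?thesis by blast
  qed
  ultimately have "interface_chart q \<Omega> i j w G U" unfolding interface_chart_def by blast
  then show ?thesis using xU by blast
qed

lemma interface_chart_normal:
  fixes \<Omega> :: "nat \<Rightarrow> 'a::euclidean_space set"
  assumes cl: "cluster q \<Omega>" and i: "i \<in> {1..q}" and ch: "interface_chart q \<Omega> i j w G U" and y: "y \<in> U" "y \<in> interface \<Omega> i j"
  shows "interface_normal \<Omega> i j y = G y /\<^sub>R norm (G y)"
proof -
  have "\<Omega> i \<in> sets borel" using cl i by (auto simp: cluster_def)
  then show ?thesis
    unfolding interface_normal_def using ch y
    by (intro outer_normal_level_set[where U = U and w = w]) (auto simp: interface_chart_def interface_def)
qed

text \<open>Otherwise \<open>x\<close> lies in the reduced boundary of every cell on whose frontier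
  it lies. With two such cells it is on an interface. With only one, that cell fills a neighbourhood
  of \<open>x\<close> up to a null set, so every direction is admissible for the monotonicity lemma
  and no unit normal can exist.\<close>

lemma boundary_minus_interfaces:
  fixes \<Omega> :: "nat \<Rightarrow> 'a::euclidean_space set"
  assumes cl: "cluster q \<Omega>" and r1: "regular1 q \<Omega>"
  shows "cluster_boundary q \<Omega> - interfaces q \<Omega> \<subseteq> (\<Union>i\<in>{1..q}. frontier (\<Omega> i) - reduced_boundary (\<Omega> i))"
proof
  fix x assume x: "x \<in> cluster_boundary q \<Omega> - interfaces q \<Omega>"
  show "x \<in> (\<Union>i\<in>{1..q}. frontier (\<Omega> i) - reduced_boundary (\<Omega> i))"
  proof (rule ccontr)
    assume "\<not> ?thesis"
    then have red: "x \<in> reduced_boundary (\<Omega> k)" if "k \<in> {1..q}" "x \<in> frontier (\<Omega> k)" for k using that by blast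
    obtain i where i: "i \<in> {1..q}" "x \<in> frontier (\<Omega> i)" using x by (auto simp: cluster_boundary_def)
    have borel: "\<Omega> k \<in> sets borel" if "k \<in> {1..q}" for k using cl that by (auto simp: cluster_def)
    have only: "x \<notin> frontier (\<Omega> j)" if j: "j \<in> {1..q} - {i}" for j
    proof
      assume "x \<in> frontier (\<Omega> j)"
      then have "x \<in> interface \<Omega> i j" "x \<in> interface \<Omega> j i"
        using red i j by (auto simp: interface_def)
      moreover have "(i, j) \<in> index_pairs q \<or> (j, i) \<in> index_pairs q" using i j by (auto simp: index_pairs_def)
      ultimately show False using x by (auto simp: interfaces_def)
    qed
    have "open (- (\<Union>j\<in>{1..q} - {i}. closure (\<Omega> j)))" by (intro open_Compl closed_UN) auto
    moreover have "x \<in> - (\<Union>j\<in>{1..q} - {i}. closure (\<Omega> j))"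
    proof -
      have "x \<notin> closure (\<Omega> j)" if j: "j \<in> {1..q} - {i}" for j
      proof
        assume "x \<in> closure (\<Omega> j)"
        moreover have "open (\<Omega> j)" using r1 j by (auto simp: regular1_def)
        ultimately have "x \<in> \<Omega> j" using only[OF j] by (auto simp: frontier_def interior_open)
        moreover have "\<Omega> j \<inter> \<Omega> i = {}" using cl i j by (auto simp: cluster_def disjoint_family_on_def)
        then have "\<Omega> j \<inter> closure (\<Omega> i) = {}" using \<open>open (\<Omega> j)\<close> by (simp add: open_Int_closure_eq_empty)
        ultimately show False using i(2) by (auto simp: frontier_def)
      qed
      then show ?thesis by blast
    qed
    ultimately obtain r where r: "0 < r" "ball x r \<subseteq> - (\<Union>j\<in>{1..q} - {i}. closure (\<Omega> j))"
      by (rule openE)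
    define Z where "Z = UNIV - (\<Union>i\<in>{1..q}. \<Omega> i)"
    have Zb: "Z \<in> sets borel" unfolding Z_def using borel by (intro sets.Diff sets.finite_UN) auto
    have Z0: "emeasure lborel Z = 0" using cl by (simp add: cluster_def Z_def)
    have full: "y \<in> \<Omega> i" if "y \<in> ball x r" "y \<notin> Z" for y
      using that r(2) closure_subset by (fastforce simp: Z_def)
    obtain v where v: "has_outer_normal (\<Omega> i) x v" using red[OF i] by (auto simp: reduced_boundary_def)
    have "0 \<le> u \<bullet> v" for u
    proof (rule outer_normal_monotone_direction[OF v borel[OF i(1)]])
      show "0 < r / 2" using r by simp
      then show "0 < r / 2 / (norm u + 1)" by (simp add: add_nonneg_pos)
      fix h assume h: "0 < h" "h < r / 2 / (norm u + 1)"
      have hu: "norm (h *\<^sub>R u) < r / 2"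
      proof -
        have "h * (norm u + 1) < r / 2" using h(2) by (simp only: pos_less_divide_eq[OF add_nonneg_pos[OF norm_ge_zero zero_less_one]])
        then show ?thesis using h by (simp add: distrib_left)
      qed
      \<comment> \<open>Near \<open>x\<close>, the point \<open>y - h *\<^sub>R u\<close> misses the
        cell only if it falls into \<open>Z\<close>, that is, if \<open>y\<close> lies in a
        translate of a null set.\<close>
      have "(+) (h *\<^sub>R u) ` Z \<in> null_sets lborel"
        using Zb Z0 image_plus_borel[OF Zb] by (auto simp: null_sets_def emeasure_lborel_translate)
      then have "AE y in lborel. y \<notin> (+) (h *\<^sub>R u) ` Z" by (rule AE_not_in)
      then show "AE y in lborel. y \<in> ball x (r / 2) \<longrightarrow> y \<in> \<Omega> i \<longrightarrow> y - h *\<^sub>R u \<in> \<Omega> i"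
      proof eventually_elim
        case (elim y)
        show ?case
        proof (intro impI full)
          assume y: "y \<in> ball x (r / 2)"
          have "dist x (y - h *\<^sub>R u) \<le> dist x y + norm (h *\<^sub>R u)"
            using dist_triangle[of x "y - h *\<^sub>R u" y] by (simp add: dist_norm)
          then show "y - h *\<^sub>R u \<in> ball x r" using y hu by auto
          show "y - h *\<^sub>R u \<notin> Z"
            using elim by (metis add_diff_cancel_left' diff_add_cancel image_eqI add.commute)
        qed
      qed
    qed
    from this[of "- v"] have "v \<bullet> v \<le> 0" by simp
    then have "v = 0" using inner_ge_zero[of v] by (simp add: antisym)
    then show False using v by (simp add: has_outer_normal_def)
  qed
qed

section \<open>The flux through the interfaces\<close>

text \<open>\<open>lam\<close> is an arbitrary family of numbers here; that it is the Lagrange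
  multiplier enters through the hypothesis \<open>stationary_cluster\<close> of the lemmas on the
  first variation.\<close>

locale smooth_cluster =
  fixes q :: nat and \<Omega> :: "nat \<Rightarrow> (real ^ 'n) set" and \<kappa> :: real and lam :: "nat \<Rightarrow> real"
  assumes dim: "2 \<le> CARD('n)" and cl: "cluster q \<Omega>" and r1: "regular1 q \<Omega>" and r2: "regular2 q \<Omega>"
    and bdd: "bounded_cluster q \<Omega>"
    and \<kappa>: "flat_density \<kappa> (surface_outer :: (real ^ 'n) set \<Rightarrow> ennreal)"
begin

abbreviation "\<Sigma> \<equiv> cluster_boundary q \<Omega>"
abbreviation "\<Sigma>1 \<equiv> interfaces q \<Omega>"
abbreviation "nrm \<equiv> interface_normal \<Omega>"

definition multiplier :: "real ^ 'n \<Rightarrow> real" where "multiplier y = (\<Sum>k\<in>{1..q}. lam k * indicator (\<Omega> k) y)"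

definition flux :: "real ^ 'n \<Rightarrow> (real ^ 'n \<Rightarrow> real) \<Rightarrow> real" where
  "flux v g = (\<Sum>(i, j)\<in>index_pairs q. (lam i - lam j) *
      (LINT p|surface_measure. indicator (interface \<Omega> i j) p * (g p * (v \<bullet> nrm i j p))))"

text \<open>The multiplier jumps by \<open>lam i - lam j\<close> across \<open>interface \<Omega> i j\<close>, so Gauss-Green makes the flux the
  limit of these difference quotients; unlike derivatives, they need no smoothness of \<open>g\<close>.\<close>

definition difference_flux :: "real ^ 'n \<Rightarrow> (real ^ 'n \<Rightarrow> real) \<Rightarrow> nat \<Rightarrow> real" where
  "difference_flux v g N = \<kappa> * (real N * (LINT y|lborel. multiplier y * (g (y + v /\<^sub>R real N) - g y)))"

lemma cell_borel [measurable]: "k \<in> {1..q} \<Longrightarrow> \<Omega> k \<in> sets borel"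
  using cl by (auto simp: cluster_def)

lemma cell_disjoint: "k \<in> {1..q} \<Longrightarrow> l \<in> {1..q} \<Longrightarrow> k \<noteq> l \<Longrightarrow> \<Omega> k \<inter> \<Omega> l = {}"
  using cl by (auto simp: cluster_def disjoint_family_on_def)

lemma finite_index_pairs: "finite (index_pairs q)"
  by (rule finite_subset[of _ "{1..q} \<times> {1..q}"]) (auto simp: index_pairs_def)

lemma index_pairsD: "(i, j) \<in> index_pairs q \<Longrightarrow> i \<in> {1..q} \<and> j \<in> {1..q} \<and> i \<noteq> j \<and> i < j"
  by (auto simp: index_pairs_def)

lemma closed_boundary: "closed \<Sigma>"
  unfolding cluster_boundary_def by (intro closed_UN) auto

lemma compact_boundary: "compact \<Sigma>"
  using bdd closed_boundary by (simp add: bounded_cluster_def compact_eq_bounded_closed)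

lemma interface_openin:
  assumes "(i, j) \<in> index_pairs q"
  shows "openin (top_of_set \<Sigma>) (interface \<Omega> i j)"
proof -
  have "locally_finite_union_of (\<lambda>M. embedded_submanifold C_inf 1 M \<and> openin (top_of_set \<Sigma>) M) (interface \<Omega> i j)"
    using r2 index_pairsD[OF assms] unfolding regular2_def by simp
  then obtain \<M> where "\<forall>M\<in>\<M>. openin (top_of_set \<Sigma>) M" "interface \<Omega> i j = \<Union>\<M>"
    unfolding locally_finite_union_of_def by blast
  then show ?thesis by auto
qed

lemma interface_borel [measurable]:
  assumes "(i, j) \<in> index_pairs q"
  shows "interface \<Omega> i j \<in> sets borel"
proof -
  obtain T where "open T" "interface \<Omega> i j = \<Sigma> \<inter> T"
    using interface_openin[OF assms] by (auto simp: openin_open)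
  then show ?thesis using closed_boundary by (auto intro!: sets.Int borel_closed borel_open)
qed

lemma interface_finite:
  assumes "(i, j) \<in> index_pairs q"
  shows "emeasure surface_measure (interface \<Omega> i j) < \<infinity>"
proof -
  have "surface_outer (interface \<Omega> i j) \<le> surface_outer (reduced_boundary (\<Omega> i))"
    by (intro hausdorff_outer_mono) (auto simp: interface_def)
  also have "\<dots> < \<infinity>" using cl index_pairsD[OF assms] by (auto simp: cluster_def)
  finally show ?thesis using assms by (simp add: emeasure_hausdorff_measure interface_borel)
qed

lemma chart:
  assumes "(i, j) \<in> index_pairs q" "x \<in> interface \<Omega> i j"
  obtains w G U where "x \<in> U" "interface_chart q \<Omega> i j w G U"
    "\<And>y. y \<in> U \<Longrightarrow> y \<in> interface \<Omega> i j \<Longrightarrow> nrm i j y = G y /\<^sub>R norm (G y)"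
proof -
  note ij = index_pairsD[OF assms(1)]
  obtain w G U where *: "x \<in> U" "interface_chart q \<Omega> i j w G U"
    using interface_chart_exists[OF cl r1 r2 _ _ _ assms(2)] ij by blast
  have "nrm i j y = G y /\<^sub>R norm (G y)" if "y \<in> U" "y \<in> interface \<Omega> i j" for y
    using interface_chart_normal[OF cl _ *(2) that] ij by blast
  with * show thesis by (rule that)
qed

lemma normal_unit: "(i, j) \<in> index_pairs q \<Longrightarrow> x \<in> interface \<Omega> i j \<Longrightarrow> norm (nrm i j x) = 1"
proof -
  assume a: "(i, j) \<in> index_pairs q" "x \<in> interface \<Omega> i j"
  obtain w G U where *: "x \<in> U" "interface_chart q \<Omega> i j w G U" "nrm i j x = G x /\<^sub>R norm (G x)"
    using chart[OF a] a(2) by metis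
  then have "G x \<noteq> 0" by (auto simp: interface_chart_def level_chart_def)
  then show ?thesis using * by simp
qed

lemma normal_continuous:
  assumes ij: "(i, j) \<in> index_pairs q"
  shows "continuous_on (interface \<Omega> i j) (nrm i j)"
  unfolding continuous_on_eq_continuous_within
proof
  fix x assume x: "x \<in> interface \<Omega> i j"
  obtain w G U where *: "x \<in> U" "interface_chart q \<Omega> i j w G U"
    "\<And>y. y \<in> U \<Longrightarrow> y \<in> interface \<Omega> i j \<Longrightarrow> nrm i j y = G y /\<^sub>R norm (G y)"
    using chart[OF ij x] by metis
  have U: "open U" "continuous_on U G" "\<And>y. y \<in> U \<Longrightarrow> G y \<noteq> 0"
    using *(2) by (auto simp: interface_chart_def level_chart_def)
  have "continuous_on U (\<lambda>y. G y /\<^sub>R norm (G y))"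
    using U by (intro continuous_intros) auto
  then have "continuous (at x within interface \<Omega> i j) (\<lambda>y. G y /\<^sub>R norm (G y))"
    using U(1) *(1) continuous_on_eq_continuous_at continuous_at_imp_continuous_at_within by blast
  moreover have "\<forall>\<^sub>F y in at x within interface \<Omega> i j. G y /\<^sub>R norm (G y) = nrm i j y"
    using eventually_at_topological[of _ x "interface \<Omega> i j"] U(1) *(1,3) by auto
  ultimately show "continuous (at x within interface \<Omega> i j) (nrm i j)"
    unfolding continuous_within using *(1,3) x by (simp add: Lim_transform_eventually)
qed

lemma interface_integrable:
  fixes f :: "real ^ 'n \<Rightarrow> 'b::{banach, second_countable_topology}"
  assumes ij: "(i, j) \<in> index_pairs q" and f: "continuous_on (interface \<Omega> i j) f"
    and B: "\<And>p. p \<in> interface \<Omega> i j \<Longrightarrow> norm (f p) \<le> B"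
  shows "integrable surface_measure (\<lambda>p. indicator (interface \<Omega> i j) p *\<^sub>R f p)"
proof (rule Bochner_Integration.integrable_bound)
  show "integrable surface_measure (\<lambda>p. B * indicator (interface \<Omega> i j) p)"
    using interface_finite[OF ij] interface_borel[OF ij] by (intro integrable_mult_right integrable_real_indicator) simp_all
  have "f \<in> borel_measurable (restrict_space borel (interface \<Omega> i j))"
    by (rule borel_measurable_continuous_on_restrict[OF f])
  then show "(\<lambda>p. indicator (interface \<Omega> i j) p *\<^sub>R f p) \<in> borel_measurable surface_measure"
    using interface_borel[OF ij] by (subst (asm) borel_measurable_restrict_space_iff) auto
  show "AE p in surface_measure. norm (indicator (interface \<Omega> i j) p *\<^sub>R f p) \<le> norm (B * indicator (interface \<Omega> i j) p)"
    using B by (auto simp: indicator_def intro!: AE_I2 order_trans[OF B abs_ge_self])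
qed

lemma flux_integrable:
  assumes ij: "(i, j) \<in> index_pairs q" and g: "continuous_on UNIV g" and B: "\<And>p. \<bar>g p\<bar> \<le> B"
  shows "integrable surface_measure (\<lambda>p. indicator (interface \<Omega> i j) p * (g p * (v \<bullet> nrm i j p)))"
proof -
  have "continuous_on (interface \<Omega> i j) (\<lambda>p. g p * (v \<bullet> nrm i j p))"
    by (intro continuous_intros normal_continuous[OF ij] continuous_on_subset[OF g]) simp
  moreover have "norm (g p * (v \<bullet> nrm i j p)) \<le> B * norm v" if "p \<in> interface \<Omega> i j" for p
  proof -
    have "\<bar>v \<bullet> nrm i j p\<bar> \<le> norm v" using Cauchy_Schwarz_ineq2[of v "nrm i j p"] normal_unit[OF ij that] by simp
    moreover have "0 \<le> B" using B[of p] by linarith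
    ultimately show ?thesis using B[of p] by (simp add: abs_mult mult_mono)
  qed
  ultimately show ?thesis
    using interface_integrable[OF ij, of "\<lambda>p. g p * (v \<bullet> nrm i j p)" "B * norm v"] by simp
qed

lemma multiplier_measurable [measurable]: "multiplier \<in> borel_measurable borel"
  unfolding multiplier_def by measurable

lemma multiplier_bound: "\<bar>multiplier y\<bar> \<le> (\<Sum>k\<in>{1..q}. \<bar>lam k\<bar>)"
  unfolding multiplier_def by (rule order_trans[OF sum_abs], intro sum_mono) (auto simp: indicator_def)

lemma multiplier_cell: "y \<in> \<Omega> k \<Longrightarrow> k \<in> {1..q} \<Longrightarrow> multiplier y = lam k"
proof -
  assume y: "y \<in> \<Omega> k" "k \<in> {1..q}"
  have "indicator (\<Omega> l) y = (if l = k then 1 else 0 :: real)" if "l \<in> {1..q}" for l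
    using cell_disjoint[OF that y(2)] y by (auto simp: indicator_def)
  then have "multiplier y = (\<Sum>l\<in>{1..q}. if l = k then lam l else 0)"
    unfolding multiplier_def by (intro sum.cong) auto
  then show ?thesis using y(2) by simp
qed

lemma difference_integrable:
  fixes f g :: "real ^ 'n \<Rightarrow> real"
  assumes f: "f \<in> borel_measurable borel" "\<And>y. \<bar>f y\<bar> \<le> C" and g: "continuous_on UNIV g" "\<And>y. y \<notin> ball z r \<Longrightarrow> g y = 0"
  shows "integrable lborel (\<lambda>y. f y * (g (y + a) - g y))"
proof -
  have "integrable lborel (\<lambda>y. f (- a + y) * g y)"
    by (rule compact_support_integrable[OF g, where C = C]) (use f in measurable)
  then have "integrable lborel (\<lambda>y. f y * g (y + a))"
    using lborel_integral_translate(2)[of "\<lambda>y. f (- a + y) * g y" a] f(1) borel_measurable_continuous_onI[OF g(1)]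
    by (simp add: add.commute)
  moreover have "integrable lborel (\<lambda>y. f y * g y)" by (rule compact_support_integrable[OF g f])
  ultimately show ?thesis by (simp add: right_diff_distrib)
qed

lemma difference_integral_zero:
  fixes g :: "real ^ 'n \<Rightarrow> real"
  assumes g: "continuous_on UNIV g" "\<And>y. y \<notin> ball z r \<Longrightarrow> g y = 0"
  shows "(LINT y|lborel. c * (g (y + a) - g y)) = 0"
proof -
  have gi: "integrable lborel g" using compact_support_integrable[OF g, where f = "\<lambda>_. 1" and C = 1] by simp
  have "g \<in> borel_measurable borel" by (rule borel_measurable_continuous_onI[OF g(1)])
  from lborel_integral_translate[OF this, of a] gi show ?thesis by (simp add: add.commute)
qed

lemma difference_flux_add:
  assumes g: "continuous_on UNIV g" "\<And>y. y \<notin> ball z r \<Longrightarrow> g y = 0"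
    and h: "continuous_on UNIV h" "\<And>y. y \<notin> ball z r \<Longrightarrow> h y = 0"
  shows "difference_flux v (\<lambda>y. g y + h y) N = difference_flux v g N + difference_flux v h N"
proof -
  have "(LINT y|lborel. multiplier y * ((g (y + v /\<^sub>R real N) + h (y + v /\<^sub>R real N)) - (g y + h y)))
      = (LINT y|lborel. multiplier y * (g (y + v /\<^sub>R real N) - g y) + multiplier y * (h (y + v /\<^sub>R real N) - h y))"
    by (intro Bochner_Integration.integral_cong) (auto simp: algebra_simps)
  also have "\<dots> = (LINT y|lborel. multiplier y * (g (y + v /\<^sub>R real N) - g y)) + (LINT y|lborel. multiplier y * (h (y + v /\<^sub>R real N) - h y))"
    by (intro Bochner_Integration.integral_add difference_integrable[OF multiplier_measurable multiplier_bound g] difference_integrable[OF multiplier_measurable multiplier_bound h])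
  finally show ?thesis by (simp add: difference_flux_def distrib_left)
qed

lemma flux_add:
  assumes g: "continuous_on UNIV g" "\<And>y. \<bar>g y\<bar> \<le> B" and h: "continuous_on UNIV h" "\<And>y. \<bar>h y\<bar> \<le> B'"
  shows "flux v (\<lambda>y. g y + h y) = flux v g + flux v h"
  unfolding flux_def sum.distrib[symmetric]
proof (intro sum.cong refl, clarify)
  fix i j assume ij: "(i, j) \<in> index_pairs q"
  have "(LINT p|surface_measure. indicator (interface \<Omega> i j) p * ((g p + h p) * (v \<bullet> nrm i j p)))
     = (LINT p|surface_measure. indicator (interface \<Omega> i j) p * (g p * (v \<bullet> nrm i j p)) + indicator (interface \<Omega> i j) p * (h p * (v \<bullet> nrm i j p)))"
    by (intro Bochner_Integration.integral_cong) (auto simp: algebra_simps)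
  also have "\<dots> = (LINT p|surface_measure. indicator (interface \<Omega> i j) p * (g p * (v \<bullet> nrm i j p)))
     + (LINT p|surface_measure. indicator (interface \<Omega> i j) p * (h p * (v \<bullet> nrm i j p)))"
    by (intro Bochner_Integration.integral_add flux_integrable[OF ij g] flux_integrable[OF ij h])
  finally show "(lam i - lam j) * (LINT p|surface_measure. indicator (interface \<Omega> i j) p * ((g p + h p) * (v \<bullet> nrm i j p)))
     = (lam i - lam j) * (LINT p|surface_measure. indicator (interface \<Omega> i j) p * (g p * (v \<bullet> nrm i j p)))
     + (lam i - lam j) * (LINT p|surface_measure. indicator (interface \<Omega> i j) p * (h p * (v \<bullet> nrm i j p)))"
    by (simp add: distrib_left)
qed

lemma difference_support:
  assumes N: "norm v / r < real N" and r: "0 < r" and y: "y \<notin> ball x (2 * r)" and supp: "\<And>y. y \<notin> ball x r \<Longrightarrow> g y = (0 :: real)"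
  shows "g (y + v /\<^sub>R real N) - g y = 0"
proof -
  have "0 \<le> norm v / r" using r by simp
  then have "0 < real N" using N by linarith
  then have "norm (v /\<^sub>R real N) < r" using N r by (simp add: field_simps)
  moreover have "dist x y \<le> dist x (y + v /\<^sub>R real N) + norm (v /\<^sub>R real N)"
    using dist_triangle[of x y "y + v /\<^sub>R real N"] by (simp add: dist_norm)
  ultimately have "y + v /\<^sub>R real N \<notin> ball x r" "y \<notin> ball x r" using y r by auto
  then show ?thesis using supp by simp
qed

text \<open>Away from the boundary the multiplier is constant, and increments of a compactly
  supported function integrate to zero. At an interface point it is almost everywhere a constant
  plus the jump times the indicator of \<open>\<Omega> i\<close>, so sliding
  \<open>\<Omega> i\<close> gives the limit.\<close>

lemma local_flux:
  assumes x: "x \<notin> \<Sigma> - \<Sigma>1"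
  shows "\<exists>r>0. \<forall>g. continuous_on UNIV g \<longrightarrow> (\<forall>y. y \<notin> ball x r \<longrightarrow> g y = 0) \<longrightarrow> difference_flux v g \<longlonglongrightarrow> flux v g"
proof (cases "x \<in> \<Sigma>")
  case False
  then obtain r0 where r0: "0 < r0" "ball x r0 \<subseteq> - \<Sigma>" using closed_boundary by (metis ComplI openE open_Compl)
  have "\<exists>k\<in>{1..q}. ball x r0 \<subseteq> \<Omega> k"
    using r0 by (intro connected_in_cell[OF cl]) auto
  then obtain k where k: "k \<in> {1..q}" "ball x r0 \<subseteq> \<Omega> k" by blast
  define r where "r = r0 / 2"
  have r: "0 < r" using r0 by (simp add: r_def)
  have "difference_flux v g \<longlonglongrightarrow> flux v g" if g: "continuous_on UNIV g" "\<And>y. y \<notin> ball x r \<Longrightarrow> g y = 0" for g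
  proof -
    have "flux v g = 0"
      unfolding flux_def
    proof (intro sum.neutral ballI, clarify)
      fix i j assume ij: "(i, j) \<in> index_pairs q"
      have "indicator (interface \<Omega> i j) p * (g p * (v \<bullet> nrm i j p)) = 0" for p
      proof (cases "p \<in> ball x r")
        case True
        then have "p \<in> ball x r0" using r0(1) by (auto simp: r_def)
        then have "p \<notin> \<Sigma>" using r0(2) by blast
        then have "p \<notin> interface \<Omega> i j" using interface_subset_boundary[OF r1, of i j] index_pairsD[OF ij] by blast
        then show ?thesis by simp
      qed (simp add: g(2))
      then have eq0: "(\<lambda>p. indicator (interface \<Omega> i j) p * (g p * (v \<bullet> nrm i j p))) = (\<lambda>_. 0 :: real)"
        by (rule ext)
      show "(lam i - lam j) * (LINT p|surface_measure. indicator (interface \<Omega> i j) p * (g p * (v \<bullet> nrm i j p))) = 0"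
        unfolding eq0 by simp
    qed
    moreover have "\<forall>\<^sub>F N in sequentially. 0 = difference_flux v g N"
    proof -
      obtain N0 :: nat where N0: "norm v / r < real N0" using reals_Archimedean2 by blast
      show ?thesis using eventually_ge_at_top[of N0]
      proof eventually_elim
        case (elim N)
        then have N: "norm v / r < real N" using N0 by linarith
        have "multiplier y * (g (y + v /\<^sub>R real N) - g y) = lam k * (g (y + v /\<^sub>R real N) - g y)" for y
        proof (cases "y \<in> ball x (2 * r)")
          case True
          then show ?thesis using multiplier_cell[of y k] k by (auto simp: r_def)
        next
          case False
          then show ?thesis using difference_support[OF N r False, of g] g(2) by simp
        qed
        then have "(LINT y|lborel. multiplier y * (g (y + v /\<^sub>R real N) - g y)) = (LINT y|lborel. lam k * (g (y + v /\<^sub>R real N) - g y))"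
          by (intro Bochner_Integration.integral_cong refl)
        also have "\<dots> = 0" by (rule difference_integral_zero[OF g])
        finally show ?case by (simp add: difference_flux_def)
      qed
    qed
    then have "difference_flux v g \<longlonglongrightarrow> 0" by (rule Lim_transform_eventually[OF tendsto_const])
    ultimately show ?thesis by simp
  qed
  then show ?thesis using r by blast
next
  case True
  then have "x \<in> \<Sigma>1" using x by blast
  then obtain i j where ij: "(i, j) \<in> index_pairs q" "x \<in> interface \<Omega> i j" by (auto simp: interfaces_def)
  obtain w G U where *: "x \<in> U" "interface_chart q \<Omega> i j w G U"
    "\<And>y. y \<in> U \<Longrightarrow> y \<in> interface \<Omega> i j \<Longrightarrow> nrm i j y = G y /\<^sub>R norm (G y)"
    using chart[OF ij] by metis
  note ij' = index_pairsD[OF ij(1)]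
  have ch: "level_chart w G U" "\<Omega> i \<inter> U = {y \<in> U. w y < 0}" "\<Omega> j \<inter> U = {y \<in> U. 0 < w y}"
    "\<forall>k\<in>{1..q} - {i, j}. \<Omega> k \<inter> U = {}" "interface \<Omega> i j \<inter> U = {y \<in> U. w y = 0}"
    using *(2) by (auto simp: interface_chart_def)
  have op: "open U" using ch(1) by (simp add: level_chart_def)
  obtain r0 where r0: "0 < r0" "ball x r0 \<subseteq> U" using op *(1) by (rule openE)
  have "\<Omega> i \<in> sets borel" using ij' cell_borel by blast
  note slide = sliding[OF dim \<kappa> ch(1) *(1) this ch(2) interface_borel[OF ij(1)] ch(5), of v]
  obtain r' where r': "0 < r'" and slide': "\<forall>g. continuous_on UNIV g \<longrightarrow> (\<forall>y. y \<notin> ball x r' \<longrightarrow> g y = 0) \<longrightarrow>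
     (\<lambda>N. \<kappa> * (real N * (LINT y|lborel. indicator (\<Omega> i) y * (g (y + v /\<^sub>R real N) - g y))))
       \<longlonglongrightarrow> (LINT p|surface_measure. indicator (interface \<Omega> i j) p * (g p * (v \<bullet> (G p /\<^sub>R norm (G p)))))"
  proof -
    from slide show thesis by (elim exE conjE) (rule that)
  qed
  define r where "r = min r' (r0 / 2)"
  have r: "0 < r" "r \<le> r'" "2 * r \<le> r0" using r' r0 by (auto simp: r_def)
  \<comment> \<open>Another pair involves a cell that misses the open set \<open>U\<close>; its
    closure, and with it that interface, misses \<open>U\<close> too.\<close>
  have other: "interface \<Omega> k l \<inter> U = {}" if kl: "(k, l) \<in> index_pairs q" "(k, l) \<noteq> (i, j)" for k l
  proof -
    have "\<exists>m\<in>{k, l}. m \<notin> {i, j}" using kl(2) index_pairsD[OF kl(1)] ij' by auto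
    then obtain m where m: "m \<in> {k, l}" "m \<in> {1..q} - {i, j}" using index_pairsD[OF kl(1)] by blast
    then have "\<Omega> m \<inter> U = {}" using ch(4) by blast
    then have "closure (\<Omega> m) \<inter> U = {}" using op by (metis Int_commute open_Int_closure_eq_empty)
    moreover have "interface \<Omega> k l \<subseteq> closure (\<Omega> m)"
      using m reduced_boundary_subset_frontier[OF r1, of m] by (auto simp: interface_def frontier_def)
    ultimately show ?thesis by blast
  qed
  have "difference_flux v g \<longlonglongrightarrow> flux v g" if g: "continuous_on UNIV g" "\<And>y. y \<notin> ball x r \<Longrightarrow> g y = 0" for g
  proof -
    define L where "L = (LINT p|surface_measure. indicator (interface \<Omega> i j) p * (g p * (v \<bullet> (G p /\<^sub>R norm (G p)))))"
    have ballU: "y \<in> U" if "y \<in> ball x r" for y using that r r0 by auto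
    have "flux v g = (\<Sum>ab\<in>index_pairs q. if ab = (i, j) then (lam i - lam j) * L else 0)"
      unfolding flux_def
    proof (intro sum.cong refl, clarify)
      fix k l assume kl: "(k, l) \<in> index_pairs q"
      show "(lam k - lam l) * (LINT p|surface_measure. indicator (interface \<Omega> k l) p * (g p * (v \<bullet> nrm k l p)))
          = (if (k, l) = (i, j) then (lam i - lam j) * L else 0)"
      proof (cases "(k, l) = (i, j)")
        case True
        have "indicator (interface \<Omega> i j) p * (g p * (v \<bullet> nrm i j p)) = indicator (interface \<Omega> i j) p * (g p * (v \<bullet> (G p /\<^sub>R norm (G p))))" for p
        proof (cases "p \<in> interface \<Omega> i j \<and> p \<in> ball x r")
          case True
          then show ?thesis using *(3)[of p] ballU[of p] by simp
        next
          case False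
          then show ?thesis using g(2)[of p] by (cases "p \<in> interface \<Omega> i j") auto
        qed
        then have "(LINT p|surface_measure. indicator (interface \<Omega> i j) p * (g p * (v \<bullet> nrm i j p))) = L"
          unfolding L_def by (intro Bochner_Integration.integral_cong refl)
        then show ?thesis using True by simp
      next
        case False
        have "indicator (interface \<Omega> k l) p * (g p * (v \<bullet> nrm k l p)) = 0" for p
        proof (cases "p \<in> interface \<Omega> k l")
          case True
          then have "p \<notin> ball x r" using other[OF kl False] ballU[of p] by blast
          then show ?thesis using g(2)[of p] by simp
        qed simp
        then have eq0: "(\<lambda>p. indicator (interface \<Omega> k l) p * (g p * (v \<bullet> nrm k l p))) = (\<lambda>_. 0 :: real)"
          by (rule ext)
        show ?thesis unfolding eq0 using False by auto
      qed
    qed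
    then have Sv: "flux v g = (lam i - lam j) * L" using ij(1) finite_index_pairs by simp
    obtain N0 :: nat where N0: "norm v / r < real N0" using reals_Archimedean2 by blast
    have "\<forall>\<^sub>F N in sequentially. (lam i - lam j) * (\<kappa> * (real N * (LINT y|lborel. indicator (\<Omega> i) y * (g (y + v /\<^sub>R real N) - g y)))) = difference_flux v g N"
      using eventually_ge_at_top[of N0]
    proof eventually_elim
      case (elim N)
      then have N: "norm v / r < real N" using N0 by linarith
      define d where "d y = g (y + v /\<^sub>R real N) - g y" for y
      have [measurable]: "d \<in> borel_measurable borel"
        unfolding d_def using borel_measurable_continuous_onI[OF g(1)] by measurable
      have [measurable]: "\<Omega> i \<in> sets borel" using ij' cell_borel by blast
      have Z: "AE y in lborel. y \<notin> UNIV - (\<Union>i\<in>{1..q}. \<Omega> i)"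
      proof (rule AE_not_in)
        have "UNIV - (\<Union>i\<in>{1..q}. \<Omega> i) \<in> sets borel" by (intro sets.Diff sets.finite_UN) (auto simp: cell_borel)
        then show "UNIV - (\<Union>i\<in>{1..q}. \<Omega> i) \<in> null_sets lborel" using cl by (auto simp: cluster_def null_sets_def)
      qed
      \<comment> \<open>The increment \<open>d\<close> vanishes outside the doubled ball, and this
        ball lies in \<open>U\<close>, where almost every point is in \<open>\<Omega> i\<close> or
        \<open>\<Omega> j\<close>.\<close>
      have "(LINT y|lborel. multiplier y * d y) = (LINT y|lborel. lam j * d y + (lam i - lam j) * (indicator (\<Omega> i) y * d y))"
      proof (rule integral_cong_AE)
        show "AE y in lborel. multiplier y * d y = lam j * d y + (lam i - lam j) * (indicator (\<Omega> i) y * d y)"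
          using Z
        proof eventually_elim
          case (elim y)
          show ?case
          proof (cases "y \<in> ball x (2 * r)")
            case True
            then have "y \<in> U" using r r0 by auto
            then have "y \<in> \<Omega> i \<or> y \<in> \<Omega> j" using elim ch(4) by blast
            then show ?thesis
            proof
              assume "y \<in> \<Omega> i"
              then show ?thesis using multiplier_cell[of y i] ij' by (simp add: algebra_simps)
            next
              assume yj: "y \<in> \<Omega> j"
              then have "y \<notin> \<Omega> i" using cell_disjoint[of i j] ij' by blast
              then show ?thesis using multiplier_cell[OF yj] ij' by simp
            qed
          next
            case False
            then show ?thesis using difference_support[OF N r(1) False, of g] g(2) by (simp add: d_def)
          qed
        qed
      qed measurable
      also have "\<dots> = (LINT y|lborel. lam j * d y) + (LINT y|lborel. (lam i - lam j) * (indicator (\<Omega> i) y * d y))"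
      proof (intro Bochner_Integration.integral_add integrable_mult_right)
        show "integrable lborel d"
        proof -
          have "integrable lborel (\<lambda>y. 1 * (g (y + v /\<^sub>R real N) - g y))"
            by (rule difference_integrable[OF _ _ g, where C = 1]) auto
          then show ?thesis by (simp add: d_def[abs_def])
        qed
        show "integrable lborel (\<lambda>y. indicator (\<Omega> i) y * d y)"
          unfolding d_def by (rule difference_integrable[OF _ _ g, where C = 1]) (auto simp: indicator_def)
      qed
      also have "(LINT y|lborel. lam j * d y) = 0" unfolding d_def by (rule difference_integral_zero[OF g])
      also have "0 + (LINT y|lborel. (lam i - lam j) * (indicator (\<Omega> i) y * d y))
          = (lam i - lam j) * (LINT y|lborel. indicator (\<Omega> i) y * d y)" by simp
      finally have "(LINT y|lborel. multiplier y * d y) = (lam i - lam j) * (LINT y|lborel. indicator (\<Omega> i) y * d y)" .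
      then show ?case unfolding difference_flux_def d_def by simp
    qed
    moreover have "(\<lambda>N. (lam i - lam j) * (\<kappa> * (real N * (LINT y|lborel. indicator (\<Omega> i) y * (g (y + v /\<^sub>R real N) - g y))))) \<longlonglongrightarrow> (lam i - lam j) * L"
      unfolding L_def using r g by (intro tendsto_mult_left slide'[rule_format]) auto
    ultimately show ?thesis unfolding Sv by (rule Lim_transform_eventually[rotated])
  qed
  then show ?thesis using r(1) by blast
qed

section \<open>Localisation by bump functions\<close>

definition bump :: "real ^ 'n \<Rightarrow> real \<Rightarrow> real ^ 'n \<Rightarrow> real" where
  "bump x r y = max 0 (min 1 (2 - dist x y / r))"

lemma bump_continuous: "0 < r \<Longrightarrow> continuous_on A (bump x r)"
  unfolding bump_def by (intro continuous_intros) auto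

lemma bump_range: "0 \<le> bump x r y" "bump x r y \<le> 1"
  by (auto simp: bump_def)

lemma bump_inside: "0 < r \<Longrightarrow> y \<in> ball x r \<Longrightarrow> bump x r y = 1"
  by (simp add: bump_def max_def min_def field_simps)

lemma bump_outside: "0 < r \<Longrightarrow> y \<notin> ball x (2 * r) \<Longrightarrow> bump x r y = 0"
  by (auto simp: bump_def max_def min_def field_simps)

lemma bump_lipschitz:
  assumes "0 < r"
  shows "\<bar>bump x r y - bump x r z\<bar> \<le> dist y z / r"
proof -
  have "\<bar>dist x y - dist x z\<bar> \<le> dist y z" using abs_dist_diff_le[of y x z] by (simp add: dist_commute)
  then have "\<bar>dist x y / r - dist x z / r\<bar> \<le> dist y z / r"
    using assms by (simp add: diff_divide_distrib[symmetric] divide_right_mono)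
  then show ?thesis unfolding bump_def by (simp add: max_def min_def abs_if split: if_splits)
qed

text \<open>Multiplying \<open>g\<close> by a bump and by its complement splits off a part supported
  in one doubled ball, where the limit is known, from a rest that vanishes on the ball and is
  handled by the remaining cover.\<close>

lemma regular_flux_cover:
  assumes "finite F" and "\<And>x r. (x, r) \<in> F \<Longrightarrow> 0 < r \<and> (\<forall>g. continuous_on UNIV g \<longrightarrow> (\<forall>y. y \<notin> ball x (2 * r) \<longrightarrow> g y = 0) \<longrightarrow> difference_flux v g \<longlonglongrightarrow> flux v g)"
    and "continuous_on UNIV g" and "\<And>y. y \<notin> ball z R \<Longrightarrow> g y = 0" and "\<And>y. g y \<noteq> 0 \<Longrightarrow> y \<in> (\<Union>(x, r)\<in>F. ball x r)"
  shows "difference_flux v g \<longlonglongrightarrow> flux v g"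
  using assms
proof (induction F arbitrary: g rule: finite_induct)
  case empty
  then have "g = (\<lambda>_. 0)" by auto
  then show ?case by (simp add: difference_flux_def[abs_def] flux_def)
next
  case (insert xr F)
  obtain x r where xr: "xr = (x, r)" by (cases xr)
  have r: "0 < r" and good: "\<And>g. continuous_on UNIV g \<Longrightarrow> (\<And>y. y \<notin> ball x (2 * r) \<Longrightarrow> g y = 0) \<Longrightarrow> difference_flux v g \<longlonglongrightarrow> flux v g"
    using insert.prems(1)[of x r] xr by auto
  define g1 where "g1 y = g y * bump x r y" for y
  define g2 where "g2 y = g y * (1 - bump x r y)" for y
  have c1: "continuous_on UNIV g1" and c2: "continuous_on UNIV g2"
    unfolding g1_def g2_def by (intro continuous_intros insert.prems(2) bump_continuous[OF r])+
  have s1: "g1 y = 0" and s2: "g2 y = 0" if "y \<notin> ball z R" for y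
    using insert.prems(3)[OF that] by (auto simp: g1_def g2_def)
  have L1: "difference_flux v g1 \<longlonglongrightarrow> flux v g1"
    by (rule good[OF c1]) (simp add: g1_def bump_outside[OF r])
  have L2: "difference_flux v g2 \<longlonglongrightarrow> flux v g2"
  proof (rule insert.IH[OF _ c2 s2])
    show "0 < r' \<and> (\<forall>g. continuous_on UNIV g \<longrightarrow> (\<forall>y. y \<notin> ball x' (2 * r') \<longrightarrow> g y = 0) \<longrightarrow> difference_flux v g \<longlonglongrightarrow> flux v g)"
      if "(x', r') \<in> F" for x' r' using insert.prems(1)[of x' r'] that by blast
    fix y assume "g2 y \<noteq> 0"
    then have "g y \<noteq> 0" "y \<notin> ball x r" using bump_inside[OF r, of y x] by (auto simp: g2_def)
    then show "y \<in> (\<Union>(x, r)\<in>F. ball x r)" using insert.prems(4)[of y] xr by auto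
  qed
  have g: "g = (\<lambda>y. g1 y + g2 y)" by (auto simp: g1_def g2_def algebra_simps)
  obtain B1 where B1: "\<And>y. \<bar>g1 y\<bar> \<le> B1" using compact_support_bounded[OF c1 s1] by blast
  obtain B2 where B2: "\<And>y. \<bar>g2 y\<bar> \<le> B2" using compact_support_bounded[OF c2 s2] by blast
  have "difference_flux v g = (\<lambda>N. difference_flux v g1 N + difference_flux v g2 N)" unfolding g by (rule ext) (rule difference_flux_add[OF c1 s1 c2 s2])
  moreover have "flux v g = flux v g1 + flux v g2" unfolding g by (rule flux_add[OF c1 B1 c2 B2])
  ultimately show ?case using tendsto_add[OF L1 L2] by simp
qed

text \<open>Compactness leaves a finite cover. The radii of \<open>local_flux\<close> are halved
  because a bump that is 1 on a ball extends to the doubled ball.\<close>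

lemma regular_flux:
  assumes g: "continuous_on UNIV g" "\<And>y. y \<notin> ball z R \<Longrightarrow> g y = 0"
    and K: "compact K" "K \<inter> (\<Sigma> - \<Sigma>1) = {}" "\<And>y. g y \<noteq> 0 \<Longrightarrow> y \<in> K"
  shows "difference_flux v g \<longlonglongrightarrow> flux v g"
proof -
  have "\<exists>r>0. \<forall>g. continuous_on UNIV g \<longrightarrow> (\<forall>y. y \<notin> ball x (2 * r) \<longrightarrow> g y = 0) \<longrightarrow> difference_flux v g \<longlonglongrightarrow> flux v g" if "x \<in> K" for x
  proof -
    have "x \<notin> \<Sigma> - \<Sigma>1" using K(2) that by blast
    from local_flux[OF this, of v] obtain r where "0 < r"
      "\<forall>g. continuous_on UNIV g \<longrightarrow> (\<forall>y. y \<notin> ball x r \<longrightarrow> g y = 0) \<longrightarrow> difference_flux v g \<longlonglongrightarrow> flux v g" by blast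
    then show ?thesis by (intro exI[of _ "r / 2"]) auto
  qed
  then obtain \<rho> where \<rho>: "\<And>x. x \<in> K \<Longrightarrow> 0 < \<rho> x \<and> (\<forall>g. continuous_on UNIV g \<longrightarrow> (\<forall>y. y \<notin> ball x (2 * \<rho> x) \<longrightarrow> g y = 0) \<longrightarrow> difference_flux v g \<longlonglongrightarrow> flux v g)"
    by metis
  have "K \<subseteq> (\<Union>x\<in>K. ball x (\<rho> x))" using \<rho> by force
  then obtain F where F: "F \<subseteq> K" "finite F" "K \<subseteq> (\<Union>x\<in>F. ball x (\<rho> x))"
    using compactE_image[OF K(1), of K "\<lambda>x. ball x (\<rho> x)"] by auto
  show ?thesis
  proof (rule regular_flux_cover[OF _ _ g])
    show "finite ((\<lambda>x. (x, \<rho> x)) ` F)" using F by simp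
    show "0 < r \<and> (\<forall>g. continuous_on UNIV g \<longrightarrow> (\<forall>y. y \<notin> ball x (2 * r) \<longrightarrow> g y = 0) \<longrightarrow> difference_flux v g \<longlonglongrightarrow> flux v g)"
      if "(x, r) \<in> (\<lambda>x. (x, \<rho> x)) ` F" for x r using that \<rho> F(1) by auto
    show "y \<in> (\<Union>(x, r)\<in>(\<lambda>x. (x, \<rho> x)) ` F. ball x r)" if "g y \<noteq> 0" for y
    proof -
      have "y \<in> (\<Union>x\<in>F. ball x (\<rho> x))" using K(3)[OF that] F(3) by blast
      then show ?thesis by auto
    qed
  qed
qed

end

text \<open>Each set of a fine cover is enclosed in a ball around one of its points, with radius
  just above its diameter; the balls are open, so finitely many suffice. Up to the constant
  \<open>c\<close> the gauges are powers of the diameters.\<close>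

lemma hausdorff_null_ball_cover:
  fixes N :: "'a::metric_space set"
  assumes s: "0 < s" and N: "compact N" "hausdorff_outer s N = 0" and \<delta>: "0 < \<delta>" and \<epsilon>: "0 < \<epsilon>"
  obtains I :: "nat set" and x :: "nat \<Rightarrow> 'a" and r :: "nat \<Rightarrow> real"
  where "finite I" "N \<subseteq> (\<Union>i\<in>I. ball (x i) (r i))" "\<And>i. 0 < r i \<and> r i \<le> \<delta>" "(\<Sum>i\<in>I. r i powr s) \<le> \<epsilon>"
proof -
  define c where "c = unit_ball_vol s / 2 powr s"
  have c: "0 < c" using s by (simp add: c_def)
  obtain E :: "nat \<Rightarrow> 'a set" where E: "N \<subseteq> (\<Union>i. E i)" "\<And>i. bounded (E i)" "\<And>i. diameter (E i) \<le> \<delta> / 2"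
    "(\<Sum>i. hausdorff_gauge s (E i)) < ennreal (c * (\<epsilon> / 2))"
    using hausdorff_outer_null_cover[OF N(2), of "\<delta> / 2" "ennreal (c * (\<epsilon> / 2))"] \<delta> \<epsilon> c by auto
  define d where "d i = diameter (E i)" for i
  have d0: "0 \<le> d i" for i by (simp add: d_def diameter_ge_0 E)
  have gauge: "hausdorff_gauge s (E i) = ennreal (c * d i powr s)" for i
    using s d0[of i] by (simp add: hausdorff_gauge_pos c_def d_def[symmetric] powr_divide)
  \<comment> \<open>Strictly larger than the diameter, so that the open ball contains the whole set
    even if it is a single point. The excesses of the powers add up to at most
    \<open>\<epsilon> / 2\<close>, the powers of the diameters to less than
    \<open>\<epsilon> / 2\<close>.\<close>
  have "\<exists>r. d i < r \<and> r \<le> \<delta> \<and> r powr s < d i powr s + \<epsilon> * (1/2) ^ Suc (Suc i)" for i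
  proof -
    have "((\<lambda>t. (d i + t) powr s) \<longlongrightarrow> (d i + 0) powr s) (at_right 0)"
      using s d0[of i] by (intro tendsto_powr' tendsto_intros)
        (auto simp: eventually_at_right_field intro!: exI[of _ 1])
    then have "\<forall>\<^sub>F t in at_right 0. (d i + t) powr s < d i powr s + \<epsilon> * (1/2) ^ Suc (Suc i)"
      using \<epsilon> by (intro order_tendstoD) auto
    moreover have "\<forall>\<^sub>F t in at_right 0. t \<in> {0<..<\<delta> / 2}" using \<delta> by (intro eventually_at_right_real) simp
    ultimately have "\<forall>\<^sub>F t in at_right (0::real). (d i + t) powr s < d i powr s + \<epsilon> * (1/2) ^ Suc (Suc i) \<and> t \<in> {0<..<\<delta> / 2}"
      by (rule eventually_conj)
    from eventually_happens'[OF _ this] obtain t where "(d i + t) powr s < d i powr s + \<epsilon> * (1/2) ^ Suc (Suc i)" "t \<in> {0<..<\<delta> / 2}"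
      by (auto simp: trivial_limit_at_right_real)
    then show ?thesis using E(3)[of i] by (intro exI[of _ "d i + t"]) (auto simp: d_def)
  qed
  then obtain r where r: "\<And>i. d i < r i" "\<And>i. r i \<le> \<delta>" "\<And>i. r i powr s < d i powr s + \<epsilon> * (1/2) ^ Suc (Suc i)"
    by metis
  define x where "x i = (SOME y. y \<in> E i)" for i
  have "E i \<subseteq> ball (x i) (r i)" for i
  proof
    fix y assume y: "y \<in> E i"
    then have "x i \<in> E i" unfolding x_def by (rule someI)
    then have "dist (x i) y \<le> d i" unfolding d_def by (intro diameter_bounded_bound E y)
    then show "y \<in> ball (x i) (r i)" using r(1)[of i] by simp
  qed
  then have "N \<subseteq> (\<Union>i\<in>UNIV. ball (x i) (r i))"
    by (intro order_trans[OF E(1)] UN_mono order_refl)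
  then obtain I where I: "finite I" "N \<subseteq> (\<Union>i\<in>I. ball (x i) (r i))"
    using compactE_image[OF N(1), of UNIV "\<lambda>i. ball (x i) (r i)"] by auto
  have "(\<Sum>i\<in>I. ennreal (c * d i powr s)) \<le> (\<Sum>i. ennreal (c * d i powr s))"
    by (intro sum_le_suminf) (auto simp: I)
  also have "\<dots> < ennreal (c * (\<epsilon> / 2))" using E(4) by (simp add: gauge)
  finally have "ennreal (\<Sum>i\<in>I. c * d i powr s) < ennreal (c * (\<epsilon> / 2))"
    using c by (subst sum_ennreal[symmetric]) auto
  then have "c * (\<Sum>i\<in>I. d i powr s) < c * (\<epsilon> / 2)"
    using c by (subst (asm) ennreal_less_iff) (auto simp: sum_distrib_left intro!: sum_nonneg)
  then have dsum: "(\<Sum>i\<in>I. d i powr s) < \<epsilon> / 2" using c by simp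
  have "(\<Sum>i\<in>I. r i powr s) \<le> (\<Sum>i\<in>I. d i powr s + \<epsilon> * (1/2) ^ Suc (Suc i))"
    using r(3) by (intro sum_mono less_imp_le)
  also have "\<dots> = (\<Sum>i\<in>I. d i powr s) + \<epsilon> / 2 * (\<Sum>i\<in>I. (1/2) ^ Suc i)"
    by (simp add: sum.distrib sum_distrib_left)
  also have "(\<Sum>i\<in>I. (1/2 :: real) ^ Suc i) \<le> 1"
    using sum_le_suminf[of "\<lambda>i. (1/2 :: real) ^ Suc i" I] power_half_series I(1) by (simp add: sums_iff)
  finally have "(\<Sum>i\<in>I. r i powr s) \<le> \<epsilon>" using dsum \<epsilon> by simp
  moreover have "0 < r i \<and> r i \<le> \<delta>" for i using r(1)[of i] r(2)[of i] d0[of i] by simp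
  ultimately show thesis using that[OF I] by blast
qed

context smooth_cluster
begin

section \<open>Cutting off the singular set\<close>

lemma singular_null: "surface_outer (\<Sigma> - \<Sigma>1) = 0"
proof -
  have "surface_outer (\<Union>i\<in>{1..q}. frontier (\<Omega> i) - reduced_boundary (\<Omega> i)) = 0"
    using r1 by (intro hausdorff_outer_null_UN) (auto simp: regular1_def)
  moreover have "surface_outer (\<Sigma> - \<Sigma>1) \<le> surface_outer (\<Union>i\<in>{1..q}. frontier (\<Omega> i) - reduced_boundary (\<Omega> i))"
    by (intro hausdorff_outer_mono boundary_minus_interfaces[OF cl r1])
  ultimately show ?thesis by simp
qed

text \<open>The interfaces are relatively open in the compact boundary, so what remains is closed.
  This is what makes finite covers by small balls possible.\<close>

lemma singular_compact: "compact (\<Sigma> - \<Sigma>1)"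
proof -
  have "openin (top_of_set \<Sigma>) \<Sigma>1"
    unfolding interfaces_def using interface_openin by (intro openin_Union) auto
  then obtain T where T: "open T" "\<Sigma>1 = \<Sigma> \<inter> T" by (auto simp: openin_open)
  then have "\<Sigma> - \<Sigma>1 = \<Sigma> \<inter> - T" by auto
  then show ?thesis using T compact_boundary by (simp add: compact_Int_closed closed_Compl)
qed

text \<open>One factor \<open>r\<close> is split off; it will cancel the slope \<open>1 / r\<close>
  of a bump.\<close>

lemma content_ball_triple:
  assumes "0 < r"
  shows "measure lborel (ball (x :: real ^ 'n) (3 * r)) = unit_ball_vol (real CARD('n)) * 3 ^ CARD('n) * (r * r powr (real CARD('n) - 1))"
proof -
  have "r * r powr (real CARD('n) - 1) = r ^ CARD('n)"
    using assms by (simp add: powr_mult_base powr_realpow[symmetric])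
  then show ?thesis using content_ball[of "3 * r" x] assms by (simp add: power_mult_distrib)
qed

definition cutoff :: "nat set \<Rightarrow> (nat \<Rightarrow> real ^ 'n) \<Rightarrow> (nat \<Rightarrow> real) \<Rightarrow> real ^ 'n \<Rightarrow> real" where
  "cutoff I x r y = min 1 (\<Sum>i\<in>I. bump (x i) (r i) y)"

lemma cutoff_range: "0 \<le> cutoff I x r y" "cutoff I x r y \<le> 1"
  by (auto simp: cutoff_def bump_range intro!: sum_nonneg)

lemma cutoff_continuous: "(\<And>i. 0 < r i) \<Longrightarrow> continuous_on A (cutoff I x r)"
  unfolding cutoff_def[abs_def] by (intro continuous_intros bump_continuous)

lemma cutoff_inside:
  assumes "finite I" "i \<in> I" "0 < r i" "y \<in> ball (x i) (r i)"
  shows "cutoff I x r y = 1"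
proof -
  have "1 = bump (x i) (r i) y" using bump_inside[OF assms(3,4)] by simp
  also have "\<dots> \<le> (\<Sum>i\<in>I. bump (x i) (r i) y)"
    using assms(1,2) bump_range by (intro member_le_sum) auto
  finally show ?thesis by (simp add: cutoff_def)
qed

lemma cutoff_outside:
  assumes "\<And>i. 0 < r i" "\<And>i. i \<in> I \<Longrightarrow> y \<notin> ball (x i) (2 * r i)"
  shows "cutoff I x r y = 0"
  using assms by (simp add: cutoff_def bump_outside)

text \<open>A bump vanishes outside the doubled ball, and the shift is at most the radius; so only
  points of the tripled ball see a change.\<close>

lemma cutoff_difference:
  assumes I: "finite I" and r: "\<And>i. 0 < r i" and h: "\<And>i. i \<in> I \<Longrightarrow> norm h \<le> r i"
  shows "\<bar>cutoff I x r (y + h) - cutoff I x r y\<bar> \<le> (\<Sum>i\<in>I. norm h / r i * indicator (ball (x i) (3 * r i)) y)"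
    and "cutoff I x r (y + h) \<le> (\<Sum>i\<in>I. indicator (ball (x i) (3 * r i)) y)"
proof -
  have out: "bump (x i) (r i) (y + h) = 0 \<and> bump (x i) (r i) y = 0" if "i \<in> I" "y \<notin> ball (x i) (3 * r i)" for i
  proof -
    have "dist (x i) y \<le> dist (x i) (y + h) + norm h"
      using dist_triangle[of "x i" y "y + h"] by (simp add: dist_norm)
    then have "y + h \<notin> ball (x i) (2 * r i)" "y \<notin> ball (x i) (2 * r i)"
      using that h[OF that(1)] r[of i] by auto
    then show ?thesis using bump_outside[OF r] by blast
  qed
  have one: "\<bar>bump (x i) (r i) (y + h) - bump (x i) (r i) y\<bar> \<le> norm h / r i * indicator (ball (x i) (3 * r i)) y" if "i \<in> I" for i
  proof (cases "y \<in> ball (x i) (3 * r i)")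
    case True
    then show ?thesis using bump_lipschitz[OF r, of "x i" i "y + h" y] by (simp add: dist_norm)
  qed (use out[OF that] in simp)
  have "\<bar>cutoff I x r (y + h) - cutoff I x r y\<bar> \<le> \<bar>(\<Sum>i\<in>I. bump (x i) (r i) (y + h)) - (\<Sum>i\<in>I. bump (x i) (r i) y)\<bar>"
    by (simp add: cutoff_def min_def)
  also have "\<dots> = \<bar>\<Sum>i\<in>I. bump (x i) (r i) (y + h) - bump (x i) (r i) y\<bar>"
    by (simp add: sum_subtractf)
  also have "\<dots> \<le> (\<Sum>i\<in>I. norm h / r i * indicator (ball (x i) (3 * r i)) y)"
    by (rule order_trans[OF sum_abs], intro sum_mono one)
  finally show "\<bar>cutoff I x r (y + h) - cutoff I x r y\<bar> \<le> (\<Sum>i\<in>I. norm h / r i * indicator (ball (x i) (3 * r i)) y)" .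
  have "cutoff I x r (y + h) \<le> (\<Sum>i\<in>I. bump (x i) (r i) (y + h))" by (simp add: cutoff_def)
  also have "\<dots> \<le> (\<Sum>i\<in>I. indicator (ball (x i) (3 * r i)) y)"
  proof (intro sum_mono)
    fix i assume "i \<in> I"
    then show "bump (x i) (r i) (y + h) \<le> indicator (ball (x i) (3 * r i)) y"
      using out[of i] bump_range(2)[of "x i" "r i" "y + h"] by (cases "y \<in> ball (x i) (3 * r i)") auto
  qed
  finally show "cutoff I x r (y + h) \<le> (\<Sum>i\<in>I. indicator (ball (x i) (3 * r i)) y)" .
qed

lemma \<kappa>_nonneg: "0 \<le> \<kappa>" using \<kappa> by (simp add: flat_density_def)

text \<open>The cutoff near the singular set has total variation comparable to \<open>\<Sum>i. r i powr (n - 1)\<close>.\<close>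

lemma singular_difference_bound:
  assumes I: "finite I" and r: "\<And>i. 0 < r i \<and> r i \<le> 1"
    and g: "continuous_on UNIV g" "\<And>y. y \<notin> ball z R \<Longrightarrow> g y = 0" and lip: "\<And>y y'. \<bar>g y - g y'\<bar> \<le> L * dist y y'"
    and B: "\<And>y. \<bar>g y\<bar> \<le> B"
  shows "\<forall>\<^sub>F N in sequentially. \<bar>difference_flux v (\<lambda>y. g y * cutoff I x r y) N\<bar>
     \<le> \<kappa> * (\<Sum>k\<in>{1..q}. \<bar>lam k\<bar>) * norm v * (L + B) * (unit_ball_vol (real CARD('n)) * 3 ^ CARD('n)) * (\<Sum>i\<in>I. r i powr (real CARD('n) - 1))"
proof -
  define A where "A = (\<Sum>k\<in>{1..q}. \<bar>lam k\<bar>)"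
  have A0: "0 \<le> A" by (auto simp: A_def intro!: sum_nonneg)
  have B0: "0 \<le> B" using B[of 0] by linarith
  have L0: "0 \<le> L"
  proof -
    have "0 \<le> L * dist (axis undefined 1 :: real ^ 'n) 0" using lip[of "axis undefined 1" 0] by linarith
    then show ?thesis by (simp add: norm_axis_1)
  qed
  define \<omega> where "\<omega> = unit_ball_vol (real CARD('n)) * 3 ^ CARD('n)"
  have \<omega>0: "0 \<le> \<omega>" by (simp add: \<omega>_def)
  \<comment> \<open>The smallest radius, or 1 if that is smaller or there are no balls; once the
    shift is below it, the estimates hold for all balls at once.\<close>
  define m where "m = Min (insert 1 (r ` I))"
  have m: "0 < m" using I r by (auto simp: m_def)
  have mr: "m \<le> r i" if "i \<in> I" for i using I that by (auto simp: m_def)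
  obtain N0 :: nat where N0: "norm v / m < real N0" using reals_Archimedean2 by blast
  define f where "f y = g y * cutoff I x r y" for y
  have f: "continuous_on UNIV f" unfolding f_def using r by (intro continuous_intros g cutoff_continuous) auto
  have fs: "f y = 0" if "y \<notin> ball z R" for y using g(2)[OF that] by (simp add: f_def)
  show ?thesis
    using eventually_ge_at_top[of "max 1 N0"]
  proof eventually_elim
    case (elim N)
    have Npos: "0 < real N" using elim by auto
    define h where "h = v /\<^sub>R real N"
    have nh: "norm h = norm v / real N" by (simp add: h_def divide_inverse mult.commute)
    have "norm v / m < real N" using N0 elim by auto
    then have "norm h \<le> m" using m Npos by (simp add: nh field_simps)
    then have hr: "norm h \<le> r i" if "i \<in> I" for i using mr[OF that] by simp
    have rpos: "0 < r i" for i using r by blast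
    note cd = cutoff_difference[OF I rpos hr, where x = x]
    \<comment> \<open>The product rule for increments: \<open>L\<close> is the slope of
      \<open>g\<close>, weighted by the cutoff, and \<open>B / r i\<close> is the slope of a bump,
      weighted by the size of \<open>g\<close>.\<close>
    define b where "b y = A * (\<Sum>i\<in>I. ((L + B / r i) * norm h) * indicator (ball (x i) (3 * r i)) y)" for y
    have bd: "\<bar>multiplier y * (f (y + h) - f y)\<bar> \<le> b y" for y
    proof -
      have "f (y + h) - f y = (g (y + h) - g y) * cutoff I x r (y + h) + g y * (cutoff I x r (y + h) - cutoff I x r y)"
        by (simp add: f_def algebra_simps)
      then have "\<bar>f (y + h) - f y\<bar> \<le> \<bar>g (y + h) - g y\<bar> * cutoff I x r (y + h) + \<bar>g y\<bar> * \<bar>cutoff I x r (y + h) - cutoff I x r y\<bar>"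
        using cutoff_range(1)[of I x r "y + h"] by (metis abs_mult abs_of_nonneg abs_triangle_ineq)
      also have "\<dots> \<le> (L * norm h) * (\<Sum>i\<in>I. indicator (ball (x i) (3 * r i)) y)
          + B * (\<Sum>i\<in>I. norm h / r i * indicator (ball (x i) (3 * r i)) y)"
        using lip[of "y + h" y] B[of y] cd(1)[where y = y] cd(2)[where y = y] cutoff_range(1)[of I x r "y + h"] L0 B0
        by (intro add_mono mult_mono) (auto simp: dist_norm)
      also have "\<dots> = (\<Sum>i\<in>I. ((L + B / r i) * norm h) * indicator (ball (x i) (3 * r i)) y)"
        unfolding sum_distrib_left sum.distrib[symmetric] by (intro sum.cong) (auto simp: algebra_simps)
      finally have "\<bar>f (y + h) - f y\<bar> \<le> (\<Sum>i\<in>I. ((L + B / r i) * norm h) * indicator (ball (x i) (3 * r i)) y)" .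
      then show ?thesis
        unfolding b_def abs_mult using multiplier_bound[of y] A0 by (intro mult_mono) (auto simp: A_def)
    qed
    have b_int: "integrable lborel b"
      unfolding b_def using emeasure_lborel_ball_finite
      by (intro integrable_mult_right Bochner_Integration.integrable_sum integrable_real_indicator) auto
    have "\<bar>LINT y|lborel. multiplier y * (f (y + h) - f y)\<bar> \<le> (LINT y|lborel. b y)"
    proof -
      have "\<bar>LINT y|lborel. multiplier y * (f (y + h) - f y)\<bar> \<le> (LINT y|lborel. \<bar>multiplier y * (f (y + h) - f y)\<bar>)"
        by (rule integral_abs_bound)
      also have "\<dots> \<le> (LINT y|lborel. b y)"
      proof (rule integral_mono[OF _ b_int bd])
        have "integrable lborel (\<lambda>y. multiplier y * (f (y + h) - f y))"
          by (rule difference_integrable[OF multiplier_measurable multiplier_bound f fs])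
        then show "integrable lborel (\<lambda>y. \<bar>multiplier y * (f (y + h) - f y)\<bar>)" by (rule integrable_abs)
      qed
      finally show ?thesis .
    qed
    also have "(LINT y|lborel. b y) = A * (\<Sum>i\<in>I. ((L + B / r i) * norm h) * measure lborel (ball (x i) (3 * r i)))"
      unfolding b_def using emeasure_lborel_ball_finite
      by (simp, subst Bochner_Integration.integral_sum) (auto intro!: integrable_mult_right integrable_real_indicator)
    also have "\<dots> \<le> A * (\<Sum>i\<in>I. norm h * (L + B) * \<omega> * r i powr (real CARD('n) - 1))"
    proof (intro mult_left_mono sum_mono A0)
      fix i
      have ri: "0 < r i" "r i \<le> 1" using r by auto
      \<comment> \<open>The extra factor \<open>r i\<close> of the volume cancels the slope of the
        bump in the \<open>B\<close> term and is bounded by 1 in the \<open>L\<close> term.\<close>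
      have "((L + B / r i) * norm h) * measure lborel (ball (x i) (3 * r i)) = norm h * (L * r i + B) * \<omega> * r i powr (real CARD('n) - 1)"
        unfolding content_ball_triple[OF ri(1)] \<omega>_def using ri by (simp add: field_simps)
      also have "\<dots> \<le> norm h * (L + B) * \<omega> * r i powr (real CARD('n) - 1)"
        using ri L0 \<omega>0 by (intro mult_right_mono mult_left_mono add_right_mono) (auto intro: mult_left_le)
      finally show "((L + B / r i) * norm h) * measure lborel (ball (x i) (3 * r i)) \<le> norm h * (L + B) * \<omega> * r i powr (real CARD('n) - 1)" .
    qed
    also have "\<dots> = norm h * (A * (L + B) * \<omega> * (\<Sum>i\<in>I. r i powr (real CARD('n) - 1)))"
      by (simp add: sum_distrib_left mult_ac)
    finally have "\<kappa> * (real N * \<bar>LINT y|lborel. multiplier y * (f (y + h) - f y)\<bar>)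
        \<le> \<kappa> * (real N * (norm h * (A * (L + B) * \<omega> * (\<Sum>i\<in>I. r i powr (real CARD('n) - 1)))))"
      using \<kappa>_nonneg by (intro mult_left_mono) auto
    also have "\<dots> = \<kappa> * A * norm v * (L + B) * \<omega> * (\<Sum>i\<in>I. r i powr (real CARD('n) - 1))"
      using Npos by (simp add: nh)
    finally show ?case
      using \<kappa>_nonneg by (simp add: difference_flux_def f_def h_def A_def \<omega>_def abs_mult)
  qed
qed

lemma flux_abs_bound:
  assumes g: "continuous_on UNIV g" and T: "open T" and B: "\<And>y. \<bar>g y\<bar> \<le> B * indicator T y"
  shows "\<bar>flux v g\<bar> \<le> (\<Sum>(i, j)\<in>index_pairs q. \<bar>lam i - lam j\<bar> * (B * norm v * measure surface_measure (interface \<Omega> i j \<inter> T)))"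
  unfolding flux_def
proof (rule order_trans[OF sum_abs], intro sum_mono, clarify)
  fix i j assume ij: "(i, j) \<in> index_pairs q"
  have B': "\<bar>g y\<bar> \<le> \<bar>B\<bar>" for y
    using B[of y] by (cases "y \<in> T") auto
  have m: "interface \<Omega> i j \<inter> T \<in> sets surface_measure" using interface_borel[OF ij] T by auto
  have fin: "emeasure surface_measure (interface \<Omega> i j \<inter> T) < \<infinity>"
    using emeasure_mono[of "interface \<Omega> i j \<inter> T" "interface \<Omega> i j" surface_measure] interface_borel[OF ij] interface_finite[OF ij]
    by (auto intro: le_less_trans)
  have "\<bar>LINT p|surface_measure. indicator (interface \<Omega> i j) p * (g p * (v \<bullet> nrm i j p))\<bar>
      \<le> (LINT p|surface_measure. \<bar>indicator (interface \<Omega> i j) p * (g p * (v \<bullet> nrm i j p))\<bar>)"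
    by (rule integral_abs_bound)
  also have "\<dots> \<le> (LINT p|surface_measure. (B * norm v) * indicator (interface \<Omega> i j \<inter> T) p)"
  proof (rule integral_mono)
    show "integrable surface_measure (\<lambda>p. \<bar>indicator (interface \<Omega> i j) p * (g p * (v \<bullet> nrm i j p))\<bar>)"
      using flux_integrable[OF ij g B'] by (rule integrable_abs)
    show "integrable surface_measure (\<lambda>p. B * norm v * indicator (interface \<Omega> i j \<inter> T) p)"
      using m fin by (intro integrable_mult_right integrable_real_indicator)
    fix p
    show "\<bar>indicator (interface \<Omega> i j) p * (g p * (v \<bullet> nrm i j p))\<bar> \<le> B * norm v * indicator (interface \<Omega> i j \<inter> T) p"
    proof (cases "p \<in> interface \<Omega> i j \<and> p \<in> T")
      case True
      then have "\<bar>g p\<bar> \<le> B" "\<bar>v \<bullet> nrm i j p\<bar> \<le> norm v"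
        using B[of p] Cauchy_Schwarz_ineq2[of v "nrm i j p"] normal_unit[OF ij] by auto
      then show ?thesis using True by (simp add: abs_mult mult_mono)
    next
      case False
      then show ?thesis using B[of p] by (auto simp: indicator_def)
    qed
  qed
  also have "\<dots> = B * norm v * measure surface_measure (interface \<Omega> i j \<inter> T)" using m by simp
  finally show "\<bar>(lam i - lam j) * (LINT p|surface_measure. indicator (interface \<Omega> i j) p * (g p * (v \<bullet> nrm i j p)))\<bar>
      \<le> \<bar>lam i - lam j\<bar> * (B * norm v * measure surface_measure (interface \<Omega> i j \<inter> T))"
    by (simp add: abs_mult mult_left_mono)
qed

text \<open>The neighbourhoods shrink to a compact set disjoint from the interface, and the
  interface has finite measure, so continuity from above applies.\<close>

lemma neighbourhood_measure_tendsto: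
  assumes ij: "(i, j) \<in> index_pairs q"
  shows "(\<lambda>m. measure surface_measure (interface \<Omega> i j \<inter> (\<Union>z\<in>\<Sigma> - \<Sigma>1. ball z (1 / real (Suc m))))) \<longlonglongrightarrow> 0"
proof -
  define A where "A m = interface \<Omega> i j \<inter> (\<Union>z\<in>\<Sigma> - \<Sigma>1. ball z (1 / real (Suc m)))" for m
  have op: "open (\<Union>z\<in>\<Sigma> - \<Sigma>1. ball z (1 / real (Suc m)))" for m by auto
  have A: "A m \<in> sets surface_measure" for m unfolding A_def using interface_borel[OF ij] op by auto
  have Afin: "emeasure surface_measure (A m) \<noteq> \<infinity>" for m
    using emeasure_mono[of "A m" "interface \<Omega> i j" surface_measure] interface_borel[OF ij] interface_finite[OF ij]
    by (auto simp: A_def top_unique)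
  have dec: "decseq A"
  proof (rule decseq_SucI)
    fix m
    have "1 / real (Suc (Suc m)) \<le> 1 / real (Suc m)" by (intro divide_left_mono) auto
    then show "A (Suc m) \<subseteq> A m" unfolding A_def by (intro Int_mono UN_mono subset_ball order_refl)
  qed
  have "(\<Inter>m. A m) = {}"
  proof (rule ccontr)
    assume "(\<Inter>m. A m) \<noteq> {}"
    then obtain p where p: "\<And>m. p \<in> A m" by blast
    have "p \<in> \<Sigma>1" using p[of 0] ij by (auto simp: A_def interfaces_def)
    then have "p \<notin> \<Sigma> - \<Sigma>1" by blast
    then obtain e where e: "0 < e" "ball p e \<subseteq> - (\<Sigma> - \<Sigma>1)"
      using compact_imp_closed[OF singular_compact] by (metis ComplI openE open_Compl)
    obtain m where "1 / real (Suc m) < e" using e(1) nat_approx_posE by blast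
    moreover obtain z where "z \<in> \<Sigma> - \<Sigma>1" "dist z p < 1 / real (Suc m)" using p[of m] by (auto simp: A_def)
    ultimately have "z \<in> ball p e" "z \<in> \<Sigma> - \<Sigma>1" unfolding mem_ball by (simp_all add: dist_commute less_trans)
    then show False using e(2) by blast
  qed
  moreover have "(\<lambda>m. measure surface_measure (A m)) \<longlonglongrightarrow> measure surface_measure (\<Inter>m. A m)"
    using A Afin dec by (intro Lim_measure_decseq) auto
  ultimately show ?thesis by (simp add: A_def)
qed

text \<open>A cutoff splits \<open>g\<close> into a part near the singular set and a part away from
  it. The near part has small difference quotients by \<open>singular_difference_bound\<close>, and
  small flux because it lives in a thin neighbourhood; \<open>regular_flux\<close> handles the
  other. Each error is below \<open>e / 3\<close>.\<close>

lemma lipschitz_flux: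
  assumes g: "continuous_on UNIV g" "\<And>y. y \<notin> ball z R \<Longrightarrow> g y = 0" and lip: "\<And>y y'. \<bar>g y - g y'\<bar> \<le> L * dist y y'"
  shows "difference_flux v g \<longlonglongrightarrow> flux v g"
proof -
  obtain B where B: "0 \<le> B" "\<And>y. \<bar>g y\<bar> \<le> B" using compact_support_bounded[OF g] by blast
  define K0 where "K0 = \<kappa> * (\<Sum>k\<in>{1..q}. \<bar>lam k\<bar>) * norm v * (L + B) * (unit_ball_vol (real CARD('n)) * 3 ^ CARD('n))"
  define V where "V m = (\<Sum>(i, j)\<in>index_pairs q. \<bar>lam i - lam j\<bar> *
     (B * norm v * measure surface_measure (interface \<Omega> i j \<inter> (\<Union>z\<in>\<Sigma> - \<Sigma>1. ball z (1 / real (Suc m))))))" for m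
  have "V \<longlonglongrightarrow> (\<Sum>(i, j)\<in>index_pairs q. \<bar>lam i - lam j\<bar> * (B * norm v * 0))"
    unfolding V_def split_beta
    by (intro tendsto_intros neighbourhood_measure_tendsto) auto
  then have V: "V \<longlonglongrightarrow> 0" by (simp add: split_beta)
  show ?thesis
    unfolding LIMSEQ_iff
  proof (intro allI impI)
    fix e :: real assume e: "0 < e"
    obtain m where m: "\<bar>V m\<bar> < e / 3"
      using V[unfolded LIMSEQ_iff, rule_format, of "e / 3"] e by auto
    \<comment> \<open>\<open>K0\<close> collects the constants of
      \<open>singular_difference_bound\<close>; with this total for the powers of the radii the near
      part contributes less than \<open>e / 3\<close>.\<close>
    define \<epsilon> where "\<epsilon> = e / 3 / (\<bar>K0\<bar> + 1)"
    have \<epsilon>: "0 < \<epsilon>" using e by (simp add: \<epsilon>_def add_nonneg_pos)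
    \<comment> \<open>A point in a doubled ball is less than three radii from a singular point of
      that ball, hence within \<open>1 / Suc m\<close> of the singular set.\<close>
    define \<delta> where "\<delta> = 1 / real (Suc m) / 4"
    have \<delta>: "0 < \<delta>" "\<delta> \<le> 1" by (auto simp: \<delta>_def)
    have s: "0 < real CARD('n) - 1" using dim by simp
    obtain I :: "nat set" and x r where Ixr: "finite I" "\<Sigma> - \<Sigma>1 \<subseteq> (\<Union>i\<in>I. ball (x i) (r i))"
      "\<And>i. 0 < r i \<and> r i \<le> \<delta>" "(\<Sum>i\<in>I. r i powr (real CARD('n) - 1)) \<le> \<epsilon>"
    proof -
      have sn: "hausdorff_outer (real CARD('n) - 1) (\<Sigma> - \<Sigma>1) = 0" using singular_null by simp
      show thesis by (rule hausdorff_null_ball_cover[OF s singular_compact sn \<delta>(1) \<epsilon>]) (rule that)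
    qed
    \<comment> \<open>Balls that miss the singular set are discarded; otherwise the near part of
      \<open>g\<close> could live far from it.\<close>
    define J where "J = {i \<in> I. ball (x i) (r i) \<inter> (\<Sigma> - \<Sigma>1) \<noteq> {}}"
    have J: "finite J" "J \<subseteq> I" "\<Sigma> - \<Sigma>1 \<subseteq> (\<Union>i\<in>J. ball (x i) (r i))"
    proof -
      show "finite J" "J \<subseteq> I" using Ixr(1) by (auto simp: J_def)
      show "\<Sigma> - \<Sigma>1 \<subseteq> (\<Union>i\<in>J. ball (x i) (r i))" using Ixr(2) unfolding J_def by blast
    qed
    define \<zeta> where "\<zeta> = cutoff J x r"
    have rpos: "0 < r i" for i using Ixr(3) by blast
    have \<zeta>c: "continuous_on A \<zeta>" for A unfolding \<zeta>_def by (rule cutoff_continuous[OF rpos])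
    define g1 where "g1 y = g y * \<zeta> y" for y
    define g2 where "g2 y = g y * (1 - \<zeta> y)" for y
    have c1: "continuous_on UNIV g1" and c2: "continuous_on UNIV g2"
      unfolding g1_def g2_def by (intro continuous_intros g \<zeta>c)+
    have s1: "g1 y = 0" and s2: "g2 y = 0" if "y \<notin> ball z R" for y
      using g(2)[OF that] by (auto simp: g1_def g2_def)
    have \<zeta>r: "0 \<le> \<zeta> y" "\<zeta> y \<le> 1" for y unfolding \<zeta>_def by (rule cutoff_range)+
    have D1: "\<forall>\<^sub>F N in sequentially. \<bar>difference_flux v g1 N\<bar> < e / 3"
    proof -
      have r1: "0 < r i \<and> r i \<le> 1" for i using Ixr(3)[of i] \<delta>(2) by auto
      have "K0 * (\<Sum>i\<in>J. r i powr (real CARD('n) - 1)) \<le> \<bar>K0\<bar> * \<epsilon>"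
      proof -
        have "(\<Sum>i\<in>J. r i powr (real CARD('n) - 1)) \<le> (\<Sum>i\<in>I. r i powr (real CARD('n) - 1))"
          using J Ixr(1) by (intro sum_mono2) auto
        then show ?thesis using Ixr(4) by (intro mult_mono) (auto intro!: sum_nonneg)
      qed
      also have "\<dots> < e / 3"
        using e by (simp add: \<epsilon>_def field_simps)
      finally have "K0 * (\<Sum>i\<in>J. r i powr (real CARD('n) - 1)) < e / 3" .
      moreover have "\<forall>\<^sub>F N in sequentially. \<bar>difference_flux v g1 N\<bar> \<le> K0 * (\<Sum>i\<in>J. r i powr (real CARD('n) - 1))"
        using singular_difference_bound[OF J(1) r1 g lip B(2), where v = v and x = x] by (simp add: K0_def g1_def[abs_def] \<zeta>_def)
      ultimately show ?thesis by (auto elim: eventually_mono)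
    qed
    have S1: "\<bar>flux v g1\<bar> < e / 3"
    proof -
      have supp: "\<bar>g1 y\<bar> \<le> B * indicator (\<Union>z\<in>\<Sigma> - \<Sigma>1. ball z (1 / real (Suc m))) y" for y
      proof (cases "\<exists>i\<in>J. y \<in> ball (x i) (2 * r i)")
        case True
        then obtain i where i: "i \<in> J" "y \<in> ball (x i) (2 * r i)" by blast
        have "ball (x i) (r i) \<inter> (\<Sigma> - \<Sigma>1) \<noteq> {}" using i(1) by (simp add: J_def)
        then obtain z where z: "z \<in> \<Sigma> - \<Sigma>1" "z \<in> ball (x i) (r i)" by blast
        have "dist z y \<le> dist (x i) z + dist (x i) y" by (metis dist_triangle3 dist_commute add.commute)
        also have "\<dots> < r i + 2 * r i" using i z by simp
        also have "\<dots> \<le> 1 / real (Suc m)"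
        proof -
          have "r i \<le> 1 / real (Suc m) / 4" using Ixr(3)[of i] unfolding \<delta>_def by blast
          moreover have "0 < 1 / real (Suc m)" by simp
          moreover have "t + 2 * t \<le> b" if "t \<le> b / 4" "0 < b" for t b :: real using that by simp
          ultimately show ?thesis by blast
        qed
        finally have "y \<in> (\<Union>z\<in>\<Sigma> - \<Sigma>1. ball z (1 / real (Suc m)))" using z(1) by auto
        moreover have "\<bar>g1 y\<bar> \<le> B" using B(2)[of y] \<zeta>r[of y] B(1)
          unfolding g1_def abs_mult using mult_mono[of "\<bar>g y\<bar>" B "\<bar>\<zeta> y\<bar>" 1] by simp
        ultimately show ?thesis by simp
      next
        case False
        then have "\<zeta> y = 0" unfolding \<zeta>_def by (intro cutoff_outside rpos) auto
        then show ?thesis using B(1) by (simp add: g1_def)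
      qed
      have "\<bar>flux v g1\<bar> \<le> V m"
        unfolding V_def by (rule flux_abs_bound[OF c1 _ supp]) auto
      then show ?thesis using m by linarith
    qed
    have D2: "difference_flux v g2 \<longlonglongrightarrow> flux v g2"
    proof (rule regular_flux[OF c2 s2])
      define K where "K = cball z R - (\<Union>i\<in>J. ball (x i) (r i))"
      show "compact K" unfolding K_def by (intro compact_diff) auto
      show "K \<inter> (\<Sigma> - \<Sigma>1) = {}" using J(3) by (auto simp: K_def)
      fix y assume "g2 y \<noteq> 0"
      then have "y \<in> ball z R" "\<zeta> y \<noteq> 1" using s2 by (auto simp: g2_def)
      then have "y \<in> cball z R" "y \<notin> ball (x i) (r i)" if "i \<in> J" for i
        using cutoff_inside[OF J(1) that, of r y x] rpos that by (auto simp: \<zeta>_def)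
      then show "y \<in> K" using \<open>y \<in> ball z R\<close> by (auto simp: K_def)
    qed
    have gs: "g = (\<lambda>y. g1 y + g2 y)" by (auto simp: g1_def g2_def algebra_simps)
    obtain B1 where B1: "\<And>y. \<bar>g1 y\<bar> \<le> B1" using compact_support_bounded[OF c1 s1] by blast
    obtain B2 where B2: "\<And>y. \<bar>g2 y\<bar> \<le> B2" using compact_support_bounded[OF c2 s2] by blast
    have Dg: "difference_flux v g N = difference_flux v g1 N + difference_flux v g2 N" for N
      by (subst gs) (rule difference_flux_add[OF c1 s1 c2 s2])
    have Sg: "flux v g = flux v g1 + flux v g2" by (subst gs) (rule flux_add[OF c1 B1 c2 B2])
    have "\<forall>\<^sub>F N in sequentially. \<bar>difference_flux v g2 N - flux v g2\<bar> < e / 3"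
      using tendstoD[OF D2, of "e / 3"] e by (simp add: dist_real_def)
    with D1 have "\<forall>\<^sub>F N in sequentially. norm (difference_flux v g N - flux v g) < e"
    proof eventually_elim
      case (elim N)
      then show ?case using S1 unfolding Dg Sg real_norm_def by linarith
    qed
    then show "\<exists>no. \<forall>N\<ge>no. norm (difference_flux v g N - flux v g) < e" by (simp add: eventually_sequentially)
  qed
qed

text \<open>The complement of a large ball is connected because the dimension is at least two, and
  it avoids the bounded cluster boundary; so it lies in a single cell.\<close>

lemma outside_cell:
  obtains k R where "k \<in> {1..q}" "0 < R" "\<And>y. R < norm y \<Longrightarrow> y \<in> \<Omega> k"
proof -
  obtain R0 where R0: "\<And>y. y \<in> \<Sigma> \<Longrightarrow> norm y \<le> R0" using bdd by (auto simp: bounded_cluster_def bounded_iff)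
  define R where "R = max R0 1"
  have op: "open (- cball (0 :: real ^ 'n) R)" by auto
  have conn: "connected (- cball (0 :: real ^ 'n) R)"
    using dim by (intro connected_complement_bounded_convex) auto
  have "- cball (0 :: real ^ 'n) R \<noteq> {}"
  proof -
    have "(R + 1) *\<^sub>R axis undefined 1 \<in> - cball (0 :: real ^ 'n) R"
      by (simp add: R_def norm_axis_1)
    then show ?thesis by blast
  qed
  moreover have "- cball 0 R \<inter> \<Sigma> = {}" using R0 by (force simp: R_def)
  ultimately have "\<exists>k\<in>{1..q}. - cball 0 R \<subseteq> \<Omega> k" by (intro connected_in_cell[OF cl op conn])
  then obtain k where "k \<in> {1..q}" "- cball 0 R \<subseteq> \<Omega> k" by blast
  then show thesis by (intro that[of k R]) (auto simp: R_def)
qed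

text \<open>For the clamped linear function the difference quotients do not depend on
  \<open>N\<close>: where the multiplier differs from its value at infinity the increment is exactly
  \<open>(v \<bullet> b) / N\<close>, and the constant value at infinity contributes nothing. Their
  common value is then the flux.\<close>

lemma linear_flux:
  "\<exists>C. \<forall>v. \<forall>b. norm b = 1 \<longrightarrow> (\<Sum>(i, j)\<in>index_pairs q. (lam i - lam j) *
      (LINT p|surface_measure. indicator (interface \<Omega> i j) p * ((p \<bullet> b) * (v \<bullet> nrm i j p)))) = C * (v \<bullet> b)"
proof -
  obtain k R0 where k: "k \<in> {1..q}" "0 < R0" "\<And>y. R0 < norm y \<Longrightarrow> y \<in> \<Omega> k" using outside_cell by blast
  \<comment> \<open>The integrand vanishes outside a ball, since \<open>k\<close> is the cell at
    infinity.\<close>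
  define C where "C = \<kappa> * (LINT y|lborel. multiplier y - lam k)"
  have "(\<Sum>(i, j)\<in>index_pairs q. (lam i - lam j) *
      (LINT p|surface_measure. indicator (interface \<Omega> i j) p * ((p \<bullet> b) * (v \<bullet> nrm i j p)))) = C * (v \<bullet> b)"
    if b: "norm b = 1" for v b
  proof -
    \<comment> \<open>Half of \<open>R\<close> is \<open>R0 + norm v\<close>, so for points of norm
      at most \<open>R0\<close> all shifted points \<open>y + v / N\<close> stay where
      \<open>g\<close> is linear.\<close>
    define R where "R = 2 * (R0 + norm v)"
    define mm where "mm y = max 0 (R - norm y)" for y :: "real ^ 'n"
    \<comment> \<open>The linear function is clamped between a cone and its negative. The cone
      dominates it up to radius \<open>R / 2\<close> and vanishes from \<open>R\<close> on; minima
      and maxima keep the Lipschitz constant 1.\<close>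
    define g where "g y = max (- mm y) (min (mm y) (y \<bullet> b))" for y
    have R2: "R / 2 = R0 + norm v" by (simp add: R_def)
    have R0: "0 < R" using k(2) by (simp add: R_def add_pos_nonneg)
    have yb: "\<bar>y \<bullet> b\<bar> \<le> norm y" for y using Cauchy_Schwarz_ineq2[of y b] b by simp
    have g_lin: "g y = y \<bullet> b" if "norm y \<le> R / 2" for y
    proof -
      have "\<bar>y \<bullet> b\<bar> \<le> mm y" using yb[of y] that by (auto simp: mm_def)
      then show ?thesis by (auto simp: g_def)
    qed
    have g_out: "g y = 0" if "y \<notin> ball 0 R" for y
      using that by (auto simp: g_def mm_def max_def min_def)
    have g_lip: "\<bar>g y - g y'\<bar> \<le> 1 * dist y y'" for y y'
    proof -
      have 1: "\<bar>mm y - mm y'\<bar> \<le> dist y y'"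
        using norm_triangle_ineq3[of y y'] by (auto simp: mm_def dist_norm max_def)
      have "\<bar>y \<bullet> b - y' \<bullet> b\<bar> \<le> dist y y'"
        using yb[of "y - y'"] by (simp add: inner_diff_left dist_norm)
      with 1 show ?thesis unfolding g_def by (auto simp: max_def min_def)
    qed
    have g_cont: "continuous_on UNIV g" unfolding g_def mm_def by (intro continuous_intros)
    have lim: "difference_flux v g \<longlonglongrightarrow> flux v g" by (rule lipschitz_flux[OF g_cont g_out g_lip])
    have DgC: "difference_flux v g N = C * (v \<bullet> b)" if N: "1 \<le> N" for N
    proof -
      define a where "a = v /\<^sub>R real N"
      have na: "norm a \<le> norm v" using N by (simp add: a_def mult_left_le_one_le inverse_le_1_iff)
      \<comment> \<open>Outside radius \<open>R0\<close> the multiplier is \<open>lam k\<close> and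
        the last term vanishes; inside, both points lie in the linear region and the increment is
        \<open>a \<bullet> b\<close>.\<close>
      have "(LINT y|lborel. multiplier y * (g (y + a) - g y)) = (LINT y|lborel. lam k * (g (y + a) - g y) + (multiplier y - lam k) * (a \<bullet> b))"
      proof (rule Bochner_Integration.integral_cong[OF refl])
        fix y
        show "multiplier y * (g (y + a) - g y) = lam k * (g (y + a) - g y) + (multiplier y - lam k) * (a \<bullet> b)"
        proof (cases "R0 < norm y")
          case True
          then show ?thesis using multiplier_cell[OF k(3) k(1)] by simp
        next
          case False
          then have "norm y \<le> R / 2" "norm (y + a) \<le> R / 2"
            using norm_triangle_ineq[of y a] na norm_ge_zero[of v] unfolding R2 by linarith+
          then have "g (y + a) - g y = a \<bullet> b" using g_lin by (simp add: inner_add_left)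
          then show ?thesis by (simp add: algebra_simps)
        qed
      qed
      also have "\<dots> = (LINT y|lborel. lam k * (g (y + a) - g y)) + (LINT y|lborel. (multiplier y - lam k) * (a \<bullet> b))"
      proof (rule Bochner_Integration.integral_add)
        show "integrable lborel (\<lambda>y. lam k * (g (y + a) - g y))"
          by (rule difference_integrable[where z = 0 and r = R and C = "\<bar>lam k\<bar>"]) (use g_cont g_out in auto)
        show "integrable lborel (\<lambda>y. (multiplier y - lam k) * (a \<bullet> b))"
        proof (rule integrable_mult_left, rule Bochner_Integration.integrable_bound)
          define Q where "Q = (\<Sum>k\<in>{1..q}. \<bar>lam k\<bar>) + \<bar>lam k\<bar>"
          show "integrable lborel (\<lambda>y. Q * indicator (cball (0 :: real ^ 'n) R0) y)"
            using emeasure_lborel_cball_finite[of "0 :: real ^ 'n" R0] by (intro integrable_mult_right integrable_real_indicator) simp_all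
          have "\<bar>multiplier y - lam k\<bar> \<le> \<bar>Q * indicator (cball 0 R0) y\<bar>" for y
          proof (cases "R0 < norm y")
            case True
            then show ?thesis using multiplier_cell[OF k(3) k(1)] by simp
          next
            case False
            then have "\<bar>multiplier y - lam k\<bar> \<le> Q" using multiplier_bound[of y] by (simp add: Q_def)
            then show ?thesis using False by simp
          qed
          then show "AE y in lborel. norm (multiplier y - lam k) \<le> norm (Q * indicator (cball 0 R0) y)" by simp
        qed measurable
      qed
      also have "(LINT y|lborel. lam k * (g (y + a) - g y)) = 0" by (rule difference_integral_zero[OF g_cont g_out])
      also have "(LINT y|lborel. (multiplier y - lam k) * (a \<bullet> b)) = (LINT y|lborel. multiplier y - lam k) * (a \<bullet> b)"
        by simp
      finally show ?thesis using N by (simp add: difference_flux_def C_def a_def)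
    qed
    have "\<forall>\<^sub>F N in sequentially. C * (v \<bullet> b) = difference_flux v g N"
      by (rule eventually_mono[OF eventually_ge_at_top[of 1]]) (simp add: DgC)
    then have "difference_flux v g \<longlonglongrightarrow> C * (v \<bullet> b)" by (rule Lim_transform_eventually[OF tendsto_const])
    then have "flux v g = C * (v \<bullet> b)" using lim LIMSEQ_unique by blast
    moreover have "flux v g = (\<Sum>(i, j)\<in>index_pairs q. (lam i - lam j) *
      (LINT p|surface_measure. indicator (interface \<Omega> i j) p * ((p \<bullet> b) * (v \<bullet> nrm i j p))))"
      unfolding flux_def
    proof (intro sum.cong refl, clarify)
      fix i j assume ij: "(i, j) \<in> index_pairs q"
      have "g p = p \<bullet> b" if "p \<in> interface \<Omega> i j" for p
      proof (rule g_lin)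
        have "p \<in> \<Sigma>" using interface_subset_boundary[OF r1, of i j] index_pairsD[OF ij] that by blast
        then have "p \<notin> \<Omega> k"
          using k(1) r1 cell_disjoint by (auto simp: cluster_boundary_def frontier_def interior_open regular1_def)
             (metis disjoint_iff Int_commute open_Int_closure_eq_empty atLeastAtMost_iff One_nat_def)
        then have "norm p \<le> R0" using k(3) by force
        then show "norm p \<le> R / 2" using norm_ge_zero[of v] unfolding R2 by linarith
      qed
      then have "(LINT p|surface_measure. indicator (interface \<Omega> i j) p * (g p * (v \<bullet> nrm i j p)))
          = (LINT p|surface_measure. indicator (interface \<Omega> i j) p * ((p \<bullet> b) * (v \<bullet> nrm i j p)))"
        by (intro Bochner_Integration.integral_cong refl) (auto simp: indicator_def)
      then show "(lam i - lam j) * (LINT p|surface_measure. indicator (interface \<Omega> i j) p * (g p * (v \<bullet> nrm i j p)))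
        = (lam i - lam j) * (LINT p|surface_measure. indicator (interface \<Omega> i j) p * ((p \<bullet> b) * (v \<bullet> nrm i j p)))"
        by simp
    qed
    ultimately show ?thesis by simp
  qed
  then show ?thesis by blast
qed

end

section \<open>Smooth cutoff functions\<close>

lemma frechet_derivative_eqI: "(f has_derivative D) (at x) \<Longrightarrow> frechet_derivative f (at x) = D"
  using frechet_derivative_at by metis

lemma Ck_on_SucI:
  assumes "\<And>x. (f has_derivative D x) (at x)" "\<And>v. Ck_on k (\<lambda>x. D x v) UNIV"
  shows "Ck_on (Suc k) f UNIV"
  using assms by (auto simp: frechet_derivative_eqI[OF assms(1)] differentiable_def)

lemma Ck_on_SucE:
  assumes "Ck_on (Suc k) f UNIV"
  obtains D where "\<And>x. (f has_derivative D x) (at x)" "\<And>v. Ck_on k (\<lambda>x. D x v) UNIV"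
  using assms that[of "\<lambda>x. frechet_derivative f (at x)"] by (auto simp: frechet_derivative_works)

lemma Ck_on_SucD: "Ck_on (Suc k) f UNIV \<Longrightarrow> Ck_on k f UNIV"
proof (induction k arbitrary: f)
  case 0
  then show ?case using differentiable_imp_continuous_within by (auto intro!: continuous_at_imp_continuous_on)
next
  case (Suc k)
  then show ?case by (auto simp del: Ck_on.simps(2) simp: Ck_on.simps(2)[of "Suc k" f] Ck_on.simps(2)[of k f])
qed

lemma Ck_on_const: "Ck_on k (\<lambda>x. c) UNIV"
proof (induction k arbitrary: c)
  case (Suc k)
  show ?case by (rule Ck_on_SucI[where D = "\<lambda>_ _. 0"]) (auto intro: Suc)
qed auto

lemma Ck_on_bounded_linear: "bounded_linear L \<Longrightarrow> Ck_on k L UNIV"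
proof (cases k)
  case 0
  assume "bounded_linear L"
  then show ?thesis using 0 by (simp add: linear_continuous_on)
next
  case (Suc m)
  assume L: "bounded_linear L"
  show ?thesis unfolding Suc
    by (rule Ck_on_SucI[where D = "\<lambda>_. L"]) (auto intro: bounded_linear_imp_has_derivative[OF L] Ck_on_const)
qed

lemma Ck_on_add: "Ck_on k f UNIV \<Longrightarrow> Ck_on k g UNIV \<Longrightarrow> Ck_on k (\<lambda>x. f x + g x) UNIV"
proof (induction k arbitrary: f g)
  case (Suc k)
  obtain D E where "\<And>x. (f has_derivative D x) (at x)" "\<And>v. Ck_on k (\<lambda>x. D x v) UNIV"
    "\<And>x. (g has_derivative E x) (at x)" "\<And>v. Ck_on k (\<lambda>x. E x v) UNIV"
    using Suc.prems by (metis Ck_on_SucE)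
  then show ?case
    by (intro Ck_on_SucI[where D = "\<lambda>x v. D x v + E x v"] has_derivative_add Suc.IH)
qed (auto intro: continuous_on_add)

lemma Ck_on_mult:
  fixes f g :: "'a::euclidean_space \<Rightarrow> real"
  shows "Ck_on k f UNIV \<Longrightarrow> Ck_on k g UNIV \<Longrightarrow> Ck_on k (\<lambda>x. f x * g x) UNIV"
proof (induction k arbitrary: f g)
  case (Suc k)
  obtain D E where D: "\<And>x. (f has_derivative D x) (at x)" "\<And>v. Ck_on k (\<lambda>x. D x v) UNIV"
    "\<And>x. (g has_derivative E x) (at x)" "\<And>v. Ck_on k (\<lambda>x. E x v) UNIV"
    using Suc.prems by (metis Ck_on_SucE)
  then show ?case
    using Suc.prems[THEN Ck_on_SucD]
    by (intro Ck_on_SucI[where D = "\<lambda>x v. f x * E x v + D x v * g x"] has_derivative_mult Ck_on_add Suc.IH)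
qed (auto intro: continuous_on_mult)

lemma Ck_on_scaleR_const:
  fixes f :: "'a::euclidean_space \<Rightarrow> real"
  shows "Ck_on k f UNIV \<Longrightarrow> Ck_on k (\<lambda>x. f x *\<^sub>R a) UNIV"
proof (induction k arbitrary: f)
  case (Suc k)
  obtain D where "\<And>x. (f has_derivative D x) (at x)" "\<And>v. Ck_on k (\<lambda>x. D x v) UNIV"
    using Suc.prems by (metis Ck_on_SucE)
  then show ?case
    by (intro Ck_on_SucI[where D = "\<lambda>x v. D x v *\<^sub>R a"] has_derivative_scaleR_left Suc.IH)
qed (auto intro: continuous_intros)

lemma Ck_on_inverse:
  fixes f :: "'a::euclidean_space \<Rightarrow> real"
  assumes nz: "\<And>x. f x \<noteq> 0"
  shows "Ck_on k f UNIV \<Longrightarrow> Ck_on k (\<lambda>x. inverse (f x)) UNIV"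
proof (induction k)
  case 0
  then show ?case using nz by (auto intro: continuous_on_inverse)
next
  case (Suc k)
  obtain D where D: "\<And>x. (f has_derivative D x) (at x)" "\<And>v. Ck_on k (\<lambda>x. D x v) UNIV"
    using Suc.prems by (metis Ck_on_SucE)
  have i: "Ck_on k (\<lambda>x. inverse (f x)) UNIV" by (rule Suc.IH[OF Ck_on_SucD[OF Suc.prems]])
  have "Ck_on k (\<lambda>x. (- 1) * ((inverse (f x) * D x v) * inverse (f x))) UNIV" for v
    by (intro Ck_on_mult Ck_on_const i D)
  then have "Ck_on k (\<lambda>x. - (inverse (f x) * D x v * inverse (f x))) UNIV" for v by simp
  then show ?case
    using nz by (intro Ck_on_SucI[where D = "\<lambda>x v. - (inverse (f x) * D x v * inverse (f x))"] Deriv.has_derivative_inverse D)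
qed

text \<open>The outer function is given together with all its derivatives as a sequence:
  differentiating the composition at level \<open>n\<close> leads to level \<open>n + 1\<close>, so
  the induction on \<open>k\<close> is over all \<open>n\<close> at once.\<close>

lemma Ck_on_compose_chain:
  fixes f :: "'a::euclidean_space \<Rightarrow> real" and hs :: "nat \<Rightarrow> real \<Rightarrow> real"
  assumes hs: "\<And>n x. (hs n has_real_derivative hs (Suc n) x) (at x)" and f: "\<And>k. Ck_on k f UNIV"
  shows "Ck_on k (\<lambda>x. hs n (f x)) UNIV"
proof (induction k arbitrary: n)
  case 0
  have "continuous_on UNIV (hs n)" by (rule DERIV_continuous_on) (rule hs)
  then show ?case using f[of 0] continuous_on_compose2[of UNIV "hs n" UNIV f] by auto
next
  case (Suc k)
  obtain D where D: "\<And>x. (f has_derivative D x) (at x)" "\<And>v. Ck_on k (\<lambda>x. D x v) UNIV"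
    using f[of "Suc k"] by (metis Ck_on_SucE)
  show ?case
  proof (rule Ck_on_SucI[where D = "\<lambda>x v. hs (Suc n) (f x) * D x v"])
    show "((\<lambda>x. hs n (f x)) has_derivative (\<lambda>v. hs (Suc n) (f x) * D x v)) (at x)" for x
      using has_derivative_compose[OF D(1) hs[of n "f x", unfolded has_field_derivative_def]] by simp
    show "Ck_on k (\<lambda>x. hs (Suc n) (f x) * D x v) UNIV" for v by (intro Ck_on_mult Suc.IH D)
  qed
qed

text \<open>The derivative of p(1/t) exp(-1/t) is t^(-2) (p(1/t) - p'(1/t)) exp(-1/t); in the
  variable s = 1/t the first factor is the polynomial s^2.\<close>

primrec exp_poly :: "nat \<Rightarrow> real poly" where
  "exp_poly 0 = 1"
| "exp_poly (Suc n) = [:0, 0, 1:] * (exp_poly n - pderiv (exp_poly n))"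

text \<open>The \<open>n\<close>-th derivative of \<open>exp (- 1 / t)\<close>, extended by \<open>0\<close> to \<open>t \<le> 0\<close>.\<close>

definition flat_exp :: "nat \<Rightarrow> real \<Rightarrow> real" where
  "flat_exp n t = (if 0 < t then poly (exp_poly n) (1 / t) * exp (- (1 / t)) else 0)"

lemma poly_times_exp_tendsto_0: "((\<lambda>s. poly p s * exp (- s)) \<longlongrightarrow> 0) (at_top :: real filter)"
proof -
  have "((\<lambda>s. \<Sum>i\<le>degree p. coeff p i * (s ^ i / exp s)) \<longlongrightarrow> (\<Sum>i\<le>degree p. coeff p i * 0)) at_top"
    by (intro tendsto_sum tendsto_mult tendsto_const tendsto_power_div_exp_0)
  moreover have "(\<lambda>s. \<Sum>i\<le>degree p. coeff p i * (s ^ i / exp s)) = (\<lambda>s. poly p s * exp (- s))"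
    by (simp add: poly_altdef sum_distrib_right exp_minus divide_inverse mult.assoc)
  ultimately show ?thesis by simp
qed

lemma flat_exp_DERIV: "(flat_exp n has_real_derivative flat_exp (Suc n) t) (at t)"
proof (cases "t = 0")
  case True
  \<comment> \<open>With s = 1/h the quotient is s p(s) exp(-s), again a polynomial times exp(-s),
    now for s tending to infinity.\<close>
  have "((\<lambda>h. flat_exp n h / h) \<longlongrightarrow> 0) (at_right 0)"
  proof -
    have "((\<lambda>h. poly ([:0, 1:] * exp_poly n) (inverse h) * exp (- (inverse h))) \<longlongrightarrow> 0) (at_right 0)"
      by (rule filterlim_compose[OF poly_times_exp_tendsto_0 filterlim_inverse_at_top_right])
    moreover have "\<forall>\<^sub>F h in at_right 0. poly ([:0, 1:] * exp_poly n) (inverse h) * exp (- (inverse h)) = flat_exp n h / h"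
      using eventually_at_right_less[of 0] by eventually_elim (simp add: flat_exp_def divide_inverse)
    ultimately show ?thesis by (rule Lim_transform_eventually)
  qed
  moreover have "((\<lambda>h. flat_exp n h / h) \<longlongrightarrow> 0) (at_left 0)"
  proof (rule Lim_transform_eventually[OF tendsto_const])
    show "\<forall>\<^sub>F h in at_left 0. 0 = flat_exp n h / h"
      by (auto simp: eventually_at_filter flat_exp_def)
  qed
  ultimately have "((\<lambda>h. flat_exp n h / h) \<longlongrightarrow> 0) (at 0)" by (simp add: filterlim_split_at)
  then show ?thesis using True by (simp add: DERIV_def flat_exp_def)
next
  case False
  show ?thesis
  proof (cases "0 < t")
    case True
    have "((\<lambda>t. poly (exp_poly n) (1 / t) * exp (- (1 / t))) has_real_derivative
      (poly (pderiv (exp_poly n)) (1 / t) * (- 1 / t ^ 2)) * exp (- (1 / t)) + poly (exp_poly n) (1 / t) * (exp (- (1 / t)) * (1 / t ^ 2))) (at t)"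
      using True by (auto intro!: derivative_eq_intros DERIV_chain2[OF poly_DERIV] simp: power2_eq_square)
    moreover have "(poly (pderiv (exp_poly n)) (1 / t) * (- 1 / t ^ 2)) * exp (- (1 / t)) + poly (exp_poly n) (1 / t) * (exp (- (1 / t)) * (1 / t ^ 2)) = flat_exp (Suc n) t"
      using True by (simp add: flat_exp_def field_simps power2_eq_square)
    ultimately have "((\<lambda>t. poly (exp_poly n) (1 / t) * exp (- (1 / t))) has_real_derivative flat_exp (Suc n) t) (at t)" by simp
    then show ?thesis
      by (rule has_field_derivative_transform_within_open[where S = "{0<..}"]) (use True in \<open>auto simp: flat_exp_def\<close>)
  next
    case neg: False
    have "((\<lambda>t. 0) has_real_derivative flat_exp (Suc n) t) (at t)" using neg by (simp add: flat_exp_def)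
    then show ?thesis
      by (rule has_field_derivative_transform_within_open[where S = "{..<0}"]) (use neg False in \<open>auto simp: flat_exp_def\<close>)
  qed
qed

text \<open>The usual quotient of flat exponentials: \<open>f\<close> is positive exactly inside
  radius \<open>2 * R\<close>, \<open>g\<close> exactly outside radius \<open>R\<close>, and since
  they add up to 3R^2 the denominator never vanishes.\<close>

lemma smooth_cutoff_exists:
  assumes R: "0 < R"
  obtains \<phi> :: "'a::euclidean_space \<Rightarrow> real" where "\<And>k. Ck_on k \<phi> UNIV" "\<And>y. norm y \<le> R \<Longrightarrow> \<phi> y = 1" "\<And>y. 2 * R \<le> norm y \<Longrightarrow> \<phi> y = 0"
proof -
  define f where "f y = (2 * R)\<^sup>2 - y \<bullet> y" for y :: 'a
  define g where "g y = y \<bullet> y - R\<^sup>2" for y :: 'a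
  have sq: "Ck_on k (\<lambda>y :: 'a. y \<bullet> y) UNIV" for k
  proof (cases k)
    case (Suc m)
    have "Ck_on m (\<lambda>y :: 'a. 2 * (y \<bullet> v)) UNIV" for v
      by (intro Ck_on_mult Ck_on_const Ck_on_bounded_linear bounded_linear_inner_left)
    then show ?thesis unfolding Suc
      by (intro Ck_on_SucI[where D = "\<lambda>y v. 2 * (y \<bullet> v)"]) (auto intro!: derivative_eq_intros simp: inner_commute)
  qed (auto intro!: continuous_intros)
  have "Ck_on k (\<lambda>y :: 'a. (2 * R)\<^sup>2 + (- 1) * (y \<bullet> y)) UNIV" for k
    by (intro Ck_on_add Ck_on_mult Ck_on_const sq)
  then have f: "Ck_on k f UNIV" for k unfolding f_def by simp
  have "Ck_on k (\<lambda>y :: 'a. y \<bullet> y + (- (R\<^sup>2))) UNIV" for k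
    by (intro Ck_on_add Ck_on_const sq)
  then have g: "Ck_on k g UNIV" for k unfolding g_def by simp
  define \<phi> where "\<phi> y = flat_exp 0 (f y) * inverse (flat_exp 0 (f y) + flat_exp 0 (g y))" for y
  have pos: "flat_exp 0 (f y) + flat_exp 0 (g y) \<noteq> 0" for y
  proof -
    have "0 < f y \<or> 0 < g y"
    proof (rule ccontr)
      assume "\<not> ?thesis"
      then have "(2 * R)\<^sup>2 \<le> R\<^sup>2" unfolding f_def g_def by linarith
      then show False using R by (simp add: power2_eq_square)
    qed
    then show ?thesis
      using add_pos_pos[OF exp_gt_zero exp_gt_zero, of "- (1 / f y)" "- (1 / g y)"] by (auto simp: flat_exp_def)
  qed
  show thesis
  proof (rule that[of \<phi>])
    show "Ck_on k \<phi> UNIV" for k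
      unfolding \<phi>_def by (intro Ck_on_mult Ck_on_inverse[OF pos] Ck_on_add Ck_on_compose_chain[of flat_exp, OF flat_exp_DERIV] f g)
    show "\<phi> y = 1" if "norm y \<le> R" for y
    proof -
      have "y \<bullet> y \<le> R\<^sup>2" using that by (simp add: dot_square_norm power_mono)
      then have "flat_exp 0 (g y) = 0" by (simp add: g_def flat_exp_def)
      then show ?thesis using pos[of y] by (simp add: \<phi>_def)
    qed
    show "\<phi> y = 0" if "2 * R \<le> norm y" for y
    proof -
      have "(2 * R)\<^sup>2 \<le> (norm y)\<^sup>2" using that R by (intro power_mono) auto
      then have "(2 * R)\<^sup>2 \<le> y \<bullet> y" by (simp only: dot_square_norm)
      then show ?thesis by (simp add: \<phi>_def f_def flat_exp_def)
    qed
  qed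
qed

lemma linear_test_field:
  fixes a b :: "'a::euclidean_space"
  assumes R: "0 < R"
  obtains X :: "'a \<Rightarrow> 'a" where "test_field X" "\<And>y. norm y \<le> R \<Longrightarrow> X y = (y \<bullet> b) *\<^sub>R a"
proof -
  obtain \<phi> :: "'a \<Rightarrow> real" where \<phi>: "\<And>k. Ck_on k \<phi> UNIV" "\<And>y. norm y \<le> R \<Longrightarrow> \<phi> y = 1" "\<And>y. 2 * R \<le> norm y \<Longrightarrow> \<phi> y = 0"
    using smooth_cutoff_exists[OF R] by metis
  define X where "X y = (\<phi> y * (y \<bullet> b)) *\<^sub>R a" for y
  show thesis
  proof (rule that[of X])
    have "supp X \<subseteq> cball 0 (2 * R)"
      unfolding supp_def using \<phi>(3) by (intro closure_minimal) (force simp: X_def)+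
    then have "compact (supp X)"
      unfolding supp_def by (metis bounded_cball bounded_subset closed_closure compact_eq_bounded_closed)
    moreover have "Ck_on k X UNIV" for k
      unfolding X_def by (intro Ck_on_scaleR_const Ck_on_mult \<phi>(1) Ck_on_bounded_linear bounded_linear_inner_left)
    ultimately show "test_field X" by (simp add: test_field_def)
  qed (simp add: X_def \<phi>(2))
qed

section \<open>First variation\<close>

context smooth_cluster
begin

text \<open>A derivative relative to a hypersurface is not unique, and
  \<open>frechet_derivative\<close> merely selects one. Composing with a curve in the interface of
  velocity \<open>h\<close> reduces the claim to uniqueness of derivatives on the line.\<close>

lemma tangential_derivative_unique:
  assumes ij: "(i, j) \<in> index_pairs q" and x: "x \<in> interface \<Omega> i j" and h: "h \<bullet> nrm i j x = 0"
    and D: "(f has_derivative D1) (at x within interface \<Omega> i j)" "(f has_derivative D2) (at x within interface \<Omega> i j)"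
  shows "D1 h = D2 h"
proof -
  obtain w G U where *: "x \<in> U" "interface_chart q \<Omega> i j w G U" "nrm i j x = G x /\<^sub>R norm (G x)"
    using chart[OF ij x] x by metis
  have G0: "G x \<noteq> 0" and wI: "interface \<Omega> i j \<inter> U = {y \<in> U. w y = 0}"
    using *(1,2) by (auto simp: interface_chart_def level_chart_def)
  then have "w x = 0" using * x by blast
  moreover have "h \<bullet> G x = 0" using h *(3) G0 by simp
  ultimately obtain \<gamma> where \<gamma>: "\<gamma> 0 = x" "(\<gamma> has_vector_derivative h) (at 0)" "\<forall>\<^sub>F t in at 0. \<gamma> t \<in> U \<and> w (\<gamma> t) = 0"
    using *(1,2) unfolding interface_chart_def by blast
  from \<gamma>(3) obtain T where T: "open T" "0 \<in> T" "\<And>t. t \<in> T \<Longrightarrow> t \<noteq> 0 \<Longrightarrow> \<gamma> t \<in> U \<and> w (\<gamma> t) = 0"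
    unfolding eventually_at_topological by blast
  have "\<gamma> t \<in> interface \<Omega> i j" if "t \<in> T" for t
    using T(3)[OF that] \<gamma>(1) x wI by (cases "t = 0") auto
  then have sub: "\<gamma> ` T \<subseteq> interface \<Omega> i j" by blast
  have \<gamma>D: "(\<gamma> has_derivative (\<lambda>t. t *\<^sub>R h)) (at 0 within T)"
    using \<gamma>(2) unfolding has_vector_derivative_def by (rule has_derivative_at_withinI)
  have "((\<lambda>t. f (\<gamma> t)) has_derivative (\<lambda>t. D (t *\<^sub>R h))) (at 0)"
    if "(f has_derivative D) (at x within interface \<Omega> i j)" for D
  proof -
    have "(f has_derivative D) (at (\<gamma> 0) within \<gamma> ` T)"
      unfolding \<gamma>(1) using that sub by (rule has_derivative_subset)
    from has_derivative_in_compose[OF \<gamma>D this] show ?thesis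
      by (simp add: at_within_open[OF T(2,1)])
  qed
  from has_derivative_unique[OF this[OF D(1)] this[OF D(2)]]
  have "D1 (1 *\<^sub>R h) = D2 (1 *\<^sub>R h)" by (rule fun_cong)
  then show ?thesis by simp
qed

lemma interface_deriv_eq:
  assumes ij: "(i, j) \<in> index_pairs q" and x: "x \<in> interface \<Omega> i j" and h: "h \<bullet> nrm i j x = 0"
    and D: "(f has_derivative L) (at x within interface \<Omega> i j)"
  shows "interface_deriv \<Omega> i j f x h = L h"
  unfolding interface_deriv_def
proof (rule tangential_derivative_unique[OF ij x h _ D])
  have "f differentiable (at x within interface \<Omega> i j)" using D by (auto simp: differentiable_def)
  then show "(f has_derivative frechet_derivative f (at x within interface \<Omega> i j)) (at x within interface \<Omega> i j)"
    by (simp add: frechet_derivative_works)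
qed

lemma normal_differentiable:
  assumes ij: "(i, j) \<in> index_pairs q" and x: "x \<in> interface \<Omega> i j"
  obtains N' where "(nrm i j has_derivative N') (at x within interface \<Omega> i j)"
proof -
  obtain w G U where *: "x \<in> U" "interface_chart q \<Omega> i j w G U"
    "\<And>y. y \<in> U \<Longrightarrow> y \<in> interface \<Omega> i j \<Longrightarrow> nrm i j y = G y /\<^sub>R norm (G y)"
    using chart[OF ij x] by metis
  have U: "open U" "G x \<noteq> 0" and G: "G differentiable (at x)"
    using *(1,2) by (auto simp: interface_chart_def level_chart_def)
  obtain G' where G': "(G has_derivative G') (at x)" using G by (auto simp: differentiable_def)
  have "(\<lambda>y. G y /\<^sub>R norm (G y)) differentiable (at x)"
    using G U(2) by (intro differentiable_scaleR differentiable_inverse differentiable_compose[of norm, OF differentiable_norm_at]) auto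
  then obtain N' where "((\<lambda>y. G y /\<^sub>R norm (G y)) has_derivative N') (at x)" by (auto simp: differentiable_def)
  then have N': "((\<lambda>y. G y /\<^sub>R norm (G y)) has_derivative N') (at x within interface \<Omega> i j)"
    by (rule has_derivative_at_withinI)
  obtain d where d: "0 < d" "ball x d \<subseteq> U" using U(1) *(1) by (rule openE)
  have "(nrm i j has_derivative N') (at x within interface \<Omega> i j)"
    by (rule has_derivative_transform_within[OF N' d(1) x]) (use d(2) *(3) in \<open>auto simp: dist_commute subset_iff\<close>)
  then show thesis by (rule that)
qed

lemma tangent_proj_simps:
  assumes n: "norm (nrm i j x) = 1"
  shows "tangent_proj \<Omega> i j x h \<bullet> nrm i j x = 0"
    and "tangent_proj \<Omega> i j x h \<bullet> a = h \<bullet> tangent_proj \<Omega> i j x a"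
    and "tangent_proj \<Omega> i j x a \<bullet> tangent_proj \<Omega> i j x b = a \<bullet> b - (a \<bullet> nrm i j x) * (b \<bullet> nrm i j x)"
proof -
  have nn: "nrm i j x \<bullet> nrm i j x = 1" using n by (simp add: dot_square_norm)
  then show "tangent_proj \<Omega> i j x h \<bullet> nrm i j x = 0" by (simp add: tangent_proj_def inner_diff_left)
  show "tangent_proj \<Omega> i j x h \<bullet> a = h \<bullet> tangent_proj \<Omega> i j x a"
    by (simp add: tangent_proj_def inner_diff_left inner_diff_right inner_commute)
  show "tangent_proj \<Omega> i j x a \<bullet> tangent_proj \<Omega> i j x b = a \<bullet> b - (a \<bullet> nrm i j x) * (b \<bullet> nrm i j x)"
    using nn by (simp add: tangent_proj_def inner_diff_left inner_diff_right inner_commute)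
qed

text \<open>The normal part of the field \<open>y \<mapsto> (y \<bullet> b) a\<close> is what produces the mean curvature term.\<close>

lemma surface_div_tangential_part:
  assumes ij: "(i, j) \<in> index_pairs q" and x: "x \<in> interface \<Omega> i j"
    and X: "open V" "x \<in> V" "\<And>y. y \<in> V \<Longrightarrow> X y = (y \<bullet> b) *\<^sub>R a"
  shows "surface_div \<Omega> i j (\<lambda>y. tangent_proj \<Omega> i j y (X y)) x
    = (a \<bullet> b - (a \<bullet> nrm i j x) * (b \<bullet> nrm i j x)) - (x \<bullet> b) * (a \<bullet> nrm i j x) * mean_curvature \<Omega> i j x"
proof -
  define n where "n = nrm i j x"
  define P where "P = tangent_proj \<Omega> i j x"
  note Ps = tangent_proj_simps[OF normal_unit[OF ij x], folded n_def P_def]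
  obtain N' where N': "(nrm i j has_derivative N') (at x within interface \<Omega> i j)"
    using normal_differentiable[OF ij x] by blast
  have "((\<lambda>y. (y \<bullet> b) *\<^sub>R a) has_derivative (\<lambda>h. (h \<bullet> b) *\<^sub>R a)) (at x)"
    by (auto intro!: derivative_eq_intros)
  then have "(X has_derivative (\<lambda>h. (h \<bullet> b) *\<^sub>R a)) (at x)"
    by (rule has_derivative_transform_within_open[OF _ X(1,2)]) (simp add: X(3))
  then have X': "(X has_derivative (\<lambda>h. (h \<bullet> b) *\<^sub>R a)) (at x within interface \<Omega> i j)"
    by (rule has_derivative_at_withinI)
  have Y': "((\<lambda>y. tangent_proj \<Omega> i j y (X y)) has_derivative
      (\<lambda>h. (h \<bullet> b) *\<^sub>R a - ((X x \<bullet> n) *\<^sub>R N' h + (X x \<bullet> N' h + ((h \<bullet> b) *\<^sub>R a) \<bullet> n) *\<^sub>R n))) (at x within interface \<Omega> i j)"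
    unfolding tangent_proj_def n_def
    by (intro has_derivative_diff has_derivative_scaleR has_derivative_inner X' N')
  have II: "second_form \<Omega> i j x (P h) (P h) = N' (P h) \<bullet> P h" for h
    unfolding second_form_def
    by (subst interface_deriv_eq[OF ij x _ N']) (use Ps(1) in \<open>simp_all add: n_def\<close>)
  \<comment> \<open>Pairing with \<open>P h\<close>, which is orthogonal to the normal, kills every
    multiple of \<open>n\<close>. What survives of the derivative of the normal part is the second
    fundamental form times \<open>X x \<bullet> n\<close>.\<close>
  have "interface_deriv \<Omega> i j (\<lambda>y. tangent_proj \<Omega> i j y (X y)) x (P h) \<bullet> P h
      = (P h \<bullet> b) * (a \<bullet> P h) - (X x \<bullet> n) * second_form \<Omega> i j x (P h) (P h)" for h
    by (subst interface_deriv_eq[OF ij x _ Y'])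
      (use Ps(1)[of h] in \<open>simp_all add: n_def II inner_diff_left inner_add_left inner_commute[of "nrm i j x" "P h"]\<close>)
  then have "surface_div \<Omega> i j (\<lambda>y. tangent_proj \<Omega> i j y (X y)) x
      = (\<Sum>e\<in>Basis. (P e \<bullet> b) * (a \<bullet> P e) - (X x \<bullet> n) * second_form \<Omega> i j x (P e) (P e))"
    unfolding surface_div_def tangent_trace_def P_def[symmetric] by simp
  also have "\<dots> = (\<Sum>e\<in>Basis. (e \<bullet> P b) * (e \<bullet> P a)) - (X x \<bullet> n) * mean_curvature \<Omega> i j x"
    unfolding mean_curvature_def tangent_trace_def P_def[symmetric]
    by (simp add: sum_subtractf sum_distrib_left Ps(2)[of _ b] inner_commute[of a] Ps(2)[of _ a])
  also have "(\<Sum>e\<in>Basis. (e \<bullet> P b) * (e \<bullet> P a)) = P b \<bullet> P a"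
    by (subst euclidean_inner[of "P b" "P a"]) (simp only: inner_commute)
  also have "P b \<bullet> P a = a \<bullet> b - (a \<bullet> n) * (b \<bullet> n)" by (simp add: Ps(3) inner_commute mult.commute)
  also have "X x \<bullet> n = (x \<bullet> b) * (a \<bullet> n)" by (simp add: X)
  finally show ?thesis by (simp add: n_def)
qed

text \<open>This and the next two definitions are \<open>A\<close>, \<open>T\<close> and
  \<open>S\<close> of the overview.\<close>

definition area :: real where
  "area = (\<Sum>(i, j)\<in>index_pairs q. LINT p|surface_measure. indicator (interface \<Omega> i j) p)"

definition normal_form :: "real ^ 'n \<Rightarrow> real ^ 'n \<Rightarrow> real" where
  "normal_form a b = (\<Sum>(i, j)\<in>index_pairs q.
     LINT p|surface_measure. indicator (interface \<Omega> i j) p * ((a \<bullet> nrm i j p) * (b \<bullet> nrm i j p)))"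

definition flux_form :: "real ^ 'n \<Rightarrow> real ^ 'n \<Rightarrow> real" where
  "flux_form a b = (\<Sum>(i, j)\<in>index_pairs q. (lam i - lam j) *
     (LINT p|surface_measure. indicator (interface \<Omega> i j) p * ((p \<bullet> b) * (a \<bullet> nrm i j p))))"

lemma normal_form_integrable:
  assumes ij: "(i, j) \<in> index_pairs q"
  shows "integrable surface_measure (\<lambda>p. indicator (interface \<Omega> i j) p * ((a \<bullet> nrm i j p) * (b \<bullet> nrm i j p)))"
proof -
  have "continuous_on (interface \<Omega> i j) (\<lambda>p. (a \<bullet> nrm i j p) * (b \<bullet> nrm i j p))"
    by (intro continuous_intros normal_continuous[OF ij])
  moreover have "norm ((a \<bullet> nrm i j p) * (b \<bullet> nrm i j p)) \<le> norm a * norm b" if "p \<in> interface \<Omega> i j" for p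
    unfolding real_norm_def abs_mult
    using Cauchy_Schwarz_ineq2[of a "nrm i j p"] Cauchy_Schwarz_ineq2[of b "nrm i j p"] normal_unit[OF ij that]
    by (intro mult_mono) auto
  ultimately show ?thesis
    using interface_integrable[OF ij, of "\<lambda>p. (a \<bullet> nrm i j p) * (b \<bullet> nrm i j p)" "norm a * norm b"] by simp
qed

lemma flux_form_integrable:
  assumes ij: "(i, j) \<in> index_pairs q"
  shows "integrable surface_measure (\<lambda>p. indicator (interface \<Omega> i j) p * ((p \<bullet> b) * (a \<bullet> nrm i j p)))"
proof -
  obtain R where R: "\<And>p. p \<in> \<Sigma> \<Longrightarrow> norm p \<le> R" using bdd by (auto simp: bounded_cluster_def bounded_iff)
  have "continuous_on (interface \<Omega> i j) (\<lambda>p. (p \<bullet> b) * (a \<bullet> nrm i j p))"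
    by (intro continuous_intros normal_continuous[OF ij])
  moreover have "norm ((p \<bullet> b) * (a \<bullet> nrm i j p)) \<le> (R * norm b) * norm a" if p: "p \<in> interface \<Omega> i j" for p
  proof -
    have "p \<in> \<Sigma>" using interface_subset_boundary[OF r1, of i j] index_pairsD[OF ij] p by blast
    then have pR: "norm p \<le> R" by (rule R)
    then have "\<bar>p \<bullet> b\<bar> \<le> R * norm b"
      using Cauchy_Schwarz_ineq2[of p b] mult_right_mono[OF pR norm_ge_zero[of b]] by linarith
    moreover have "\<bar>a \<bullet> nrm i j p\<bar> \<le> norm a"
      using Cauchy_Schwarz_ineq2[of a "nrm i j p"] normal_unit[OF ij p] by simp
    moreover have "0 \<le> R" using pR norm_ge_zero[of p] by linarith
    ultimately show ?thesis unfolding real_norm_def abs_mult by (intro mult_mono) auto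
  qed
  ultimately show ?thesis
    using interface_integrable[OF ij, of "\<lambda>p. (p \<bullet> b) * (a \<bullet> nrm i j p)" "(R * norm b) * norm a"] by simp
qed

lemma area_integrable:
  assumes ij: "(i, j) \<in> index_pairs q"
  shows "integrable surface_measure (indicator (interface \<Omega> i j) :: real ^ 'n \<Rightarrow> real)"
  using interface_finite[OF ij] interface_borel[OF ij] by (intro integrable_real_indicator) simp_all

lemma first_variation_linear:
  assumes st: "stationary_cluster q \<Omega> lam"
  shows "(a \<bullet> b) * area - normal_form a b = flux_form a b"
proof -
  obtain R0 where R0: "\<And>p. p \<in> \<Sigma> \<Longrightarrow> norm p \<le> R0" using bdd by (auto simp: bounded_cluster_def bounded_iff)
  \<comment> \<open>Larger than every norm on the boundary, so that \<open>X\<close> is linear on a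
    neighbourhood of each interface point, and positive even if the boundary is empty.\<close>
  define R where "R = max R0 0 + 1"
  have R: "0 < R" by (simp add: R_def)
  obtain X :: "real ^ 'n \<Rightarrow> real ^ 'n" where X: "test_field X" "\<And>y. norm y \<le> R \<Longrightarrow> X y = (y \<bullet> b) *\<^sub>R a"
    using linear_test_field[OF R] by metis
  have "0 = (\<Sum>(i, j)\<in>index_pairs q. LINT x:interface \<Omega> i j|surface_measure.
             surface_div \<Omega> i j (\<lambda>y. tangent_proj \<Omega> i j y (X y)) x)"
    using st X(1) unfolding stationary_cluster_def by simp
  also have "\<dots> = (\<Sum>(i, j)\<in>index_pairs q. ((a \<bullet> b) * (LINT p|surface_measure. indicator (interface \<Omega> i j) p)
      - (LINT p|surface_measure. indicator (interface \<Omega> i j) p * ((a \<bullet> nrm i j p) * (b \<bullet> nrm i j p))))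
      - (lam i - lam j) * (LINT p|surface_measure. indicator (interface \<Omega> i j) p * ((p \<bullet> b) * (a \<bullet> nrm i j p))))"
  proof (intro sum.cong refl, clarify)
    fix i j assume ij: "(i, j) \<in> index_pairs q"
    have "indicator (interface \<Omega> i j) p *\<^sub>R surface_div \<Omega> i j (\<lambda>y. tangent_proj \<Omega> i j y (X y)) p
      = ((a \<bullet> b) * indicator (interface \<Omega> i j) p - indicator (interface \<Omega> i j) p * ((a \<bullet> nrm i j p) * (b \<bullet> nrm i j p)))
        - (lam i - lam j) * (indicator (interface \<Omega> i j) p * ((p \<bullet> b) * (a \<bullet> nrm i j p)))" for p
    proof (cases "p \<in> interface \<Omega> i j")
      case True
      have "p \<in> \<Sigma>" using interface_subset_boundary[OF r1, of i j] index_pairsD[OF ij] True by blast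
      then have "p \<in> ball 0 R" using R0[of p] by (simp add: R_def)
      moreover have "mean_curvature \<Omega> i j p = lam i - lam j"
        using st index_pairsD[OF ij] True unfolding stationary_cluster_def by blast
      ultimately show ?thesis
        using surface_div_tangential_part[OF ij True open_ball, of 0 R X b a] X(2) True by (simp add: mult_ac)
    qed simp
    then have "(LINT x:interface \<Omega> i j|surface_measure. surface_div \<Omega> i j (\<lambda>y. tangent_proj \<Omega> i j y (X y)) x)
      = (LINT p|surface_measure. ((a \<bullet> b) * indicator (interface \<Omega> i j) p - indicator (interface \<Omega> i j) p * ((a \<bullet> nrm i j p) * (b \<bullet> nrm i j p)))
        - (lam i - lam j) * (indicator (interface \<Omega> i j) p * ((p \<bullet> b) * (a \<bullet> nrm i j p))))"
      unfolding set_lebesgue_integral_def by (intro Bochner_Integration.integral_cong refl)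
    also have "\<dots> = ((a \<bullet> b) * (LINT p|surface_measure. indicator (interface \<Omega> i j) p)
      - (LINT p|surface_measure. indicator (interface \<Omega> i j) p * ((a \<bullet> nrm i j p) * (b \<bullet> nrm i j p))))
      - (lam i - lam j) * (LINT p|surface_measure. indicator (interface \<Omega> i j) p * ((p \<bullet> b) * (a \<bullet> nrm i j p)))"
      using area_integrable[OF ij] normal_form_integrable[OF ij, of a b] flux_form_integrable[OF ij, of b a]
      by (simp only: Bochner_Integration.integral_diff Bochner_Integration.integrable_diff integrable_mult_right
          integral_mult_right_zero)
    finally show "(LINT x:interface \<Omega> i j|surface_measure. surface_div \<Omega> i j (\<lambda>y. tangent_proj \<Omega> i j y (X y)) x)
      = ((a \<bullet> b) * (LINT p|surface_measure. indicator (interface \<Omega> i j) p)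
      - (LINT p|surface_measure. indicator (interface \<Omega> i j) p * ((a \<bullet> nrm i j p) * (b \<bullet> nrm i j p))))
      - (lam i - lam j) * (LINT p|surface_measure. indicator (interface \<Omega> i j) p * ((p \<bullet> b) * (a \<bullet> nrm i j p)))" .
  qed
  also have "\<dots> = (a \<bullet> b) * area - normal_form a b - flux_form a b"
    unfolding area_def normal_form_def flux_form_def split_beta by (simp add: sum_subtractf sum_distrib_left)
  finally show ?thesis by simp
qed

lemma normal_form_trace: "(\<Sum>b\<in>Basis. normal_form b b) = area"
proof -
  have "(\<Sum>b\<in>Basis. normal_form b b) = (\<Sum>(i, j)\<in>index_pairs q. \<Sum>b\<in>Basis.
      LINT p|surface_measure. indicator (interface \<Omega> i j) p * ((b \<bullet> nrm i j p) * (b \<bullet> nrm i j p)))"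
    unfolding normal_form_def split_beta by (rule sum.swap)
  also have "\<dots> = area"
    unfolding area_def
  proof (intro sum.cong refl, clarify)
    fix i j assume ij: "(i, j) \<in> index_pairs q"
    have "(\<Sum>b\<in>Basis. LINT p|surface_measure. indicator (interface \<Omega> i j) p * ((b \<bullet> nrm i j p) * (b \<bullet> nrm i j p)))
      = (LINT p|surface_measure. (\<Sum>b\<in>Basis. indicator (interface \<Omega> i j) p * ((b \<bullet> nrm i j p) * (b \<bullet> nrm i j p))))"
      by (intro Bochner_Integration.integral_sum[symmetric] normal_form_integrable[OF ij])
    also have "\<dots> = (LINT p|surface_measure. indicator (interface \<Omega> i j) p)"
    proof (intro Bochner_Integration.integral_cong refl)
      fix p
      show "(\<Sum>b\<in>Basis. indicator (interface \<Omega> i j) p * ((b \<bullet> nrm i j p) * (b \<bullet> nrm i j p))) = (indicator (interface \<Omega> i j) p :: real)"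
      proof (cases "p \<in> interface \<Omega> i j")
        case True
        have "(\<Sum>b\<in>Basis. (b \<bullet> nrm i j p) * (b \<bullet> nrm i j p)) = nrm i j p \<bullet> nrm i j p"
          by (subst euclidean_inner[of "nrm i j p" "nrm i j p"]) (simp add: inner_commute)
        then show ?thesis using True normal_unit[OF ij True] by (simp add: dot_square_norm)
      qed simp
    qed
    finally show "(\<Sum>b\<in>Basis. LINT p|surface_measure. indicator (interface \<Omega> i j) p * ((b \<bullet> nrm i j p) * (b \<bullet> nrm i j p)))
      = (LINT p|surface_measure. indicator (interface \<Omega> i j) p)" .
  qed
  finally show ?thesis .
qed

lemma normal_form_eq_flux_form:
  assumes st: "stationary_cluster q \<Omega> lam" and ab: "a \<in> Basis" "b \<in> Basis"
  shows "normal_form a b = flux_form a b / (real CARD('n) - 1)"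
proof -
  obtain C where C: "\<And>v b. norm b = 1 \<Longrightarrow> flux_form v b = C * (v \<bullet> b)"
    using linear_flux unfolding flux_form_def[symmetric] by blast
  have N: "normal_form v b = (v \<bullet> b) * (area - C)" if "b \<in> Basis" for v b
    using first_variation_linear[OF st, of v b] C[of b v] that by (simp add: algebra_simps)
  have "area = (\<Sum>b\<in>Basis. normal_form b b)" by (rule normal_form_trace[symmetric])
  also have "\<dots> = (\<Sum>b\<in>(Basis :: (real ^ 'n) set). (b \<bullet> b) * (area - C))" by (intro sum.cong refl N)
  also have "\<dots> = real CARD('n) * (area - C)" by (simp add: inner_Basis)
  finally have "C = (real CARD('n) - 1) * (area - C)" by (simp add: algebra_simps)
  then have "area - C = C / (real CARD('n) - 1)" using dim by (simp add: field_simps)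
  then show ?thesis using N[of b a] C[of b a] ab by simp
qed

text \<open>Checked entry by entry: the entry with indices \<open>a\<close>, \<open>b\<close> is
  \<open>normal_form\<close> minus \<open>flux_form / (n - 1)\<close> at the corresponding basis
  vectors. Integrability of the matrix-valued sum comes first, since it allows entries to be taken
  under the integral.\<close>

lemma quasi_center_integral:
  assumes st: "stationary_cluster q \<Omega> lam"
  shows "has_bochner_integral surface_measure
           (\<lambda>p. \<Sum>(i, j)\<in>index_pairs q. indicator (interface \<Omega> i j) p *\<^sub>R
                tensor (nrm i j p) (quasi_center \<Omega> i j p)) 0"
proof -
  define k where "k i j = (lam i - lam j) / (real CARD('n) - 1)" for i j
  define T where "T i j p = tensor (nrm i j p) (nrm i j p - k i j *\<^sub>R p)" for i j p
  have eq: "indicator (interface \<Omega> i j) p *\<^sub>R tensor (nrm i j p) (quasi_center \<Omega> i j p) = indicator (interface \<Omega> i j) p *\<^sub>R T i j p"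
    if ij: "(i, j) \<in> index_pairs q" for i j p
  proof (cases "p \<in> interface \<Omega> i j")
    case True
    then have "mean_curvature \<Omega> i j p = lam i - lam j"
      using st index_pairsD[OF ij] unfolding stationary_cluster_def by blast
    then show ?thesis by (simp add: T_def quasi_center_def k_def)
  qed simp
  obtain R where R: "\<And>p. p \<in> \<Sigma> \<Longrightarrow> norm p \<le> R" using bdd by (auto simp: bounded_cluster_def bounded_iff)
  have comp: "T i j p $ a $ b = (axis a 1 \<bullet> nrm i j p) * (axis b 1 \<bullet> nrm i j p) - k i j * ((p \<bullet> axis b 1) * (axis a 1 \<bullet> nrm i j p))" for i j p a b
    by (simp add: T_def tensor_def inner_axis inner_axis' algebra_simps)
  have int: "integrable surface_measure (\<lambda>p. indicator (interface \<Omega> i j) p *\<^sub>R T i j p)" if ij: "(i, j) \<in> index_pairs q" for i j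
  proof (rule interface_integrable[OF ij])
    show "continuous_on (interface \<Omega> i j) (T i j)"
      unfolding T_def tensor_def by (intro continuous_intros normal_continuous[OF ij])
    fix p assume p: "p \<in> interface \<Omega> i j"
    have "p \<in> \<Sigma>" using interface_subset_boundary[OF r1, of i j] index_pairsD[OF ij] p by blast
    then have pR: "norm p \<le> R" by (rule R)
    have n1: "\<bar>nrm i j p $ a\<bar> \<le> 1" for a
      using component_le_norm_cart[of "nrm i j p" a] normal_unit[OF ij p] by simp
    have "\<bar>T i j p $ a $ b\<bar> \<le> 1 + \<bar>k i j\<bar> * R" for a b
    proof -
      have "\<bar>T i j p $ a $ b\<bar> = \<bar>nrm i j p $ a\<bar> * \<bar>nrm i j p $ b - k i j * p $ b\<bar>"
        by (simp add: T_def tensor_def abs_mult)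
      also have "\<dots> \<le> 1 * (1 + \<bar>k i j\<bar> * R)"
      proof (intro mult_mono n1)
        have "\<bar>k i j * p $ b\<bar> \<le> \<bar>k i j\<bar> * R"
          unfolding abs_mult using component_le_norm_cart[of p b] pR by (intro mult_left_mono) auto
        then show "\<bar>nrm i j p $ b - k i j * p $ b\<bar> \<le> 1 + \<bar>k i j\<bar> * R" using n1[of b] by linarith
      qed auto
      finally show ?thesis by simp
    qed
    then have row: "norm (T i j p $ a) \<le> real CARD('n) * (1 + \<bar>k i j\<bar> * R)" for a
      by (intro order_trans[OF norm_le_l1_cart] order_trans[OF sum_bounded_above[of UNIV]]) auto
    have "norm (T i j p) \<le> (\<Sum>a\<in>UNIV. norm (T i j p $ a))" unfolding norm_vec_def by (intro L2_set_le_sum) auto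
    also have "\<dots> \<le> real CARD('n) * (real CARD('n) * (1 + \<bar>k i j\<bar> * R))"
      using row by (intro order_trans[OF sum_bounded_above[of UNIV]]) auto
    finally show "norm (T i j p) \<le> real CARD('n) * (real CARD('n) * (1 + \<bar>k i j\<bar> * R))" .
  qed
  define F where "F p = (\<Sum>(i, j)\<in>index_pairs q. indicator (interface \<Omega> i j) p *\<^sub>R T i j p)" for p
  have intF: "integrable surface_measure F"
    unfolding F_def split_beta using int by (intro Bochner_Integration.integrable_sum) (auto simp: split_beta)
  have "(LINT p|surface_measure. F p) = 0"
  proof -
    have "(LINT p|surface_measure. F p) $ a $ b = 0" for a b
    proof -
      have bl: "bounded_linear (\<lambda>A :: real ^ 'n ^ 'n. A $ a $ b)"
        by (intro bounded_linear_compose[OF bounded_linear_vec_nth bounded_linear_vec_nth])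
      have "(LINT p|surface_measure. F p) $ a $ b = (LINT p|surface_measure. F p $ a $ b)"
        by (rule integral_bounded_linear[OF bl intF, symmetric])
      also have "\<dots> = (LINT p|surface_measure. (\<Sum>(i, j)\<in>index_pairs q.
          indicator (interface \<Omega> i j) p * ((axis a 1 \<bullet> nrm i j p) * (axis b 1 \<bullet> nrm i j p))
          - k i j * (indicator (interface \<Omega> i j) p * ((p \<bullet> axis b 1) * (axis a 1 \<bullet> nrm i j p)))))"
      proof (intro Bochner_Integration.integral_cong refl)
        fix p
        have "F p $ a $ b = (\<Sum>(i, j)\<in>index_pairs q. (indicator (interface \<Omega> i j) p *\<^sub>R T i j p) $ a $ b)"
          unfolding F_def split_beta by simp
        also have "\<dots> = (\<Sum>(i, j)\<in>index_pairs q.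
          indicator (interface \<Omega> i j) p * ((axis a 1 \<bullet> nrm i j p) * (axis b 1 \<bullet> nrm i j p))
          - k i j * (indicator (interface \<Omega> i j) p * ((p \<bullet> axis b 1) * (axis a 1 \<bullet> nrm i j p))))"
          unfolding split_beta by (intro sum.cong refl) (simp add: comp right_diff_distrib mult.left_commute)
        finally show "F p $ a $ b = (\<Sum>(i, j)\<in>index_pairs q.
          indicator (interface \<Omega> i j) p * ((axis a 1 \<bullet> nrm i j p) * (axis b 1 \<bullet> nrm i j p))
          - k i j * (indicator (interface \<Omega> i j) p * ((p \<bullet> axis b 1) * (axis a 1 \<bullet> nrm i j p))))" .
      qed
      also have "\<dots> = (\<Sum>(i, j)\<in>index_pairs q. LINT p|surface_measure.
          indicator (interface \<Omega> i j) p * ((axis a 1 \<bullet> nrm i j p) * (axis b 1 \<bullet> nrm i j p))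
          - k i j * (indicator (interface \<Omega> i j) p * ((p \<bullet> axis b 1) * (axis a 1 \<bullet> nrm i j p))))"
        unfolding split_beta
        by (intro Bochner_Integration.integral_sum Bochner_Integration.integrable_diff integrable_mult_right
            normal_form_integrable flux_form_integrable) auto
      also have "\<dots> = (\<Sum>(i, j)\<in>index_pairs q.
          (LINT p|surface_measure. indicator (interface \<Omega> i j) p * ((axis a 1 \<bullet> nrm i j p) * (axis b 1 \<bullet> nrm i j p)))
          - k i j * (LINT p|surface_measure. indicator (interface \<Omega> i j) p * ((p \<bullet> axis b 1) * (axis a 1 \<bullet> nrm i j p))))"
      proof (intro sum.cong refl, clarify)
        fix i j assume ij: "(i, j) \<in> index_pairs q"
        show "(LINT p|surface_measure.
          indicator (interface \<Omega> i j) p * ((axis a 1 \<bullet> nrm i j p) * (axis b 1 \<bullet> nrm i j p))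
          - k i j * (indicator (interface \<Omega> i j) p * ((p \<bullet> axis b 1) * (axis a 1 \<bullet> nrm i j p))))
         = (LINT p|surface_measure. indicator (interface \<Omega> i j) p * ((axis a 1 \<bullet> nrm i j p) * (axis b 1 \<bullet> nrm i j p)))
          - k i j * (LINT p|surface_measure. indicator (interface \<Omega> i j) p * ((p \<bullet> axis b 1) * (axis a 1 \<bullet> nrm i j p)))"
          by (subst Bochner_Integration.integral_diff[OF normal_form_integrable[OF ij] integrable_mult_right[OF flux_form_integrable[OF ij]]]) simp
      qed
      also have "\<dots> = normal_form (axis a 1) (axis b 1) - flux_form (axis a 1) (axis b 1) / (real CARD('n) - 1)"
        unfolding normal_form_def flux_form_def split_beta k_def by (simp add: sum_subtractf sum_divide_distrib)
      also have "\<dots> = 0"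
        using normal_form_eq_flux_form[OF st, of "axis a 1" "axis b 1"] by (simp add: axis_in_Basis_iff)
      finally show ?thesis .
    qed
    then show ?thesis by (simp add: vec_eq_iff)
  qed
  moreover have "(\<lambda>p. \<Sum>(i, j)\<in>index_pairs q. indicator (interface \<Omega> i j) p *\<^sub>R tensor (nrm i j p) (quasi_center \<Omega> i j p)) = F"
    unfolding F_def by (intro ext sum.cong refl) (auto simp: eq)
  ultimately show ?thesis using intF by (simp add: has_bochner_integral_iff)
qed

end

theorem lemma7p9:
  fixes \<Omega> :: "nat \<Rightarrow> (real ^ 'n) set" and q :: nat and lam :: "nat \<Rightarrow> real"
  assumes "CARD('n) \<ge> 2"
    and "regular_cluster q \<Omega>"
    and "bounded_cluster q \<Omega>"
    and "stationary_cluster q \<Omega> lam"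
    and "stable_cluster q \<Omega> lam \<or> bounded_curvature q \<Omega>"
  shows "has_bochner_integral surface_measure
           (\<lambda>p. \<Sum>(i, j)\<in>index_pairs q.
              indicator (interface \<Omega> i j) p *\<^sub>R
                tensor (interface_normal \<Omega> i j p) (quasi_center \<Omega> i j p)) 0"
proof -
  obtain \<kappa> where "flat_density \<kappa> (surface_outer :: (real ^ 'n) set \<Rightarrow> ennreal)"
    using flat_density_exists[OF assms(1)] by blast
  moreover have "regular1 q \<Omega>" "regular2 q \<Omega>" "cluster q \<Omega>"
    using assms(4) by (simp_all add: stationary_cluster_def)
  ultimately interpret smooth_cluster q \<Omega> \<kappa> lam
    using assms(1,3) by unfold_locales
  show ?thesis by (rule quasi_center_integral[OF assms(4)])
qed

end
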